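(* Let $\{X_k\}_{k\in\mathbb{Z}}$ be a time series with (rescaled) spectral density $\varphi_0$, let $\varphi_{\mathrm{par}}$ be the (rescaled) spectral density of the working model, let $\delta\in[0,1]$, let $0<m<M<\infty$, let $\Theta$ be the parameter space, $\Pi_0$ the restricted Bernstein-Dirichlet process prior on $\Theta$, and $\Pi_n$ the pseudo-posterior based on the corrected Whittle likelihood and the observations $X_1,\dots,X_n$, all as defined, and satisfying the assumptions stated, in the context. Suppose in addition that $$\inf_{0\le x\le 1}\varphi_0(x)>m\quad\text{and}\quad \left\|\frac{\varphi_0}{\varphi_{\mathrm{par}}^{\delta}}\right\|_{\mathrm{Lip}}\cdot\left\|\varphi_{\mathrm{par}}^{\delta}\right\|_{\mathrm{Lip}}<M .$$ Then for every $r>0$, $$\Pi_n\left(\{\varphi\in\Theta:\ \|\varphi-\varphi_0\|_\infty\ge r\}\right)\longrightarrow 0\quad\text{in } P\text{-probability as } n\to\infty .$$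
   Context: **Norms.** For $\varphi\in C([0,1])$ (real-valued continuous functions on $[0,1]$), $\|\varphi\|_\infty=\sup_{x\in[0,1]}|\varphi(x)|$, $L(\varphi)=\sup_{0\le x\ne y\le 1}\left|\frac{\varphi(x)-\varphi(y)}{x-y}\right|$, and $\|\varphi\|_{\mathrm{Lip}}=\|\varphi\|_\infty+L(\varphi)$. **Time series.** $\{X_k\}_{k\in\mathbb{Z}}$ is a real-valued, zero-mean, strongly (strictly) stationary time series with finite variance on a probability space $(\Omega,\mathcal{F},P)$. Put $\mathcal{U}_k=\sigma(X_s,\,s\le k)$, $\mathcal{U}_{-\infty}=\bigcap_{k\in\mathbb{Z}}\mathcal{U}_k$ and $\gamma_0(k)=\operatorname{E}(X_0X_k)$. It is assumed that $\operatorname{E}(X_0\mid\mathcal{U}_{-\infty})=0$, that $\operatorname{E}(X_0X_k\mid\mathcal{U}_{-\infty})=\gamma_0(k)$ for all $k\in\mathbb{Z}$, and that $\sum_{k\in\mathbb{Z}}|\gamma_0(k)|<\infty$. The spectral density rescaled to $[0,1]$ is $$\varphi_0(x)=\frac{1}{2\pi}\sum_{k\in\mathbb{Z}}\gamma_0(k)\cos(k\pi x),\quad x\in[0,1].$$ It is assumed that $\varphi_0\ge\beta$ on $[0,1]$ for some $\beta>0$ and that $L(\varphi_0)<\infty$. **Working model.** $\varphi_{\mathrm{par}}:[0,1]\to\mathbb{R}$ is the rescaled spectral density of a mean-zero stationary Gaussian working model; it is Lipschitz continuous and satisfies $\varphi_{\mathrm{par}}\ge\beta_{\mathrm{par}}$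 for some $\beta_{\mathrm{par}}>0$. Its autocovariance function is $\gamma_{\mathrm{par}}(h)=2\pi\int_0^1\varphi_{\mathrm{par}}(x)\cos(h\pi x)\,dx$, and $\Gamma_{\mathrm{par}}=\Gamma_{n,\mathrm{par}}=(\gamma_{\mathrm{par}}(k-j))_{k,j=1}^n$. **Corrected Whittle likelihood (proxy model).** Let $N=\lfloor (n-1)/2\rfloor$ and $y_j=2j/n$. For a function $\xi$ on $[0,1]$, let $D_n(\xi)$ be the $n\times n$ diagonal matrix $\mathrm{diag}(\xi(0),\xi(y_1),\xi(y_1),\dots,\xi(y_N),\xi(y_N),\xi(y_{n/2}))$ if $n$ is even, and $\mathrm{diag}(\xi(0),\xi(y_1),\xi(y_1),\dots,\xi(y_N),\xi(y_N))$ if $n$ is odd. Let $F_n$ be the real discrete Fourier transform matrix, i.e. the orthogonal $n\times n$ matrix whose rows are, in order, $n^{-1/2}(1,\dots,1)$, then for $j=1,\dots,N$ the two rows $\sqrt{2/n}\,(\cos(2\pi jt/n))_{t=1}^n$ and $\sqrt{2/n}\,(\sin(2\pi jt/n))_{t=1}^n$, and finally, if $n$ is even, $n^{-1/2}((-1)^t)_{t=1}^n$. Put $C_n(\varphi)=F_n'\,D_n^{-1/2}\!\left(\varphi/\varphi_{\mathrm{par}}\right)F_n$ (prime denotes transpose). For $x_1^n=(x_1,\dots,x_n)'\in\mathbb{R}^n$ define $$f_\varphi(x_1^n)=(2\pi)^{-n/2}\det\left(\Gamma_{\mathrm{par}}^{-1}C_n^2(\varphi)\right)^{1/2}\exp\left(-\tfrac12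 (x_1^n)'C_n(\varphi)\Gamma_{\mathrm{par}}^{-1}C_n(\varphi)x_1^n\right).$$ **Parameter space.** $\Theta=\{\varphi\in C([0,1]):\ \|\varphi\|_{\mathrm{Lip}}\le M,\ \inf_{0\le x\le1}\varphi(x)\ge m\}$, with the metric $d_\infty(\phi,\psi)=\|\phi-\psi\|_\infty$ and its Borel $\sigma$-algebra $\mathcal{T}$. **Prior.** $\delta\in[0,1]$ is fixed. Let $\beta(x;a,b)=\frac{\Gamma(a+b)}{\Gamma(a)\Gamma(b)}x^{a-1}(1-x)^{b-1}$. The Bernstein-Dirichlet process prior is the law of the random function $c(x)=\tau\sum_{j=1}^{K}w_{j,K}(G)\,\beta(x;j,K-j+1)$, $x\in[0,1]$, where $w_{j,K}(G)=G\left(\left(\frac{j-1}{K},\frac{j}{K}\right]\right)$ and $G,K,\tau$ are independent; $G$ is a Dirichlet process on $[0,1]$ with base measure $\alpha G_0$, where $\alpha>0$ and $G_0$ is a probability distribution on $[0,1]$ with full support $[0,1]$; $K$ takes values in $\{1,2,\dots\}$ with probability mass function $\rho(k)>0$ for all $k\ge1$; $\tau$ is a continuous random variable with support $(0,\infty)$ (every nonempty open subinterval of $(0,\infty)$ has positive probability). $\Pi_C$ denotes the law of $\varphi=c\,\varphi_{\mathrm{par}}^{\delta}$ on $C([0,1])$. The prior on $\Theta$ is $\Pi_0(A)=\Pi_C(A\cap\Theta)/\Pi_C(\Theta)$ for $A\in\mathcal{T}$. **Pseudo-posterior.** With $X_1^n=(X_1,\dots,X_n)'$, for $A\in\mathcal{T}$,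 $$\Pi_n(A)=\frac{\int_A f_\varphi(X_1^n)\,\Pi_0(d\varphi)}{\int_\Theta f_\varphi(X_1^n)\,\Pi_0(d\varphi)}.$$ *)

theory Defs
  imports
    "HOL-Probability.Probability"
    "Jordan_Normal_Form.Gauss_Jordan_Elimination"
    "Jordan_Normal_Form.Determinant"
begin

text \<open>The norms are extended-valued, so that a non-Lipschitz function has infinite Lipschitz norm.
  Only the values of \<open>\<phi>\<close> on \<open>[0,1]\<close> enter.\<close>

definition sup_norm :: "(real \<Rightarrow> real) \<Rightarrow> ennreal" where
  "sup_norm \<phi> = (SUP x\<in>{0..1}. ennreal \<bar>\<phi> x\<bar>)"

definition lip_const :: "(real \<Rightarrow> real) \<Rightarrow> ennreal" where
  "lip_const \<phi> = (SUP (x, y)\<in>{(x, y). x \<in> {0..1} \<and> y \<in> {0..1} \<and> x \<noteq> y}.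
     ennreal \<bar>(\<phi> x - \<phi> y) / (x - y)\<bar>)"

definition lip_norm :: "(real \<Rightarrow> real) \<Rightarrow> ennreal" where
  "lip_norm \<phi> = sup_norm \<phi> + lip_const \<phi>"

text \<open>\<open>C([0,1])\<close> with the supremum metric; its points are functions on the reals that are
  \<open>undefined\<close> outside \<open>[0,1]\<close> (extensional).\<close>

definition C01 :: "(real \<Rightarrow> real) metric" where
  "C01 = cfunspace (top_of_set {0..1}) euclidean_metric"

definition metric_borel :: "'a metric \<Rightarrow> 'a measure" where
  "metric_borel X = sigma (mspace X) {U. openin (mtopology_of X) U}"

definition Theta :: "real \<Rightarrow> real \<Rightarrow> (real \<Rightarrow> real) set" where
  "Theta m M = {\<phi> \<in> mspace C01. lip_norm \<phi> \<le> ennreal M \<and> (INF x\<in>{0..1}. \<phi> x) \<ge> m}"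

definition strictly_stationary :: "'a measure \<Rightarrow> (int \<Rightarrow> 'a \<Rightarrow> real) \<Rightarrow> bool" where
  "strictly_stationary P X \<longleftrightarrow>
     (\<forall>h J. finite J \<longrightarrow>
        distr P (PiM J (\<lambda>_. borel)) (\<lambda>\<omega>. \<lambda>j\<in>J. X (j + h) \<omega>) =
        distr P (PiM J (\<lambda>_. borel)) (\<lambda>\<omega>. \<lambda>j\<in>J. X j \<omega>))"

definition past :: "'a measure \<Rightarrow> (int \<Rightarrow> 'a \<Rightarrow> real) \<Rightarrow> int \<Rightarrow> 'a measure" where
  "past P X k = sigma (space P) (\<Union>s\<in>{..k}. {X s -` B \<inter> space P | B. B \<in> sets borel})"

definition remote_past :: "'a measure \<Rightarrow> (int \<Rightarrow> 'a \<Rightarrow> real) \<Rightarrow> 'a measure" where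
  "remote_past P X = sigma (space P) (\<Inter>k. sets (past P X k))"

definition autocov :: "'a measure \<Rightarrow> (int \<Rightarrow> 'a \<Rightarrow> real) \<Rightarrow> int \<Rightarrow> real" where
  "autocov P X k = (LINT \<omega>|P. X 0 \<omega> * X k \<omega>)"

definition spectral_density :: "(int \<Rightarrow> real) \<Rightarrow> real \<Rightarrow> real" where
  "spectral_density \<gamma> x = 1 / (2 * pi) * (\<Sum>\<^sub>\<infinity>k. \<gamma> k * cos (of_int k * pi * x))"

definition converges_in_prob :: "'a measure \<Rightarrow> (nat \<Rightarrow> 'a \<Rightarrow> real) \<Rightarrow> real \<Rightarrow> bool" where
  "converges_in_prob P Y l \<longleftrightarrow>
     (\<forall>\<epsilon>>0. (\<lambda>n. measure P {\<omega> \<in> space P. \<bar>Y n \<omega> - l\<bar> > \<epsilon>}) \<longlonglongrightarrow> 0)"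

definition gamma_par :: "(real \<Rightarrow> real) \<Rightarrow> int \<Rightarrow> real" where
  "gamma_par \<phi>par h = 2 * pi * integral {0..1} (\<lambda>x. \<phi>par x * cos (of_int h * pi * x))"

definition Gamma_par :: "nat \<Rightarrow> (real \<Rightarrow> real) \<Rightarrow> real mat" where
  "Gamma_par n \<phi>par = mat n n (\<lambda>(k, j). gamma_par \<phi>par (int k - int j))"

text \<open>Matrix indices start at 0. The frequencies along the diagonal are
  \<open>0, y\<^sub>1, y\<^sub>1, \<dots>, y\<^sub>N, y\<^sub>N\<close>, followed by \<open>y\<^sub>n\<^sub>/\<^sub>2 = 1\<close> if \<open>n\<close> is even: position
  \<open>i\<close> carries \<open>y\<^sub>j = 2 j / n\<close> with \<open>j = \<lceil>i / 2\<rceil>\<close>.\<close>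

definition freq_index :: "nat \<Rightarrow> nat" where
  "freq_index i = (i + 1) div 2"

definition D_inv_sqrt :: "nat \<Rightarrow> (real \<Rightarrow> real) \<Rightarrow> real mat" where
  "D_inv_sqrt n \<xi> = mat_diag n (\<lambda>i. \<xi> (2 * real (freq_index i) / real n) powr (- 1 / 2))"

text \<open>Row \<open>0\<close> is constant, rows \<open>2 j - 1\<close> and \<open>2 j\<close> are the cosine and sine rows of frequency \<open>j\<close>,
  and for even \<open>n\<close> the last row alternates. Column \<open>t\<close> belongs to time \<open>t + 1\<close>.\<close>

definition DFT :: "nat \<Rightarrow> real mat" where
  "DFT n = mat n n (\<lambda>(i, t).
     if i = 0 then 1 / sqrt (real n)
     else if even n \<and> i = n - 1 then (- 1) ^ (t + 1) / sqrt (real n)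
     else if odd i then sqrt (2 / real n) * cos (2 * pi * real (freq_index i) * real (t + 1) / real n)
     else sqrt (2 / real n) * sin (2 * pi * real (freq_index i) * real (t + 1) / real n))"

definition C_mat :: "nat \<Rightarrow> (real \<Rightarrow> real) \<Rightarrow> (real \<Rightarrow> real) \<Rightarrow> real mat" where
  "C_mat n \<phi>par \<phi> =
     transpose_mat (DFT n) * D_inv_sqrt n (\<lambda>x. \<phi> x / \<phi>par x) * DFT n"

text \<open>For a strictly positive working spectral density \<open>Gamma_par\<close> is positive definite, so the
  option returned by \<^const>\<open>mat_inverse\<close> is never \<^const>\<open>None\<close>.\<close>

definition corrected_likelihood ::
  "nat \<Rightarrow> (real \<Rightarrow> real) \<Rightarrow> (real \<Rightarrow> real) \<Rightarrow> real vec \<Rightarrow> real" where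
  "corrected_likelihood n \<phi>par \<phi> x =
     (let C = C_mat n \<phi>par \<phi>; \<Gamma>inv = the (mat_inverse (Gamma_par n \<phi>par)) in
      (2 * pi) powr (- real n / 2)
      * sqrt (Determinant.det (\<Gamma>inv * (C * C)))
      * exp (- 1 / 2 * scalar_prod x ((C * \<Gamma>inv * C) *\<^sub>v x)))"

text \<open>Gamma distribution with shape \<open>a \<ge> 0\<close> and unit rate, degenerate at \<open>0\<close> for \<open>a = 0\<close>.\<close>

definition gamma_law :: "real \<Rightarrow> real measure" where
  "gamma_law a =
     (if a = 0 then return borel 0
      else density lborel
        (\<lambda>x. ennreal (if x > 0 then x powr (a - 1) * exp (- x) / Gamma a else 0)))"

text \<open>Ferguson's definition of the Dirichlet distribution, as the law of normalised independent
  Gamma variables; it allows some (not all) of the parameters to be zero.\<close>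

definition dirichlet_law :: "'i set \<Rightarrow> ('i \<Rightarrow> real) \<Rightarrow> ('i \<Rightarrow> real) measure" where
  "dirichlet_law I a =
     distr (PiM I (\<lambda>i. gamma_law (a i))) (PiM I (\<lambda>_. borel)) (\<lambda>z. \<lambda>i\<in>I. z i / (\<Sum>j\<in>I. z j))"

abbreviation unit_borel :: "real measure" where
  "unit_borel \<equiv> restrict_space borel {0..1}"

definition dirichlet_process ::
  "'b measure \<Rightarrow> ('b \<Rightarrow> real measure) \<Rightarrow> real \<Rightarrow> real measure \<Rightarrow> bool" where
  "dirichlet_process Q G \<alpha> G0 \<longleftrightarrow>
     G \<in> Q \<rightarrow>\<^sub>M prob_algebra unit_borel \<and>
     (\<forall>(k::nat) A. A \<in> {..<k} \<rightarrow> sets unit_borel \<and> disjoint_family_on A {..<k} \<and>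
          (\<Union>i<k. A i) = {0..1} \<longrightarrow>
        distr Q (PiM {..<k} (\<lambda>_. borel)) (\<lambda>\<omega>. \<lambda>i\<in>{..<k}. measure (G \<omega>) (A i)) =
        dirichlet_law {..<k} (\<lambda>i. \<alpha> * measure G0 (A i)))"

definition full_support_01 :: "real measure \<Rightarrow> bool" where
  "full_support_01 G0 \<longleftrightarrow>
     (\<forall>U. open U \<and> U \<inter> {0..1} \<noteq> {} \<longrightarrow> measure G0 (U \<inter> {0..1}) > 0)"

text \<open>Natural-number exponents, because the convention \<open>0\<^sup>0 = 1\<close> is needed at the end points
  (whereas \<open>0 powr 0 = 0\<close>); only used for \<open>a, b \<ge> 1\<close>.\<close>

definition beta_density :: "nat \<Rightarrow> nat \<Rightarrow> real \<Rightarrow> real" where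
  "beta_density a b x =
     Gamma (real (a + b)) / (Gamma (real a) * Gamma (real b)) * x ^ (a - 1) * (1 - x) ^ (b - 1)"

definition bernstein_fun :: "real measure \<Rightarrow> nat \<Rightarrow> real \<Rightarrow> real \<Rightarrow> real" where
  "bernstein_fun G K \<tau> x =
     \<tau> * (\<Sum>j=1..K. measure G {(real j - 1) / real K <.. real j / real K}
                   * beta_density j (K - j + 1) x)"

text \<open>Mutual independence; \<open>indep_vars\<close> would force a common value type.\<close>

definition indep_three ::
  "'b measure \<Rightarrow> ('b \<Rightarrow> 'c) \<Rightarrow> 'c measure \<Rightarrow> ('b \<Rightarrow> 'd) \<Rightarrow> 'd measure \<Rightarrow> ('b \<Rightarrow> 'e) \<Rightarrow> 'e measure \<Rightarrow> bool"
where
  "indep_three Q X SX Y SY Z SZ \<longleftrightarrow>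
     prob_space.indep_sets Q
       ((!) [sets (vimage_algebra (space Q) X SX),
             sets (vimage_algebra (space Q) Y SY),
             sets (vimage_algebra (space Q) Z SZ)]) {..<3}"

definition prior_C ::
  "'b measure \<Rightarrow> ('b \<Rightarrow> real measure) \<Rightarrow> ('b \<Rightarrow> nat) \<Rightarrow> ('b \<Rightarrow> real) \<Rightarrow> (real \<Rightarrow> real) \<Rightarrow> real
    \<Rightarrow> (real \<Rightarrow> real) measure" where
  "prior_C Q G K \<tau> \<phi>par \<delta> =
     distr Q (metric_borel C01)
       (\<lambda>\<omega>. \<lambda>x\<in>{0..1}. bernstein_fun (G \<omega>) (K \<omega>) (\<tau> \<omega>) x * \<phi>par x powr \<delta>)"

definition restricted_prior ::
  "real \<Rightarrow> real \<Rightarrow> (real \<Rightarrow> real) measure \<Rightarrow> (real \<Rightarrow> real) measure" where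
  "restricted_prior m M \<Pi>C =
     measure_of (Theta m M) (sets (metric_borel (submetric C01 (Theta m M))))
       (\<lambda>A. emeasure \<Pi>C (A \<inter> Theta m M) / emeasure \<Pi>C (Theta m M))"

text \<open>For a prior concentrated on its own space, as \<^const>\<open>restricted_prior\<close> is on \<open>Theta m M\<close>.\<close>

definition pseudo_posterior ::
  "nat \<Rightarrow> (real \<Rightarrow> real) \<Rightarrow> (real \<Rightarrow> real) measure \<Rightarrow> real vec \<Rightarrow> (real \<Rightarrow> real) set \<Rightarrow> real" where
  "pseudo_posterior n \<phi>par \<Pi>0 x A =
     (LINT \<phi>:A|\<Pi>0. corrected_likelihood n \<phi>par \<phi> x) /
     (LINT \<phi>:space \<Pi>0|\<Pi>0. corrected_likelihood n \<phi>par \<phi> x)"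

end

theory Submission imports Defs begin

text \<open>The sum over the Fourier frequencies \<open>y\<close> of \<open>ln (\<phi> y) + \<phi>0 y / \<phi> y\<close> is the
  expected Whittle contrast. The idea is that \<open>- 2\<close> times the corrected log likelihood is this sum
  up to a constant that does not depend on \<open>\<phi>\<close> and an error of size \<open>o(n)\<close> in probability,
  uniformly over \<open>\<Theta>\<close>. With \<open>u = \<phi>0 / \<phi>\<close> the contrast exceeds its value at \<open>\<phi>0\<close> by
  the sum of the divergences \<open>u - 1 - ln u \<ge> 0\<close>. If \<open>\<phi> \<in> \<Theta>\<close> is at distance at
  least \<open>r\<close> from \<open>\<phi>0\<close>, then by the Lipschitz bounds the two functions differ by
  \<open>r / 4\<close> on an interval whose length does not depend on \<open>\<phi>\<close>, so a fixed fraction of the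
  frequencies contributes a fixed amount and the excess is at least \<open>g * n\<close>
  (\<open>divergence_lower\<close>). Near \<open>\<phi>0\<close> the excess is below a small multiple of \<open>n\<close>, and
  the prior charges every neighbourhood of \<open>\<phi>0\<close> (\<open>prior_neighbourhood_pos\<close>). Hence the
  posterior mass of the distant functions is at most a constant times \<open>exp (- g * n / 4)\<close>
  (\<open>posterior_mass_bound\<close>), on an event whose probability tends to one.

  \<^bold>\<open>The quadratic form.\<close> Conjugating a diagonal matrix by the Fourier matrix gives a circulant
  matrix. For a cosine polynomial \<open>\<psi>\<close> the Toeplitz matrix with symbol \<open>\<psi>\<close> differs from
  the circulant one only in its corners (\<open>nrm_corner_sq\<close>). So
  \<open>C \<Gamma>\<^sub>p\<^sub>a\<^sub>r\<^sup>-\<^sup>1 C\<close>, with \<open>C\<close> of symbol \<open>(\<phi> / \<phi>par)\<close> to the power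
  \<open>- 1 / 2\<close>, is close to the circulant with symbol \<open>1 / (2 * pi * \<phi>)\<close>: the working model
  cancels. Stability comes from the lower bound \<open>2 * pi * b\<close> for the spectrum of
  \<open>\<Gamma>\<^sub>p\<^sub>a\<^sub>r\<close>. Every \<open>\<phi> \<in> \<Theta>\<close> is Lipschitz with a common constant, and a Bernstein
  polynomial of a common degree therefore reduces all symbols at once to finitely many cosines with
  bounded coefficients (\<open>uniform_trig_approx\<close>). This leaves finitely many random quantities, the
  cyclic sample autocovariances of the sample and the corner terms.

  \<^bold>\<open>The law of large numbers.\<close> The corner terms have bounded expectation. Convergence of
  the sample autocovariances in probability is the only place where the conditions on the remote past
  enter. With \<open>Z t = X t * X (t + k) - \<gamma> k\<close>, a reverse martingale argument makes \<open>Z 0\<close>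
  almost orthogonal to all bounded functions of the distant past (\<open>reverse_martingale_small\<close>). Since
  \<open>Z\<close> may fail to have a second moment, instead of a variance the proof bounds the expected Huber
  loss of the mean of the \<open>Z t\<close>; its derivative is bounded, and the loss telescopes over time into
  such covariances with the past (\<open>huber_mean_vanishes\<close>).

  \<^bold>\<open>The prior.\<close> The Bernstein polynomial of \<open>c0 = \<phi>0 / \<phi>par\<^sup>\<delta>\<close> has
  Lipschitz norm at most that of \<open>c0\<close> and approximates \<open>c0\<close> uniformly. Its coefficients, up to
  a small error, have positive prior probability, and the strict inequality between the product of the
  norms and \<open>M\<close> leaves room for that error inside \<open>\<Theta>\<close>.\<close>

section \<open>Reverse martingales\<close>

text \<open>The limit is unaffected by dropping an initial segment, so it is measurable with respect to every
  \<open>F j\<close>, hence with respect to their intersection.\<close>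

lemma tail_limit_measurable:
  fixes Y :: "nat \<Rightarrow> 'a \<Rightarrow> real"
  assumes Fsub: "\<And>j. subalgebra M (F j)" and dec: "\<And>i j. i \<le> j \<Longrightarrow> sets (F j) \<subseteq> sets (F i)"
    and T: "subalgebra M T" "sets T = (\<Inter>j. sets (F j))"
    and Y: "\<And>j. Y j \<in> borel_measurable (F j)"
  shows "(\<lambda>x. lim (\<lambda>i. Y i x)) \<in> borel_measurable T"
proof -
  have sp: "space (F j) = space M" "space T = space M" for j
    using Fsub T(1) by (auto simp: subalgebra_def)
  have m: "(\<lambda>x. lim (\<lambda>i. Y i x)) \<in> borel_measurable (F j)" for j
  proof -
    have 1: "Y (i + j) \<in> borel_measurable (F j)" for i
      using Y[of "i+j"] measurable_mono[OF order_refl, of borel "F (i+j)" "F j"] dec[of j "i+j"] sp by auto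
    have eq: "lim (\<lambda>i. Y i x) = lim (\<lambda>i. Y (i + j) x)" for x
    proof -
      have "(\<lambda>i. Y i x) \<longlonglongrightarrow> l \<longleftrightarrow> (\<lambda>i. Y (i + j) x) \<longlonglongrightarrow> l" for l
        using LIMSEQ_ignore_initial_segment[of "\<lambda>i. Y i x" l j] LIMSEQ_offset[of "\<lambda>i. Y i x" j l] by blast
      then show ?thesis unfolding lim_def by presburger
    qed
    show ?thesis unfolding eq by (rule borel_measurable_lim_metric) (rule 1)
  qed
  show ?thesis
  proof (rule measurableI)
    fix A :: "real set" assume "A \<in> sets borel"
    then have "(\<lambda>x. lim (\<lambda>i. Y i x)) -` A \<inter> space M \<in> sets (F j)" for j
      using measurable_sets[OF m[of j]] sp by metis
    then show "(\<lambda>x. lim (\<lambda>i. Y i x)) -` A \<inter> space T \<in> sets T" using T(2) sp by auto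
  qed auto
qed

text \<open>A version of the conditional expectation that is bounded everywhere and not just almost
  everywhere, so that no null sets have to be tracked along a decreasing sequence of \<open>\<sigma>\<close>-algebras.\<close>

lemma (in prob_space) cond_exp_clamped:
  fixes W :: "'a \<Rightarrow> real"
  assumes F: "subalgebra M F" and W: "W \<in> borel_measurable M" "\<And>x. \<bar>W x\<bar> \<le> c"
  shows "\<exists>Y \<in> borel_measurable F. (\<forall>x. \<bar>Y x\<bar> \<le> c) \<and>
    (\<forall>g B. g \<in> borel_measurable F \<longrightarrow> (\<forall>x. \<bar>g x\<bar> \<le> B) \<longrightarrow> (\<integral>x. g x * Y x \<partial>M) = (\<integral>x. g x * W x \<partial>M))"
proof -
  interpret fs: finite_measure_subalgebra M F by unfold_locales (rule F)
  define Y where "Y x = max (- c) (min c (real_cond_exp M F W x))" for x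
  have c0: "c \<ge> 0" using W(2)[of undefined] by linarith
  have [measurable]: "W \<in> borel_measurable M" by (rule W)
  have Wi: "integrable M W" by (rule integrable_const_bound[where B=c]) (use W in auto)
  have lo: "AE x in M. real_cond_exp M F W x \<ge> - c"
    by (rule fs.real_cond_exp_ge_c[OF Wi]) (rule AE_I2, use W(2) in \<open>metis abs_le_D2 minus_le_iff\<close>)
  have hi: "AE x in M. real_cond_exp M F W x \<le> c"
    by (rule fs.real_cond_exp_le_c[OF Wi]) (rule AE_I2, use W(2) in \<open>metis abs_le_D1\<close>)
  have eq: "AE x in M. Y x = real_cond_exp M F W x"
    using lo hi by eventually_elim (auto simp: Y_def)
  have Ym: "Y \<in> borel_measurable F" unfolding Y_def[abs_def] by measurable
  have "(\<integral>x. g x * Y x \<partial>M) = (\<integral>x. g x * W x \<partial>M)"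
    if g[measurable]: "g \<in> borel_measurable F" and gB: "\<forall>x. \<bar>g x\<bar> \<le> B" for g B
  proof -
    have gM[measurable]: "g \<in> borel_measurable M" by (rule measurable_from_subalg[OF F g])
    have [measurable]: "Y \<in> borel_measurable M" by (rule measurable_from_subalg[OF F Ym])
    have [measurable]: "real_cond_exp M F W \<in> borel_measurable M" by (rule measurable_from_subalg[OF F]) simp
    have gW: "integrable M (\<lambda>x. g x * W x)"
      by (rule integrable_const_bound[where B="B*c"])
         (use W(2) gB c0 in \<open>auto simp: abs_mult intro!: mult_mono order_trans[OF abs_ge_zero gB[rule_format]]\<close>)
    have "(\<integral>x. g x * Y x \<partial>M) = (\<integral>x. g x * real_cond_exp M F W x \<partial>M)"
      by (rule integral_cong_AE) (use eq in auto)
    also have "\<dots> = (\<integral>x. g x * W x \<partial>M)"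
      by (rule fs.real_cond_exp_intg(2)[OF gW g]) measurable
    finally show ?thesis .
  qed
  moreover have "\<bar>Y x\<bar> \<le> c" for x using c0 by (auto simp: Y_def)
  ultimately show ?thesis using Ym by blast
qed

lemma (in prob_space) L2_close_imp_L1_close:
  fixes D :: "'a \<Rightarrow> real"
  assumes "D \<in> borel_measurable M" "\<And>x. \<bar>D x\<bar> \<le> c" "(\<integral>x. (D x)\<^sup>2 \<partial>M) \<le> s\<^sup>2" "s > 0"
  shows "(\<integral>x. \<bar>D x\<bar> \<partial>M) \<le> s"
proof -
  have [measurable]: "D \<in> borel_measurable M" by fact
  have i1: "integrable M (\<lambda>x. \<bar>D x\<bar>)" by (rule integrable_const_bound[where B=c]) (use assms in auto)
  have i2: "integrable M (\<lambda>x. (D x)\<^sup>2)"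
    by (rule integrable_const_bound[where B="c\<^sup>2"]) (use assms(2) in \<open>auto intro!: AE_I2 power2_le_iff_abs_le[THEN iffD2] order_trans[OF abs_ge_zero]\<close>)
  have "\<bar>D x\<bar> \<le> (s + (D x)\<^sup>2 / s) / 2" for x
  proof -
    have "0 \<le> (\<bar>D x\<bar> - s)\<^sup>2" by simp
    then have "2 * s * \<bar>D x\<bar> \<le> s\<^sup>2 + (D x)\<^sup>2" by (simp add: power2_eq_square algebra_simps flip: abs_mult)
    then show ?thesis using assms(4) by (simp add: field_simps power2_eq_square)
  qed
  then have "(\<integral>x. \<bar>D x\<bar> \<partial>M) \<le> (\<integral>x. (s + (D x)\<^sup>2 / s) / 2 \<partial>M)"
    by (intro integral_mono i1) (use i2 in auto)
  also have "\<dots> = (s + (\<integral>x. (D x)\<^sup>2 \<partial>M) / s) / 2" using i2 by (simp add: prob_space)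
  also have "\<dots> \<le> (s + s\<^sup>2 / s) / 2" using assms by (intro divide_right_mono add_left_mono) auto
  also have "\<dots> = s" using assms(4) by (simp add: power2_eq_square)
  finally show ?thesis .
qed

lemma (in prob_space) AE_convergent_of_summable_L1_increments:
  fixes Y :: "nat \<Rightarrow> 'a \<Rightarrow> real"
  assumes Y: "\<And>i. Y i \<in> borel_measurable M" "\<And>i x. \<bar>Y i x\<bar> \<le> c"
    and small: "\<And>i. (\<integral>x. \<bar>Y i x - Y (Suc i) x\<bar> \<partial>M) \<le> (1/2)^i"
  shows "AE x in M. convergent (\<lambda>i. Y i x)"
proof -
  have [measurable]: "Y i \<in> borel_measurable M" for i by fact
  have int: "integrable M (\<lambda>x. \<bar>Y i x - Y (Suc i) x\<bar>)" for i
  proof (rule integrable_const_bound[where B="2*c"])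
    have "\<bar>Y i x - Y (Suc i) x\<bar> \<le> 2*c" for x using Y(2)[of i x] Y(2)[of "Suc i" x] by linarith
    then show "AE x in M. norm \<bar>Y i x - Y (Suc i) x\<bar> \<le> 2*c" by simp
  qed measurable
  have "(\<integral>\<^sup>+x. (\<Sum>i. ennreal \<bar>Y i x - Y (Suc i) x\<bar>) \<partial>M) = (\<Sum>i. \<integral>\<^sup>+x. ennreal \<bar>Y i x - Y (Suc i) x\<bar> \<partial>M)"
    by (rule nn_integral_suminf) measurable
  also have "\<dots> \<le> (\<Sum>i. ennreal ((1/2)^i))"
    by (intro suminf_le) (use small int in \<open>auto simp: nn_integral_eq_integral intro!: ennreal_leI\<close>)
  also have "\<dots> = ennreal (\<Sum>i. (1/2)^i)" by (rule suminf_ennreal2) auto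
  also have "\<dots> < \<infinity>" by simp
  finally have "(\<integral>\<^sup>+x. (\<Sum>i. ennreal \<bar>Y i x - Y (Suc i) x\<bar>) \<partial>M) \<noteq> \<infinity>" by auto
  then have "AE x in M. (\<Sum>i. ennreal \<bar>Y i x - Y (Suc i) x\<bar>) \<noteq> \<infinity>"
    by (intro nn_integral_PInf_AE) measurable
  then show ?thesis
  proof eventually_elim
    case (elim x)
    then have "summable (\<lambda>i. \<bar>Y i x - Y (Suc i) x\<bar>)" by (intro summable_suminf_not_top) auto
    then have "summable (\<lambda>i. Y i x - Y (Suc i) x)" by (rule summable_rabs_cancel)
    then have "convergent (\<lambda>n. Y 0 x - (\<Sum>i<n. Y i x - Y (Suc i) x))"
      by (intro convergent_diff convergent_const) (simp add: summable_iff_convergent)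
    moreover have "Y 0 x - (\<Sum>i<n. Y i x - Y (Suc i) x) = Y n x" for n by (induction n) auto
    ultimately show ?case by simp
  qed
qed

text \<open>The conditional expectations \<open>Y j\<close> of \<open>W\<close> given \<open>F j\<close> have decreasing second
  moments and orthogonal increments, so a subsequence converges almost surely to some \<open>L\<close>, which is
  measurable with respect to the intersection \<open>T\<close>. For \<open>g\<close> measurable with respect to
  \<open>F j\<close> and bounded by 1 the integral of \<open>W * g\<close> is at most the expectation of \<open>\<bar>Y j\<bar>\<close>, which is
  close to that of \<open>\<bar>L\<bar>\<close>, and \<open>s = sgn L\<close> attains the latter. The statement asks for
  an \<open>s\<close> and not for the limit so that it survives the truncation of unbounded functions.\<close>

lemma (in prob_space) reverse_martingale_bounded:
  fixes W :: "'a \<Rightarrow> real" and F :: "nat \<Rightarrow> 'a measure"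
  assumes Fsub: "\<And>j. subalgebra M (F j)" and dec: "\<And>i j. i \<le> j \<Longrightarrow> sets (F j) \<subseteq> sets (F i)"
    and T: "subalgebra M T" "sets T = (\<Inter>j. sets (F j))"
    and W: "W \<in> borel_measurable M" "\<And>x. \<bar>W x\<bar> \<le> c" and "e > 0"
  shows "\<exists>j. \<exists>s \<in> borel_measurable T. (\<forall>x. \<bar>s x\<bar> \<le> 1) \<and>
    (\<forall>g \<in> borel_measurable (F j). (\<forall>x. \<bar>g x\<bar> \<le> 1) \<longrightarrow> (\<integral>x. W x * g x \<partial>M) \<le> (\<integral>x. W x * s x \<partial>M) + e)"
proof -
  have c0: "c \<ge> 0" using W(2)[of undefined] by linarith
  have sp: "space (F j) = space M" for j using Fsub by (auto simp: subalgebra_def)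
  have up: "g \<in> borel_measurable (F i)" if "g \<in> borel_measurable (F j)" "i \<le> j" for g :: "'a \<Rightarrow> real" and i j
    using that measurable_mono[OF order_refl, of borel "F j" "F i"] dec[OF that(2)] sp by auto
  have "\<forall>j. \<exists>Y. Y \<in> borel_measurable (F j) \<and> (\<forall>x. \<bar>Y x\<bar> \<le> c) \<and>
    (\<forall>g B. g \<in> borel_measurable (F j) \<longrightarrow> (\<forall>x. \<bar>g x\<bar> \<le> B) \<longrightarrow> (\<integral>x. g x * Y x \<partial>M) = (\<integral>x. g x * W x \<partial>M))"
    using cond_exp_clamped[OF Fsub W] by blast
  then obtain Y where Ym: "\<And>j. Y j \<in> borel_measurable (F j)" and Yc: "\<And>j x. \<bar>Y j x\<bar> \<le> c"
    and Yi: "\<And>j g B. g \<in> borel_measurable (F j) \<Longrightarrow> (\<And>x. \<bar>g x\<bar> \<le> B) \<Longrightarrow> (\<integral>x. g x * Y j x \<partial>M) = (\<integral>x. g x * W x \<partial>M)"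
    by metis
  have [measurable]: "Y j \<in> borel_measurable M" for j by (rule measurable_from_subalg[OF Fsub Ym])
  have [measurable]: "W \<in> borel_measurable M" by fact
  have YY: "integrable M (\<lambda>x. Y i x * Y j x)" for i j
    by (rule integrable_const_bound[where B="c*c"]) (use Yc c0 in \<open>auto simp: abs_mult intro!: mult_mono\<close>)
  define a where "a j = (\<integral>x. Y j x * Y j x \<partial>M)" for j
  have diff: "(\<integral>x. (Y i x - Y j x)\<^sup>2 \<partial>M) = a i - a j" if "i \<le> j" for i j
  proof -
    have "(\<integral>x. Y j x * Y i x \<partial>M) = a j"
      using Yi[OF up[OF Ym that] Yc] Yi[OF Ym Yc] by (simp add: a_def)
    moreover have "(\<integral>x. (Y i x - Y j x)\<^sup>2 \<partial>M) = (\<integral>x. Y i x * Y i x - 2 * (Y j x * Y i x) + Y j x * Y j x \<partial>M)"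
      by (intro Bochner_Integration.integral_cong) (auto simp: power2_eq_square algebra_simps)
    ultimately show ?thesis using YY by (simp add: a_def)
  qed
  have mono: "a j \<le> a i" if "i \<le> j" for i j using diff[OF that] Bochner_Integration.integral_nonneg[of M "\<lambda>x. (Y i x - Y j x)\<^sup>2"] by simp
  have "convergent a"
  proof -
    have "decseq a" by (simp add: decseq_def mono)
    moreover have "\<And>i. 0 \<le> a i" by (simp add: a_def)
    ultimately show ?thesis using decseq_convergent convergentI by metis
  qed
  then have "Cauchy a" by (rule convergent_Cauchy)
  have "\<forall>i. \<exists>N. \<forall>m\<ge>N. a N - a m \<le> ((1/2)^i)\<^sup>2"
  proof
    fix i
    obtain N where "\<forall>m\<ge>N. \<forall>n\<ge>N. dist (a m) (a n) < ((1/2::real)^i)\<^sup>2"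
      using metric_CauchyD[OF \<open>Cauchy a\<close>, of "((1/2::real)^i)\<^sup>2"] by auto
    then show "\<exists>N. \<forall>m\<ge>N. a N - a m \<le> ((1/2)^i)\<^sup>2" by (intro exI[of _ N]) (force simp: dist_real_def)
  qed
  then obtain N where N: "\<And>i m. m \<ge> N i \<Longrightarrow> a (N i) - a m \<le> ((1/2)^i)\<^sup>2" by metis
  \<comment> \<open>a subsequence along which the increments have summable expectations\<close>
  define r where "r i = (\<Sum>l\<le>i. N l) + i" for i
  have rN: "r i \<ge> N i" for i unfolding r_def by (rule trans_le_add1) (rule member_le_sum, auto)
  have rmono: "i \<le> j \<Longrightarrow> r i \<le> r j" for i j
    unfolding r_def by (intro add_mono sum_mono2) auto
  have ri: "i \<le> r i" for i by (simp add: r_def)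
  have incr: "(\<integral>x. \<bar>Y (r i) x - Y (r (Suc i)) x\<bar> \<partial>M) \<le> (1/2)^i" for i
  proof (rule L2_close_imp_L1_close)
    show "\<bar>Y (r i) x - Y (r (Suc i)) x\<bar> \<le> 2 * c" for x using Yc[of "r i" x] Yc[of "r (Suc i)" x] by linarith
    have "r i \<le> r (Suc i)" by (rule rmono) simp
    then have "(\<integral>x. (Y (r i) x - Y (r (Suc i)) x)\<^sup>2 \<partial>M) \<le> a (N i) - a (r (Suc i))"
      using diff mono[OF rN[of i]] by simp
    also have "\<dots> \<le> ((1/2)^i)\<^sup>2" using N rN[of i] \<open>r i \<le> r (Suc i)\<close> by auto
    finally show "(\<integral>x. (Y (r i) x - Y (r (Suc i)) x)\<^sup>2 \<partial>M) \<le> ((1/2)^i)\<^sup>2" .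
  qed auto
  have conv: "AE x in M. convergent (\<lambda>i. Y (r i) x)"
    by (rule AE_convergent_of_summable_L1_increments[OF _ Yc incr]) simp
  define L where "L x = lim (\<lambda>i. Y (r i) x)" for x
  have lim: "AE x in M. (\<lambda>i. Y (r i) x) \<longlonglongrightarrow> L x"
    using conv by eventually_elim (simp add: L_def convergent_LIMSEQ_iff)
  have LT: "L \<in> borel_measurable T"
    unfolding L_def
  proof (rule tail_limit_measurable[where F="\<lambda>i. F (r i)" and M=M])
    show "sets T = (\<Inter>j. sets (F (r j)))" using T(2) dec[OF ri] by blast
  qed (use Fsub dec[OF rmono] T(1) Ym in blast)+
  have [measurable]: "L \<in> borel_measurable M" by (rule measurable_from_subalg[OF T(1) LT])
  define s where "s x = sgn (L x)" for x
  have sT: "s \<in> borel_measurable T" unfolding s_def[abs_def] using LT by measurable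
  have [measurable]: "s \<in> borel_measurable M" by (rule measurable_from_subalg[OF T(1) sT])
  have s1: "\<bar>s x\<bar> \<le> 1" for x by (simp add: s_def sgn_real_def)
  have sF: "s \<in> borel_measurable (F j)" for j
    using sT measurable_mono[OF order_refl, of borel T "F j"] T sp by (auto simp: subalgebra_def)
  have l1: "(\<lambda>i. \<integral>x. \<bar>Y (r i) x\<bar> \<partial>M) \<longlonglongrightarrow> (\<integral>x. \<bar>L x\<bar> \<partial>M)"
  proof (rule integral_dominated_convergence[where w="\<lambda>_. c"])
    show "AE x in M. (\<lambda>i. \<bar>Y (r i) x\<bar>) \<longlonglongrightarrow> \<bar>L x\<bar>" using lim by eventually_elim (rule tendsto_rabs)
  qed (use Yc in auto)
  have l2: "(\<lambda>i. \<integral>x. s x * Y (r i) x \<partial>M) \<longlonglongrightarrow> (\<integral>x. s x * L x \<partial>M)"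
  proof (rule integral_dominated_convergence[where w="\<lambda>_. c"])
    show "AE x in M. (\<lambda>i. s x * Y (r i) x) \<longlonglongrightarrow> s x * L x" using lim by eventually_elim (rule tendsto_mult_left)
    have "\<bar>s x\<bar> * \<bar>Y (r i) x\<bar> \<le> 1 * c" for i x by (rule mult_mono) (use Yc s1 in auto)
    then show "AE x in M. norm (s x * Y (r i) x) \<le> c" for i by (auto simp: abs_mult)
  qed auto
  have "(\<integral>x. s x * Y (r i) x \<partial>M) = (\<integral>x. s x * W x \<partial>M)" for i by (rule Yi[OF sF s1])
  then have "(\<integral>x. s x * W x \<partial>M) = (\<integral>x. s x * L x \<partial>M)" using l2 by (simp add: LIMSEQ_const_iff)
  moreover have "s x * L x = \<bar>L x\<bar>" for x by (simp add: s_def sgn_real_def)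
  ultimately have EL: "(\<integral>x. \<bar>L x\<bar> \<partial>M) = (\<integral>x. W x * s x \<partial>M)" by (simp add: mult.commute)
  have "eventually (\<lambda>i. (\<integral>x. \<bar>Y (r i) x\<bar> \<partial>M) < (\<integral>x. \<bar>L x\<bar> \<partial>M) + e) sequentially"
    by (rule order_tendstoD(2)[OF l1]) (use \<open>e > 0\<close> in simp)
  then obtain i where i: "(\<integral>x. \<bar>Y (r i) x\<bar> \<partial>M) < (\<integral>x. \<bar>L x\<bar> \<partial>M) + e" by (auto simp: eventually_sequentially)
  have "(\<integral>x. W x * g x \<partial>M) \<le> (\<integral>x. W x * s x \<partial>M) + e"
    if g: "g \<in> borel_measurable (F (r i))" "\<forall>x. \<bar>g x\<bar> \<le> 1" for g
  proof -
    have [measurable]: "g \<in> borel_measurable M" by (rule measurable_from_subalg[OF Fsub g(1)])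
    have b: "\<bar>g x\<bar> * \<bar>Y (r i) x\<bar> \<le> 1 * \<bar>Y (r i) x\<bar>" for x by (rule mult_right_mono) (use g(2) in auto)
    have "(\<integral>x. W x * g x \<partial>M) = (\<integral>x. g x * Y (r i) x \<partial>M)"
      using Yi[OF g(1), of 1] g(2) by (simp add: mult.commute)
    also have "\<dots> \<le> (\<integral>x. \<bar>Y (r i) x\<bar> \<partial>M)"
    proof (rule integral_mono)
      show "integrable M (\<lambda>x. g x * Y (r i) x)"
        by (rule integrable_const_bound[where B=c]) (use order_trans[OF b] Yc[of "r i"] in \<open>auto simp: abs_mult\<close>)
      show "integrable M (\<lambda>x. \<bar>Y (r i) x\<bar>)"
        by (rule integrable_const_bound[where B=c]) (use Yc in auto)
      show "g x * Y (r i) x \<le> \<bar>Y (r i) x\<bar>" for x using b[of x] abs_ge_self[of "g x * Y (r i) x"] by (simp add: abs_mult)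
    qed
    finally show ?thesis using i EL by simp
  qed
  then show ?thesis using sT s1 by blast
qed

text \<open>Truncation at a high level changes all the integrals by at most \<open>e / 3\<close>, uniformly in
  \<open>g\<close>. Functions that are measurable with respect to \<open>T\<close> are orthogonal to \<open>Z\<close>, so
  the comparison function \<open>s\<close> of the bounded case contributes nothing beyond truncation.\<close>

lemma (in prob_space) reverse_martingale_small:
  fixes Z :: "'a \<Rightarrow> real" and F :: "nat \<Rightarrow> 'a measure"
  assumes Fsub: "\<And>j. subalgebra M (F j)" and dec: "\<And>i j. i \<le> j \<Longrightarrow> sets (F j) \<subseteq> sets (F i)"
    and T: "subalgebra M T" "sets T = (\<Inter>j. sets (F j))"
    and Z: "integrable M Z" "AE x in M. real_cond_exp M T Z x = 0" and "e > 0"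
  shows "\<exists>j. \<forall>g \<in> borel_measurable (F j). (\<forall>x. \<bar>g x\<bar> \<le> 1) \<longrightarrow> (\<integral>x. Z x * g x \<partial>M) \<le> e"
proof -
  interpret fs: finite_measure_subalgebra M T by unfold_locales (rule T)
  have [measurable]: "Z \<in> borel_measurable M" using Z(1) by simp
  define W where "W n x = max (- real n) (min (real n) (Z x))" for n x
  have [measurable]: "W n \<in> borel_measurable M" for n unfolding W_def[abs_def] by measurable
  have Wn: "\<bar>W n x\<bar> \<le> real n" and WZ: "\<bar>Z x - W n x\<bar> \<le> \<bar>Z x\<bar>" for n x by (auto simp: W_def)
  have "(\<lambda>n. \<integral>x. \<bar>Z x - W n x\<bar> \<partial>M) \<longlonglongrightarrow> (\<integral>x. 0 \<partial>M)"
  proof (rule integral_dominated_convergence[where w="\<lambda>x. \<bar>Z x\<bar>"])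
    show "AE x in M. (\<lambda>n. \<bar>Z x - W n x\<bar>) \<longlonglongrightarrow> 0"
    proof (rule AE_I2, rule tendsto_eventually)
      fix x
      obtain N where N: "\<bar>Z x\<bar> \<le> real N" using real_arch_simple by blast
      show "\<forall>\<^sub>F n in sequentially. \<bar>Z x - W n x\<bar> = 0"
        unfolding eventually_sequentially
      proof (intro exI allI impI)
        fix n assume "N \<le> n" then show "\<bar>Z x - W n x\<bar> = 0" using N by (auto simp: W_def abs_le_iff max_def min_def)
      qed
    qed
  qed (use Z WZ in auto)
  then have "eventually (\<lambda>n. (\<integral>x. \<bar>Z x - W n x\<bar> \<partial>M) < e/3) sequentially"
    by (rule order_tendstoD) (use \<open>e>0\<close> in simp)
  then obtain n where n: "(\<integral>x. \<bar>Z x - W n x\<bar> \<partial>M) < e/3" by (auto simp: eventually_sequentially)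
  have iR: "integrable M (\<lambda>x. \<bar>Z x - W n x\<bar>)"
    by (rule Bochner_Integration.integrable_bound[OF Z(1)]) (use WZ in auto)
  have close: "\<bar>(\<integral>x. Z x * g x \<partial>M) - (\<integral>x. W n x * g x \<partial>M)\<bar> \<le> e/3"
    if [measurable]: "g \<in> borel_measurable M" and g1: "\<And>x. \<bar>g x\<bar> \<le> 1" for g
  proof -
    have iZ: "integrable M (\<lambda>x. Z x * g x)"
      by (rule Bochner_Integration.integrable_bound[OF Z(1)]) (use g1 in \<open>auto simp: abs_mult intro!: AE_I2 mult_left_le\<close>)
    have b: "\<bar>W n x\<bar> * \<bar>g x\<bar> \<le> real n * 1" for x by (rule mult_mono) (use Wn g1 in auto)
    have iW: "integrable M (\<lambda>x. W n x * g x)"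
      by (rule integrable_const_bound[where B="real n"]) (use b in \<open>auto simp: abs_mult\<close>)
    have "\<bar>\<integral>x. (Z x - W n x) * g x \<partial>M\<bar> \<le> (\<integral>x. \<bar>(Z x - W n x) * g x\<bar> \<partial>M)" by (rule integral_abs_bound)
    also have "\<dots> \<le> (\<integral>x. \<bar>Z x - W n x\<bar> \<partial>M)"
    proof (rule integral_mono[OF _ iR])
      show "integrable M (\<lambda>x. \<bar>(Z x - W n x) * g x\<bar>)"
        using Bochner_Integration.integrable_diff[OF iZ iW] by (simp add: algebra_simps)
    qed (use g1 in \<open>auto simp: abs_mult intro!: mult_left_le\<close>)
    finally show ?thesis using n iZ iW by (simp add: algebra_simps)
  qed
  obtain j s where s: "s \<in> borel_measurable T" "\<forall>x. \<bar>s x\<bar> \<le> 1"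
    and j: "\<forall>g \<in> borel_measurable (F j). (\<forall>x. \<bar>g x\<bar> \<le> 1) \<longrightarrow> (\<integral>x. W n x * g x \<partial>M) \<le> (\<integral>x. W n x * s x \<partial>M) + e/3"
    using reverse_martingale_bounded[where W="W n" and F=F and T=T and c="real n" and e="e/3", OF Fsub dec T _ Wn] \<open>e>0\<close>
    by auto
  have sM[measurable]: "s \<in> borel_measurable M" by (rule measurable_from_subalg[OF T(1) s(1)])
  have "(\<integral>x. s x * Z x \<partial>M) = (\<integral>x. s x * real_cond_exp M T Z x \<partial>M)"
  proof (rule fs.real_cond_exp_intg(2)[symmetric])
    show "integrable M (\<lambda>x. s x * Z x)"
      by (rule Bochner_Integration.integrable_bound[OF Z(1)]) (use s(2) in \<open>auto simp: abs_mult mult_left_le_one_le\<close>)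
  qed (use s(1) in auto)
  also have "\<dots> = (\<integral>x. 0 \<partial>M)"
  proof (rule integral_cong_AE)
    have [measurable]: "real_cond_exp M T Z \<in> borel_measurable M" by (rule measurable_from_subalg[OF T(1)]) simp
    show "(\<lambda>x. s x * real_cond_exp M T Z x) \<in> borel_measurable M" by measurable
  qed (use Z(2) in auto)
  finally have "(\<integral>x. Z x * s x \<partial>M) = 0" by (simp add: mult.commute)
  then have ws: "(\<integral>x. W n x * s x \<partial>M) \<le> e/3" using close[OF sM] s(2) by force
  show ?thesis
  proof (intro exI[of _ j] ballI impI)
    fix g :: "'a \<Rightarrow> real" assume g: "g \<in> borel_measurable (F j)" "\<forall>x. \<bar>g x\<bar> \<le> 1"
    have "g \<in> borel_measurable M" by (rule measurable_from_subalg[OF Fsub g(1)])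
    then have "\<bar>(\<integral>x. Z x * g x \<partial>M) - (\<integral>x. W n x * g x \<partial>M)\<bar> \<le> e/3" using close g(2) by blast
    then have "(\<integral>x. Z x * g x \<partial>M) \<le> (\<integral>x. W n x * g x \<partial>M) + e/3" by linarith
    moreover have "(\<integral>x. W n x * g x \<partial>M) \<le> (\<integral>x. W n x * s x \<partial>M) + e/3" using j g by blast
    ultimately show "(\<integral>x. Z x * g x \<partial>M) \<le> e" using ws by linarith
  qed
qed

section \<open>Sample autocovariances\<close>

definition clamp1 :: "real \<Rightarrow> real" where
  "clamp1 x = max (- 1) (min 1 x)"

text \<open>The convex function with derivative \<open>clamp1\<close>. It is quadratic near zero, so that it controls
  probabilities, and of linear growth, so that it is integrable along with its argument.\<close>

definition huber :: "real \<Rightarrow> real" where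
  "huber x = (if \<bar>x\<bar> \<le> 1 then x\<^sup>2 / 2 else \<bar>x\<bar> - 1 / 2)"

lemma clamp1_bound: "\<bar>clamp1 x\<bar> \<le> 1" by (auto simp: clamp1_def)

lemma clamp1_diff: "\<bar>clamp1 x - clamp1 y\<bar> \<le> min 2 \<bar>x - y\<bar>" by (auto simp: clamp1_def)

lemma clamp1_measurable [measurable]: "clamp1 \<in> borel_measurable borel"
  unfolding clamp1_def[abs_def] by measurable

lemma huber_measurable [measurable]: "huber \<in> borel_measurable borel"
  unfolding huber_def[abs_def] by measurable

lemma huber_nonneg: "0 \<le> huber x" by (auto simp: huber_def)

lemma huber_le_abs: "huber x \<le> \<bar>x\<bar>"
proof (cases "\<bar>x\<bar> \<le> 1")
  case True
  have "x\<^sup>2 \<le> \<bar>x\<bar> * 1" unfolding power2_eq_square abs_mult_self_eq[symmetric, of x] using True by (intro mult_left_mono) auto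
  then show ?thesis using True by (simp add: huber_def)
qed (auto simp: huber_def)

lemma huber_norm_le: "norm (huber x) \<le> norm x"
  using huber_nonneg[of x] huber_le_abs[of x] by simp

lemma huber_ge:
  assumes "e \<le> 1" "0 < e" "e \<le> \<bar>x\<bar>" shows "e\<^sup>2 / 2 \<le> huber x"
proof -
  have "e\<^sup>2 \<le> 1" using assms by (simp add: power_le_one)
  moreover have "e\<^sup>2 \<le> x\<^sup>2" using assms by (metis abs_ge_zero power2_abs power_mono less_imp_le)
  ultimately show ?thesis using assms by (auto simp: huber_def)
qed

text \<open>Convexity: the tangent at \<open>b\<close> stays below the graph. The left-hand estimate in the proof is
  Fenchel's inequality for the conjugate \<open>c\<^sup>2 / 2\<close> on \<open>[-1, 1]\<close>.\<close>

lemma huber_tangent: "huber b - huber a \<le> clamp1 b * (b - a)"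
proof -
  have *: "c * a - c\<^sup>2 / 2 \<le> huber a" if "\<bar>c\<bar> \<le> 1" for c
  proof (cases "\<bar>a\<bar> \<le> 1")
    case True
    have "0 \<le> (a - c)\<^sup>2" by simp
    then show ?thesis using True by (simp add: huber_def power2_eq_square algebra_simps)
  next
    case False
    have "c * a \<le> \<bar>c\<bar> * \<bar>a\<bar>" by (metis abs_ge_self abs_mult)
    moreover have "\<bar>c\<bar> * \<bar>a\<bar> \<le> \<bar>a\<bar> - 1 + \<bar>c\<bar>"
    proof -
      have "0 \<le> (1 - \<bar>c\<bar>) * (\<bar>a\<bar> - 1)" using that False by (intro mult_nonneg_nonneg) auto
      then show ?thesis by (simp add: algebra_simps)
    qed
    moreover have "\<bar>c\<bar> \<le> (1 + c\<^sup>2) / 2"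
      using zero_le_power2[of "1 - \<bar>c\<bar>"] unfolding power2_diff by simp
    ultimately show ?thesis using False by (simp add: huber_def)
  qed
  have "huber b = clamp1 b * b - (clamp1 b)\<^sup>2 / 2"
    by (auto simp: huber_def clamp1_def power2_eq_square max_def min_def)
  then show ?thesis using *[OF clamp1_bound, of b] by (simp add: algebra_simps)
qed

text \<open>The part of the assumptions on the time series that yields the law of large numbers for products
  at a fixed lag.\<close>

locale remotely_uncorrelated_series = prob_space P for P :: "'a measure" +
  fixes X :: "int \<Rightarrow> 'a \<Rightarrow> real" and \<gamma> :: "int \<Rightarrow> real"
  assumes X_meas [measurable]: "\<And>k. X k \<in> borel_measurable P"
    and stationary: "strictly_stationary P X"
    and square_integrable: "\<And>k. integrable P (\<lambda>\<omega>. (X k \<omega>)\<^sup>2)"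
    and gamma_eq: "\<gamma> = autocov P X"
    and remote: "\<And>k. AE \<omega> in P. real_cond_exp P (remote_past P X) (\<lambda>\<omega>. X 0 \<omega> * X k \<omega>) \<omega> = \<gamma> k"
begin

lemma integral_shift:
  fixes F :: "(int \<Rightarrow> real) \<Rightarrow> real"
  assumes J: "finite J" and F[measurable]: "F \<in> borel_measurable (PiM J (\<lambda>_. borel))"
  shows "(\<integral>\<omega>. F (\<lambda>j\<in>J. X (j + h) \<omega>) \<partial>P) = (\<integral>\<omega>. F (\<lambda>j\<in>J. X j \<omega>) \<partial>P)"
proof -
  have "(\<integral>\<omega>. F (\<lambda>j\<in>J. X (j + h) \<omega>) \<partial>P) = integral\<^sup>L (distr P (PiM J (\<lambda>_. borel)) (\<lambda>\<omega>. \<lambda>j\<in>J. X (j + h) \<omega>)) F"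
    by (rule integral_distr[symmetric]) measurable
  also have "\<dots> = integral\<^sup>L (distr P (PiM J (\<lambda>_. borel)) (\<lambda>\<omega>. \<lambda>j\<in>J. X j \<omega>)) F"
    using stationary J unfolding strictly_stationary_def by metis
  also have "\<dots> = (\<integral>\<omega>. F (\<lambda>j\<in>J. X j \<omega>) \<partial>P)"
    by (rule integral_distr) measurable
  finally show ?thesis .
qed

lemma product_integrable: "integrable P (\<lambda>\<omega>. X s \<omega> * X t \<omega>)"
proof (rule Bochner_Integration.integrable_bound)
  show "integrable P (\<lambda>\<omega>. (X s \<omega>)\<^sup>2 + (X t \<omega>)\<^sup>2)" using square_integrable by auto
  have "\<bar>a * b\<bar> \<le> a\<^sup>2 + b\<^sup>2" for a b :: real
  proof -
    have "0 \<le> (\<bar>a\<bar> - \<bar>b\<bar>)\<^sup>2" "0 \<le> a\<^sup>2 + b\<^sup>2" by auto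
    then have "2 * (\<bar>a\<bar> * \<bar>b\<bar>) \<le> a\<^sup>2 + b\<^sup>2" "0 \<le> \<bar>a\<bar> * \<bar>b\<bar>" unfolding power2_diff by auto
    then show ?thesis unfolding abs_mult by linarith
  qed
  then show "AE \<omega> in P. norm (X s \<omega> * X t \<omega>) \<le> norm ((X s \<omega>)\<^sup>2 + (X t \<omega>)\<^sup>2)" by simp
qed measurable

lemma expectation_product: "(\<integral>\<omega>. X s \<omega> * X t \<omega> \<partial>P) = \<gamma> (t - s)"
proof -
  have "(\<integral>\<omega>. (\<lambda>x. x 0 * x (t - s)) (\<lambda>j\<in>{0, t - s}. X (j + s) \<omega>) \<partial>P) =
      (\<integral>\<omega>. (\<lambda>x. x 0 * x (t - s)) (\<lambda>j\<in>{0, t - s}. X j \<omega>) \<partial>P)"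
    by (rule integral_shift) measurable
  then show ?thesis by (simp add: gamma_eq autocov_def)
qed

lemma sets_past: "sets (past P X k) = sigma_sets (space P) (\<Union>s\<in>{..k}. {X s -` B \<inter> space P |B. B \<in> sets borel})"
  unfolding past_def by (rule sets_measure_of) blast

lemma space_past: "space (past P X k) = space P"
  unfolding past_def by (rule space_measure_of) blast

lemma past_subalgebra: "subalgebra P (past P X k)"
  unfolding subalgebra_def sets_past space_past
  by (intro conjI refl sets.sigma_sets_subset) (auto intro!: measurable_sets)

lemma past_measurable: "s \<le> k \<Longrightarrow> X s \<in> borel_measurable (past P X k)"
  by (rule measurableI) (auto simp: sets_past space_past intro!: sigma_sets.Basic)

lemma past_mono: "k \<le> l \<Longrightarrow> sets (past P X k) \<subseteq> sets (past P X l)"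
  unfolding sets_past by (rule sigma_sets_mono') force

text \<open>The intersection of all past \<open>\<sigma>\<close>-algebras is already a \<open>\<sigma>\<close>-algebra, and by
  monotonicity it is the intersection along any sequence of times tending to \<open>- \<infinity>\<close>.\<close>

lemma remote_past_sets: "sets (remote_past P X) = (\<Inter>i::nat. sets (past P X (k - int i)))"
proof -
  note sp = space_past
  have "sets (remote_past P X) = sigma_sets (space P) (\<Inter>l. sets (past P X l))"
    unfolding remote_past_def by (rule sets_measure_of) (use sets.sets_into_space sp in blast)
  also have "\<dots> = (\<Inter>l. sets (past P X l))"
  proof
    have "sigma_sets (space P) (\<Inter>l. sets (past P X l)) \<subseteq> sets (past P X j)" for j
      using sets.sigma_sets_subset[of "\<Inter>l. sets (past P X l)" "past P X j"] sp by auto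
    then show "sigma_sets (space P) (\<Inter>l. sets (past P X l)) \<subseteq> (\<Inter>l. sets (past P X l))" by auto
  qed auto
  also have "\<dots> = (\<Inter>i::nat. sets (past P X (k - int i)))"
  proof
    show "(\<Inter>i::nat. sets (past P X (k - int i))) \<subseteq> (\<Inter>l. sets (past P X l))"
    proof
      fix A assume A: "A \<in> (\<Inter>i::nat. sets (past P X (k - int i)))"
      have "A \<in> sets (past P X l)" for l
      proof -
        have "k - int (nat (k - l)) \<le> l" by linarith
        then show ?thesis using A past_mono by blast
      qed
      then show "A \<in> (\<Inter>l. sets (past P X l))" by auto
    qed
  qed auto
  finally show ?thesis .
qed

lemma remote_past_subalgebra: "subalgebra P (remote_past P X)"
proof -
  have "space (remote_past P X) = space P" unfolding remote_past_def
    by (rule space_measure_of) (use sets.sets_into_space space_past in blast)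
  then show ?thesis using remote_past_sets[of 0] past_subalgebra unfolding subalgebra_def by blast
qed

end

context remotely_uncorrelated_series begin

definition centred :: "nat \<Rightarrow> int \<Rightarrow> 'a \<Rightarrow> real" where
  "centred k t \<omega> = X t \<omega> * X (t + int k) \<omega> - \<gamma> (int k)"

lemma centred_measurable [measurable]: "centred k t \<in> borel_measurable P"
  unfolding centred_def[abs_def] by measurable

lemma centred_integrable: "integrable P (centred k t)"
  unfolding centred_def[abs_def] using product_integrable by simp

lemma centred_past: "t + int k \<le> l \<Longrightarrow> centred k t \<in> borel_measurable (past P X l)"
  unfolding centred_def[abs_def] using past_measurable[of t l] past_measurable[of "t + int k" l] by simp

lemma centred_remote: "AE \<omega> in P. real_cond_exp P (remote_past P X) (centred k 0) \<omega> = 0"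
proof -
  interpret fs: finite_measure_subalgebra P "remote_past P X"
    by unfold_locales (rule remote_past_subalgebra)
  have "AE \<omega> in P. real_cond_exp P (remote_past P X) (\<lambda>\<omega>. X 0 \<omega> * X (int k) \<omega> - \<gamma> (int k)) \<omega> =
      real_cond_exp P (remote_past P X) (\<lambda>\<omega>. X 0 \<omega> * X (int k) \<omega>) \<omega> - real_cond_exp P (remote_past P X) (\<lambda>\<omega>. \<gamma> (int k)) \<omega>"
    using product_integrable by (intro fs.real_cond_exp_diff) auto
  moreover have "AE \<omega> in P. real_cond_exp P (remote_past P X) (\<lambda>\<omega>. \<gamma> (int k)) \<omega> = \<gamma> (int k)"
    by (rule fs.real_cond_exp_F_meas) auto
  ultimately show ?thesis using remote[of "int k"]
    by eventually_elim (simp add: centred_def[abs_def])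
qed

text \<open>Stationarity moves the last summand to time zero, and the earlier summands into its past.\<close>

lemma centred_sum_shift:
  "(\<integral>\<omega>. centred k (int t + 1) \<omega> * clamp1 ((\<Sum>i\<le>t. centred k (int i + 1) \<omega>) / real n) \<partial>P) =
   (\<integral>\<omega>. centred k 0 \<omega> * clamp1 ((\<Sum>i\<le>t. centred k (- int i) \<omega>) / real n) \<partial>P)"
proof -
  define J where "J = {- int t..int k}"
  define z where "z x u = x u * x (u + int k) - \<gamma> (int k)" for x :: "int \<Rightarrow> real" and u
  define F where "F x = z x 0 * clamp1 ((\<Sum>i\<le>t. z x (- int i)) / real n)" for x
  have zm: "(\<lambda>x. z x u) \<in> borel_measurable (PiM J (\<lambda>_. borel))" if "u \<in> J" "u + int k \<in> J" for u
    unfolding z_def using that by measurable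
  have Fm: "F \<in> borel_measurable (PiM J (\<lambda>_. borel))"
    unfolding F_def[abs_def] by (intro borel_measurable_times zm measurable_compose[OF _ clamp1_measurable] borel_measurable_divide borel_measurable_sum)
      (auto simp: J_def)
  have ex: "z (\<lambda>j\<in>J. X (j + h) \<omega>) u = centred k (u + h) \<omega>" if "u \<in> J" "u + int k \<in> J" for u h \<omega>
    using that by (simp add: z_def centred_def add.commute add.left_commute)
  have Fx: "F (\<lambda>j\<in>J. X (j + h) \<omega>) = centred k h \<omega> * clamp1 ((\<Sum>i\<le>t. centred k (- int i + h) \<omega>) / real n)" for h \<omega>
  proof -
    have "(\<Sum>i\<le>t. z (\<lambda>j\<in>J. X (j + h) \<omega>) (- int i)) = (\<Sum>i\<le>t. centred k (- int i + h) \<omega>)"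
      by (rule sum.cong[OF refl], rule ex) (auto simp: J_def)
    moreover have "z (\<lambda>j\<in>J. X (j + h) \<omega>) 0 = centred k h \<omega>" using ex[of 0] by (simp add: J_def)
    ultimately show ?thesis by (simp add: F_def)
  qed
  have rev: "(\<Sum>i\<le>t. centred k (- int i + (int t + 1)) \<omega>) = (\<Sum>i\<le>t. centred k (int i + 1) \<omega>)" for \<omega>
    by (rule sum.reindex_bij_witness[of _ "\<lambda>i. t - i" "\<lambda>i. t - i"]) (auto simp: of_nat_diff algebra_simps)
  have "(\<integral>\<omega>. F (\<lambda>j\<in>J. X (j + (int t + 1)) \<omega>) \<partial>P) = (\<integral>\<omega>. F (\<lambda>j\<in>J. X (j + 0) \<omega>) \<partial>P)"
    using integral_shift[of J F "int t + 1"] integral_shift[of J F 0] Fm by (simp add: J_def)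
  then show ?thesis unfolding Fx rev by simp
qed

text \<open>Adding one summand \<open>Z\<close> to the mean raises the Huber loss by at most \<open>Z / n\<close> times the
  clamped new mean. After a shift this is the covariance of the summand at time zero with a bounded
  function of the times \<open>0, - 1, - 2, \<dots>\<close>. Leaving out the last \<open>j\<close> times changes that
  function by \<open>O(1 / n)\<close> in a dominated way, and makes it a function of the distant past, with which
  the covariance is small.\<close>

lemma huber_mean_vanishes:
  assumes "e > 0"
  shows "\<forall>\<^sub>F n in sequentially. (\<integral>\<omega>. huber ((\<Sum>i<n. centred k (int i + 1) \<omega>) / real n) \<partial>P) \<le> e"
proof -
  obtain j where j: "\<And>g. g \<in> borel_measurable (past P X (int k - int j)) \<Longrightarrow> (\<And>x. \<bar>g x\<bar> \<le> 1) \<Longrightarrow> (\<integral>x. centred k 0 x * g x \<partial>P) \<le> e/2"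
    using reverse_martingale_small[where F="\<lambda>j. past P X (int k - int j)" and T="remote_past P X" and Z="centred k 0" and e="e/2",
        OF past_subalgebra past_mono remote_past_subalgebra remote_past_sets centred_integrable centred_remote] assms
    by auto
  \<comment> \<open>bounds the change when the times \<open>0, - 1, \<dots>, - (j - 1)\<close> are left out of the sum\<close>
  define B where "B \<omega> = (\<Sum>i<j. \<bar>centred k (- int i) \<omega>\<bar>)" for \<omega>
  have [measurable]: "B \<in> borel_measurable P" unfolding B_def[abs_def] by measurable
  define err where "err n = (\<integral>\<omega>. \<bar>centred k 0 \<omega>\<bar> * min 2 (B \<omega> / real n) \<partial>P)" for n
  have ZZ: "integrable P (\<lambda>\<omega>. 2 * \<bar>centred k 0 \<omega>\<bar>)" using centred_integrable by auto
  have B0: "0 \<le> B \<omega>" for \<omega> by (simp add: B_def sum_nonneg)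
  have eb: "\<bar>\<bar>centred k 0 \<omega>\<bar> * min 2 (B \<omega> / real n)\<bar> \<le> 2 * \<bar>centred k 0 \<omega>\<bar>" for \<omega> n
  proof -
    have "0 \<le> min 2 (B \<omega> / real n)" using B0 by simp
    then have "\<bar>min 2 (B \<omega> / real n)\<bar> \<le> 2" by simp
    then have "\<bar>centred k 0 \<omega>\<bar> * \<bar>min 2 (B \<omega> / real n)\<bar> \<le> \<bar>centred k 0 \<omega>\<bar> * 2" by (intro mult_left_mono) auto
    then show ?thesis by (simp add: abs_mult)
  qed
  have ei: "integrable P (\<lambda>\<omega>. \<bar>centred k 0 \<omega>\<bar> * min 2 (B \<omega> / real n))" for n
    by (rule Bochner_Integration.integrable_bound[OF ZZ]) (use eb in auto)
  have "err \<longlonglongrightarrow> (\<integral>\<omega>. 0 \<partial>P)"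
    unfolding err_def
  proof (rule integral_dominated_convergence[OF _ _ ZZ])
    show "AE \<omega> in P. (\<lambda>n. \<bar>centred k 0 \<omega>\<bar> * min 2 (B \<omega> / real n)) \<longlonglongrightarrow> 0"
    proof (rule AE_I2)
      fix \<omega>
      have "(\<lambda>n. B \<omega> / real n) \<longlonglongrightarrow> 0" by (rule lim_const_over_n)
      then have "(\<lambda>n. \<bar>centred k 0 \<omega>\<bar> * min 2 (B \<omega> / real n)) \<longlonglongrightarrow> \<bar>centred k 0 \<omega>\<bar> * min 2 0" by (intro tendsto_intros)
      then show "(\<lambda>n. \<bar>centred k 0 \<omega>\<bar> * min 2 (B \<omega> / real n)) \<longlonglongrightarrow> 0" by simp
    qed
  qed (use eb in auto)
  then have "\<forall>\<^sub>F n in sequentially. err n < e/2" by (intro order_tendstoD) (use assms in auto)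
  then show ?thesis
  proof (eventually_elim)
    case (elim n)
    define c where "c t \<omega> = clamp1 ((\<Sum>i\<le>t. centred k (int i + 1) \<omega>) / real n)" for t \<omega>
    define V where "V t \<omega> = clamp1 ((\<Sum>i\<le>t. centred k (- int i) \<omega>) / real n)" for t \<omega>
    define W where "W t \<omega> = clamp1 ((\<Sum>i\<in>{j..t}. centred k (- int i) \<omega>) / real n)" for t \<omega>
    have [measurable]: "c t \<in> borel_measurable P" "V t \<in> borel_measurable P" "W t \<in> borel_measurable P" for t
      unfolding c_def[abs_def] V_def[abs_def] W_def[abs_def] by measurable
    have ic: "integrable P (\<lambda>\<omega>. centred k s \<omega> * g \<omega>)"
      if [measurable]: "g \<in> borel_measurable P" and "\<And>\<omega>. \<bar>g \<omega>\<bar> \<le> 1" for s g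
      by (rule Bochner_Integration.integrable_bound[OF centred_integrable[of k s]])
        (use that(2) in \<open>auto simp: abs_mult intro!: AE_I2 mult_left_le\<close>)
    have bds: "\<bar>c t \<omega>\<bar> \<le> 1" "\<bar>V t \<omega>\<bar> \<le> 1" "\<bar>W t \<omega>\<bar> \<le> 1" for t \<omega> by (auto simp: c_def V_def W_def clamp1_bound)
    have each: "(\<integral>\<omega>. centred k (int t + 1) \<omega> * c t \<omega> \<partial>P) \<le> e" for t
    proof -
      have "W t \<in> borel_measurable (past P X (int k - int j))"
        unfolding W_def[abs_def]
        by (intro measurable_compose[OF _ clamp1_measurable] borel_measurable_divide borel_measurable_sum centred_past) auto
      then have 1: "(\<integral>\<omega>. centred k 0 \<omega> * W t \<omega> \<partial>P) \<le> e/2" by (rule j) (rule bds)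
      have VW: "\<bar>V t \<omega> - W t \<omega>\<bar> \<le> min 2 (B \<omega> / real n)" for \<omega>
      proof -
        have split: "{..t} = {j..t} \<union> ({..t} \<inter> {..<j})" by auto
        have "(\<Sum>i\<in>{j..t} \<union> ({..t} \<inter> {..<j}). centred k (- int i) \<omega>) =
            (\<Sum>i\<in>{j..t}. centred k (- int i) \<omega>) + (\<Sum>i\<in>{..t} \<inter> {..<j}. centred k (- int i) \<omega>)"
          by (rule sum.union_disjoint) auto
        then have "(\<Sum>i\<le>t. centred k (- int i) \<omega>) = (\<Sum>i\<in>{j..t}. centred k (- int i) \<omega>) + (\<Sum>i\<in>{..t} \<inter> {..<j}. centred k (- int i) \<omega>)"
          unfolding split[symmetric] .
        moreover have "\<bar>\<Sum>i\<in>{..t} \<inter> {..<j}. centred k (- int i) \<omega>\<bar> \<le> B \<omega>"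
          unfolding B_def by (rule order_trans[OF sum_abs]) (rule sum_mono2, auto)
        ultimately have "\<bar>(\<Sum>i\<le>t. centred k (- int i) \<omega>) / real n - (\<Sum>i\<in>{j..t}. centred k (- int i) \<omega>) / real n\<bar> \<le> B \<omega> / real n"
          by (simp add: diff_divide_distrib[symmetric] abs_divide divide_right_mono)
        then show ?thesis unfolding V_def W_def by (intro order_trans[OF clamp1_diff]) auto
      qed
      have "(\<integral>\<omega>. centred k (int t + 1) \<omega> * c t \<omega> \<partial>P) = (\<integral>\<omega>. centred k 0 \<omega> * V t \<omega> \<partial>P)"
        unfolding c_def V_def by (rule centred_sum_shift)
      also have "\<dots> \<le> (\<integral>\<omega>. centred k 0 \<omega> * W t \<omega> + \<bar>centred k 0 \<omega>\<bar> * min 2 (B \<omega> / real n) \<partial>P)"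
      proof (rule integral_mono)
        show "integrable P (\<lambda>\<omega>. centred k 0 \<omega> * V t \<omega>)" by (rule ic) (auto simp: bds)
        show "integrable P (\<lambda>\<omega>. centred k 0 \<omega> * W t \<omega> + \<bar>centred k 0 \<omega>\<bar> * min 2 (B \<omega> / real n))"
          by (intro Bochner_Integration.integrable_add ei ic) (auto simp: bds)
        fix \<omega>
        have "centred k 0 \<omega> * V t \<omega> - centred k 0 \<omega> * W t \<omega> \<le> \<bar>centred k 0 \<omega>\<bar> * \<bar>V t \<omega> - W t \<omega>\<bar>"
          unfolding abs_mult[symmetric] right_diff_distrib[symmetric] by (rule abs_ge_self)
        also have "\<dots> \<le> \<bar>centred k 0 \<omega>\<bar> * min 2 (B \<omega> / real n)" by (intro mult_left_mono VW) auto
        finally show "centred k 0 \<omega> * V t \<omega> \<le> centred k 0 \<omega> * W t \<omega> + \<bar>centred k 0 \<omega>\<bar> * min 2 (B \<omega> / real n)" by simp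
      qed
      also have "\<dots> = (\<integral>\<omega>. centred k 0 \<omega> * W t \<omega> \<partial>P) + err n"
        unfolding err_def by (intro Bochner_Integration.integral_add ei ic) (auto simp: bds)
      finally show ?thesis using 1 elim by simp
    qed
    \<comment> \<open>the Huber loss telescopes, starting from the loss 0 of the empty sum\<close>
    have pw: "huber ((\<Sum>i<n. centred k (int i + 1) \<omega>) / real n) \<le> (\<Sum>t<n. centred k (int t + 1) \<omega> * c t \<omega>) / real n" for \<omega>
    proof -
      define a where "a t = (\<Sum>i<t. centred k (int i + 1) \<omega>) / real n" for t
      have "huber (a m) \<le> (\<Sum>t<m. centred k (int t + 1) \<omega> * c t \<omega>) / real n" for m
      proof (induction m)
        case (Suc m)
        have "a (Suc m) - a m = centred k (int m + 1) \<omega> / real n" by (simp add: a_def add_divide_distrib)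
        moreover have "clamp1 (a (Suc m)) = c m \<omega>" by (simp add: a_def c_def lessThan_Suc_atMost del: sum.lessThan_Suc)
        ultimately have "huber (a (Suc m)) \<le> huber (a m) + c m \<omega> * (centred k (int m + 1) \<omega> / real n)"
          using huber_tangent[of "a (Suc m)" "a m"] by simp
        then show ?case using Suc by (simp add: add_divide_distrib mult.commute)
      qed (simp add: a_def huber_def)
      then show ?thesis by (simp add: a_def)
    qed
    have "(\<integral>\<omega>. huber ((\<Sum>i<n. centred k (int i + 1) \<omega>) / real n) \<partial>P) \<le> (\<integral>\<omega>. (\<Sum>t<n. centred k (int t + 1) \<omega> * c t \<omega>) / real n \<partial>P)"
    proof (rule integral_mono[OF _ _ pw])
      show "integrable P (\<lambda>\<omega>. (\<Sum>t<n. centred k (int t + 1) \<omega> * c t \<omega>) / real n)"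
        by (intro integrable_divide Bochner_Integration.integrable_sum ic) (auto simp: bds)
      have "integrable P (\<lambda>\<omega>. (\<Sum>i<n. centred k (int i + 1) \<omega>) / real n)"
        by (intro integrable_divide Bochner_Integration.integrable_sum centred_integrable)
      then show "integrable P (\<lambda>\<omega>. huber ((\<Sum>i<n. centred k (int i + 1) \<omega>) / real n))"
        by (rule Bochner_Integration.integrable_bound) (measurable, intro AE_I2 huber_norm_le)
    qed
    also have "\<dots> = (\<Sum>t<n. (\<integral>\<omega>. centred k (int t + 1) \<omega> * c t \<omega> \<partial>P)) / real n"
      using ic bds by (simp add: Bochner_Integration.integral_sum)
    also have "\<dots> \<le> (\<Sum>t<n. e) / real n" by (intro divide_right_mono sum_mono each) auto
    also have "\<dots> \<le> e" using assms by simp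
    finally show ?case .
  qed
qed

lemma sample_autocovariance_converges:
  "converges_in_prob P (\<lambda>n \<omega>. (\<Sum>i<n. X (int i + 1) \<omega> * X (int i + 1 + int k) \<omega>) / real n) (\<gamma> (int k))"
  unfolding converges_in_prob_def
proof (intro allI impI)
  fix d :: real assume "d > 0"
  define s where "s = min d 1"
  have s: "0 < s" "s \<le> 1" "s \<le> d" using \<open>d > 0\<close> by (auto simp: s_def)
  define A where "A n \<omega> = (\<Sum>i<n. centred k (int i + 1) \<omega>) / real n" for n \<omega>
  have [measurable]: "A n \<in> borel_measurable P" for n unfolding A_def[abs_def] by measurable
  have Aint: "integrable P (A n)" for n
    unfolding A_def[abs_def] by (intro integrable_divide Bochner_Integration.integrable_sum centred_integrable)
  have hint: "integrable P (\<lambda>\<omega>. huber (A n \<omega>))" for n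
    by (rule Bochner_Integration.integrable_bound[OF Aint[of n]]) (measurable, intro AE_I2 huber_norm_le)
  show "(\<lambda>n. measure P {\<omega> \<in> space P. d < \<bar>(\<Sum>i<n. X (int i + 1) \<omega> * X (int i + 1 + int k) \<omega>) / real n - \<gamma> (int k)\<bar>}) \<longlonglongrightarrow> 0"
  proof (rule tendsto_0_le[where K=1])
    show "(\<lambda>n. (\<integral>\<omega>. huber (A n \<omega>) \<partial>P) * 2 / s\<^sup>2) \<longlonglongrightarrow> 0"
    proof (rule LIMSEQ_I)
      fix r :: real assume "r > 0"
      then have "r * s\<^sup>2 / 4 > 0" using s by simp
      then obtain N where N: "\<And>n. n \<ge> N \<Longrightarrow> (\<integral>\<omega>. huber (A n \<omega>) \<partial>P) \<le> r * s\<^sup>2 / 4"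
        using huber_mean_vanishes[of "r * s\<^sup>2 / 4" k] by (auto simp: A_def eventually_sequentially)
      have "norm ((\<integral>\<omega>. huber (A n \<omega>) \<partial>P) * 2 / s\<^sup>2 - 0) < r" if "n \<ge> N" for n
      proof -
        have "0 \<le> (\<integral>\<omega>. huber (A n \<omega>) \<partial>P)" by (simp add: huber_nonneg)
        moreover have "(\<integral>\<omega>. huber (A n \<omega>) \<partial>P) * 2 / s\<^sup>2 \<le> r / 2"
          using N[OF that] s by (simp add: field_simps)
        ultimately show ?thesis using \<open>r > 0\<close> by simp
      qed
      then show "\<exists>N. \<forall>n\<ge>N. norm ((\<integral>\<omega>. huber (A n \<omega>) \<partial>P) * 2 / s\<^sup>2 - 0) < r" by blast
    qed
    show "\<forall>\<^sub>F n in sequentially. norm (measure P {\<omega> \<in> space P. d < \<bar>(\<Sum>i<n. X (int i + 1) \<omega> * X (int i + 1 + int k) \<omega>) / real n - \<gamma> (int k)\<bar>})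
        \<le> norm ((\<integral>\<omega>. huber (A n \<omega>) \<partial>P) * 2 / s\<^sup>2) * 1"
    proof (rule eventually_mono[OF eventually_gt_at_top[of 0]])
      fix n :: nat assume "n > 0"
      then have eq: "(\<Sum>i<n. X (int i + 1) \<omega> * X (int i + 1 + int k) \<omega>) / real n - \<gamma> (int k) = A n \<omega>" for \<omega>
        by (simp add: A_def centred_def sum_subtractf diff_divide_distrib)
      have "measure P {\<omega> \<in> space P. d < \<bar>A n \<omega>\<bar>} \<le> measure P {\<omega> \<in> space P. huber (A n \<omega>) \<ge> s\<^sup>2 / 2}"
      proof (rule finite_measure_mono)
        have "s\<^sup>2 / 2 \<le> huber (A n \<omega>)" if "d < \<bar>A n \<omega>\<bar>" for \<omega> using s that by (intro huber_ge) auto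
        then show "{\<omega> \<in> space P. d < \<bar>A n \<omega>\<bar>} \<subseteq> {\<omega> \<in> space P. huber (A n \<omega>) \<ge> s\<^sup>2 / 2}" by blast
      qed measurable
      also have "\<dots> \<le> (\<integral>\<omega>. huber (A n \<omega>) \<partial>P) / (s\<^sup>2 / 2)"
        by (rule integral_Markov_inequality_measure[OF hint, of "{}"]) (use s in \<open>auto simp: huber_nonneg\<close>)
      finally show "norm (measure P {\<omega> \<in> space P. d < \<bar>(\<Sum>i<n. X (int i + 1) \<omega> * X (int i + 1 + int k) \<omega>) / real n - \<gamma> (int k)\<bar>})
        \<le> norm ((\<integral>\<omega>. huber (A n \<omega>) \<partial>P) * 2 / s\<^sup>2) * 1"
        unfolding eq by (simp add: huber_nonneg abs_of_nonneg)
    qed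
  qed
qed

end

section \<open>The real discrete Fourier transform\<close>

definition dft :: "nat \<Rightarrow> nat \<Rightarrow> nat \<Rightarrow> real" where
  "dft n i t =
     (if i = 0 then 1 / sqrt (real n)
      else if even n \<and> i = n - 1 then (- 1) ^ (t + 1) / sqrt (real n)
      else if odd i then sqrt (2 / real n) * cos (2 * pi * real (freq_index i) * real (t + 1) / real n)
      else sqrt (2 / real n) * sin (2 * pi * real (freq_index i) * real (t + 1) / real n))"

lemma DFT_eq: "DFT n = mat n n (\<lambda>(i, t). dft n i t)"
  unfolding DFT_def dft_def ..

text \<open>Real part of a geometric sum of roots of unity.\<close>

lemma sum_cos_roots_of_unity:
  assumes n: "n > 0"
  shows "(\<Sum>j<n. cos (2 * pi * real j * real_of_int l / real n)) = (if int n dvd l then real n else 0)"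
proof (cases "int n dvd l")
  case True
  then obtain q where q: "l = int n * q" by blast
  have "cos (2 * pi * real j * real_of_int l / real n) = 1" for j
  proof -
    have "2 * pi * real j * real_of_int l / real n = 2 * pi * real_of_int (int j * q)"
      using n by (simp add: q)
    then show ?thesis by (metis cos_int_2pin mult.commute)
  qed
  then show ?thesis using True by simp
next
  case False
  define a where "a = 2 * pi * real_of_int l / real n"
  have "sin (a / 2) \<noteq> 0"
  proof
    assume "sin (a / 2) = 0"
    then obtain i where "a / 2 = real_of_int i * pi" by (auto simp: sin_zero_iff_int2)
    then have "pi * (real_of_int l / real n) = pi * real_of_int i" by (simp add: a_def)
    then have "real_of_int l / real n = real_of_int i" using mult_left_cancel[OF pi_neq_zero] by blast
    then have "real_of_int l = real_of_int (i * int n)" using n by (simp add: field_simps)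
    then have "l = i * int n" by (simp only: of_int_eq_iff)
    then show False using False by simp
  qed
  have "(\<Sum>j<m. 2 * sin (a / 2) * cos (real j * a)) = sin ((real m - 1/2) * a) + sin (a / 2)" for m
  proof (induction m)
    case (Suc m)
    have "sin ((real (Suc m) - 1/2) * a) - sin ((real m - 1/2) * a) = 2 * sin (a / 2) * cos (real m * a)"
      by (subst sin_diff_sin) (simp add: algebra_simps)
    then show ?case using Suc by simp
  qed simp
  from this[of n] have "2 * sin (a / 2) * (\<Sum>j<n. cos (real j * a)) = sin ((real n - 1/2) * a) + sin (a / 2)"
    by (simp add: sum_distrib_left)
  also have "(real n - 1/2) * a = - (a / 2) + 2 * pi * real_of_int l"
    using n by (simp add: a_def field_simps)
  also have "sin (- (a / 2) + 2 * pi * real_of_int l) = - sin (a / 2)"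
    unfolding sin_add using sin_int_2pin[of l] cos_int_2pin[of l] by (simp add: mult.commute)
  finally have "(\<Sum>j<n. cos (real j * a)) = 0" using \<open>sin (a / 2) \<noteq> 0\<close> by simp
  moreover have "real j * a = 2 * pi * real j * real_of_int l / real n" for j by (simp add: a_def)
  ultimately show ?thesis using False by simp
qed

lemma sum_pairs: "(\<Sum>i<2 * N + 1. a i) = a 0 + (\<Sum>j<N. a (2 * j + 1) + a (2 * j + 2))"
  for a :: "nat \<Rightarrow> real"
  by (induction N) auto

lemma sum_symmetric:
  fixes H :: "nat \<Rightarrow> real"
  assumes "\<And>j. 0 < j \<Longrightarrow> j < n \<Longrightarrow> H (n - j) = H j" "n = 2 * N + 1 \<or> n = 2 * N + 2"
  shows "(\<Sum>j<n. H j) = H 0 + (\<Sum>j<N. 2 * H (j + 1)) + (if even n then H (n div 2) else 0)"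
proof -
  have low: "(\<Sum>j\<in>{1..N}. H j) = (\<Sum>j<N. H (j + 1))"
    by (rule sum.reindex_bij_witness[of _ "\<lambda>j. j + 1" "\<lambda>j. j - 1"]) auto
  have high: "(\<Sum>j\<in>{n - N..<n}. H j) = (\<Sum>j<N. H (j + 1))"
    by (rule sum.reindex_bij_witness[of _ "\<lambda>j. n - (j + 1)" "\<lambda>j. n - j - 1"])
       (use assms in \<open>auto simp: Suc_diff_Suc\<close>)
  have "(\<Sum>j<n. H j) = (\<Sum>j\<in>insert 0 {1..N} \<union> {n - N..<n} \<union> (if even n then {n div 2} else {}). H j)"
    by (rule sum.cong) (use assms(2) in auto)
  also have "\<dots> = (\<Sum>j\<in>insert 0 {1..N}. H j) + (\<Sum>j\<in>{n - N..<n}. H j) + (\<Sum>j\<in>(if even n then {n div 2} else {}). H j)"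
    by (subst sum.union_disjoint; (use assms(2) in auto)?)+
  also have "(\<Sum>j\<in>insert 0 {1..N}. H j) = H 0 + (\<Sum>j\<in>{1..N}. H j)" by simp
  finally show ?thesis unfolding low high sum_distrib_left[symmetric] by simp
qed

text \<open>The rows \<open>2 * j - 1\<close> and \<open>2 * j\<close> of the real transform stand for the complex frequencies
  \<open>j\<close> and \<open>n - j\<close>. A row sum is therefore a sum over all complex frequencies, as soon as each
  pair of rows carries twice the common value of the two; row \<open>0\<close>, and the last row for even
  \<open>n\<close>, are their own mirror images.\<close>

lemma freq_sum:
  fixes a H :: "nat \<Rightarrow> real"
  assumes "n > 0" and sym: "\<And>j. 0 < j \<Longrightarrow> j < n \<Longrightarrow> H (n - j) = H j"
    and a0: "a 0 = H 0"
    and pair: "\<And>j. 1 \<le> j \<Longrightarrow> 2 * j < n \<Longrightarrow> a (2 * j - 1) + a (2 * j) = 2 * H j"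
    and last: "even n \<Longrightarrow> a (n - 1) = H (n div 2)"
  shows "(\<Sum>i<n. a i) = (\<Sum>j<n. H j)"
proof -
  define N where "N = (n - 1) div 2"
  have N: "n = 2 * N + 1 \<or> n = 2 * N + 2" using \<open>n > 0\<close> unfolding N_def by presburger
  have p: "(\<Sum>j<N. a (2 * j + 1) + a (2 * j + 2)) = (\<Sum>j<N. 2 * H (j + 1))"
  proof (rule sum.cong[OF refl])
    fix j assume "j \<in> {..<N}"
    then show "a (2 * j + 1) + a (2 * j + 2) = 2 * H (j + 1)" using pair[of "j + 1"] N by auto
  qed
  show ?thesis
  proof (cases "even n")
    case True
    then have n: "n = Suc (2 * N + 1)" using N by auto
    have "(\<Sum>i<n. a i) = (\<Sum>i<2 * N + 1. a i) + a (n - 1)" unfolding n by simp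
    then show ?thesis using sum_symmetric[of n H N, OF sym N] True last a0 p unfolding sum_pairs by simp
  next
    case False
    then have n: "n = 2 * N + 1" using N by auto
    then have "(\<Sum>i<n. a i) = (\<Sum>i<2 * N + 1. a i)" by simp
    then show ?thesis using sum_symmetric[of n H N, OF sym N] False a0 p unfolding sum_pairs by simp
  qed
qed

lemma cos_freq_reflect:
  assumes "j \<le> n" "n > 0"
  shows "cos (2 * pi * real (n - j) * real_of_int l / real n) = cos (2 * pi * real j * real_of_int l / real n)"
proof -
  have "2 * pi * real (n - j) * real_of_int l / real n = 2 * pi * real_of_int l - 2 * pi * real j * real_of_int l / real n"
    using assms by (simp add: of_nat_diff field_simps)
  then show ?thesis using sin_int_2pin[of l] cos_int_2pin[of l] by (simp add: cos_diff mult.commute)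
qed

lemma freq_index_simps:
  "freq_index 0 = 0" "1 \<le> j \<Longrightarrow> freq_index (2 * j - 1) = j" "freq_index (2 * j) = j"
  "even n \<Longrightarrow> n > 0 \<Longrightarrow> freq_index (n - 1) = n div 2"
  "Suc 0 \<le> j \<Longrightarrow> freq_index (2 * j - Suc 0) = j"
  "even n \<Longrightarrow> n > 0 \<Longrightarrow> freq_index (n - Suc 0) = n div 2"
  by (auto simp: freq_index_def)

lemma cos_grid_sum:
  assumes "n > 0"
  shows "(\<Sum>i<n. cos (2 * pi * real (freq_index i) * real_of_int l / real n)) = (if int n dvd l then real n else 0)"
proof -
  have "(\<Sum>i<n. cos (2 * pi * real (freq_index i) * real_of_int l / real n)) =
        (\<Sum>j<n. cos (2 * pi * real j * real_of_int l / real n))"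
  proof (rule freq_sum[OF assms])
    show "cos (2 * pi * real (n - j) * real_of_int l / real n) = cos (2 * pi * real j * real_of_int l / real n)"
      if "0 < j" "j < n" for j using that by (intro cos_freq_reflect) auto
  qed (use assms in \<open>auto simp: freq_index_simps\<close>)
  then show ?thesis using sum_cos_roots_of_unity[OF assms] by simp
qed

lemma dft_pair:
  assumes "1 \<le> j" "2 * j < n"
  shows "dft n (2 * j - 1) s * dft n (2 * j - 1) t + dft n (2 * j) s * dft n (2 * j) t =
    2 / real n * cos (2 * pi * real j * real_of_int (int s - int t) / real n)"
proof -
  let ?u = "\<lambda>s. 2 * pi * real j * real (s + 1) / real n"
  have d1: "dft n (2 * j - 1) s = sqrt (2 / real n) * cos (?u s)" for s
    using assms by (auto simp: dft_def freq_index_simps)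
  have "\<not> (even n \<and> 2 * j = n - 1)" using assms by presburger
  then have d2: "dft n (2 * j) s = sqrt (2 / real n) * sin (?u s)" for s
    using assms by (auto simp: dft_def freq_index_simps)
  have sq: "sqrt (2 / real n) * sqrt (2 / real n) = 2 / real n" by simp
  have "dft n (2 * j - 1) s * dft n (2 * j - 1) t + dft n (2 * j) s * dft n (2 * j) t =
     (sqrt (2 / real n) * sqrt (2 / real n)) * (cos (?u s) * cos (?u t) + sin (?u s) * sin (?u t))"
    unfolding d1 d2 by (simp only: algebra_simps)
  also have "\<dots> = 2 / real n * cos (?u s - ?u t)" unfolding sq cos_diff ..
  also have "?u s - ?u t = 2 * pi * real j * real_of_int (int s - int t) / real n"
    unfolding diff_divide_distrib[symmetric] by (simp add: algebra_simps)
  finally show ?thesis .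
qed

text \<open>Multiplication by \<open>cos (k * pi * y)\<close> on the Fourier side averages the cyclic shifts by
  \<open>k\<close> and by \<open>- k\<close>.\<close>

lemma circulant_kernel:
  assumes n: "n > 0"
  shows "(\<Sum>i<n. cos (real k * pi * (2 * real (freq_index i) / real n)) * dft n i s * dft n i t) =
    ((if int n dvd int s - int t + int k then 1 else 0) + (if int n dvd int s - int t - int k then 1 else 0)) / 2"
proof -
  define g where "g j = cos (2 * pi * real j * real_of_int (int k) / real n)" for j
  define H where "H j = g j * cos (2 * pi * real j * real_of_int (int s - int t) / real n) / real n" for j
  have "(\<Sum>i<n. g (freq_index i) * (dft n i s * dft n i t)) = (\<Sum>j<n. H j)"
  proof (rule freq_sum[OF n])
    show "H (n - j) = H j" if "0 < j" "j < n" for j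
      unfolding H_def g_def using that by (simp only: cos_freq_reflect less_imp_le n)
    show "g (freq_index 0) * (dft n 0 s * dft n 0 t) = H 0"
      by (simp add: H_def freq_index_simps dft_def)
    show "g (freq_index (2 * j - 1)) * (dft n (2 * j - 1) s * dft n (2 * j - 1) t) +
        g (freq_index (2 * j)) * (dft n (2 * j) s * dft n (2 * j) t) = 2 * H j" if "1 \<le> j" "2 * j < n" for j
      using dft_pair[OF that, of s t] that
      by (simp only: freq_index_simps H_def distrib_left[symmetric]) simp
    show "g (freq_index (n - 1)) * (dft n (n - 1) s * dft n (n - 1) t) = H (n div 2)" if "even n"
    proof -
      have n2: "n \<ge> 2" "n - 1 \<noteq> 0" using that n by presburger+
      have "dft n (n - 1) s * dft n (n - 1) t = ((- 1) ^ (s + 1) * (- 1) ^ (t + 1)) / real n"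
        using n2 that by (simp add: dft_def)
      also have "(- 1) ^ (s + 1) * (- 1) ^ (t + 1) = cos (pi * real (s + t))"
        unfolding cos_npi2 by (simp add: power_add)
      also have "cos (pi * real (s + t)) = cos (pi * real_of_int (int s - int t))"
      proof -
        have "pi * real_of_int (int s - int t) = pi * real (s + t) - 2 * pi * real t" by (simp add: algebra_simps)
        then show ?thesis using sin_int_2pin[of "int t"] cos_int_2pin[of "int t"] by (simp add: cos_diff mult.commute)
      qed
      also have "pi * real_of_int (int s - int t) = 2 * pi * real (n div 2) * real_of_int (int s - int t) / real n"
        using that n by (simp add: real_of_nat_div)
      finally show ?thesis using that n by (simp add: H_def freq_index_simps)
    qed
  qed
  also have "(\<Sum>j<n. H j) = (\<Sum>j<n. (cos (2 * pi * real j * real_of_int (int s - int t + int k) / real n)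
      + cos (2 * pi * real j * real_of_int (int s - int t - int k) / real n)) / 2 / real n)"
  proof (rule sum.cong[OF refl])
    fix j
    have e: "2 * pi * real j * real_of_int (int s - int t + int k) / real n = 2 * pi * real j * real_of_int (int s - int t) / real n + 2 * pi * real j * real_of_int (int k) / real n"
      "2 * pi * real j * real_of_int (int s - int t - int k) / real n = 2 * pi * real j * real_of_int (int s - int t) / real n - 2 * pi * real j * real_of_int (int k) / real n"
      by (simp_all only: of_int_add of_int_diff distrib_left right_diff_distrib add_divide_distrib diff_divide_distrib)
    show "H j = (cos (2 * pi * real j * real_of_int (int s - int t + int k) / real n)
      + cos (2 * pi * real j * real_of_int (int s - int t - int k) / real n)) / 2 / real n"
      unfolding e cos_add cos_diff H_def g_def by simp
  qed
  also have "\<dots> = ((\<Sum>j<n. cos (2 * pi * real j * real_of_int (int s - int t + int k) / real n))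
      + (\<Sum>j<n. cos (2 * pi * real j * real_of_int (int s - int t - int k) / real n))) / 2 / real n"
    by (simp only: sum_divide_distrib[symmetric] sum.distrib)
  also have "\<dots> = ((if int n dvd int s - int t + int k then 1 else 0) + (if int n dvd int s - int t - int k then 1 else 0)) / 2"
    unfolding sum_cos_roots_of_unity[OF n] using n by simp
  finally show ?thesis by (simp add: g_def mult.assoc mult.left_commute mult.commute)
qed

lemma dft_columns_orthonormal:
  assumes "s < n" "t < n"
  shows "(\<Sum>i<n. dft n i s * dft n i t) = (if s = t then 1 else 0)"
proof -
  have "n > 0" using assms by simp
  have "int n dvd int s - int t \<longleftrightarrow> s = t"
    using assms by (simp add: mod_eq_dvd_iff[symmetric])
  then show ?thesis using circulant_kernel[OF \<open>n > 0\<close>, of 0 s t] by simp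
qed

lemma DFT_orthogonal: "transpose_mat (DFT n) * DFT n = 1\<^sub>m n" "DFT n * transpose_mat (DFT n) = 1\<^sub>m n"
proof -
  have c: "DFT n \<in> carrier_mat n n" "transpose_mat (DFT n) \<in> carrier_mat n n" by (auto simp: DFT_eq)
  show 1: "transpose_mat (DFT n) * DFT n = 1\<^sub>m n"
    by (rule eq_matI) (auto simp: DFT_eq scalar_prod_def atLeast0LessThan dft_columns_orthonormal)
  show "DFT n * transpose_mat (DFT n) = 1\<^sub>m n" by (rule mat_mult_left_right_inverse[OF c(2,1) 1])
qed

lemma dft_rows_orthonormal:
  assumes "i < n" "j < n"
  shows "(\<Sum>t<n. dft n i t * dft n j t) = (if i = j then 1 else 0)"
proof -
  have "(DFT n * transpose_mat (DFT n)) $$ (i, j) = (1\<^sub>m n :: real mat) $$ (i, j)" unfolding DFT_orthogonal ..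
  then show ?thesis using assms by (simp add: DFT_eq scalar_prod_def atLeast0LessThan)
qed

section \<open>Circulant and Toeplitz matrices\<close>

definition grid :: "nat \<Rightarrow> nat \<Rightarrow> real" where
  "grid n i = 2 * real (freq_index i) / real n"

text \<open>Together with \<open>circ\<close> and \<open>toep\<close> below: the matrix-vector products of the statement,
  written for vectors as functions on the natural numbers, of which only the values below \<open>n\<close> matter.
  This keeps carrier conditions out of the analysis.\<close>

definition fcoef :: "nat \<Rightarrow> (nat \<Rightarrow> real) \<Rightarrow> nat \<Rightarrow> real" where
  "fcoef n x i = (\<Sum>s<n. dft n i s * x s)"

text \<open>The matrix \<open>F' D F\<close>, with \<open>D\<close> the diagonal of the values of \<open>\<xi>\<close> at the Fourier
  frequencies, applied to \<open>x\<close>.\<close>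

definition circ :: "nat \<Rightarrow> (real \<Rightarrow> real) \<Rightarrow> (nat \<Rightarrow> real) \<Rightarrow> nat \<Rightarrow> real" where
  "circ n \<xi> x t = (\<Sum>i<n. \<xi> (grid n i) * fcoef n x i * dft n i t)"

definition toep :: "nat \<Rightarrow> (real \<Rightarrow> real) \<Rightarrow> (nat \<Rightarrow> real) \<Rightarrow> nat \<Rightarrow> real" where
  "toep n \<psi> x t = (\<Sum>s<n. gamma_par \<psi> (int t - int s) * x s)"

abbreviation nrm :: "nat \<Rightarrow> (nat \<Rightarrow> real) \<Rightarrow> real" where
  "nrm n x \<equiv> L2_set x {..<n}"

lemma grid_range: "i < n \<Longrightarrow> grid n i \<in> {0..1}"
  by (auto simp: grid_def freq_index_def field_simps)

lemma nrm_sq: "(nrm n x)\<^sup>2 = (\<Sum>t<n. (x t)\<^sup>2)"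
  by (simp add: L2_set_def sum_nonneg)

lemma fcoef_circ:
  assumes "i < n"
  shows "fcoef n (circ n \<xi> x) i = \<xi> (grid n i) * fcoef n x i"
proof -
  have "fcoef n (circ n \<xi> x) i = (\<Sum>s<n. \<Sum>j<n. \<xi> (grid n j) * fcoef n x j * (dft n i s * dft n j s))"
    unfolding fcoef_def[of n "circ n \<xi> x"] circ_def by (simp add: sum_distrib_left mult_ac)
  also have "\<dots> = (\<Sum>j<n. \<xi> (grid n j) * fcoef n x j * (\<Sum>s<n. dft n i s * dft n j s))"
    by (subst sum.swap) (simp add: sum_distrib_left)
  also have "\<dots> = (\<Sum>j<n. if j = i then \<xi> (grid n j) * fcoef n x j else 0)"
    by (rule sum.cong[OF refl]) (use assms in \<open>auto simp: dft_rows_orthonormal\<close>)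
  finally show ?thesis using assms by simp
qed

lemma parseval: "(\<Sum>i<n. fcoef n x i * fcoef n y i) = (\<Sum>t<n. x t * y t)"
proof -
  have "(\<Sum>i<n. fcoef n x i * fcoef n y i) = (\<Sum>i<n. \<Sum>s<n. \<Sum>t<n. x s * y t * (dft n i s * dft n i t))"
    by (simp add: fcoef_def sum_product mult_ac)
  also have "\<dots> = (\<Sum>s<n. \<Sum>t<n. x s * y t * (\<Sum>i<n. dft n i s * dft n i t))"
    by (subst sum.swap, rule sum.cong[OF refl], subst sum.swap, simp add: sum_distrib_left)
  also have "\<dots> = (\<Sum>s<n. \<Sum>t<n. if s = t then x s * y t else 0)"
    by (intro sum.cong[OF refl]) (simp add: dft_columns_orthonormal)
  finally show ?thesis by simp
qed

lemma circ_circ: "circ n \<xi> (circ n \<eta> x) t = circ n (\<lambda>u. \<xi> u * \<eta> u) x t"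
  unfolding circ_def[of n \<xi>] circ_def[of n "\<lambda>u. \<xi> u * \<eta> u"]
  by (rule sum.cong[OF refl]) (simp add: fcoef_circ)

text \<open>The real Fourier basis diagonalises every \<open>circ\<close>.\<close>

lemma inner_circ: "(\<Sum>t<n. y t * circ n \<xi> x t) = (\<Sum>i<n. \<xi> (grid n i) * fcoef n y i * fcoef n x i)"
proof -
  have "(\<Sum>t<n. y t * circ n \<xi> x t) = (\<Sum>i<n. fcoef n y i * fcoef n (circ n \<xi> x) i)"
    by (rule parseval[symmetric])
  also have "\<dots> = (\<Sum>i<n. \<xi> (grid n i) * fcoef n y i * fcoef n x i)"
    by (rule sum.cong[OF refl]) (simp add: fcoef_circ)
  finally show ?thesis .
qed

lemma nrm_circ_sq: "(nrm n (circ n \<xi> x))\<^sup>2 = (\<Sum>i<n. (\<xi> (grid n i))\<^sup>2 * (fcoef n x i)\<^sup>2)"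
proof -
  have "(nrm n (circ n \<xi> x))\<^sup>2 = (\<Sum>i<n. fcoef n (circ n \<xi> x) i * fcoef n (circ n \<xi> x) i)"
    unfolding nrm_sq parseval by (simp add: power2_eq_square)
  also have "\<dots> = (\<Sum>i<n. (\<xi> (grid n i))\<^sup>2 * (fcoef n x i)\<^sup>2)"
    by (rule sum.cong[OF refl]) (simp add: fcoef_circ power2_eq_square)
  finally show ?thesis .
qed

lemma nrm_fcoef_sq: "(\<Sum>i<n. (fcoef n x i)\<^sup>2) = (nrm n x)\<^sup>2"
  unfolding nrm_sq using parseval[of n x x] by (simp add: power2_eq_square)

lemma nrm_circ_le:
  assumes "\<And>i. i < n \<Longrightarrow> \<bar>\<xi> (grid n i)\<bar> \<le> B" "0 \<le> B"
  shows "nrm n (circ n \<xi> x) \<le> B * nrm n x"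
proof (rule power2_le_imp_le)
  have "(nrm n (circ n \<xi> x))\<^sup>2 \<le> (\<Sum>i<n. B\<^sup>2 * (fcoef n x i)\<^sup>2)"
    unfolding nrm_circ_sq
    by (intro sum_mono mult_right_mono) (use assms in \<open>auto intro!: power2_le_iff_abs_le[THEN iffD2]\<close>)
  then show "(nrm n (circ n \<xi> x))\<^sup>2 \<le> (B * nrm n x)\<^sup>2"
    by (simp add: power_mult_distrib sum_distrib_left[symmetric] nrm_fcoef_sq)
  show "0 \<le> B * nrm n x" using assms by (simp add: L2_set_nonneg)
qed

lemma circ_sum: "circ n (\<lambda>u. \<Sum>k\<in>A. c k * f k u) x t = (\<Sum>k\<in>A. c k * circ n (f k) x t)"
  unfolding circ_def sum_distrib_left sum_distrib_right
  by (subst sum.swap) (simp add: mult_ac)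

lemma circ_diff: "circ n (\<lambda>u. f u - g u) x t = circ n f x t - circ n g x t"
  unfolding circ_def by (simp add: algebra_simps sum_subtractf)

lemma circ_vec_diff: "circ n f (\<lambda>t. x t - y t) t = circ n f x t - circ n f y t"
  unfolding circ_def fcoef_def by (simp add: algebra_simps sum_subtractf)

lemma circ_cong_grid: "(\<And>i. i < n \<Longrightarrow> f (grid n i) = g (grid n i)) \<Longrightarrow> circ n f x t = circ n g x t"
  unfolding circ_def by simp

lemma circ_cos:
  assumes "t < n" "k \<le> n"
  shows "circ n (\<lambda>u. cos (real k * pi * u)) x t = (x ((t + k) mod n) + x ((t + n - k) mod n)) / 2"
proof -
  have n: "n > 0" using assms by simp
  have e1: "int n dvd int s - int t - int k \<longleftrightarrow> s = (t + k) mod n" if "s < n" for s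
  proof -
    have "int n dvd int s - int t - int k \<longleftrightarrow> int s mod int n = int (t + k) mod int n"
      unfolding mod_eq_dvd_iff by (simp add: algebra_simps)
    also have "\<dots> \<longleftrightarrow> s mod n = (t + k) mod n" by (simp only: of_nat_eq_iff flip: zmod_int)
    finally show ?thesis using that by simp
  qed
  have e2: "int n dvd int s - int t + int k \<longleftrightarrow> s = (t + n - k) mod n" if "s < n" for s
  proof -
    have "int n dvd int s - int t + int k \<longleftrightarrow> int n dvd (int s - int t + int k - int n) + int n" by simp
    also have "\<dots> \<longleftrightarrow> int n dvd int s - int t + int k - int n" by (rule dvd_add_left_iff) simp
    also have "\<dots> \<longleftrightarrow> int s mod int n = int (t + n - k) mod int n"
      unfolding mod_eq_dvd_iff using assms by (simp add: of_nat_diff algebra_simps)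
    also have "\<dots> \<longleftrightarrow> s mod n = (t + n - k) mod n" by (simp only: of_nat_eq_iff flip: zmod_int)
    finally show ?thesis using that by simp
  qed
  have "circ n (\<lambda>u. cos (real k * pi * u)) x t =
      (\<Sum>s<n. (\<Sum>i<n. cos (real k * pi * (2 * real (freq_index i) / real n)) * dft n i s * dft n i t) * x s)"
    unfolding circ_def fcoef_def grid_def sum_distrib_left sum_distrib_right
    by (subst sum.swap) (simp add: mult_ac)
  also have "\<dots> = (\<Sum>s<n. ((if s = (t + n - k) mod n then x s else 0) + (if s = (t + k) mod n then x s else 0)) / 2)"
    unfolding circulant_kernel[OF n] by (rule sum.cong[OF refl]) (simp add: e1 e2)
  also have "\<dots> = ((\<Sum>s<n. if s = (t + n - k) mod n then x s else 0) + (\<Sum>s<n. if s = (t + k) mod n then x s else 0)) / 2"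
    by (simp add: sum.distrib flip: sum_divide_distrib)
  finally show ?thesis using n by simp
qed

lemma integral_cos_int: "integral {0..1} (\<lambda>x. cos (real_of_int l * pi * x)) = (if l = 0 then 1 else 0)"
proof (cases "l = 0")
  case False
  define F where "F x = sin (real_of_int l * pi * x) / (real_of_int l * pi)" for x
  have "((\<lambda>x. cos (real_of_int l * pi * x)) has_integral (F 1 - F 0)) {0..1}"
    unfolding F_def
    by (rule fundamental_theorem_of_calculus)
       (use False in \<open>auto intro!: derivative_eq_intros simp flip: has_real_derivative_iff_has_vector_derivative\<close>)
  moreover have "F 1 = 0" "F 0 = 0" by (auto simp: F_def sin_zero_iff_int2)
  ultimately show ?thesis using False by (simp add: integral_unique)
qed simp

lemma integrable_gamma_par:
  assumes "continuous_on {0..1} \<psi>"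
  shows "(\<lambda>x. \<psi> x * cos (real_of_int h * pi * x)) integrable_on {0..1}"
  by (intro integrable_continuous_real continuous_intros assms)

lemma gamma_par_cos:
  "gamma_par (\<lambda>u. cos (real k * pi * u)) h = pi * ((if h = int k then 1 else 0) + (if h = - int k then 1 else 0))"
proof -
  have i: "(\<lambda>u. cos (real_of_int l * pi * u)) integrable_on {0..1}" for l
    by (intro integrable_continuous_real continuous_intros)
  have "cos (real k * pi * u) * cos (real_of_int h * pi * u) =
      (cos (real_of_int (h - int k) * pi * u) + cos (real_of_int (h + int k) * pi * u)) / 2" for u
    by (simp add: cos_add cos_diff algebra_simps)
  then have "integral {0..1} (\<lambda>u. cos (real k * pi * u) * cos (real_of_int h * pi * u)) =
    integral {0..1} (\<lambda>u. (cos (real_of_int (h - int k) * pi * u) + cos (real_of_int (h + int k) * pi * u)) / 2)"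
    by (simp only:)
  also have "\<dots> = ((if h - int k = 0 then 1 else 0) + (if h + int k = 0 then 1 else 0)) / 2"
    using i[of "h - int k"] i[of "h + int k"]
    unfolding integral_divide integral_cos_int[symmetric] by (subst integral_add) auto
  finally show ?thesis unfolding gamma_par_def by (auto simp: algebra_simps)
qed

lemma gamma_par_diff:
  assumes "continuous_on {0..1} f" "continuous_on {0..1} g"
  shows "gamma_par (\<lambda>u. f u - g u) h = gamma_par f h - gamma_par g h"
  unfolding gamma_par_def left_diff_distrib
  by (subst integral_diff[OF integrable_gamma_par[OF assms(1)] integrable_gamma_par[OF assms(2)]])
     (rule right_diff_distrib)

lemma gamma_par_sum:
  assumes "finite A" "\<And>k. k \<in> A \<Longrightarrow> continuous_on {0..1} (f k)"
  shows "gamma_par (\<lambda>u. \<Sum>k\<in>A. c k * f k u) h = (\<Sum>k\<in>A. c k * gamma_par (f k) h)"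
proof -
  have "integral {0..1} (\<lambda>u. (\<Sum>k\<in>A. c k * f k u) * cos (real_of_int h * pi * u)) =
      integral {0..1} (\<lambda>u. \<Sum>k\<in>A. c k * (f k u * cos (real_of_int h * pi * u)))"
    by (simp only: sum_distrib_right mult.assoc)
  also have "\<dots> = (\<Sum>k\<in>A. integral {0..1} (\<lambda>u. c k * (f k u * cos (real_of_int h * pi * u))))"
    by (rule integral_sum) (use assms in \<open>auto intro!: integrable_on_mult_right integrable_gamma_par\<close>)
  finally show ?thesis unfolding gamma_par_def by (simp add: sum_distrib_left mult.left_commute)
qed

lemma toep_diff:
  assumes "continuous_on {0..1} f" "continuous_on {0..1} g"
  shows "toep n (\<lambda>u. f u - g u) x t = toep n f x t - toep n g x t"
  unfolding toep_def gamma_par_diff[OF assms] by (simp add: left_diff_distrib sum_subtractf)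

lemma toep_vec_diff: "toep n f (\<lambda>t. x t - y t) t = toep n f x t - toep n f y t"
  unfolding toep_def by (simp add: right_diff_distrib sum_subtractf)

lemma toep_sum:
  assumes "finite A" "\<And>k. k \<in> A \<Longrightarrow> continuous_on {0..1} (f k)"
  shows "toep n (\<lambda>u. \<Sum>k\<in>A. c k * f k u) x t = (\<Sum>k\<in>A. c k * toep n (f k) x t)"
proof -
  have "gamma_par (\<lambda>u. \<Sum>k\<in>A. c k * f k u) h = (\<Sum>k\<in>A. c k * gamma_par (f k) h)" for h
    by (rule gamma_par_sum[OF assms])
  then have "toep n (\<lambda>u. \<Sum>k\<in>A. c k * f k u) x t = (\<Sum>s<n. \<Sum>k\<in>A. c k * (gamma_par (f k) (int t - int s) * x s))"
    by (simp only: toep_def sum_distrib_right mult.assoc)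
  also have "\<dots> = (\<Sum>k\<in>A. c k * toep n (f k) x t)"
    by (subst sum.swap) (simp only: toep_def sum_distrib_left)
  finally show ?thesis .
qed

lemma toep_cos:
  assumes "t < n"
  shows "toep n (\<lambda>u. cos (real k * pi * u)) x t =
    pi * ((if k \<le> t then x (t - k) else 0) + (if t + k < n then x (t + k) else 0))"
proof -
  have "toep n (\<lambda>u. cos (real k * pi * u)) x t =
      (\<Sum>s<n. pi * ((if s = t - k \<and> k \<le> t then x s else 0) + (if s = t + k then x s else 0)))"
    unfolding toep_def gamma_par_cos by (rule sum.cong[OF refl]) auto
  also have "\<dots> = pi * ((\<Sum>s<n. if s = t - k then (if k \<le> t then x s else 0) else 0) + (\<Sum>s<n. if s = t + k then x s else 0))"
    unfolding sum_distrib_left[symmetric] sum.distrib[symmetric] by (intro arg_cong[where f="\<lambda>z. pi * z"] sum.cong) auto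
  finally show ?thesis using assms by auto
qed

text \<open>The circulant shift wraps around where the Toeplitz one runs off the end, and this is the whole
  difference. The factor \<open>2 * pi\<close> is that in the autocovariances of a rescaled spectral density.\<close>

lemma circulant_minus_toeplitz:
  assumes "t < n" "k \<le> n"
  shows "2 * pi * circ n (\<lambda>u. cos (real k * pi * u)) x t - toep n (\<lambda>u. cos (real k * pi * u)) x t =
    pi * ((if n \<le> t + k then x (t + k - n) else 0) + (if t < k then x (t + n - k) else 0))"
proof -
  have "(t + k) mod n = (if n \<le> t + k then t + k - n else t + k)"
  proof (cases "n \<le> t + k")
    case True
    then show ?thesis using assms by (cases "t + k - n < n") (auto simp: le_mod_geq mod_if)
  qed simp
  moreover have "(t + n - k) mod n = (if t < k then t + n - k else t - k)"
  proof (cases "t < k")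
    case False
    then have "t + n - k = n + (t - k)" by simp
    then have "(t + n - k) mod n = (t - k) mod n" by (simp only: mod_add_self1)
    then show ?thesis using False assms by simp
  qed (use assms in auto)
  ultimately show ?thesis unfolding circ_cos[OF assms] toep_cos[OF assms(1)] by (auto simp: algebra_simps)
qed

text \<open>Only the first and the last \<open>k\<close> entries of \<open>x\<close> occur. For a stationary sample their
  sum of squares stays bounded in probability as \<open>n\<close> grows.\<close>

lemma nrm_corner_sq:
  assumes "k \<le> n"
  shows "(nrm n (\<lambda>t. 2 * pi * circ n (\<lambda>u. cos (real k * pi * u)) x t - toep n (\<lambda>u. cos (real k * pi * u)) x t))\<^sup>2
    \<le> 2 * pi\<^sup>2 * ((\<Sum>t<k. (x t)\<^sup>2) + (\<Sum>t\<in>{n - k..<n}. (x t)\<^sup>2))"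
proof -
  have sq: "(a + b)\<^sup>2 \<le> 2 * (a\<^sup>2 + b\<^sup>2)" for a b :: real
    using zero_le_power2[of "a - b"] unfolding power2_diff power2_sum by simp
  have "(nrm n (\<lambda>t. 2 * pi * circ n (\<lambda>u. cos (real k * pi * u)) x t - toep n (\<lambda>u. cos (real k * pi * u)) x t))\<^sup>2
    = (\<Sum>t<n. (pi * ((if n \<le> t + k then x (t + k - n) else 0) + (if t < k then x (t + n - k) else 0)))\<^sup>2)"
    unfolding nrm_sq by (rule sum.cong[OF refl]) (use assms in \<open>simp add: circulant_minus_toeplitz\<close>)
  also have "\<dots> \<le> (\<Sum>t<n. pi\<^sup>2 * (2 * ((if n \<le> t + k then (x (t + k - n))\<^sup>2 else 0) + (if t < k then (x (t + n - k))\<^sup>2 else 0))))"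
    unfolding power_mult_distrib by (intro sum_mono mult_left_mono order_trans[OF sq]) auto
  also have "\<dots> = 2 * pi\<^sup>2 * ((\<Sum>t<n. if n \<le> t + k then (x (t + k - n))\<^sup>2 else 0) + (\<Sum>t<n. if t < k then (x (t + n - k))\<^sup>2 else 0))"
    by (simp only: sum.distrib[symmetric] sum_distrib_left mult_ac)
  also have "(\<Sum>t<n. if n \<le> t + k then (x (t + k - n))\<^sup>2 else 0) = (\<Sum>t<k. (x t)\<^sup>2)"
  proof -
    have "(\<Sum>t<n. if n \<le> t + k then (x (t + k - n))\<^sup>2 else 0) = (\<Sum>t\<in>{t\<in>{..<n}. n \<le> t + k}. (x (t + k - n))\<^sup>2)"
      by (rule sum.inter_filter[symmetric]) simp
    also have "\<dots> = (\<Sum>t<k. (x t)\<^sup>2)"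
      by (rule sum.reindex_bij_witness[of _ "\<lambda>t. t + n - k" "\<lambda>t. t + k - n"]) (use assms in auto)
    finally show ?thesis .
  qed
  also have "(\<Sum>t<n. if t < k then (x (t + n - k))\<^sup>2 else 0) = (\<Sum>t\<in>{n - k..<n}. (x t)\<^sup>2)"
  proof -
    have "(\<Sum>t<n. if t < k then (x (t + n - k))\<^sup>2 else 0) = (\<Sum>t\<in>{t\<in>{..<n}. t < k}. (x (t + n - k))\<^sup>2)"
      by (rule sum.inter_filter[symmetric]) simp
    also have "\<dots> = (\<Sum>t\<in>{n - k..<n}. (x t)\<^sup>2)"
      by (rule sum.reindex_bij_witness[of _ "\<lambda>t. t + k - n" "\<lambda>t. t + n - k"]) (use assms in auto)
    finally show ?thesis .
  qed
  finally show ?thesis .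
qed

text \<open>Real and imaginary part of the Fourier polynomial of \<open>x\<close> at the angle \<open>pi * u\<close>.\<close>

definition trig_c :: "nat \<Rightarrow> (nat \<Rightarrow> real) \<Rightarrow> real \<Rightarrow> real" where
  "trig_c n x u = (\<Sum>t<n. x t * cos (real t * pi * u))"

definition trig_s :: "nat \<Rightarrow> (nat \<Rightarrow> real) \<Rightarrow> real \<Rightarrow> real" where
  "trig_s n x u = (\<Sum>t<n. x t * sin (real t * pi * u))"

lemma trig_continuous [continuous_intros]: "continuous_on S (trig_c n x)" "continuous_on S (trig_s n x)"
  unfolding trig_c_def[abs_def] trig_s_def[abs_def] by (intro continuous_intros)+

lemma toep_bilinear:
  assumes "continuous_on {0..1} \<psi>"
  shows "(\<Sum>t<n. y t * toep n \<psi> x t) =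
    2 * pi * integral {0..1} (\<lambda>u. \<psi> u * (trig_c n y u * trig_c n x u + trig_s n y u * trig_s n x u))"
proof -
  have "\<psi> u * (trig_c n y u * trig_c n x u + trig_s n y u * trig_s n x u) =
    (\<Sum>t<n. \<Sum>s<n. (y t * x s) * (\<psi> u * cos (real_of_int (int t - int s) * pi * u)))" for u
  proof -
    have "cos (real_of_int (int t - int s) * pi * u) =
       cos (real t * pi * u) * cos (real s * pi * u) + sin (real t * pi * u) * sin (real s * pi * u)" for t s
      by (simp add: left_diff_distrib cos_diff)
    note addition = this
    have cc: "trig_c n y u * trig_c n x u = (\<Sum>t<n. \<Sum>s<n. (y t * x s) * (cos (real t * pi * u) * cos (real s * pi * u)))"
      unfolding trig_c_def sum_product by (simp only: mult_ac)
    have ss: "trig_s n y u * trig_s n x u = (\<Sum>t<n. \<Sum>s<n. (y t * x s) * (sin (real t * pi * u) * sin (real s * pi * u)))"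
      unfolding trig_s_def sum_product by (simp only: mult_ac)
    show ?thesis unfolding cc ss addition
      by (simp only: sum_distrib_left distrib_left sum.distrib[symmetric] mult_ac)
  qed
  then have "integral {0..1} (\<lambda>u. \<psi> u * (trig_c n y u * trig_c n x u + trig_s n y u * trig_s n x u)) =
    integral {0..1} (\<lambda>u. \<Sum>t<n. \<Sum>s<n. (y t * x s) * (\<psi> u * cos (real_of_int (int t - int s) * pi * u)))"
    by (simp only:)
  also have "\<dots> = (\<Sum>t<n. integral {0..1} (\<lambda>u. \<Sum>s<n. (y t * x s) * (\<psi> u * cos (real_of_int (int t - int s) * pi * u))))"
    by (intro integral_sum finite_lessThan integrable_sum integrable_on_mult_right integrable_gamma_par assms)
  also have "\<dots> = (\<Sum>t<n. \<Sum>s<n. integral {0..1} (\<lambda>u. (y t * x s) * (\<psi> u * cos (real_of_int (int t - int s) * pi * u))))"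
    by (intro sum.cong[OF refl] integral_sum finite_lessThan integrable_on_mult_right integrable_gamma_par assms)
  also have "\<dots> = (\<Sum>t<n. \<Sum>s<n. (y t * x s) * integral {0..1} (\<lambda>u. \<psi> u * cos (real_of_int (int t - int s) * pi * u)))"
    by (simp only: integral_mult_right)
  finally show ?thesis unfolding toep_def gamma_par_def by (simp only: sum_distrib_left mult_ac)
qed

lemma nrm_sq_integral:
  "(nrm n x)\<^sup>2 = integral {0..1} (\<lambda>u. (trig_c n x u)\<^sup>2 + (trig_s n x u)\<^sup>2)"
proof -
  have "toep n (\<lambda>u. 1) x t = 2 * pi * x t" if "t < n" for t
    using toep_cos[OF that, of 0 x] that by simp
  then have "(\<Sum>t<n. x t * toep n (\<lambda>u. 1) x t) = 2 * pi * (nrm n x)\<^sup>2"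
    unfolding nrm_sq by (simp add: sum_distrib_left power2_eq_square mult_ac)
  then show ?thesis unfolding toep_bilinear[OF continuous_on_const] by (simp add: power2_eq_square)
qed

text \<open>The quadratic form is the integral of the symbol against the squared modulus of the Fourier
  polynomial of \<open>x\<close>.\<close>

lemma toep_lower:
  assumes "continuous_on {0..1} \<psi>" "\<And>u. u \<in> {0..1} \<Longrightarrow> b \<le> \<psi> u"
  shows "2 * pi * b * (nrm n x)\<^sup>2 \<le> (\<Sum>t<n. x t * toep n \<psi> x t)"
proof -
  have "b * (nrm n x)\<^sup>2 = integral {0..1} (\<lambda>u. b * ((trig_c n x u)\<^sup>2 + (trig_s n x u)\<^sup>2))"
    unfolding nrm_sq_integral by simp
  also have "\<dots> \<le> integral {0..1} (\<lambda>u. \<psi> u * (trig_c n x u * trig_c n x u + trig_s n x u * trig_s n x u))"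
    unfolding power2_eq_square
    by (intro integral_le integrable_continuous_real continuous_intros assms mult_right_mono) auto
  finally show ?thesis unfolding toep_bilinear[OF assms(1)] by simp
qed

text \<open>The symbol may change sign, so the form alone does not bound the norm. The bilinear form is an
  integral of the symbol against products of Fourier polynomials, and these are square integrable with
  known norms.\<close>

lemma nrm_toep_le:
  assumes "continuous_on {0..1} \<psi>" "\<And>u. u \<in> {0..1} \<Longrightarrow> \<bar>\<psi> u\<bar> \<le> B" "0 < B"
  shows "nrm n (toep n \<psi> x) \<le> 2 * pi * B * nrm n x"
proof (rule power2_le_imp_le)
  define y where "y = toep n \<psi> x"
  define a where "a = 2 * pi * B"
  have a: "a > 0" using assms by (simp add: a_def)
  let ?q = "\<lambda>x u. (trig_c n x u)\<^sup>2 + (trig_s n x u)\<^sup>2"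
  have "(nrm n y)\<^sup>2 = (\<Sum>t<n. y t * toep n \<psi> x t)"
    unfolding nrm_sq y_def by (simp add: power2_eq_square)
  also have "\<dots> = 2 * pi * integral {0..1} (\<lambda>u. \<psi> u * (trig_c n y u * trig_c n x u + trig_s n y u * trig_s n x u))"
    by (rule toep_bilinear[OF assms(1)])
  also have "\<dots> \<le> 2 * pi * integral {0..1} (\<lambda>u. (B / 2 * a) * ?q x u + (B / 2 / a) * ?q y u)"
  proof (intro mult_left_mono integral_le integrable_continuous_real continuous_intros assms)
    fix u :: real assume u: "u \<in> {0..1}"
    have young: "\<bar>v * w\<bar> \<le> (a * w\<^sup>2 + v\<^sup>2 / a) / 2" for v w :: real
    proof -
      have "0 \<le> (a * \<bar>w\<bar> - \<bar>v\<bar>)\<^sup>2" by simp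
      then have "2 * a * (\<bar>v\<bar> * \<bar>w\<bar>) \<le> a\<^sup>2 * w\<^sup>2 + v\<^sup>2" by (simp add: power2_diff power_mult_distrib mult_ac)
      then show ?thesis using a by (simp add: abs_mult field_simps power2_eq_square)
    qed
    let ?A = "trig_c n y u * trig_c n x u + trig_s n y u * trig_s n x u"
    have "\<psi> u * ?A \<le> \<bar>\<psi> u\<bar> * \<bar>?A\<bar>" unfolding abs_mult[symmetric] by (rule abs_ge_self)
    also have "\<dots> \<le> B * \<bar>?A\<bar>" by (intro mult_right_mono assms u) simp
    also have "\<dots> \<le> B * ((a * (trig_c n x u)\<^sup>2 + (trig_c n y u)\<^sup>2 / a) / 2 + (a * (trig_s n x u)\<^sup>2 + (trig_s n y u)\<^sup>2 / a) / 2)"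
      by (intro mult_left_mono order_trans[OF abs_triangle_ineq] add_mono young) (use assms in auto)
    also have "\<dots> = (B / 2 * a) * ?q x u + (B / 2 / a) * ?q y u"
      by (simp add: add_divide_distrib algebra_simps)
    finally show "\<psi> u * ?A \<le> (B / 2 * a) * ?q x u + (B / 2 / a) * ?q y u" .
  qed (use a in auto)
  also have "integral {0..1} (\<lambda>u. (B / 2 * a) * ?q x u + (B / 2 / a) * ?q y u) = (B / 2 * a) * (nrm n x)\<^sup>2 + (B / 2 / a) * (nrm n y)\<^sup>2"
  proof -
    have i: "(\<lambda>u. c * ?q z u) integrable_on {0..1}" for c z
      by (intro integrable_continuous_real continuous_intros)
    show ?thesis unfolding nrm_sq_integral integral_add[OF i i] by simp
  qed
  also have "2 * pi * ((B / 2 * a) * (nrm n x)\<^sup>2 + (B / 2 / a) * (nrm n y)\<^sup>2) = a\<^sup>2 / 2 * (nrm n x)\<^sup>2 + (nrm n y)\<^sup>2 / 2"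
    using assms by (simp add: a_def field_simps power2_eq_square)
  finally have "(nrm n y)\<^sup>2 \<le> a\<^sup>2 * (nrm n x)\<^sup>2" by simp
  then show "(nrm n (toep n \<psi> x))\<^sup>2 \<le> (2 * pi * B * nrm n x)\<^sup>2"
    by (simp add: y_def a_def power_mult_distrib)
qed (use assms in \<open>simp add: L2_set_nonneg\<close>)

section \<open>Uniform trigonometric approximation\<close>

inductive_set cos_polys :: "(real \<Rightarrow> real) set" where
  monomial: "(\<lambda>u. a * cos (real k * pi * u)) \<in> cos_polys"
| add: "f \<in> cos_polys \<Longrightarrow> g \<in> cos_polys \<Longrightarrow> (\<lambda>u. f u + g u) \<in> cos_polys"

lemma cos_polys_mult:
  assumes "f \<in> cos_polys" "g \<in> cos_polys"
  shows "(\<lambda>u. f u * g u) \<in> cos_polys"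
  using assms(1)
proof induction
  case (monomial a k)
  show ?case using assms(2)
  proof induction
    case (monomial b l)
    define d where "d = (if l \<le> k then k - l else l - k)"
    have "cos (real d * pi * u) = cos (real k * pi * u - real l * pi * u)" for u
      using cos_minus[of "real k * pi * u - real l * pi * u"]
      by (auto simp: d_def of_nat_diff left_diff_distrib)
    note d = this
    have "real (k + l) * pi * u = real k * pi * u + real l * pi * u" for u by (simp add: algebra_simps)
    then have "a * cos (real k * pi * u) * (b * cos (real l * pi * u)) =
      (a * b / 2) * cos (real (k + l) * pi * u) + (a * b / 2) * cos (real d * pi * u)" for u
      unfolding d by (simp only: cos_add cos_diff) (simp add: field_simps)
    then show ?case by (simp only:) (intro cos_polys.intros)
  next
    case (add g h)
    then show ?case unfolding distrib_left by (intro cos_polys.add)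
  qed
next
  case (add f h)
  then show ?case unfolding distrib_right by (intro cos_polys.add)
qed

lemma cos_polys_continuous: "f \<in> cos_polys \<Longrightarrow> continuous_on S f"
  by (induction rule: cos_polys.induct) (auto intro!: continuous_intros)

lemma cos_polys_expansion:
  assumes "f \<in> cos_polys"
  shows "\<exists>d c. \<forall>D\<ge>d. \<forall>u. f u = (\<Sum>k\<le>D. c k * cos (real k * pi * u))"
  using assms
proof induction
  case (monomial a k)
  have "a * cos (real k * pi * u) = (\<Sum>j\<le>D. (if j = k then a else 0) * cos (real j * pi * u))" if "D \<ge> k" for D u
  proof -
    have "(\<Sum>j\<le>D. (if j = k then a else 0) * cos (real j * pi * u)) = (\<Sum>j\<le>D. if j = k then a * cos (real j * pi * u) else 0)"
      by (rule sum.cong) auto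
    then show ?thesis using that by simp
  qed
  then show ?case by (intro exI[of _ k] exI[of _ "\<lambda>j. if j = k then a else 0"]) blast
next
  case (add f g)
  then obtain d c d' c' where
    f: "\<forall>D\<ge>d. \<forall>u. f u = (\<Sum>k\<le>D. c k * cos (real k * pi * u))" and
    g: "\<forall>D\<ge>d'. \<forall>u. g u = (\<Sum>k\<le>D. c' k * cos (real k * pi * u))" by blast
  have "f u + g u = (\<Sum>k\<le>D. (c k + c' k) * cos (real k * pi * u))" if "D \<ge> max d d'" for D u
  proof -
    have "f u = (\<Sum>k\<le>D. c k * cos (real k * pi * u))" using f that by simp
    moreover have "g u = (\<Sum>k\<le>D. c' k * cos (real k * pi * u))" using g that by simp
    ultimately show ?thesis by (simp only: distrib_right sum.distrib)
  qed
  then show ?case by (intro exI[of _ "max d d'"] exI[of _ "\<lambda>k. c k + c' k"]) blast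
qed

text \<open>Stone and Weierstrass: the cosine polynomials form an algebra by the product formula, and
  \<open>cos (pi * u)\<close> is injective on \<open>[0,1]\<close>. The coefficients have to be valid for all large
  \<open>D\<close> because several approximations are brought to a common length later.\<close>

lemma cos_polys_dense:
  assumes "continuous_on {0..1} f" "e > 0"
  shows "\<exists>d c. \<forall>D\<ge>d. \<forall>u\<in>{0..1}. \<bar>f u - (\<Sum>k\<le>D. c k * cos (real k * pi * u))\<bar> < e"
proof -
  interpret function_ring_on cos_polys "{0..1::real}"
  proof
    show "(\<lambda>_. a) \<in> cos_polys" for a using cos_polys.monomial[of a 0] by simp
    show "\<exists>f\<in>cos_polys. f x \<noteq> f y" if "x \<in> {0..1}" "y \<in> {0..1}" "x \<noteq> y" for x y :: real
    proof
      show "(\<lambda>u. 1 * cos (real 1 * pi * u)) \<in> cos_polys" by (rule cos_polys.monomial)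
      show "1 * cos (real 1 * pi * x) \<noteq> 1 * cos (real 1 * pi * y)"
      proof
        assume "1 * cos (real 1 * pi * x) = 1 * cos (real 1 * pi * y)"
        then have "cos (pi * x) = cos (pi * y)" by simp
        then have "pi * x = pi * y"
          by (rule cos_inj_pi[rotated 4]) (use that in auto)
        then show False using that by simp
      qed
    qed
  qed (auto intro: cos_polys.add cos_polys_mult cos_polys_continuous)
  obtain g where g: "g \<in> cos_polys" "\<forall>u\<in>{0..1}. \<bar>f u - g u\<bar> < e"
    using Stone_Weierstrass_basic[OF assms] by blast
  obtain d c where "\<forall>D\<ge>d. \<forall>u. g u = (\<Sum>k\<le>D. c k * cos (real k * pi * u))"
    using cos_polys_expansion[OF g(1)] by blast
  then show ?thesis using g(2) by (intro exI[of _ d] exI[of _ c]) metis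
qed

definition lipschitz01 :: "real \<Rightarrow> (real \<Rightarrow> real) \<Rightarrow> bool" where
  "lipschitz01 L f \<longleftrightarrow> (\<forall>x\<in>{0..1}. \<forall>y\<in>{0..1}. \<bar>f x - f y\<bar> \<le> L * \<bar>x - y\<bar>)"

lemma lipschitz01_continuous:
  assumes "lipschitz01 L f"
  shows "continuous_on {0..1} f"
proof (rule continuous_onI)
  fix x e :: real assume x: "x \<in> {0..1}" and e: "e > 0"
  have "\<bar>f y - f x\<bar> \<le> e" if "y \<in> {0..1}" "\<bar>y - x\<bar> < e / (\<bar>L\<bar> + 1)" for y
  proof -
    have "\<bar>f y - f x\<bar> \<le> L * \<bar>y - x\<bar>" using assms x that unfolding lipschitz01_def by blast
    also have "\<dots> \<le> (\<bar>L\<bar> + 1) * \<bar>y - x\<bar>" by (intro mult_right_mono) auto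
    also have "\<dots> \<le> e" using that(2) by (simp add: field_simps)
    finally show ?thesis .
  qed
  then show "\<exists>d>0. \<forall>x'\<in>{0..1}. dist x' x < d \<longrightarrow> dist (f x') (f x) \<le> e"
    using e by (intro exI[of _ "e / (\<bar>L\<bar> + 1)"]) (auto simp: dist_real_def)
qed

text \<open>The mean absolute deviation of a binomial variable divided by \<open>J\<close> is at most
  \<open>1 / sqrt J\<close> by its variance. The point is that the rate depends only on the Lipschitz
  constant.\<close>

lemma bernstein_approx:
  assumes L: "lipschitz01 L f" "0 \<le> L" and J: "J > 0" and x: "x \<in> {0..1}"
  shows "\<bar>(\<Sum>i\<le>J. f (real i / real J) * Bernstein J i x) - f x\<bar> \<le> L / sqrt (real J)"
proof -
  have b0: "0 \<le> Bernstein J i x" for i using x by (intro Bernstein_nonneg) auto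
  define s where "s = sqrt (real J)"
  have s: "s > 0" "s * s = real J" using J by (auto simp: s_def)
  have var: "(\<Sum>i\<le>J. (real i / real J - x)\<^sup>2 * Bernstein J i x) \<le> 1 / (4 * real J)"
  proof -
    have "(\<Sum>i\<le>J. (real i - real J * x)\<^sup>2 * Bernstein J i x) = real J * x * (1 - x)"
    proof -
      have "(real i - real J * x)\<^sup>2 = real i * (real i - 1) + (1 - 2 * real J * x) * real i + (real J)\<^sup>2 * x\<^sup>2 * 1" for i
        by (simp add: power2_eq_square algebra_simps)
      then have "(\<Sum>i\<le>J. (real i - real J * x)\<^sup>2 * Bernstein J i x) =
         (\<Sum>i\<le>J. real i * (real i - 1) * Bernstein J i x) + (1 - 2 * real J * x) * (\<Sum>i\<le>J. real i * Bernstein J i x)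
          + (real J)\<^sup>2 * x\<^sup>2 * (\<Sum>i\<le>J. Bernstein J i x)"
        by (simp only: distrib_right sum.distrib sum_distrib_left mult.assoc mult_1)
      then show ?thesis
        unfolding sum_k_Bernstein sum_kk_Bernstein sum_Bernstein by (simp add: power2_eq_square algebra_simps)
    qed
    also have "\<dots> \<le> real J * (1 / 4)"
    proof -
      have "x * (1 - x) \<le> 1 / 4" using zero_le_power2[of "x - 1/2"] by (simp add: power2_eq_square algebra_simps)
      then show ?thesis by (simp only: mult.assoc) (intro mult_left_mono, auto)
    qed
    finally have "(\<Sum>i\<le>J. (real i - real J * x)\<^sup>2 * Bernstein J i x) / (real J)\<^sup>2 \<le> real J * (1 / 4) / (real J)\<^sup>2"
      by (rule divide_right_mono) simp
    moreover have "(real i / real J - x)\<^sup>2 = (real i - real J * x)\<^sup>2 / (real J)\<^sup>2" for i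
    proof -
      have "real i / real J - x = (real i - real J * x) / real J" using J by (simp add: field_simps)
      then show ?thesis by (simp add: power_divide)
    qed
    ultimately show ?thesis using J by (simp add: sum_divide_distrib power2_eq_square)
  qed
  \<comment> \<open>the quadratic majorant of \<open>\<bar>v\<bar>\<close> that balances the two terms at \<open>v = 1 / s\<close>\<close>
  have dev: "\<bar>v\<bar> \<le> 1 / (2 * s) + (s / 2) * v\<^sup>2" for v
  proof -
    have "0 \<le> (s * \<bar>v\<bar> - 1)\<^sup>2" by simp
    then have "2 * s * \<bar>v\<bar> \<le> s\<^sup>2 * v\<^sup>2 + 1"
      by (simp add: power2_diff power_mult_distrib)
    then show ?thesis using s(1) by (simp add: field_simps power2_eq_square)
  qed
  have "(\<Sum>i\<le>J. f (real i / real J) * Bernstein J i x) - f x = (\<Sum>i\<le>J. (f (real i / real J) - f x) * Bernstein J i x)"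
    using sum_Bernstein[of J x] by (simp add: left_diff_distrib sum_subtractf flip: sum_distrib_left)
  then have "\<bar>(\<Sum>i\<le>J. f (real i / real J) * Bernstein J i x) - f x\<bar> \<le> (\<Sum>i\<le>J. \<bar>f (real i / real J) - f x\<bar> * Bernstein J i x)"
    using sum_abs[of "\<lambda>i. (f (real i / real J) - f x) * Bernstein J i x" "{..J}"] b0 by (simp add: abs_mult)
  also have "\<dots> \<le> (\<Sum>i\<le>J. (L * (1 / (2 * s) + (s / 2) * (real i / real J - x)\<^sup>2)) * Bernstein J i x)"
  proof (intro sum_mono mult_right_mono b0)
    fix i assume "i \<in> {..J}"
    then have "real i / real J \<in> {0..1}" using J by auto
    then have "\<bar>f (real i / real J) - f x\<bar> \<le> L * \<bar>real i / real J - x\<bar>" using L(1) x unfolding lipschitz01_def by blast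
    also have "\<dots> \<le> L * (1 / (2 * s) + (s / 2) * (real i / real J - x)\<^sup>2)" by (intro mult_left_mono dev L)
    finally show "\<bar>f (real i / real J) - f x\<bar> \<le> L * (1 / (2 * s) + (s / 2) * (real i / real J - x)\<^sup>2)" .
  qed
  also have "\<dots> = L * (1 / (2 * s) * (\<Sum>i\<le>J. Bernstein J i x) + (s / 2) * (\<Sum>i\<le>J. (real i / real J - x)\<^sup>2 * Bernstein J i x))"
    by (simp only: distrib_left distrib_right sum.distrib sum_distrib_left mult.assoc)
  also have "\<dots> \<le> L * (1 / (2 * s) * 1 + (s / 2) * (1 / (4 * real J)))"
    using var s(1) L(2) by (intro mult_left_mono add_mono) (auto simp: sum_Bernstein)
  also have "\<dots> \<le> L / s"
  proof -
    have "1 / (2 * s) * 1 + (s / 2) * (1 / (4 * real J)) = 5 / 8 / s"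
      unfolding s(2)[symmetric] using s(1) by (simp add: field_simps)
    also have "\<dots> \<le> 1 / s" using s(1) by (intro divide_right_mono) auto
    finally have "L * (1 / (2 * s) * 1 + (s / 2) * (1 / (4 * real J))) \<le> L * (1 / s)" by (intro mult_left_mono L(2))
    then show ?thesis by simp
  qed
  finally show ?thesis by (simp add: s_def)
qed

text \<open>One length \<open>D\<close> and one coefficient bound \<open>C\<close> serve a whole Lipschitz ball. A Bernstein
  polynomial of a common degree approximates each \<open>f\<close>, so that only the finitely many functions
  \<open>Bernstein J i * w\<close> need approximation by cosines. The weight \<open>w\<close> is merely continuous; it
  carries the dependence on the working model.\<close>

lemma uniform_trig_approx:
  assumes w: "continuous_on {0..1} w" and "0 \<le> L" "0 < B" "0 < e"
  shows "\<exists>D C. 0 \<le> C \<and> (\<forall>f. lipschitz01 L f \<longrightarrow> (\<forall>x\<in>{0..1}. \<bar>f x\<bar> \<le> B) \<longrightarrow>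
    (\<exists>c. (\<forall>k\<le>D. \<bar>c k\<bar> \<le> C) \<and> (\<forall>u\<in>{0..1}. \<bar>f u * w u - (\<Sum>k\<le>D. c k * cos (real k * pi * u))\<bar> \<le> e)))"
proof -
  have "bounded (w ` {0..1})" by (intro compact_imp_bounded compact_continuous_image w) simp
  then obtain W where "W > 0" and W': "\<forall>x\<in>w ` {0..1}. norm x \<le> W" unfolding bounded_pos by blast
  then have W: "\<And>u. u \<in> {0..1} \<Longrightarrow> \<bar>w u\<bar> \<le> W" "W > 0" by auto
  obtain J :: nat where "(2 * L * W / e)\<^sup>2 < real J" using reals_Archimedean2[of "(2 * L * W / e)\<^sup>2"] by blast
  moreover have "(0::real) \<le> (2 * L * W / e)\<^sup>2" by simp
  ultimately have J: "J > 0" "(2 * L * W / e)\<^sup>2 < real J" by linarith+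
  have JL: "L / sqrt (real J) * W \<le> e / 2"
  proof -
    have "2 * L * W / e \<le> sqrt (real J)" using J(2) by (simp add: real_le_rsqrt)
    then show ?thesis using J(1) assms by (simp add: field_simps)
  qed
  define e' where "e' = e / (2 * B * real (J + 1))"
  have e': "e' > 0" using assms by (simp add: e'_def)
  have "\<exists>d c. \<forall>D\<ge>d. \<forall>u\<in>{0..1}. \<bar>Bernstein J i u * w u - (\<Sum>k\<le>D. c k * cos (real k * pi * u))\<bar> < e'" for i
    by (rule cos_polys_dense) (use e' in \<open>auto intro!: continuous_intros w simp: Bernstein_def\<close>)
  then obtain d c where dc: "\<And>i D u. D \<ge> d i \<Longrightarrow> u \<in> {0..1} \<Longrightarrow>
      \<bar>Bernstein J i u * w u - (\<Sum>k\<le>D. c i k * cos (real k * pi * u))\<bar> < e'" by metis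
  define D where "D = (\<Sum>i\<le>J. d i)"
  have D: "d i \<le> D" if "i \<le> J" for i unfolding D_def using that by (intro member_le_sum) auto
  define C where "C = (\<Sum>k\<le>D. \<Sum>i\<le>J. B * \<bar>c i k\<bar>)"
  have "0 \<le> C" unfolding C_def using assms by (intro sum_nonneg mult_nonneg_nonneg) auto
  moreover have "\<exists>c. (\<forall>k\<le>D. \<bar>c k\<bar> \<le> C) \<and> (\<forall>u\<in>{0..1}. \<bar>f u * w u - (\<Sum>k\<le>D. c k * cos (real k * pi * u))\<bar> \<le> e)"
    if f: "lipschitz01 L f" "\<forall>x\<in>{0..1}. \<bar>f x\<bar> \<le> B" for f
  proof -
    define b where "b k = (\<Sum>i\<le>J. f (real i / real J) * c i k)" for k
    have fB: "\<bar>f (real i / real J)\<bar> \<le> B" if "i \<le> J" for i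
    proof -
      have "real i / real J \<in> {0..1}" using that J by simp
      then show ?thesis using f(2) by blast
    qed
    have "\<bar>b k\<bar> \<le> C" if "k \<le> D" for k
    proof -
      have "\<bar>b k\<bar> \<le> (\<Sum>i\<le>J. \<bar>f (real i / real J)\<bar> * \<bar>c i k\<bar>)"
        unfolding b_def abs_mult[symmetric] by (rule sum_abs)
      also have "\<dots> \<le> (\<Sum>i\<le>J. B * \<bar>c i k\<bar>)" by (intro sum_mono mult_right_mono fB) auto
      also have "\<dots> \<le> C" unfolding C_def
        by (rule member_le_sum[where f="\<lambda>k. \<Sum>i\<le>J. B * \<bar>c i k\<bar>"])
           (use that assms in \<open>auto intro!: sum_nonneg\<close>)
      finally show ?thesis .
    qed
    moreover have "\<bar>f u * w u - (\<Sum>k\<le>D. b k * cos (real k * pi * u))\<bar> \<le> e" if u: "u \<in> {0..1}" for u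
    proof -
      define q where "q i = (\<Sum>k\<le>D. c i k * cos (real k * pi * u))" for i
      have "(\<Sum>k\<le>D. b k * cos (real k * pi * u)) = (\<Sum>i\<le>J. f (real i / real J) * q i)"
        unfolding b_def q_def sum_distrib_left sum_distrib_right by (subst sum.swap) (simp only: mult.assoc)
      then have "f u * w u - (\<Sum>k\<le>D. b k * cos (real k * pi * u)) =
        (f u - (\<Sum>i\<le>J. f (real i / real J) * Bernstein J i u)) * w u + (\<Sum>i\<le>J. f (real i / real J) * (Bernstein J i u * w u - q i))"
        by (simp add: algebra_simps sum_subtractf sum_distrib_left)
      also have "\<bar>\<dots>\<bar> \<le> L / sqrt (real J) * W + (\<Sum>i\<le>J. B * e')"
      proof (rule order_trans[OF abs_triangle_ineq], rule add_mono)
        have "\<bar>f u - (\<Sum>i\<le>J. f (real i / real J) * Bernstein J i u)\<bar> \<le> L / sqrt (real J)"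
          using bernstein_approx[OF f(1) assms(2) J(1) u] by (simp add: abs_minus_commute)
        then show "\<bar>(f u - (\<Sum>i\<le>J. f (real i / real J) * Bernstein J i u)) * w u\<bar> \<le> L / sqrt (real J) * W"
          unfolding abs_mult using W(1)[OF u] by (intro mult_mono) auto
        have "\<bar>\<Sum>i\<le>J. f (real i / real J) * (Bernstein J i u * w u - q i)\<bar> \<le> (\<Sum>i\<le>J. \<bar>f (real i / real J)\<bar> * \<bar>Bernstein J i u * w u - q i\<bar>)"
          unfolding abs_mult[symmetric] by (rule sum_abs)
        also have "\<dots> \<le> (\<Sum>i\<le>J. B * e')"
        proof (intro sum_mono mult_mono fB)
          fix i assume "i \<in> {..J}"
          then show "\<bar>Bernstein J i u * w u - q i\<bar> \<le> e'" unfolding q_def using dc[OF D u] by (simp add: less_imp_le)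
        qed (use assms in auto)
        finally show "\<bar>\<Sum>i\<le>J. f (real i / real J) * (Bernstein J i u * w u - q i)\<bar> \<le> (\<Sum>i\<le>J. B * e')" .
      qed
      also have "(\<Sum>i\<le>J. B * e') = e / 2"
      proof -
        have nz: "2 * B * real (J + 1) \<noteq> 0" using assms by simp
        have "(\<Sum>i\<le>J. B * e') = (2 * B * real (J + 1)) * e' / 2" by simp
        also have "(2 * B * real (J + 1)) * e' = e"
        proof -
          have "c \<noteq> 0 \<Longrightarrow> c * (e / c) = e" for c by simp
          then show ?thesis unfolding e'_def using nz by blast
        qed
        finally show ?thesis .
      qed
      finally show ?thesis using JL by linarith
    qed
    ultimately show ?thesis by blast
  qed
  ultimately show ?thesis by blast
qed

section \<open>The corrected quadratic form\<close>

abbreviation root_ratio :: "(real \<Rightarrow> real) \<Rightarrow> (real \<Rightarrow> real) \<Rightarrow> real \<Rightarrow> real" where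
  "root_ratio \<phi> \<psi> \<equiv> (\<lambda>u. (\<phi> u / \<psi> u) powr (- 1 / 2))"

text \<open>The consequences of membership in \<open>Theta m M\<close> that the analysis uses, without reference to
  the function space.\<close>

definition admissible :: "real \<Rightarrow> real \<Rightarrow> (real \<Rightarrow> real) \<Rightarrow> bool" where
  "admissible m M \<phi> \<longleftrightarrow> lipschitz01 M \<phi> \<and> (\<forall>u\<in>{0..1}. m \<le> \<phi> u \<and> \<phi> u \<le> M)"

lemma inverse_sqrt_lipschitz:
  assumes "0 < m" "m \<le> a" "m \<le> b"
  shows "\<bar>1 / sqrt a - 1 / sqrt b\<bar> \<le> \<bar>a - b\<bar> / (m * sqrt m)"
proof -
  have p: "0 < sqrt m" "sqrt m \<le> sqrt a" "sqrt m \<le> sqrt b" using assms by auto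
  have "\<bar>sqrt b - sqrt a\<bar> * (sqrt a + sqrt b) = \<bar>(sqrt b - sqrt a) * (sqrt a + sqrt b)\<bar>"
    using p by (simp add: abs_mult)
  also have "(sqrt b - sqrt a) * (sqrt a + sqrt b) = b - a"
    using assms by (simp add: algebra_simps)
  finally have e: "\<bar>sqrt b - sqrt a\<bar> * (sqrt a + sqrt b) = \<bar>a - b\<bar>" by (simp add: abs_minus_commute)
  have "sqrt m \<le> sqrt a + sqrt b" using p by linarith
  then have "\<bar>sqrt b - sqrt a\<bar> * sqrt m \<le> \<bar>sqrt b - sqrt a\<bar> * (sqrt a + sqrt b)"
    by (rule mult_left_mono) simp
  then have "\<bar>sqrt b - sqrt a\<bar> * sqrt m \<le> \<bar>a - b\<bar>" using e by linarith
  then have 1: "\<bar>sqrt b - sqrt a\<bar> \<le> \<bar>a - b\<bar> / sqrt m" unfolding pos_le_divide_eq[OF p(1)] .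
  have "sqrt m * sqrt m \<le> sqrt a * sqrt b" by (intro mult_mono p) (use p in linarith)+
  then have 2: "m \<le> sqrt a * sqrt b" using assms by simp
  have ab: "0 < sqrt a" "0 < sqrt b" using assms by auto
  then have "1 / sqrt a - 1 / sqrt b = (sqrt b - sqrt a) / (sqrt a * sqrt b)"
    by (simp add: field_simps)
  then have "\<bar>1 / sqrt a - 1 / sqrt b\<bar> = \<bar>sqrt b - sqrt a\<bar> / (sqrt a * sqrt b)"
    using ab by (simp add: abs_divide abs_mult)
  also have "\<dots> \<le> (\<bar>a - b\<bar> / sqrt m) / m" using 1 2 assms by (intro frac_le) auto
  finally show ?thesis by (simp add: mult.commute)
qed

lemma powr_minus_half: "a powr (- 1 / 2) = inverse (a powr (1 / 2))" for a :: real
proof -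
  have "(- 1 / 2 :: real) = - (1 / 2)" by simp
  then show ?thesis by (simp only: powr_minus)
qed

lemma inverse_lipschitz:
  fixes a b m :: real
  assumes "0 < m" "m \<le> a" "m \<le> b"
  shows "\<bar>1 / a - 1 / b\<bar> \<le> \<bar>a - b\<bar> / m\<^sup>2"
proof -
  have "1 / a - 1 / b = (b - a) / (a * b)" using assms by (simp add: field_simps)
  then have "\<bar>1 / a - 1 / b\<bar> = \<bar>a - b\<bar> / (a * b)" using assms by (simp add: abs_divide abs_mult abs_minus_commute)
  also have "\<dots> \<le> \<bar>a - b\<bar> / m\<^sup>2" unfolding power2_eq_square
    using assms by (intro divide_left_mono mult_mono) auto
  finally show ?thesis .
qed

lemma admissible_inverse_sqrt:
  assumes "0 < m" "0 \<le> M" "admissible m M \<phi>"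
  shows "lipschitz01 (M / (m * sqrt m)) (\<lambda>u. \<phi> u powr (- 1 / 2))" "\<forall>u\<in>{0..1}. \<bar>\<phi> u powr (- 1 / 2)\<bar> \<le> 1 / sqrt m"
proof -
  have e: "\<phi> u powr (- 1 / 2) = 1 / sqrt (\<phi> u)" if "u \<in> {0..1}" for u
  proof -
    have "m \<le> \<phi> u" using assms(3) that unfolding admissible_def by blast
    then have "\<phi> u > 0" using assms(1) by linarith
    then have "\<phi> u powr (1 / 2) = sqrt (\<phi> u)" by (intro powr_half_sqrt) linarith
    then show ?thesis by (simp only: powr_minus_half inverse_eq_divide)
  qed
  show "lipschitz01 (M / (m * sqrt m)) (\<lambda>u. \<phi> u powr (- 1 / 2))"
    unfolding lipschitz01_def
  proof (intro ballI)
    fix x y :: real assume xy: "x \<in> {0..1}" "y \<in> {0..1}"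
    have "\<bar>1 / sqrt (\<phi> x) - 1 / sqrt (\<phi> y)\<bar> \<le> \<bar>\<phi> x - \<phi> y\<bar> / (m * sqrt m)"
      using assms xy unfolding admissible_def by (intro inverse_sqrt_lipschitz) auto
    also have "\<dots> \<le> (M * \<bar>x - y\<bar>) / (m * sqrt m)"
      using assms xy unfolding admissible_def lipschitz01_def by (intro divide_right_mono) auto
    finally show "\<bar>\<phi> x powr (- 1 / 2) - \<phi> y powr (- 1 / 2)\<bar> \<le> M / (m * sqrt m) * \<bar>x - y\<bar>"
      using e[OF xy(1)] e[OF xy(2)] by simp
  qed
  show "\<forall>u\<in>{0..1}. \<bar>\<phi> u powr (- 1 / 2)\<bar> \<le> 1 / sqrt m"
  proof
    fix u :: real assume u: "u \<in> {0..1}"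
    then have "m \<le> \<phi> u" using assms unfolding admissible_def by blast
    then show "\<bar>\<phi> u powr (- 1 / 2)\<bar> \<le> 1 / sqrt m" unfolding e[OF u] using assms by (simp add: frac_le)
  qed
qed

lemma admissible_inverse:
  assumes "0 < m" "0 \<le> M" "admissible m M \<phi>"
  shows "lipschitz01 (M / m\<^sup>2) (\<lambda>u. 1 / \<phi> u)" "\<forall>u\<in>{0..1}. \<bar>1 / \<phi> u\<bar> \<le> 1 / m"
proof -
  show "lipschitz01 (M / m\<^sup>2) (\<lambda>u. 1 / \<phi> u)"
    unfolding lipschitz01_def
  proof (intro ballI)
    fix x y :: real assume xy: "x \<in> {0..1}" "y \<in> {0..1}"
    have "\<bar>1 / \<phi> x - 1 / \<phi> y\<bar> \<le> \<bar>\<phi> x - \<phi> y\<bar> / m\<^sup>2"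
      using assms xy unfolding admissible_def by (intro inverse_lipschitz) auto
    also have "\<dots> \<le> (M * \<bar>x - y\<bar>) / m\<^sup>2"
      using assms xy unfolding admissible_def lipschitz01_def by (intro divide_right_mono) auto
    finally show "\<bar>1 / \<phi> x - 1 / \<phi> y\<bar> \<le> M / m\<^sup>2 * \<bar>x - y\<bar>" by simp
  qed
  show "\<forall>u\<in>{0..1}. \<bar>1 / \<phi> u\<bar> \<le> 1 / m"
  proof
    fix u :: real assume u: "u \<in> {0..1}"
    then have "m \<le> \<phi> u" using assms unfolding admissible_def by blast
    then show "\<bar>1 / \<phi> u\<bar> \<le> 1 / m" using assms by (simp add: frac_le)
  qed
qed

text \<open>The error made by treating the Toeplitz matrix with symbol \<open>\<psi>\<close> as a circulant one.\<close>

definition defect :: "nat \<Rightarrow> (real \<Rightarrow> real) \<Rightarrow> (nat \<Rightarrow> real) \<Rightarrow> nat \<Rightarrow> real" where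
  "defect n \<psi> x t = 2 * pi * circ n \<psi> x t - toep n \<psi> x t"

abbreviation cosk :: "nat \<Rightarrow> real \<Rightarrow> real" where
  "cosk k \<equiv> (\<lambda>u. cos (real k * pi * u))"

lemma nrm_triangle: "nrm n (\<lambda>t. x t + y t) \<le> nrm n x + nrm n y"
  by (rule L2_set_triangle_ineq)

lemma nrm_scale: "nrm n (\<lambda>t. a * x t) = \<bar>a\<bar> * nrm n x"
  unfolding L2_set_def power_mult_distrib sum_distrib_left[symmetric] real_sqrt_mult by simp

lemma nrm_sum_le: "finite A \<Longrightarrow> nrm n (\<lambda>t. \<Sum>k\<in>A. x k t) \<le> (\<Sum>k\<in>A. nrm n (x k))"
proof (induction A rule: finite_induct)
  case empty
  then show ?case by (simp add: L2_set_def)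
next
  case (insert a A)
  then have "nrm n (\<lambda>t. \<Sum>k\<in>insert a A. x k t) = nrm n (\<lambda>t. x a t + (\<Sum>k\<in>A. x k t))" by simp
  also have "\<dots> \<le> nrm n (x a) + nrm n (\<lambda>t. \<Sum>k\<in>A. x k t)" by (rule nrm_triangle)
  finally show ?case using insert by simp
qed

lemma inner_le_nrm: "\<bar>\<Sum>t<n. x t * y t\<bar> \<le> nrm n x * nrm n y"
proof -
  have "\<bar>\<Sum>t<n. x t * y t\<bar> \<le> (\<Sum>t<n. \<bar>x t\<bar> * \<bar>y t\<bar>)" unfolding abs_mult[symmetric] by (rule sum_abs)
  also have "\<dots> \<le> nrm n x * nrm n y" by (rule L2_set_mult_ineq)
  finally show ?thesis .
qed

lemma nrm_defect_le:
  assumes "continuous_on {0..1} \<psi>" "\<And>u. u \<in> {0..1} \<Longrightarrow> \<bar>\<psi> u\<bar> \<le> B" "0 < B"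
  shows "nrm n (defect n \<psi> x) \<le> 4 * pi * B * nrm n x"
proof -
  have "nrm n (defect n \<psi> x) = nrm n (\<lambda>t. 2 * pi * circ n \<psi> x t + (- 1) * toep n \<psi> x t)"
    by (simp add: defect_def[abs_def])
  also have "\<dots> \<le> nrm n (\<lambda>t. 2 * pi * circ n \<psi> x t) + nrm n (\<lambda>t. (- 1) * toep n \<psi> x t)" by (rule nrm_triangle)
  also have "\<dots> = 2 * pi * nrm n (circ n \<psi> x) + nrm n (toep n \<psi> x)" unfolding nrm_scale by simp
  also have "\<dots> \<le> 2 * pi * (B * nrm n x) + 2 * pi * B * nrm n x"
    using nrm_circ_le[of n \<psi> B x] nrm_toep_le[where \<psi>=\<psi> and B=B and n=n and x=x] assms grid_range by (intro add_mono mult_left_mono) auto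
  finally show ?thesis by (simp add: mult_ac)
qed

lemma defect_diff:
  assumes "continuous_on {0..1} f" "continuous_on {0..1} g"
  shows "defect n (\<lambda>u. f u - g u) x t = defect n f x t - defect n g x t"
  unfolding defect_def circ_diff toep_diff[OF assms] by (simp add: algebra_simps)

lemma defect_vec_diff: "defect n f (\<lambda>t. x t - y t) t = defect n f x t - defect n f y t"
  unfolding defect_def circ_vec_diff toep_vec_diff by (simp add: algebra_simps)

lemma cosk_continuous [continuous_intros]: "continuous_on S (cosk k)"
  by (intro continuous_intros)

lemma defect_sum:
  assumes "finite A"
  shows "defect n (\<lambda>u. \<Sum>k\<in>A. c k * cosk k u) x t = (\<Sum>k\<in>A. c k * defect n (cosk k) x t)"
proof -
  have "defect n (\<lambda>u. \<Sum>k\<in>A. c k * cosk k u) x t = 2 * pi * (\<Sum>k\<in>A. c k * circ n (cosk k) x t) - (\<Sum>k\<in>A. c k * toep n (cosk k) x t)"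
    unfolding defect_def circ_sum by (subst toep_sum[OF assms]) (auto intro: cosk_continuous)
  then show ?thesis unfolding defect_def by (simp add: sum_distrib_left sum_subtractf right_diff_distrib mult_ac)
qed

lemma defect_vec_sum:
  "defect n \<psi> (\<lambda>t. \<Sum>l\<in>A. c l * y l t) t = (\<Sum>l\<in>A. c l * defect n \<psi> (y l) t)"
proof -
  have 1: "circ n \<psi> (\<lambda>t. \<Sum>l\<in>A. c l * y l t) t = (\<Sum>l\<in>A. c l * circ n \<psi> (y l) t)"
  proof -
    have "fcoef n (\<lambda>t. \<Sum>l\<in>A. c l * y l t) i = (\<Sum>l\<in>A. c l * fcoef n (y l) i)" for i
      unfolding fcoef_def sum_distrib_left by (subst sum.swap) (simp only: mult_ac)
    then show ?thesis unfolding circ_def by (simp only: sum_distrib_left sum_distrib_right, subst sum.swap) (simp only: mult_ac)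
  qed
  have 2: "toep n \<psi> (\<lambda>t. \<Sum>l\<in>A. c l * y l t) t = (\<Sum>l\<in>A. c l * toep n \<psi> (y l) t)"
    unfolding toep_def sum_distrib_left by (subst sum.swap) (simp only: mult_ac)
  show ?thesis unfolding defect_def 1 2 by (simp add: sum_distrib_left sum_subtractf right_diff_distrib mult_ac)
qed

text \<open>The defect is linear in the symbol and in the vector, and it is bounded on both sides by
  sup norms. Replacing \<open>\<phi>par\<close> and the symbol of the inner circulant by cosine polynomials
  therefore costs a small multiple of the norm of \<open>x\<close>, and the rest is a combination of finitely
  many corner terms, with coefficients bounded uniformly in \<open>\<phi>\<close>.\<close>

lemma defect_approx:
  assumes par: "continuous_on {0..1} \<phi>par" "\<forall>u\<in>{0..1}. 0 < \<phi>par u"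
    and m: "0 < m" "0 \<le> M" and e: "0 < e"
  shows "\<exists>D A. 0 \<le> A \<and> (\<forall>n x \<phi>. admissible m M \<phi> \<longrightarrow>
    nrm n (defect n \<phi>par (circ n (\<lambda>u. (\<phi> u / \<phi>par u) powr (- 1 / 2) / (2 * pi * \<phi>par u)) x)) \<le>
      e * nrm n x + A * (\<Sum>k\<le>D. \<Sum>l\<le>D. nrm n (defect n (cosk k) (circ n (cosk l) x))))"
proof -
  note par = par(1) par(2)[rule_format]
  define w where "w u = \<phi>par u powr (1 / 2) / (2 * pi * \<phi>par u)" for u
  have nz: "\<phi>par u \<noteq> 0" if "u \<in> {0..1}" for u using par(2)[OF that] by simp
  have wc: "continuous_on {0..1} w"
    unfolding w_def by (intro continuous_intros par(1)) (use nz in auto)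
  have "bounded (\<phi>par ` {0..1})" "bounded (w ` {0..1})"
    by (intro compact_imp_bounded compact_continuous_image par wc; simp)+
  then obtain Bp W where "Bp > 0" "W > 0" "\<forall>x\<in>\<phi>par ` {0..1}. norm x \<le> Bp" "\<forall>x\<in>w ` {0..1}. norm x \<le> W"
    unfolding bounded_pos by blast
  then have B: "Bp > 0" "W > 0" "\<And>u. u \<in> {0..1} \<Longrightarrow> \<bar>\<phi>par u\<bar> \<le> Bp" "\<And>u. u \<in> {0..1} \<Longrightarrow> \<bar>w u\<bar> \<le> W" by auto
  define Be where "Be = 1 / sqrt m * W"
  have Be: "Be > 0" using m B by (simp add: Be_def)
  define e1 where "e1 = min 1 (e / (2 * (4 * pi * Be)))"
  have e1: "e1 > 0" "4 * pi * e1 * Be \<le> e / 2" using e Be by (auto simp: e1_def field_simps min_def)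
  define e2 where "e2 = e / (2 * (4 * pi * (Bp + e1)))"
  have c: "0 < 4 * pi * (Bp + e1)" using B e1(1) by simp
  have "c * (e / (2 * c)) = e / 2" if "0 < c" for c using that by simp
  from this[OF c] c e have e2: "e2 > 0" "4 * pi * (Bp + e1) * e2 = e / 2" unfolding e2_def by simp_all
  obtain d a where da: "\<And>D u. D \<ge> d \<Longrightarrow> u \<in> {0..1} \<Longrightarrow> \<bar>\<phi>par u - (\<Sum>k\<le>D. a k * cosk k u)\<bar> < e1"
    using cos_polys_dense[OF par(1) e1(1)] by blast
  have "0 \<le> M / (m * sqrt m)" "0 < 1 / sqrt m" using m by auto
  from uniform_trig_approx[OF wc this e2(1)]
  obtain D0 C where C: "0 \<le> C" and D0: "\<And>f. lipschitz01 (M / (m * sqrt m)) f \<Longrightarrow> (\<forall>x\<in>{0..1}. \<bar>f x\<bar> \<le> 1 / sqrt m) \<Longrightarrow>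
    \<exists>c. (\<forall>k\<le>D0. \<bar>c k\<bar> \<le> C) \<and> (\<forall>u\<in>{0..1}. \<bar>f u * w u - (\<Sum>k\<le>D0. c k * cosk k u)\<bar> \<le> e2)" by blast
  define D where "D = max d D0"
  define p where "p u = (\<Sum>k\<le>D. a k * cosk k u)" for u
  have pc: "continuous_on {0..1} p" unfolding p_def[abs_def] by (intro continuous_intros)
  have pe: "\<bar>\<phi>par u - p u\<bar> \<le> e1" if "u \<in> {0..1}" for u using da[of D u] that unfolding p_def D_def by simp
  have pB: "\<bar>p u\<bar> \<le> Bp + e1" if "u \<in> {0..1}" for u using pe[OF that] B(3)[OF that] by linarith
  define A where "A = (\<Sum>k\<le>D. \<bar>a k\<bar>) * C"
  have "0 \<le> A" unfolding A_def using C by (intro mult_nonneg_nonneg sum_nonneg) auto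
  moreover have "nrm n (defect n \<phi>par (circ n (\<lambda>u. (\<phi> u / \<phi>par u) powr (- 1 / 2) / (2 * pi * \<phi>par u)) x)) \<le>
      e * nrm n x + A * (\<Sum>k\<le>D. \<Sum>l\<le>D. nrm n (defect n (cosk k) (circ n (cosk l) x)))"
    if ad: "admissible m M \<phi>" for n x \<phi>
  proof -
    define \<eta> where "\<eta> u = \<phi> u powr (- 1 / 2) * w u" for u
    note isq = admissible_inverse_sqrt[OF m ad]
    obtain c where c: "\<forall>k\<le>D0. \<bar>c k\<bar> \<le> C" "\<forall>u\<in>{0..1}. \<bar>\<eta> u - (\<Sum>k\<le>D0. c k * cosk k u)\<bar> \<le> e2"
      using D0[OF isq] unfolding \<eta>_def by blast
    define q where "q u = (\<Sum>k\<le>D0. c k * cosk k u)" for u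
    define v where "v = circ n \<eta> x"
    define v' where "v' = circ n q x"
    have ve: "circ n (\<lambda>u. (\<phi> u / \<phi>par u) powr (- 1 / 2) / (2 * pi * \<phi>par u)) x = v"
    proof
      fix t
      show "circ n (\<lambda>u. (\<phi> u / \<phi>par u) powr (- 1 / 2) / (2 * pi * \<phi>par u)) x t = v t"
        unfolding v_def
      proof (rule circ_cong_grid)
        fix i assume "i < n"
        then have u: "grid n i \<in> {0..1}" by (rule grid_range)
        then have "\<phi>par (grid n i) > 0" "m \<le> \<phi> (grid n i)" using par ad unfolding admissible_def by blast+
        moreover from this m have "\<phi> (grid n i) > 0" by linarith
        ultimately have "\<phi>par (grid n i) > 0" "\<phi> (grid n i) > 0" by auto
        then show "(\<phi> (grid n i) / \<phi>par (grid n i)) powr (- 1 / 2) / (2 * pi * \<phi>par (grid n i)) = \<eta> (grid n i)"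
          unfolding \<eta>_def w_def by (simp add: powr_divide powr_minus_half[simplified] inverse_eq_divide)
      qed
    qed
    have nv: "nrm n v \<le> Be * nrm n x"
      unfolding v_def
    proof (rule nrm_circ_le)
      fix i assume "i < n"
      then have u: "grid n i \<in> {0..1}" by (rule grid_range)
      show "\<bar>\<eta> (grid n i)\<bar> \<le> Be" unfolding \<eta>_def Be_def abs_mult
        using isq(2) B(4)[OF u] u m by (intro mult_mono) auto
    qed (use Be in simp)
    have nvv: "nrm n (\<lambda>t. v t - v' t) \<le> e2 * nrm n x"
      unfolding v_def v'_def circ_diff[symmetric]
      by (rule nrm_circ_le) (use c(2) grid_range e2 in \<open>auto simp: q_def\<close>)
    have "nrm n (defect n \<phi>par v) = nrm n (\<lambda>t. (defect n (\<lambda>u. \<phi>par u - p u) v t + defect n p (\<lambda>t. v t - v' t) t) + defect n p v' t)"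
      unfolding defect_diff[OF par(1) pc] defect_vec_diff by simp
    also have "\<dots> \<le> nrm n (\<lambda>t. defect n (\<lambda>u. \<phi>par u - p u) v t + defect n p (\<lambda>t. v t - v' t) t) + nrm n (defect n p v')"
      by (rule nrm_triangle)
    also have "\<dots> \<le> (nrm n (defect n (\<lambda>u. \<phi>par u - p u) v) + nrm n (defect n p (\<lambda>t. v t - v' t))) + nrm n (defect n p v')"
      by (intro add_right_mono nrm_triangle)
    also have "\<dots> \<le> (4 * pi * e1 * nrm n v + 4 * pi * (Bp + e1) * nrm n (\<lambda>t. v t - v' t)) + nrm n (defect n p v')"
      by (intro add_mono nrm_defect_le order_refl continuous_intros par pc pe pB) (use e1 B in auto)
    also have "\<dots> \<le> (4 * pi * e1 * (Be * nrm n x) + 4 * pi * (Bp + e1) * (e2 * nrm n x)) + nrm n (defect n p v')"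
      by (intro add_mono mult_left_mono nv nvv order_refl) (use e1 B in auto)
    also have "\<dots> = (4 * pi * e1 * Be + 4 * pi * (Bp + e1) * e2) * nrm n x + nrm n (defect n p v')"
      by (simp only: distrib_right mult.assoc)
    also have "\<dots> \<le> (e / 2 + e / 2) * nrm n x + nrm n (defect n p v')"
      by (intro add_right_mono mult_right_mono add_mono) (use e1 e2 in \<open>auto simp: L2_set_nonneg\<close>)
    also have "nrm n (defect n p v') \<le> A * (\<Sum>k\<le>D. \<Sum>l\<le>D. nrm n (defect n (cosk k) (circ n (cosk l) x)))"
    proof -
      have v'e: "v' = (\<lambda>t. \<Sum>l\<le>D0. c l * circ n (cosk l) x t)" unfolding v'_def q_def[abs_def] by (rule ext) (rule circ_sum)
      have "nrm n (defect n p v') = nrm n (\<lambda>t. \<Sum>k\<le>D. a k * (\<Sum>l\<le>D0. c l * defect n (cosk k) (circ n (cosk l) x) t))"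
        unfolding p_def[abs_def] defect_sum[OF finite_atMost, abs_def] v'e defect_vec_sum by (simp add: defect_sum defect_vec_sum)
      also have "\<dots> \<le> (\<Sum>k\<le>D. nrm n (\<lambda>t. a k * (\<Sum>l\<le>D0. c l * defect n (cosk k) (circ n (cosk l) x) t)))"
        by (rule nrm_sum_le) simp
      also have "\<dots> \<le> (\<Sum>k\<le>D. \<bar>a k\<bar> * (\<Sum>l\<le>D0. C * nrm n (defect n (cosk k) (circ n (cosk l) x))))"
        unfolding nrm_scale
      proof (intro sum_mono mult_left_mono)
        fix k
        have "nrm n (\<lambda>t. \<Sum>l\<le>D0. c l * defect n (cosk k) (circ n (cosk l) x) t) \<le> (\<Sum>l\<le>D0. nrm n (\<lambda>t. c l * defect n (cosk k) (circ n (cosk l) x) t))"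
          by (rule nrm_sum_le) simp
        also have "\<dots> \<le> (\<Sum>l\<le>D0. C * nrm n (defect n (cosk k) (circ n (cosk l) x)))"
          unfolding nrm_scale by (intro sum_mono mult_right_mono) (use c(1) in \<open>auto simp: L2_set_nonneg\<close>)
        finally show "nrm n (\<lambda>t. \<Sum>l\<le>D0. c l * defect n (cosk k) (circ n (cosk l) x) t) \<le> (\<Sum>l\<le>D0. C * nrm n (defect n (cosk k) (circ n (cosk l) x)))" .
      qed auto
      also have "\<dots> \<le> (\<Sum>k\<le>D. \<bar>a k\<bar> * (C * (\<Sum>k\<le>D. \<Sum>l\<le>D. nrm n (defect n (cosk k) (circ n (cosk l) x)))))"
      proof (intro sum_mono mult_left_mono)
        fix k assume k: "k \<in> {..D}"
        have "(\<Sum>l\<le>D0. C * nrm n (defect n (cosk k) (circ n (cosk l) x))) \<le> (\<Sum>l\<le>D. C * nrm n (defect n (cosk k) (circ n (cosk l) x)))"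
          by (rule sum_mono2) (use C in \<open>auto simp: D_def L2_set_nonneg\<close>)
        also have "\<dots> = C * (\<Sum>l\<le>D. nrm n (defect n (cosk k) (circ n (cosk l) x)))" by (simp add: sum_distrib_left)
        also have "\<dots> \<le> C * (\<Sum>k\<le>D. \<Sum>l\<le>D. nrm n (defect n (cosk k) (circ n (cosk l) x)))"
          by (intro mult_left_mono C member_le_sum[where f="\<lambda>k. \<Sum>l\<le>D. nrm n (defect n (cosk k) (circ n (cosk l) x))"] k)
             (auto simp: L2_set_nonneg intro!: sum_nonneg)
        finally show "(\<Sum>l\<le>D0. C * nrm n (defect n (cosk k) (circ n (cosk l) x))) \<le> C * (\<Sum>k\<le>D. \<Sum>l\<le>D. nrm n (defect n (cosk k) (circ n (cosk l) x)))" .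
      qed auto
      finally show ?thesis unfolding A_def sum_distrib_right[symmetric] by (simp only: mult.assoc)
    qed
    finally show ?thesis unfolding ve by simp
  qed
  ultimately show ?thesis by blast
qed

text \<open>With \<open>Y = C x\<close>, the vector \<open>U = \<Gamma>\<^sub>p\<^sub>a\<^sub>r\<^sup>-\<^sup>1 Y\<close> is compared to
  \<open>v\<close>, obtained from \<open>Y\<close> by dividing by \<open>2 * pi * \<phi>par\<close> on the Fourier side. The
  Toeplitz matrix maps \<open>U - v\<close> to the defect of \<open>v\<close>, and it is bounded below by
  \<open>2 * pi * b\<close>. On the Fourier side the form \<open>Y \<bullet> v\<close> is diagonal, with the working model
  cancelling.\<close>

lemma quadratic_form_residual:
  assumes par: "continuous_on {0..1} \<phi>par" "\<forall>u\<in>{0..1}. b \<le> \<phi>par u" "0 < b"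
    and pos: "\<forall>u\<in>{0..1}. 0 < \<phi> u"
    and U: "\<forall>t<n. toep n \<phi>par U t = circ n (root_ratio \<phi> \<phi>par) x t"
  shows "\<bar>(\<Sum>t<n. circ n (root_ratio \<phi> \<phi>par) x t * U t) - (\<Sum>i<n. 1 / (2 * pi * \<phi> (grid n i)) * (fcoef n x i)\<^sup>2)\<bar>
    \<le> nrm n (circ n (root_ratio \<phi> \<phi>par) x) *
      (nrm n (defect n \<phi>par (circ n (\<lambda>u. (\<phi> u / \<phi>par u) powr (- 1 / 2) / (2 * pi * \<phi>par u)) x)) / (2 * pi * b))"
proof -
  note par = par(1) par(2)[rule_format] par(3) and pos = pos[rule_format] and U = U[rule_format]
  define g where "g u = (\<phi> u / \<phi>par u) powr (- 1 / 2)" for u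
  define \<eta> where "\<eta> u = g u / (2 * pi * \<phi>par u)" for u
  define Y where "Y = circ n g x"
  define v where "v = circ n \<eta> x"
  define R where "R = defect n \<phi>par v"
  have pp: "0 < \<phi>par u" if "u \<in> {0..1}" for u using par(2)[OF that] par(3) by simp
  \<comment> \<open>up to its defect, the Toeplitz matrix maps \<open>v\<close> to \<open>Y\<close>\<close>
  have YR: "2 * pi * circ n \<phi>par v t = Y t" for t
  proof -
    have "2 * pi * circ n \<phi>par v t = (\<Sum>k\<in>{()}. 2 * pi * circ n (\<lambda>u. \<phi>par u * \<eta> u) x t)"
      unfolding v_def circ_circ by simp
    also have "\<dots> = circ n (\<lambda>u. \<Sum>k\<in>{()}. 2 * pi * (\<phi>par u * \<eta> u)) x t"
      by (rule circ_sum[symmetric])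
    also have "\<dots> = Y t" unfolding Y_def
    proof (rule circ_cong_grid)
      fix i assume "i < n"
      then show "(\<Sum>k\<in>{()}. 2 * pi * (\<phi>par (grid n i) * \<eta> (grid n i))) = g (grid n i)"
        using pp[OF grid_range[OF \<open>i < n\<close>]] by (simp add: \<eta>_def)
    qed
    finally show ?thesis .
  qed
  have "toep n \<phi>par (\<lambda>t. U t - v t) t = R t" if "t < n" for t
    unfolding toep_vec_diff R_def defect_def YR using U[OF that] by (simp add: Y_def g_def[abs_def])
  then have "(\<Sum>t<n. (U t - v t) * toep n \<phi>par (\<lambda>t. U t - v t) t) = (\<Sum>t<n. (U t - v t) * R t)" by simp
  then have "2 * pi * b * (nrm n (\<lambda>t. U t - v t))\<^sup>2 \<le> (\<Sum>t<n. (U t - v t) * R t)"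
    using toep_lower[where b=b and \<psi>=\<phi>par and n=n and x="\<lambda>t. U t - v t"] par by simp
  also have "\<dots> \<le> nrm n (\<lambda>t. U t - v t) * nrm n R" using inner_le_nrm[where n=n and x="\<lambda>t. U t - v t" and y=R] by linarith
  \<comment> \<open>division by the norm of \<open>U - v\<close> gives the bound, unless that norm is zero\<close>
  finally have q: "nrm n (\<lambda>t. U t - v t) * (2 * pi * b * nrm n (\<lambda>t. U t - v t)) \<le> nrm n (\<lambda>t. U t - v t) * nrm n R"
    by (simp only: power2_eq_square mult_ac)
  have "nrm n (\<lambda>t. U t - v t) \<le> nrm n R / (2 * pi * b)"
  proof (cases "nrm n (\<lambda>t. U t - v t) = 0")
    case True
    then show ?thesis using par(3) by (simp add: L2_set_nonneg)
  next
    case False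
    then have "0 < nrm n (\<lambda>t. U t - v t)" using L2_set_nonneg[of "\<lambda>t. U t - v t" "{..<n}"] by linarith
    then have "2 * pi * b * nrm n (\<lambda>t. U t - v t) \<le> nrm n R" using q by (simp only: mult_le_cancel_left_pos)
    then show ?thesis using par(3) by (simp add: field_simps)
  qed
  then have "nrm n Y * nrm n (\<lambda>t. U t - v t) \<le> nrm n Y * (nrm n R / (2 * pi * b))"
    by (intro mult_left_mono) (auto simp: L2_set_nonneg)
  then have "\<bar>\<Sum>t<n. Y t * (U t - v t)\<bar> \<le> nrm n Y * (nrm n R / (2 * pi * b))"
    using inner_le_nrm[where n=n and x=Y and y="\<lambda>t. U t - v t"] by linarith
  moreover have "(\<Sum>t<n. Y t * v t) = (\<Sum>i<n. 1 / (2 * pi * \<phi> (grid n i)) * (fcoef n x i)\<^sup>2)"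
  proof -
    have "(\<Sum>t<n. Y t * v t) = (\<Sum>i<n. fcoef n Y i * fcoef n v i)" by (rule parseval[symmetric])
    also have "\<dots> = (\<Sum>i<n. 1 / (2 * pi * \<phi> (grid n i)) * (fcoef n x i)\<^sup>2)"
    proof (rule sum.cong[OF refl])
      fix i assume "i \<in> {..<n}"
      then have i: "i < n" by simp
      define u where "u = grid n i"
      have u: "u \<in> {0..1}" unfolding u_def by (rule grid_range[OF i])
      have "g u * g u = (\<phi> u / \<phi>par u) powr (- 1)" unfolding g_def powr_add[symmetric] by simp
      also have "\<dots> = \<phi>par u / \<phi> u" using pp[OF u] pos[OF u] by (simp add: powr_minus_divide)
      finally have "g u * \<eta> u = 1 / (2 * pi * \<phi> u)" using pp[OF u] by (simp add: \<eta>_def field_simps)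
      moreover have "g u * fcoef n x i * (\<eta> u * fcoef n x i) = (g u * \<eta> u) * (fcoef n x i)\<^sup>2"
        by (simp only: power2_eq_square mult_ac)
      ultimately have "g u * fcoef n x i * (\<eta> u * fcoef n x i) = 1 / (2 * pi * \<phi> u) * (fcoef n x i)\<^sup>2"
        by simp
      then show "fcoef n Y i * fcoef n v i = 1 / (2 * pi * \<phi> (grid n i)) * (fcoef n x i)\<^sup>2"
        unfolding Y_def v_def fcoef_circ[OF i] u_def by simp
    qed
    finally show ?thesis .
  qed
  ultimately show ?thesis
    unfolding Y_def v_def R_def \<eta>_def[abs_def] g_def[abs_def] by (simp add: right_diff_distrib sum_subtractf)
qed

lemma cos_product_grid_sum:
  assumes "n > 0"
  shows "(\<Sum>i<n. cos (real_of_int j * pi * grid n i) * cos (real k * pi * grid n i)) =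
    ((if int n dvd j + int k then real n else 0) + (if int n dvd j - int k then real n else 0)) / 2"
proof -
  have "cos (real_of_int j * pi * grid n i) * cos (real k * pi * grid n i) =
    (cos (2 * pi * real (freq_index i) * real_of_int (j + int k) / real n)
     + cos (2 * pi * real (freq_index i) * real_of_int (j - int k) / real n)) / 2" for i
  proof -
    have "2 * pi * real (freq_index i) * real_of_int (j + int k) / real n = real_of_int j * pi * grid n i + real k * pi * grid n i"
      "2 * pi * real (freq_index i) * real_of_int (j - int k) / real n = real_of_int j * pi * grid n i - real k * pi * grid n i"
      by (simp_all add: grid_def add_divide_distrib diff_divide_distrib algebra_simps)
    then show ?thesis by (simp only: cos_add cos_diff) simp
  qed
  then show ?thesis
    by (simp only: sum_divide_distrib[symmetric] sum.distrib cos_grid_sum[OF assms])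
qed

text \<open>The absolutely summable autocovariances dominate the cosine series, so its tails are small
  uniformly in \<open>u\<close>.\<close>

lemma spectral_truncation:
  fixes \<gamma> :: "int \<Rightarrow> real"
  assumes s: "(\<lambda>k. \<bar>\<gamma> k\<bar>) summable_on UNIV" and e: "e > 0"
  shows "\<exists>d0::nat. \<forall>d\<ge>d0. \<forall>u. \<bar>2 * pi * spectral_density \<gamma> u - (\<Sum>j\<in>{- int d..int d}. \<gamma> j * cos (real_of_int j * pi * u))\<bar> \<le> e"
proof -
  obtain F where F: "finite F" "dist (\<Sum>k\<in>F. \<bar>\<gamma> k\<bar>) (infsum (\<lambda>k. \<bar>\<gamma> k\<bar>) UNIV) \<le> e"
    using infsum_finite_approximation[OF s e] by blast
  obtain d0 :: nat where d0: "F \<subseteq> {- int d0..int d0}"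
  proof -
    have "finite (nat ` abs ` F)" using F by simp
    then obtain d0 where "\<forall>x\<in>nat ` abs ` F. x \<le> d0" using finite_nat_set_iff_bounded_le by blast
    then have "F \<subseteq> {- int d0..int d0}" by force
    then show ?thesis by (rule that)
  qed
  have "\<bar>2 * pi * spectral_density \<gamma> u - (\<Sum>j\<in>{- int d..int d}. \<gamma> j * cos (real_of_int j * pi * u))\<bar> \<le> e"
    if d: "d \<ge> d0" for d u
  proof -
    define f where "f k = \<gamma> k * cos (real_of_int k * pi * u)" for k
    define A where "A = {- int d..int d}"
    have A: "finite A" "F \<subseteq> A" using d0 d by (auto simp: A_def)
    have fb: "norm (f k) \<le> \<bar>\<gamma> k\<bar>" for k by (simp add: f_def abs_mult mult_left_le)
    have fs: "(\<lambda>k. norm (f k)) summable_on B" for B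
      by (rule Infinite_Sum.abs_summable_on_comparison_test'[OF summable_on_subset[OF s]]) (use fb in auto)
    have gs: "(\<lambda>k. \<bar>\<gamma> k\<bar>) summable_on B" for B by (rule summable_on_subset[OF s]) auto
    have "infsum f (A \<union> - A) = infsum f A + infsum f (- A)"
      by (rule infsum_Un_disjoint) (auto intro: abs_summable_summable fs)
    then have f1: "infsum f UNIV - (\<Sum>j\<in>A. f j) = infsum f (- A)" using A by simp
    have "infsum (\<lambda>k. \<bar>\<gamma> k\<bar>) (A \<union> - A) = infsum (\<lambda>k. \<bar>\<gamma> k\<bar>) A + infsum (\<lambda>k. \<bar>\<gamma> k\<bar>) (- A)"
      by (rule infsum_Un_disjoint) (auto intro: gs)
    then have g1: "infsum (\<lambda>k. \<bar>\<gamma> k\<bar>) (- A) = infsum (\<lambda>k. \<bar>\<gamma> k\<bar>) UNIV - (\<Sum>j\<in>A. \<bar>\<gamma> j\<bar>)" using A by simp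
    have "\<bar>infsum f (- A)\<bar> \<le> infsum (\<lambda>k. norm (f k)) (- A)" using norm_infsum_bound[OF fs[of "- A"]] by simp
    also have "\<dots> \<le> infsum (\<lambda>k. \<bar>\<gamma> k\<bar>) (- A)" by (rule infsum_mono) (use fs gs fb in auto)
    also have "\<dots> \<le> infsum (\<lambda>k. \<bar>\<gamma> k\<bar>) UNIV - (\<Sum>j\<in>F. \<bar>\<gamma> j\<bar>)"
      unfolding g1 using sum_mono2[OF A, of "\<lambda>j. \<bar>\<gamma> j\<bar>"] by simp
    also have "\<dots> \<le> e" using F(2) by (simp add: dist_real_def)
    finally have "\<bar>infsum f UNIV - (\<Sum>j\<in>A. f j)\<bar> \<le> e" unfolding f1 .
    moreover have "2 * pi * spectral_density \<gamma> u = infsum f UNIV" by (simp add: spectral_density_def f_def[abs_def])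
    ultimately show ?thesis by (simp add: f_def A_def)
  qed
  then show ?thesis by blast
qed

text \<open>For a truncated series the grid average is exactly \<open>\<gamma> k\<close> as soon as \<open>n\<close> exceeds
  all the occurring frequency sums, since then no aliasing takes place.\<close>

lemma spectral_grid_coefficients:
  fixes \<gamma> :: "int \<Rightarrow> real"
  assumes s: "(\<lambda>k. \<bar>\<gamma> k\<bar>) summable_on UNIV" and sym: "\<And>k. \<gamma> (- k) = \<gamma> k"
  shows "(\<lambda>n. (\<Sum>i<n. 2 * pi * spectral_density \<gamma> (grid n i) * cosk k (grid n i)) / real n) \<longlonglongrightarrow> \<gamma> (int k)"
proof (rule LIMSEQ_I)
  fix r :: real assume r: "r > 0"
  obtain d0 :: nat where d0: "\<forall>d\<ge>d0. \<forall>u. \<bar>2 * pi * spectral_density \<gamma> u - (\<Sum>j\<in>{- int d..int d}. \<gamma> j * cos (real_of_int j * pi * u))\<bar> \<le> r / 2"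
    using spectral_truncation[OF s, of "r/2"] r by auto
  define d where "d = max d0 k"
  have d: "\<And>u. \<bar>2 * pi * spectral_density \<gamma> u - (\<Sum>j\<in>{- int d..int d}. \<gamma> j * cos (real_of_int j * pi * u))\<bar> \<le> r / 2" "k \<le> d"
    using d0 by (auto simp: d_def)
  have "norm ((\<Sum>i<n. 2 * pi * spectral_density \<gamma> (grid n i) * cosk k (grid n i)) / real n - \<gamma> (int k)) < r"
    if n: "n \<ge> 2 * d + 1" for n
  proof -
    have n0: "n > 0" using n by simp
    define tr where "tr u = (\<Sum>j\<in>{- int d..int d}. \<gamma> j * cos (real_of_int j * pi * u))" for u
    have "(\<Sum>i<n. tr (grid n i) * cosk k (grid n i)) =
      (\<Sum>j\<in>{- int d..int d}. \<gamma> j * (\<Sum>i<n. cos (real_of_int j * pi * grid n i) * cosk k (grid n i)))"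
      unfolding tr_def sum_distrib_right sum_distrib_left by (subst sum.swap) (simp only: mult.assoc)
    also have "\<dots> = (\<Sum>j\<in>{- int d..int d}. (if j = - int k then \<gamma> j * real n / 2 else 0) + (if j = int k then \<gamma> j * real n / 2 else 0))"
    proof (rule sum.cong[OF refl])
      fix j assume j: "j \<in> {- int d..int d}"
      have "int n dvd j + int k \<longleftrightarrow> j = - int k"
      proof
        assume "int n dvd j + int k"
        moreover have "\<bar>j + int k\<bar> < int n" using j d(2) n by auto
        ultimately show "j = - int k" using zdvd_imp_le[of "int n" "\<bar>j + int k\<bar>"] by (cases "j + int k = 0") auto
      qed simp
      moreover have "int n dvd j - int k \<longleftrightarrow> j = int k"
      proof
        assume "int n dvd j - int k"
        moreover have "\<bar>j - int k\<bar> < int n" using j d(2) n by auto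
        ultimately show "j = int k" using zdvd_imp_le[of "int n" "\<bar>j - int k\<bar>"] by (cases "j - int k = 0") auto
      qed simp
      ultimately show "\<gamma> j * (\<Sum>i<n. cos (real_of_int j * pi * grid n i) * cosk k (grid n i)) =
        (if j = - int k then \<gamma> j * real n / 2 else 0) + (if j = int k then \<gamma> j * real n / 2 else 0)"
        unfolding cos_product_grid_sum[OF n0] by auto
    qed
    also have "\<dots> = \<gamma> (int k) * real n"
      unfolding sum.distrib using d(2) by (simp add: sym)
    finally have tr: "(\<Sum>i<n. tr (grid n i) * cosk k (grid n i)) = \<gamma> (int k) * real n" .
    have "\<bar>(\<Sum>i<n. 2 * pi * spectral_density \<gamma> (grid n i) * cosk k (grid n i)) - (\<Sum>i<n. tr (grid n i) * cosk k (grid n i))\<bar> \<le>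
      (\<Sum>i<n. \<bar>(2 * pi * spectral_density \<gamma> (grid n i) - tr (grid n i)) * cosk k (grid n i)\<bar>)"
      unfolding sum_subtractf[symmetric] left_diff_distrib[symmetric] by (rule sum_abs)
    also have "\<dots> \<le> (\<Sum>i<n. r / 2 * 1)"
      unfolding abs_mult by (intro sum_mono mult_mono) (use r d(1) in \<open>auto simp: tr_def\<close>)
    also have "\<dots> = r / 2 * real n" by simp
    finally have "\<bar>(\<Sum>i<n. 2 * pi * spectral_density \<gamma> (grid n i) * cosk k (grid n i)) - \<gamma> (int k) * real n\<bar> \<le> r / 2 * real n"
      unfolding tr .
    then have "\<bar>(\<Sum>i<n. 2 * pi * spectral_density \<gamma> (grid n i) * cosk k (grid n i)) - \<gamma> (int k) * real n\<bar> / real n \<le> r / 2"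
      using n0 by (simp add: divide_le_eq)
    moreover have "(\<Sum>i<n. 2 * pi * spectral_density \<gamma> (grid n i) * cosk k (grid n i)) / real n - \<gamma> (int k) =
      ((\<Sum>i<n. 2 * pi * spectral_density \<gamma> (grid n i) * cosk k (grid n i)) - \<gamma> (int k) * real n) / real n"
      using n0 by (simp add: diff_divide_distrib)
    ultimately have "norm ((\<Sum>i<n. 2 * pi * spectral_density \<gamma> (grid n i) * cosk k (grid n i)) / real n - \<gamma> (int k)) \<le> r / 2"
      by (simp only: real_norm_def abs_divide abs_of_nat)
    then show ?thesis using r by linarith
  qed
  then show "\<exists>no. \<forall>n\<ge>no. norm ((\<Sum>i<n. 2 * pi * spectral_density \<gamma> (grid n i) * cosk k (grid n i)) / real n - \<gamma> (int k)) < r"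
    by blast
qed

text \<open>Both sums are linear in \<open>1 / \<phi>\<close>. Replacing it by a cosine polynomial turns the first into
  cyclic sample autocovariances and the second into the corresponding grid sums of
  \<open>2 * pi * \<phi>0\<close>.\<close>

lemma whittle_form_approx:
  assumes m: "0 < m" "0 \<le> M" and B0: "\<forall>u\<in>{0..1}. \<bar>\<phi>0 u\<bar> \<le> B0" "0 < B0" and e: "0 < e"
  shows "\<exists>D C. 0 \<le> C \<and> (\<forall>n x \<phi>. admissible m M \<phi> \<longrightarrow>
    \<bar>(\<Sum>i<n. 1 / (2 * pi * \<phi> (grid n i)) * (fcoef n x i)\<^sup>2) - (\<Sum>i<n. \<phi>0 (grid n i) / \<phi> (grid n i))\<bar> \<le>
      e * ((nrm n x)\<^sup>2 + real n) +
      C * (\<Sum>k\<le>D. \<bar>(\<Sum>t<n. x t * circ n (cosk k) x t) - (\<Sum>i<n. 2 * pi * \<phi>0 (grid n i) * cosk k (grid n i))\<bar>))"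
proof -
  define e' where "e' = min e (e / (2 * pi * B0))"
  have e': "0 < e'" "e' \<le> e" "2 * pi * B0 * e' \<le> e" using e B0(2) by (auto simp: e'_def min_def field_simps)
  have "0 \<le> M / m\<^sup>2" "0 < 1 / m" using m by auto
  moreover have "continuous_on {0..1} (\<lambda>u::real. 1 / (2 * pi) :: real)" by (rule continuous_on_const)
  ultimately obtain D C where C: "0 \<le> C" and D: "\<And>f. lipschitz01 (M / m\<^sup>2) f \<Longrightarrow> (\<forall>x\<in>{0..1}. \<bar>f x\<bar> \<le> 1 / m) \<Longrightarrow>
    \<exists>c. (\<forall>k\<le>D. \<bar>c k\<bar> \<le> C) \<and> (\<forall>u\<in>{0..1}. \<bar>f u * (1 / (2 * pi)) - (\<Sum>k\<le>D. c k * cosk k u)\<bar> \<le> e')"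
    using uniform_trig_approx[where w="\<lambda>u. 1 / (2 * pi)" and L="M / m\<^sup>2" and B="1 / m" and e=e'] e'(1) by blast
  have "\<bar>(\<Sum>i<n. 1 / (2 * pi * \<phi> (grid n i)) * (fcoef n x i)\<^sup>2) - (\<Sum>i<n. \<phi>0 (grid n i) / \<phi> (grid n i))\<bar> \<le>
      e * ((nrm n x)\<^sup>2 + real n) +
      C * (\<Sum>k\<le>D. \<bar>(\<Sum>t<n. x t * circ n (cosk k) x t) - (\<Sum>i<n. 2 * pi * \<phi>0 (grid n i) * cosk k (grid n i))\<bar>)"
    if ad: "admissible m M \<phi>" for n x \<phi>
  proof -
    define \<psi> where "\<psi> u = 1 / \<phi> u * (1 / (2 * pi))" for u
    obtain c where c: "\<forall>k\<le>D. \<bar>c k\<bar> \<le> C" "\<forall>u\<in>{0..1}. \<bar>\<psi> u - (\<Sum>k\<le>D. c k * cosk k u)\<bar> \<le> e'"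
      using D[OF admissible_inverse[OF m ad]] unfolding \<psi>_def by blast
    define q where "q u = (\<Sum>k\<le>D. c k * cosk k u)" for u
    define S where "S k = (\<Sum>t<n. x t * circ n (cosk k) x t)" for k
    define T where "T k = (\<Sum>i<n. 2 * pi * \<phi>0 (grid n i) * cosk k (grid n i))" for k
    have qe: "\<bar>\<psi> (grid n i) - q (grid n i)\<bar> \<le> e'" if "i < n" for i using c(2) grid_range[OF that] by (auto simp: q_def)
    have 1: "(\<Sum>i<n. q (grid n i) * (fcoef n x i)\<^sup>2) = (\<Sum>k\<le>D. c k * S k)"
      unfolding q_def S_def inner_circ sum_distrib_left sum_distrib_right
      by (subst sum.swap) (simp only: power2_eq_square mult.assoc)
    have 2: "(\<Sum>i<n. 2 * pi * \<phi>0 (grid n i) * q (grid n i)) = (\<Sum>k\<le>D. c k * T k)"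
      unfolding q_def T_def sum_distrib_left sum_distrib_right
      by (subst sum.swap) (simp only: mult_ac)
    have "\<bar>(\<Sum>i<n. \<psi> (grid n i) * (fcoef n x i)\<^sup>2) - (\<Sum>i<n. q (grid n i) * (fcoef n x i)\<^sup>2)\<bar> \<le>
      (\<Sum>i<n. \<bar>(\<psi> (grid n i) - q (grid n i)) * (fcoef n x i)\<^sup>2\<bar>)"
      unfolding sum_subtractf[symmetric] left_diff_distrib[symmetric] by (rule sum_abs)
    also have "\<dots> \<le> (\<Sum>i<n. e' * (fcoef n x i)\<^sup>2)"
      unfolding abs_mult by (intro sum_mono mult_mono) (use qe e' in auto)
    also have "\<dots> = e' * (nrm n x)\<^sup>2" by (simp only: sum_distrib_left[symmetric] nrm_fcoef_sq)
    also have "\<dots> \<le> e * (nrm n x)\<^sup>2" using e' by (intro mult_right_mono) auto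
    finally have A: "\<bar>(\<Sum>i<n. \<psi> (grid n i) * (fcoef n x i)\<^sup>2) - (\<Sum>k\<le>D. c k * S k)\<bar> \<le> e * (nrm n x)\<^sup>2"
      unfolding 1 .
    have "\<bar>(\<Sum>i<n. 2 * pi * \<phi>0 (grid n i) * \<psi> (grid n i)) - (\<Sum>i<n. 2 * pi * \<phi>0 (grid n i) * q (grid n i))\<bar> \<le>
      (\<Sum>i<n. \<bar>2 * pi * \<phi>0 (grid n i) * (\<psi> (grid n i) - q (grid n i))\<bar>)"
      unfolding sum_subtractf[symmetric] right_diff_distrib[symmetric] by (rule sum_abs)
    also have "\<dots> \<le> (\<Sum>i<n. 2 * pi * B0 * e')"
      unfolding abs_mult by (intro sum_mono mult_mono) (use qe e' B0 grid_range in auto)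
    also have "\<dots> \<le> e * real n" using e'(3) mult_right_mono[OF e'(3), of "real n"] by (simp add: mult_ac)
    finally have B: "\<bar>(\<Sum>i<n. 2 * pi * \<phi>0 (grid n i) * \<psi> (grid n i)) - (\<Sum>k\<le>D. c k * T k)\<bar> \<le> e * real n"
      unfolding 2 .
    have "\<bar>(\<Sum>k\<le>D. c k * S k) - (\<Sum>k\<le>D. c k * T k)\<bar> \<le> (\<Sum>k\<le>D. \<bar>c k * (S k - T k)\<bar>)"
      unfolding sum_subtractf[symmetric] right_diff_distrib[symmetric] by (rule sum_abs)
    also have "\<dots> \<le> (\<Sum>k\<le>D. C * \<bar>S k - T k\<bar>)"
      unfolding abs_mult by (intro sum_mono mult_right_mono) (use c(1) in auto)
    also have "\<dots> = C * (\<Sum>k\<le>D. \<bar>S k - T k\<bar>)" by (simp only: sum_distrib_left)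
    finally have ST: "\<bar>(\<Sum>k\<le>D. c k * S k) - (\<Sum>k\<le>D. c k * T k)\<bar> \<le> C * (\<Sum>k\<le>D. \<bar>S k - T k\<bar>)" .
    have p1: "(\<Sum>i<n. 1 / (2 * pi * \<phi> (grid n i)) * (fcoef n x i)\<^sup>2) = (\<Sum>i<n. \<psi> (grid n i) * (fcoef n x i)\<^sup>2)"
      by (simp add: \<psi>_def mult_ac)
    have p2: "(\<Sum>i<n. \<phi>0 (grid n i) / \<phi> (grid n i)) = (\<Sum>i<n. 2 * pi * \<phi>0 (grid n i) * \<psi> (grid n i))"
      by (simp add: \<psi>_def)
    have ds: "e * ((nrm n x)\<^sup>2 + real n) = e * (nrm n x)\<^sup>2 + e * real n" by (rule distrib_left)
    show ?thesis unfolding p1 p2 S_def[symmetric] T_def[symmetric] ds using A B ST by linarith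
  qed
  then show ?thesis using C by blast
qed

lemma divide_inverse_inverse: "x / inverse y = x * y" for x y :: real
  by (simp add: divide_inverse)

lemma ratio_powr_minus_half:
  fixes a b :: real
  shows "(a / b) powr (- 1 / 2) = a powr (- 1 / 2) * b powr (1 / 2)"
proof -
  have "(a / b) powr (- 1 / 2) = a powr (- 1 / 2) / b powr (- 1 / 2)"
    by (rule powr_divide)
  also have "\<dots> = a powr (- 1 / 2) * b powr (1 / 2)"
    unfolding powr_minus_half[of b] by (rule divide_inverse_inverse)
  finally show ?thesis .
qed

lemma fraction_bound:
  fixes K e :: real
  assumes "0 \<le> K" "0 < e"
  shows "0 < e / (4 * (K + 1))" "K * (e / (4 * (K + 1))) \<le> e / 4"
proof -
  show "0 < e / (4 * (K + 1))" using assms by (intro divide_pos_pos) auto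
  have "K * (e / (4 * (K + 1))) = (e / 4) * (K / (K + 1))" by simp
  also have "\<dots> \<le> (e / 4) * 1" using assms by (intro mult_left_mono) (auto simp: divide_le_eq)
  finally show "K * (e / (4 * (K + 1))) \<le> e / 4" by simp
qed

text \<open>Everything random that matters is a finite list of numbers: the squared norm of the sample, its
  cyclic autocovariances up to lag \<open>D\<close>, and the corner terms up to \<open>D\<close>. If these are
  near their limits, the quadratic form of the likelihood is near its limit, uniformly over admissible
  \<open>\<phi>\<close>. The vector \<open>U\<close> plays the role of \<open>\<Gamma>\<^sub>p\<^sub>a\<^sub>r\<^sup>-\<^sup>1 C x\<close>.\<close>

lemma quadratic_form_approx:
  assumes par: "continuous_on {0..1} \<phi>par" "\<forall>u\<in>{0..1}. b \<le> \<phi>par u" "0 < b"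
    and m: "0 < m" "0 \<le> M" and B0: "\<forall>u\<in>{0..1}. \<bar>\<phi>0 u\<bar> \<le> B0" "0 < B0"
    and lim: "\<And>k. (\<lambda>n. (\<Sum>i<n. 2 * pi * \<phi>0 (grid n i) * cosk k (grid n i)) / real n) \<longlonglongrightarrow> \<gamma> (int k)"
    and e: "0 < e" and V: "0 < V"
  shows "\<exists>D d N. 0 < d \<and> (\<forall>n\<ge>N. \<forall>x. (nrm n x)\<^sup>2 \<le> V * real n \<longrightarrow>
     (\<forall>k\<le>D. \<bar>(\<Sum>t<n. x t * circ n (cosk k) x t) / real n - \<gamma> (int k)\<bar> \<le> d) \<longrightarrow>
     (\<forall>k\<le>D. \<forall>l\<le>D. (nrm n (defect n (cosk k) (circ n (cosk l) x)))\<^sup>2 \<le> d\<^sup>2 * real n) \<longrightarrow>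
     (\<forall>\<phi> U. admissible m M \<phi> \<longrightarrow> (\<forall>t<n. toep n \<phi>par U t = circ n (root_ratio \<phi> \<phi>par) x t) \<longrightarrow>
        \<bar>(\<Sum>t<n. circ n (root_ratio \<phi> \<phi>par) x t * U t) - (\<Sum>i<n. \<phi>0 (grid n i) / \<phi> (grid n i))\<bar> \<le> e * real n))"
proof -
  have pp': "\<forall>u\<in>{0..1}. 0 < \<phi>par u" using par(2,3) by fastforce
  note pp = pp'[rule_format]
  have "bounded (\<phi>par ` {0..1})" by (intro compact_imp_bounded compact_continuous_image par) simp
  then obtain Bp where "Bp > 0" "\<forall>x\<in>\<phi>par ` {0..1}. norm x \<le> Bp" unfolding bounded_pos by blast
  then have Bp: "Bp > 0" "\<And>u. u \<in> {0..1} \<Longrightarrow> \<phi>par u \<le> Bp" by (auto simp: abs_le_iff)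
  \<comment> \<open>Four errors arise: \<open>e1\<close> and \<open>e2\<close> from trigonometric approximation, \<open>d1\<close> from the corner terms and \<open>d2\<close> from the autocovariances. Each is made at most \<open>e / 4 * n\<close>.\<close>
  define Bg where "Bg = 1 / sqrt m * sqrt Bp"
  have Bg: "Bg > 0" using m Bp by (simp add: Bg_def)
  define K1 where "K1 = Bg * sqrt V / (2 * pi * b)"
  have K1: "K1 > 0" using Bg V par(3) by (simp add: K1_def)
  define e1 where "e1 = e / (4 * (K1 * sqrt V))"
  have e1: "0 < e1" "K1 * (e1 * sqrt V) = e / 4" using e K1 V by (auto simp: e1_def)
  define e2 where "e2 = e / (4 * (V + 1))"
  have e2: "0 < e2" "e2 * (V + 1) = e / 4" using e V by (auto simp: e2_def field_simps)
  obtain D1 A where A: "0 \<le> A" and D1: "\<And>n x \<phi>. admissible m M \<phi> \<Longrightarrow>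
    nrm n (defect n \<phi>par (circ n (\<lambda>u. (\<phi> u / \<phi>par u) powr (- 1 / 2) / (2 * pi * \<phi>par u)) x)) \<le>
      e1 * nrm n x + A * (\<Sum>k\<le>D1. \<Sum>l\<le>D1. nrm n (defect n (cosk k) (circ n (cosk l) x)))"
    using defect_approx[OF par(1) pp' m e1(1)] by blast
  from whittle_form_approx[where ?\<phi>0.0=\<phi>0 and ?B0.0=B0, OF m B0 e2(1)]
  obtain D2 C where C: "0 \<le> C" and D2: "\<forall>n x \<phi>. admissible m M \<phi> \<longrightarrow>
    \<bar>(\<Sum>i<n. 1 / (2 * pi * \<phi> (grid n i)) * (fcoef n x i)\<^sup>2) - (\<Sum>i<n. \<phi>0 (grid n i) / \<phi> (grid n i))\<bar> \<le>
      e2 * ((nrm n x)\<^sup>2 + real n) +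
      C * (\<Sum>k\<le>D2. \<bar>(\<Sum>t<n. x t * circ n (cosk k) x t) - (\<Sum>i<n. 2 * pi * \<phi>0 (grid n i) * cosk k (grid n i))\<bar>)"
    by (elim exE conjE) (rule that)
  note D2 = D2[rule_format]
  define d1 where "d1 = e / (4 * (K1 * A * (real (D1 + 1))\<^sup>2 + 1))"
  have q1: "0 \<le> K1 * A * (real (D1 + 1))\<^sup>2" using K1 A by simp
  have d1: "0 < d1" "K1 * A * (real (D1 + 1))\<^sup>2 * d1 \<le> e / 4"
    using fraction_bound[OF q1 e] unfolding d1_def by auto
  define d2 where "d2 = e / (8 * (C * real (D2 + 1) + 1))"
  have q2: "0 \<le> C * real (D2 + 1)" using C by simp
  have d2: "0 < d2" "C * (real (D2 + 1) * (2 * d2)) \<le> e / 4"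
  proof -
    have h: "2 * (e / (8 * K)) = e / (4 * K)" for K by simp
    show "0 < d2" unfolding d2_def using e q2 by (intro divide_pos_pos) auto
    show "C * (real (D2 + 1) * (2 * d2)) \<le> e / 4"
      using fraction_bound(2)[OF q2 e] unfolding d2_def h by (simp only: mult.assoc)
  qed
  define d where "d = min d1 d2"
  have d: "0 < d" "d \<le> d1" "d \<le> d2" using d1 d2 by (auto simp: d_def)
  define D where "D = max D1 D2"
  have "\<exists>N. \<forall>n\<ge>N. \<forall>k\<le>D2. \<bar>(\<Sum>i<n. 2 * pi * \<phi>0 (grid n i) * cosk k (grid n i)) / real n - \<gamma> (int k)\<bar> < d"
  proof -
    have "\<forall>\<^sub>F n in sequentially. \<forall>k\<in>{..D2}. \<bar>(\<Sum>i<n. 2 * pi * \<phi>0 (grid n i) * cosk k (grid n i)) / real n - \<gamma> (int k)\<bar> < d"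
    proof (rule eventually_ball_finite)
      show "\<forall>k\<in>{..D2}. \<forall>\<^sub>F n in sequentially. \<bar>(\<Sum>i<n. 2 * pi * \<phi>0 (grid n i) * cosk k (grid n i)) / real n - \<gamma> (int k)\<bar> < d"
        using tendstoD[OF lim d(1)] by (simp add: dist_real_def)
    qed simp
    then show ?thesis by (auto simp: eventually_sequentially)
  qed
  then obtain N where N: "\<And>n k. n \<ge> N \<Longrightarrow> k \<le> D2 \<Longrightarrow> \<bar>(\<Sum>i<n. 2 * pi * \<phi>0 (grid n i) * cosk k (grid n i)) / real n - \<gamma> (int k)\<bar> < d"
    by blast
  have "\<bar>(\<Sum>t<n. circ n (root_ratio \<phi> \<phi>par) x t * U t) - (\<Sum>i<n. \<phi>0 (grid n i) / \<phi> (grid n i))\<bar> \<le> e * real n"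
    if n: "n \<ge> max N 1" and xV: "(nrm n x)\<^sup>2 \<le> V * real n"
      and cov: "\<forall>k\<le>D. \<bar>(\<Sum>t<n. x t * circ n (cosk k) x t) / real n - \<gamma> (int k)\<bar> \<le> d"
      and cor: "\<forall>k\<le>D. \<forall>l\<le>D. (nrm n (defect n (cosk k) (circ n (cosk l) x)))\<^sup>2 \<le> d\<^sup>2 * real n"
      and ad: "admissible m M \<phi>"
      and U: "\<forall>t<n. toep n \<phi>par U t = circ n (root_ratio \<phi> \<phi>par) x t" for n x \<phi> U
  proof -
    define s where "s = sqrt (real n)"
    have s: "0 < s" "s * s = real n" using n by (auto simp: s_def)
    let ?g = "root_ratio \<phi> \<phi>par"
    let ?R = "defect n \<phi>par (circ n (\<lambda>u. (\<phi> u / \<phi>par u) powr (- 1 / 2) / (2 * pi * \<phi>par u)) x)"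
    have phipos': "\<forall>u\<in>{0..1}. 0 < \<phi> u"
    proof
      fix u :: real assume that: "u \<in> {0..1}"
      have "m \<le> \<phi> u" using ad that unfolding admissible_def by blast
      then show "0 < \<phi> u" using m by linarith
    qed
    note phipos = phipos'[rule_format]
    have nx: "nrm n x \<le> sqrt V * s"
      unfolding s_def real_sqrt_mult[symmetric] by (rule real_le_rsqrt[OF xV])
    have nY: "nrm n (circ n ?g x) \<le> Bg * (sqrt V * s)"
    proof -
      have "nrm n (circ n ?g x) \<le> Bg * nrm n x"
      proof (rule nrm_circ_le)
        fix i assume "i < n"
        define u where "u = grid n i"
        have u: "u \<in> {0..1}" unfolding u_def by (rule grid_range[OF \<open>i < n\<close>])
        have "?g u = \<phi> u powr (- 1 / 2) * \<phi>par u powr (1 / 2)"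
          by (rule ratio_powr_minus_half)
        also have "\<bar>\<dots>\<bar> \<le> 1 / sqrt m * sqrt Bp"
          unfolding abs_mult
        proof (rule mult_mono)
          show "\<bar>\<phi> u powr (- 1 / 2)\<bar> \<le> 1 / sqrt m" using admissible_inverse_sqrt(2)[OF m ad] u by blast
          show "\<bar>\<phi>par u powr (1 / 2)\<bar> \<le> sqrt Bp"
            unfolding powr_half_sqrt[OF less_imp_le[OF pp[OF u]]] using pp[OF u] Bp(2)[OF u] by simp
        qed (use m in auto)
        finally show "\<bar>?g (grid n i)\<bar> \<le> Bg" unfolding u_def Bg_def .
      qed (use Bg in simp)
      also have "\<dots> \<le> Bg * (sqrt V * s)" by (intro mult_left_mono nx) (use Bg in simp)
      finally show ?thesis .
    qed
    have nE: "nrm n (defect n (cosk k) (circ n (cosk l) x)) \<le> d * s" if "k \<le> D1" "l \<le> D1" for k l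
    proof (rule power2_le_imp_le)
      show "(nrm n (defect n (cosk k) (circ n (cosk l) x)))\<^sup>2 \<le> (d * s)\<^sup>2"
        using cor that s(2) by (simp add: D_def power2_eq_square mult_ac)
    qed (use d s in simp)
    have "(\<Sum>k\<le>D1. \<Sum>l\<le>D1. nrm n (defect n (cosk k) (circ n (cosk l) x))) \<le> (\<Sum>k\<le>D1. \<Sum>l\<le>D1. d * s)"
      by (intro sum_mono nE) auto
    also have "\<dots> = (real (D1 + 1))\<^sup>2 * d * s" by (simp add: power2_eq_square)
    also have "\<dots> \<le> (real (D1 + 1))\<^sup>2 * d1 * s" using d s by (intro mult_right_mono mult_left_mono) auto
    finally have E: "(\<Sum>k\<le>D1. \<Sum>l\<le>D1. nrm n (defect n (cosk k) (circ n (cosk l) x))) \<le> (real (D1 + 1))\<^sup>2 * d1 * s" .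
    have "nrm n ?R \<le> e1 * (sqrt V * s) + A * ((real (D1 + 1))\<^sup>2 * d1 * s)"
      by (rule order_trans[OF D1[OF ad]]) (intro add_mono mult_left_mono nx E, use e1 A in auto)
    then have "nrm n (circ n ?g x) * (nrm n ?R / (2 * pi * b)) \<le>
       (Bg * (sqrt V * s)) * ((e1 * (sqrt V * s) + A * ((real (D1 + 1))\<^sup>2 * d1 * s)) / (2 * pi * b))"
      by (intro mult_mono nY divide_right_mono) (use par(3) Bg s V in \<open>auto simp: L2_set_nonneg\<close>)
    also have "\<dots> = (K1 * (e1 * sqrt V) + K1 * A * (real (D1 + 1))\<^sup>2 * d1) * (s * s)"
      by (simp add: K1_def add_divide_distrib algebra_simps)
    also have "\<dots> \<le> (e / 4 + e / 4) * real n"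
      unfolding s(2) by (intro mult_right_mono add_mono) (use e1 d1 in auto)
    finally have T1: "\<bar>(\<Sum>t<n. circ n ?g x t * U t) - (\<Sum>i<n. 1 / (2 * pi * \<phi> (grid n i)) * (fcoef n x i)\<^sup>2)\<bar> \<le> (e / 4 + e / 4) * real n"
      using quadratic_form_residual[OF par phipos' U] by linarith
    have "(\<Sum>k\<le>D2. \<bar>(\<Sum>t<n. x t * circ n (cosk k) x t) - (\<Sum>i<n. 2 * pi * \<phi>0 (grid n i) * cosk k (grid n i))\<bar>) \<le> (\<Sum>k\<le>D2. 2 * d2 * real n)"
    proof (rule sum_mono)
      fix k assume "k \<in> {..D2}"
      then have "\<bar>(\<Sum>t<n. x t * circ n (cosk k) x t) / real n - \<gamma> (int k)\<bar> \<le> d"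
        "\<bar>(\<Sum>i<n. 2 * pi * \<phi>0 (grid n i) * cosk k (grid n i)) / real n - \<gamma> (int k)\<bar> < d"
        using cov N n by (auto simp: D_def)
      then have "\<bar>(\<Sum>t<n. x t * circ n (cosk k) x t) / real n - (\<Sum>i<n. 2 * pi * \<phi>0 (grid n i) * cosk k (grid n i)) / real n\<bar> \<le> 2 * d2"
        using d(3) by linarith
      then have "\<bar>(\<Sum>t<n. x t * circ n (cosk k) x t) - (\<Sum>i<n. 2 * pi * \<phi>0 (grid n i) * cosk k (grid n i))\<bar> / real n \<le> 2 * d2"
        unfolding diff_divide_distrib[symmetric] abs_divide by simp
      then show "\<bar>(\<Sum>t<n. x t * circ n (cosk k) x t) - (\<Sum>i<n. 2 * pi * \<phi>0 (grid n i) * cosk k (grid n i))\<bar> \<le> 2 * d2 * real n"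
        using n by (simp add: divide_le_eq)
    qed
    also have "\<dots> = real (D2 + 1) * (2 * d2) * real n" by simp
    finally have ST: "(\<Sum>k\<le>D2. \<bar>(\<Sum>t<n. x t * circ n (cosk k) x t) - (\<Sum>i<n. 2 * pi * \<phi>0 (grid n i) * cosk k (grid n i))\<bar>) \<le> real (D2 + 1) * (2 * d2) * real n" .
    have "\<bar>(\<Sum>i<n. 1 / (2 * pi * \<phi> (grid n i)) * (fcoef n x i)\<^sup>2) - (\<Sum>i<n. \<phi>0 (grid n i) / \<phi> (grid n i))\<bar> \<le>
      e2 * (V * real n + real n) + C * (real (D2 + 1) * (2 * d2) * real n)"
      by (rule order_trans[OF D2[OF ad]]) (intro add_mono mult_left_mono xV ST order_refl, use e2 C in auto)
    also have "\<dots> = (e2 * (V + 1) + C * (real (D2 + 1) * (2 * d2))) * real n" by (simp only: algebra_simps)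
    also have "\<dots> \<le> (e / 4 + e / 4) * real n"
      by (intro mult_right_mono add_mono) (use e2 d2 in auto)
    finally have T2: "\<bar>(\<Sum>i<n. 1 / (2 * pi * \<phi> (grid n i)) * (fcoef n x i)\<^sup>2) - (\<Sum>i<n. \<phi>0 (grid n i) / \<phi> (grid n i))\<bar> \<le> (e / 4 + e / 4) * real n" .
    have "(e / 4 + e / 4) * real n + (e / 4 + e / 4) * real n = e * real n" by (simp add: distrib_right)
    then show ?thesis using T1 T2 by linarith
  qed
  note key = this
  show ?thesis
    by (intro exI[of _ D] exI[of _ d] exI[of _ "max N 1"] conjI allI impI d(1)) (rule key; assumption)
qed

section \<open>Continuous functions and the parameter space\<close>

text \<open>Compactness of \<open>[0,1]\<close> makes boundedness automatic.\<close>

lemma mspace_C01: "mspace C01 = {f \<in> extensional {0..1}. continuous_on {0..1} f}"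
proof -
  have "compactin (top_of_set {0..1::real}) (topspace (top_of_set {0..1}))"
    by (simp add: compactin_subtopology)
  then show ?thesis unfolding C01_def compactin_mspace_cfunspace[OF \<open>compactin _ _\<close>] by auto
qed

lemma C01_mdist_le:
  assumes "f \<in> mspace C01" "g \<in> mspace C01"
  shows "mdist C01 f g \<le> a \<longleftrightarrow> (\<forall>x\<in>{0..1}. \<bar>f x - g x\<bar> \<le> a)"
  using assms unfolding C01_def by (subst cfunspace_mdist_le) (auto simp: dist_real_def)

lemma C01_eval_continuous:
  assumes "x \<in> {0..1}"
  shows "continuous_map (mtopology_of C01) euclidean (\<lambda>f. f x)"
proof -
  have "Lipschitz_continuous_map C01 euclidean_metric (\<lambda>f. f x :: real)"
    unfolding Lipschitz_continuous_map_def
  proof (intro conjI exI[of _ 1] ballI)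
    fix f g assume "f \<in> mspace C01" "g \<in> mspace C01"
    then have "\<bar>f x - g x\<bar> \<le> mdist C01 f g" using C01_mdist_le[of f g "mdist C01 f g"] assms by blast
    then show "mdist euclidean_metric (f x) (g x) \<le> 1 * mdist C01 f g" by (simp add: dist_real_def)
  qed auto
  then have "continuous_map (mtopology_of C01) (mtopology_of euclidean_metric) (\<lambda>f. f x :: real)"
    by (intro uniformly_continuous_imp_continuous_map Lipschitz_imp_uniformly_continuous_map)
  then show ?thesis by simp
qed

lemma sup_norm_upper: "x \<in> {0..1} \<Longrightarrow> ennreal \<bar>f x\<bar> \<le> sup_norm f"
  unfolding sup_norm_def by (rule SUP_upper)

lemma lip_const_upper:
  "x \<in> {0..1} \<Longrightarrow> y \<in> {0..1} \<Longrightarrow> x \<noteq> y \<Longrightarrow> ennreal \<bar>(f x - f y) / (x - y)\<bar> \<le> lip_const f"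
  unfolding lip_const_def by (rule SUP_upper2[of "(x, y)"]) auto

lemma sup_norm_le_iff: "0 \<le> a \<Longrightarrow> sup_norm f \<le> ennreal a \<longleftrightarrow> (\<forall>x\<in>{0..1}. \<bar>f x\<bar> \<le> a)"
  unfolding sup_norm_def by (auto simp: SUP_le_iff)

lemma lip_const_le_iff:
  "0 \<le> a \<Longrightarrow> lip_const f \<le> ennreal a \<longleftrightarrow> (\<forall>x\<in>{0..1}. \<forall>y\<in>{0..1}. x \<noteq> y \<longrightarrow> \<bar>(f x - f y) / (x - y)\<bar> \<le> a)"
  unfolding lip_const_def by (auto simp: SUP_le_iff)

text \<open>The two suprema of the norm are merged into one family of inequalities, each of which involves
  only three points. This exhibits \<open>Theta\<close> as an intersection of closed conditions.\<close>

lemma lip_norm_le_iff: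
  assumes "0 \<le> M"
  shows "lip_norm f \<le> ennreal M \<longleftrightarrow>
    (\<forall>x\<in>{0..1}. \<forall>y\<in>{0..1}. \<forall>z\<in>{0..1}. y \<noteq> z \<longrightarrow> \<bar>f x\<bar> + \<bar>(f y - f z) / (y - z)\<bar> \<le> M)"
proof
  assume le: "lip_norm f \<le> ennreal M"
  show "\<forall>x\<in>{0..1}. \<forall>y\<in>{0..1}. \<forall>z\<in>{0..1}. y \<noteq> z \<longrightarrow> \<bar>f x\<bar> + \<bar>(f y - f z) / (y - z)\<bar> \<le> M"
  proof (intro ballI impI)
    fix x y z :: real assume "x \<in> {0..1}" "y \<in> {0..1}" "z \<in> {0..1}" "y \<noteq> z"
    then have "ennreal \<bar>f x\<bar> + ennreal \<bar>(f y - f z) / (y - z)\<bar> \<le> lip_norm f"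
      unfolding lip_norm_def by (intro add_mono sup_norm_upper lip_const_upper)
    then have "ennreal (\<bar>f x\<bar> + \<bar>(f y - f z) / (y - z)\<bar>) \<le> ennreal M"
      using le by (subst ennreal_plus) auto
    then show "\<bar>f x\<bar> + \<bar>(f y - f z) / (y - z)\<bar> \<le> M" using assms by (simp only: ennreal_le_iff)
  qed
next
  assume b: "\<forall>x\<in>{0..1}. \<forall>y\<in>{0..1}. \<forall>z\<in>{0..1}. y \<noteq> z \<longrightarrow> \<bar>f x\<bar> + \<bar>(f y - f z) / (y - z)\<bar> \<le> M"
  define S where "S = {(x, y). x \<in> {0..1::real} \<and> y \<in> {0..1::real} \<and> x \<noteq> y}"
  have S: "S \<noteq> {}" unfolding S_def by (intro ex_in_conv[THEN iffD1] exI[of _ "(0, 1)"]) auto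
  have "sup_norm f + lip_const f = (SUP p\<in>S. sup_norm f + (case p of (x, y) \<Rightarrow> ennreal \<bar>(f x - f y) / (x - y)\<bar>))"
    unfolding lip_const_def S_def[symmetric] by (simp add: ennreal_SUP_add_right[OF S])
  also have "\<dots> \<le> ennreal M"
  proof (rule SUP_least)
    fix p assume "p \<in> S"
    then obtain y z where p: "p = (y, z)" "y \<in> {0..1}" "z \<in> {0..1}" "y \<noteq> z" unfolding S_def by auto
    have "sup_norm f + ennreal \<bar>(f y - f z) / (y - z)\<bar> = (SUP x\<in>{0..1}. ennreal \<bar>f x\<bar> + ennreal \<bar>(f y - f z) / (y - z)\<bar>)"
      unfolding sup_norm_def by (rule ennreal_SUP_add_left[symmetric]) auto
    also have "\<dots> \<le> ennreal M"
    proof (rule SUP_least)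
      fix x :: real assume "x \<in> {0..1}"
      then have "ennreal (\<bar>f x\<bar> + \<bar>(f y - f z) / (y - z)\<bar>) \<le> ennreal M" using b p by (intro ennreal_leI) blast
      then show "ennreal \<bar>f x\<bar> + ennreal \<bar>(f y - f z) / (y - z)\<bar> \<le> ennreal M" by (subst (asm) ennreal_plus) auto
    qed
    finally show "sup_norm f + (case p of (x, y) \<Rightarrow> ennreal \<bar>(f x - f y) / (x - y)\<bar>) \<le> ennreal M" using p by simp
  qed
  finally show "lip_norm f \<le> ennreal M" unfolding lip_norm_def .
qed

lemma lip_norm_finite:
  assumes "lip_norm f < \<infinity>"
  obtains S L where "0 \<le> S" "0 \<le> L" "lip_norm f = ennreal (S + L)"
    "\<And>x. x \<in> {0..1} \<Longrightarrow> \<bar>f x\<bar> \<le> S"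
    "\<And>x y. x \<in> {0..1} \<Longrightarrow> y \<in> {0..1} \<Longrightarrow> \<bar>f x - f y\<bar> \<le> L * \<bar>x - y\<bar>"
proof -
  have fin: "sup_norm f < \<infinity>" "lip_const f < \<infinity>" using assms unfolding lip_norm_def by auto
  define S where "S = enn2real (sup_norm f)"
  define L where "L = enn2real (lip_const f)"
  have e: "sup_norm f = ennreal S" "lip_const f = ennreal L" "0 \<le> S" "0 \<le> L"
    using fin by (auto simp: S_def L_def ennreal_enn2real)
  have s: "\<bar>f x\<bar> \<le> S" if "x \<in> {0..1}" for x using sup_norm_le_iff[OF e(3), of f] e(1) that by simp
  have l: "\<bar>f x - f y\<bar> \<le> L * \<bar>x - y\<bar>" if "x \<in> {0..1}" "y \<in> {0..1}" for x y
  proof (cases "x = y")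
    case False
    have "lip_const f \<le> ennreal L" using e(2) by simp
    then have "\<bar>(f x - f y) / (x - y)\<bar> \<le> L" unfolding lip_const_le_iff[OF e(4)] using that False by blast
    then show ?thesis using False by (simp add: abs_divide divide_le_eq)
  qed simp
  have "lip_norm f = ennreal (S + L)" unfolding lip_norm_def e(1,2) using e(3,4) by simp
  then show ?thesis using that e(3,4) s l by blast
qed

lemma Theta_iff:
  assumes "0 \<le> M"
  shows "\<phi> \<in> Theta m M \<longleftrightarrow> \<phi> \<in> mspace C01 \<and>
    (\<forall>x\<in>{0..1}. \<forall>y\<in>{0..1}. \<forall>z\<in>{0..1}. y \<noteq> z \<longrightarrow> \<bar>\<phi> x\<bar> + \<bar>(\<phi> y - \<phi> z) / (y - z)\<bar> \<le> M) \<and>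
    (\<forall>x\<in>{0..1}. m \<le> \<phi> x)"
proof -
  have inf: "m \<le> (INF x\<in>{0..1}. \<phi> x) \<longleftrightarrow> (\<forall>x\<in>{0..1}. m \<le> \<phi> x)"
    if b: "\<forall>x\<in>{0..1}. \<forall>y\<in>{0..1}. \<forall>z\<in>{0..1}. y \<noteq> z \<longrightarrow> \<bar>\<phi> x\<bar> + \<bar>(\<phi> y - \<phi> z) / (y - z)\<bar> \<le> M"
  proof
    assume m: "m \<le> (INF x\<in>{0..1}. \<phi> x)"
    show "\<forall>x\<in>{0..1}. m \<le> \<phi> x"
    proof
      fix x :: real assume x: "x \<in> {0..1}"
      have "bdd_below (\<phi> ` {0..1})"
      proof (rule bdd_belowI2)
        fix y :: real assume "y \<in> {0..1}"
        then have "\<bar>\<phi> y\<bar> + \<bar>(\<phi> 0 - \<phi> 1) / (0 - 1)\<bar> \<le> M" using b by (metis atLeastAtMost_iff order_refl zero_le_one zero_neq_one)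
        then show "- M \<le> \<phi> y" by linarith
      qed
      then have "(INF x\<in>{0..1}. \<phi> x) \<le> \<phi> x" using x by (rule cINF_lower)
      then show "m \<le> \<phi> x" using m by simp
    qed
  next
    assume "\<forall>x\<in>{0..1}. m \<le> \<phi> x"
    then show "m \<le> (INF x\<in>{0..1}. \<phi> x)" by (intro cINF_greatest) auto
  qed
  show ?thesis unfolding Theta_def mem_Collect_eq lip_norm_le_iff[OF assms] using inf by blast
qed

text \<open>An intersection of conditions on finitely many values of the function, and evaluations are
  continuous. Closedness makes the restriction of the prior to \<open>Theta\<close> well defined.\<close>

lemma Theta_closed:
  assumes "0 \<le> M"
  shows "closedin (mtopology_of C01) (Theta m M)"
proof -
  let ?T = "mtopology_of C01"
  define A where "A x y z = {f \<in> topspace ?T. \<bar>f x\<bar> + \<bar>(f y - f z) / (y - z)\<bar> \<in> {..M}}" for x y z :: real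
  define B where "B x = {f \<in> topspace ?T. f x \<in> {m..}}" for x :: real
  define \<A> where "\<A> = {topspace ?T} \<union> {A x y z |x y z. x \<in> {0..1} \<and> y \<in> {0..1} \<and> z \<in> {0..1} \<and> y \<noteq> z} \<union> {B x |x. x \<in> {0..1}}"
  have "closedin ?T C" if "C \<in> \<A>" for C
  proof -
    have "closedin ?T (A x y z)" if "x \<in> {0..1}" "y \<in> {0..1}" "z \<in> {0..1}" "y \<noteq> z" for x y z
      unfolding A_def
    proof (rule closedin_continuous_map_preimage)
      have "y - z \<noteq> 0" using that by simp
      then show "continuous_map ?T euclidean (\<lambda>f. \<bar>f x\<bar> + \<bar>(f y - f z) / (y - z)\<bar>)"
        by (intro continuous_map_add continuous_map_real_abs continuous_map_real_divide continuous_map_diff C01_eval_continuous that)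
          auto
    qed simp
    moreover have "closedin ?T (B x)" if "x \<in> {0..1}" for x
      unfolding B_def by (rule closedin_continuous_map_preimage[OF C01_eval_continuous[OF that]]) simp
    ultimately show ?thesis using that closedin_topspace[of ?T] unfolding \<A>_def by blast
  qed
  then have "closedin ?T (\<Inter>\<A>)" by (intro closedin_Inter) (auto simp: \<A>_def)
  moreover have "\<Inter>\<A> = Theta m M"
  proof (rule equalityI; rule subsetI)
    fix f assume f: "f \<in> \<Inter>\<A>"
    then have 1: "f \<in> mspace C01" by (simp add: \<A>_def)
    have 2: "\<bar>f x\<bar> + \<bar>(f y - f z) / (y - z)\<bar> \<le> M" if "x \<in> {0..1}" "y \<in> {0..1}" "z \<in> {0..1}" "y \<noteq> z" for x y z
    proof -
      have "A x y z \<in> \<A>" unfolding \<A>_def using that by blast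
      then have "f \<in> A x y z" using f by blast
      then show ?thesis by (simp add: A_def)
    qed
    have 3: "m \<le> f x" if "x \<in> {0..1}" for x
    proof -
      have "B x \<in> \<A>" unfolding \<A>_def using that by blast
      then have "f \<in> B x" using f by blast
      then show ?thesis by (simp add: B_def)
    qed
    show "f \<in> Theta m M" unfolding Theta_iff[OF assms] using 1 2 3 by blast
  next
    fix f assume "f \<in> Theta m M"
    then show "f \<in> \<Inter>\<A>" unfolding Theta_iff[OF assms] by (auto simp: \<A>_def A_def B_def)
  qed
  ultimately show ?thesis by simp
qed

lemma metric_open_sets: "{U. openin (mtopology_of X) U} \<subseteq> Pow (mspace X)"
proof
  fix U assume "U \<in> {U. openin (mtopology_of X) U}"
  then have "U \<subseteq> topspace (mtopology_of X)" by (intro openin_subset) simp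
  then show "U \<in> Pow (mspace X)" by simp
qed

lemma space_metric_borel [simp]: "space (metric_borel X) = mspace X"
  unfolding metric_borel_def by (rule space_measure_of[OF metric_open_sets])

lemma sets_metric_borel: "sets (metric_borel X) = sigma_sets (mspace X) {U. openin (mtopology_of X) U}"
  unfolding metric_borel_def by (rule sets_measure_of[OF metric_open_sets])

lemma open_in_metric_borel: "openin (mtopology_of X) U \<Longrightarrow> U \<in> sets (metric_borel X)"
  unfolding sets_metric_borel by (rule sigma_sets.Basic) simp

lemma closed_in_metric_borel:
  assumes "closedin (mtopology_of X) U" shows "U \<in> sets (metric_borel X)"
proof -
  have "mspace X - U \<in> sets (metric_borel X)" "U \<subseteq> mspace X"
    using assms by (auto simp: closedin_def intro: open_in_metric_borel)
  moreover have "mspace X - (mspace X - U) = U" using \<open>U \<subseteq> mspace X\<close> by auto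
  ultimately show ?thesis using sets.compl_sets[of "mspace X - U" "metric_borel X"] by simp
qed

text \<open>Measurability into a function space is not a pointwise matter in general. Here the function
  depends continuously on finitely many real coefficients, and these are random variables.\<close>

lemma finite_combination_measurable:
  fixes v :: "nat \<Rightarrow> 'b \<Rightarrow> real" and b :: "nat \<Rightarrow> real \<Rightarrow> real"
  assumes J: "finite J" and v: "\<And>j. v j \<in> borel_measurable Q" and b: "\<And>j. j \<in> J \<Longrightarrow> continuous_on {0..1} (b j)"
  shows "(\<lambda>\<omega>. \<lambda>x\<in>{0..1}. \<Sum>j\<in>J. v j \<omega> * b j x) \<in> Q \<rightarrow>\<^sub>M metric_borel C01"
proof -
  define F where "F w = (\<lambda>x\<in>{0..1::real}. \<Sum>j\<in>J. w j * b j x)" for w :: "nat \<Rightarrow> real"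
  have Fsp: "F w \<in> mspace C01" for w
  proof -
    have "continuous_on {0..1} (\<lambda>x. \<Sum>j\<in>J. w j * b j x)" by (intro continuous_intros b)
    then have "continuous_on {0..1} (F w)" unfolding F_def by (rule continuous_on_eq) auto
    then show ?thesis unfolding mspace_C01 by (simp add: F_def)
  qed
  have "\<exists>C>0. \<forall>j\<in>J. \<forall>x\<in>{0..1}. \<bar>b j x\<bar> \<le> C"
  proof -
    have "\<exists>c. \<forall>x\<in>{0..1}. \<bar>b j x\<bar> \<le> c" if "j \<in> J" for j
    proof -
      have "bounded (b j ` {0..1})" by (intro compact_imp_bounded compact_continuous_image b that) simp
      then show ?thesis unfolding bounded_iff by auto
    qed
    then obtain c where c: "\<And>j x. j \<in> J \<Longrightarrow> x \<in> {0..1} \<Longrightarrow> \<bar>b j x\<bar> \<le> c j" by metis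
    have "\<bar>b j x\<bar> \<le> 1 + (\<Sum>j\<in>J. \<bar>c j\<bar>)" if "j \<in> J" "x \<in> {0..1}" for j x
    proof -
      have "\<bar>c j\<bar> \<le> (\<Sum>j\<in>J. \<bar>c j\<bar>)" using that J by (intro member_le_sum) auto
      then show ?thesis using c[OF that] by linarith
    qed
    moreover have "0 < 1 + (\<Sum>j\<in>J. \<bar>c j\<bar>)" by (intro add_pos_nonneg sum_nonneg) auto
    ultimately show ?thesis by blast
  qed
  then obtain C where C: "C > 0" "\<And>j x. j \<in> J \<Longrightarrow> x \<in> {0..1} \<Longrightarrow> \<bar>b j x\<bar> \<le> C" by blast
  interpret Metric_space "mspace C01" "mdist C01" by (rule Metric_space_mspace_mdist)
  have opn: "open {w. F w \<in> U}" if U: "openin (mtopology_of C01) U" for U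
  proof (subst open_subopen, intro ballI)
    fix w0 assume "w0 \<in> {w. F w \<in> U}"
    then have "F w0 \<in> U" by simp
    then obtain r where r: "r > 0" "mball (F w0) r \<subseteq> U"
      using U unfolding mtopology_of_def openin_mtopology by blast
    define e where "e = r / (2 * C * (real (card J) + 1))"
    have e: "e > 0" using r C by (simp add: e_def)
    define N where "N = (\<Inter>j\<in>J. {w :: nat \<Rightarrow> real. \<bar>w j - w0 j\<bar> < e})"
    have "open N" unfolding N_def
    proof (rule open_INT[OF J], rule ballI)
      fix j
      show "open {w :: nat \<Rightarrow> real. \<bar>w j - w0 j\<bar> < e}"
        by (intro open_Collect_less continuous_intros continuous_on_product_coordinates)
    qed
    moreover have "w0 \<in> N" using e by (simp add: N_def)
    moreover have "N \<subseteq> {w. F w \<in> U}"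
    proof
      fix w assume w: "w \<in> N"
      have "\<bar>F w0 x - F w x\<bar> \<le> r / 2" if x: "x \<in> {0..1}" for x
      proof -
        have "\<bar>F w0 x - F w x\<bar> = \<bar>\<Sum>j\<in>J. (w0 j - w j) * b j x\<bar>"
          using x by (simp add: F_def sum_subtractf left_diff_distrib)
        also have "\<dots> \<le> (\<Sum>j\<in>J. \<bar>(w0 j - w j) * b j x\<bar>)" by (rule sum_abs)
        also have "\<dots> \<le> (\<Sum>j\<in>J. e * C)"
          unfolding abs_mult
        proof (intro sum_mono mult_mono)
          fix j assume "j \<in> J"
          then have "\<bar>w j - w0 j\<bar> < e" using w by (simp add: N_def)
          then show "\<bar>w0 j - w j\<bar> \<le> e" by linarith
        qed (use C x e in auto)
        also have "\<dots> = real (card J) * (e * C)" by simp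
        also have "\<dots> \<le> (real (card J) + 1) * (e * C)" using e C by (intro mult_right_mono) auto
        also have "\<dots> = (2 * C * (real (card J) + 1)) * e / 2" by simp
        also have "(2 * C * (real (card J) + 1)) * e = r"
        proof -
          have "K * (r / K) = r" if "K \<noteq> 0" for K using that by simp
          moreover have "2 * C * (real (card J) + 1) \<noteq> 0" using C by (simp add: add_nonneg_eq_0_iff)
          ultimately show ?thesis unfolding e_def by blast
        qed
        finally show ?thesis .
      qed
      then have "mdist C01 (F w0) (F w) \<le> r / 2" using C01_mdist_le[OF Fsp Fsp] by blast
      then have "F w \<in> mball (F w0) r" using r Fsp by (simp add: in_mball)
      then show "w \<in> {w. F w \<in> U}" using r by auto
    qed
    ultimately show "\<exists>T. open T \<and> w0 \<in> T \<and> T \<subseteq> {w. F w \<in> U}" by blast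
  qed
  have vm: "(\<lambda>\<omega> j. v j \<omega>) \<in> borel_measurable Q"
    by (rule measurable_coordinatewise_then_product) (rule v)
  have "(\<lambda>\<omega>. F (\<lambda>j. v j \<omega>)) \<in> Q \<rightarrow>\<^sub>M metric_borel C01"
    unfolding metric_borel_def
  proof (rule measurable_measure_of[OF metric_open_sets])
    fix U assume "U \<in> {U. openin (mtopology_of C01) U}"
    then have "{w. F w \<in> U} \<in> sets borel" using opn by auto
    from measurable_sets[OF vm this] show "(\<lambda>\<omega>. F (\<lambda>j. v j \<omega>)) -` U \<inter> space Q \<in> sets Q"
      by (simp add: vimage_def)
  qed (use Fsp in auto)
  then show ?thesis by (simp add: F_def)
qed

section \<open>Bernstein polynomials and Dirichlet distributions\<close>

abbreviation cell :: "nat \<Rightarrow> nat \<Rightarrow> real set" where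
  "cell n i \<equiv> {real i / real (Suc n)<..real (i + 1) / real (Suc n)}"

text \<open>The polynomial of degree at most \<open>n\<close> with Bernstein coefficients \<open>a\<close>.\<close>

definition bern :: "nat \<Rightarrow> (nat \<Rightarrow> real) \<Rightarrow> real \<Rightarrow> real" where
  "bern n a x = (\<Sum>i\<le>n. a i * Bernstein n i x)"

text \<open>The recursion behind de Casteljau's algorithm. It gives the bounds on values and differences by
  induction on the degree.\<close>

lemma de_casteljau: "bern (Suc n) a x = (1 - x) * bern n a x + x * bern n (\<lambda>i. a (Suc i)) x"
proof -
  have z: "Bernstein n (Suc n) x = 0" by (simp add: Bernstein_def)
  have b0: "Bernstein (Suc n) 0 x = (1 - x) * Bernstein n 0 x" by (simp add: Bernstein_def)
  have bs: "Bernstein (Suc n) (Suc i) x = (1 - x) * Bernstein n (Suc i) x + x * Bernstein n i x" if "i \<le> n" for i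
  proof (cases "i = n")
    case True
    then show ?thesis by (simp add: Bernstein_def)
  next
    case False
    then have "n - i = Suc (n - Suc i)" using that by simp
    then show ?thesis by (simp add: Bernstein_def algebra_simps)
  qed
  have "bern (Suc n) a x = a 0 * Bernstein (Suc n) 0 x + (\<Sum>i\<le>n. a (Suc i) * Bernstein (Suc n) (Suc i) x)"
    unfolding bern_def by (rule sum.atMost_Suc_shift)
  also have "(\<Sum>i\<le>n. a (Suc i) * Bernstein (Suc n) (Suc i) x) =
      (\<Sum>i\<le>n. (1 - x) * (a (Suc i) * Bernstein n (Suc i) x) + x * (a (Suc i) * Bernstein n i x))"
    by (rule sum.cong[OF refl]) (simp add: bs algebra_simps)
  also have "\<dots> = (1 - x) * (\<Sum>i\<le>n. a (Suc i) * Bernstein n (Suc i) x) + x * bern n (\<lambda>i. a (Suc i)) x"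
    by (simp only: sum.distrib sum_distrib_left bern_def)
  also have "a 0 * Bernstein (Suc n) 0 x + \<dots> =
      (1 - x) * (a 0 * Bernstein n 0 x + (\<Sum>i\<le>n. a (Suc i) * Bernstein n (Suc i) x)) + x * bern n (\<lambda>i. a (Suc i)) x"
    unfolding b0 by (simp add: algebra_simps)
  also have "a 0 * Bernstein n 0 x + (\<Sum>i\<le>n. a (Suc i) * Bernstein n (Suc i) x) = bern n a x"
    unfolding bern_def using sum.atMost_Suc_shift[of "\<lambda>i. a i * Bernstein n i x" n] z by simp
  finally show ?thesis .
qed

lemma bern_le:
  assumes "\<And>i. i \<le> n \<Longrightarrow> \<bar>a i\<bar> \<le> B" "x \<in> {0..1}"
  shows "\<bar>bern n a x\<bar> \<le> B"
proof -
  have b0: "0 \<le> Bernstein n i x" for i using assms(2) by (intro Bernstein_nonneg) auto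
  have "\<bar>bern n a x\<bar> \<le> (\<Sum>i\<le>n. \<bar>a i\<bar> * Bernstein n i x)"
    unfolding bern_def using sum_abs[of "\<lambda>i. a i * Bernstein n i x" "{..n}"] b0 by (simp add: abs_mult)
  also have "\<dots> \<le> (\<Sum>i\<le>n. B * Bernstein n i x)" by (intro sum_mono mult_right_mono assms b0) auto
  also have "\<dots> = B" by (simp add: sum_distrib_left[symmetric])
  finally show ?thesis .
qed

lemma bern_diff: "bern n a x - bern n b x = bern n (\<lambda>i. a i - b i) x"
  by (simp add: bern_def sum_subtractf left_diff_distrib)

text \<open>The derivative has the Bernstein coefficients \<open>n * (a (i + 1) - a i)\<close>; the induction avoids
  differentiation.\<close>

lemma bern_lipschitz:
  assumes "\<And>i. i < n \<Longrightarrow> \<bar>a (Suc i) - a i\<bar> \<le> \<Delta>" "x \<in> {0..1}" "y \<in> {0..1}"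
  shows "\<bar>bern n a x - bern n a y\<bar> \<le> real n * \<Delta> * \<bar>x - y\<bar>"
  using assms(1)
proof (induction n arbitrary: a)
  case 0
  then show ?case by (simp add: bern_def Bernstein_def)
next
  case (Suc n)
  let ?b = "\<lambda>i. a (Suc i)"
  have 1: "\<bar>bern n a x - bern n a y\<bar> \<le> real n * \<Delta> * \<bar>x - y\<bar>" by (rule Suc.IH) (use Suc.prems in auto)
  have 2: "\<bar>bern n ?b x - bern n ?b y\<bar> \<le> real n * \<Delta> * \<bar>x - y\<bar>" by (rule Suc.IH) (use Suc.prems in auto)
  have 3: "\<bar>bern n ?b y - bern n a y\<bar> \<le> \<Delta>"
    unfolding bern_diff by (rule bern_le[OF _ assms(3)]) (use Suc.prems in auto)
  have "bern (Suc n) a x - bern (Suc n) a y =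
    ((1 - x) * (bern n a x - bern n a y) + x * (bern n ?b x - bern n ?b y)) + (x - y) * (bern n ?b y - bern n a y)"
    unfolding de_casteljau by (simp add: algebra_simps)
  also have "\<bar>\<dots>\<bar> \<le> ((1 - x) * (real n * \<Delta> * \<bar>x - y\<bar>) + x * (real n * \<Delta> * \<bar>x - y\<bar>)) + \<bar>x - y\<bar> * \<Delta>"
  proof (intro order_trans[OF abs_triangle_ineq] add_mono)
    show "\<bar>(1 - x) * (bern n a x - bern n a y)\<bar> \<le> (1 - x) * (real n * \<Delta> * \<bar>x - y\<bar>)"
      unfolding abs_mult using assms(2) 1 by (intro mult_mono) auto
    show "\<bar>x * (bern n ?b x - bern n ?b y)\<bar> \<le> x * (real n * \<Delta> * \<bar>x - y\<bar>)"
      unfolding abs_mult using assms(2) 2 by (intro mult_mono) auto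
    show "\<bar>(x - y) * (bern n ?b y - bern n a y)\<bar> \<le> \<bar>x - y\<bar> * \<Delta>"
      unfolding abs_mult using 3 by (intro mult_left_mono) auto
  qed
  also have "\<dots> = real (Suc n) * \<Delta> * \<bar>x - y\<bar>" by (simp add: algebra_simps)
  finally show ?case .
qed

lemma beta_density_Bernstein:
  assumes "i \<le> n"
  shows "beta_density (i + 1) (Suc n - (i + 1) + 1) x = real (Suc n) * Bernstein n i x"
proof -
  have e: "Suc n - (i + 1) + 1 = n - i + 1" using assms by simp
  have g: "Gamma (real (k + 1)) = fact k" for k using Gamma_fact[of k, where 'a=real] by (simp add: add.commute)
  have "i + 1 + (n - i + 1) = Suc n + 1" using assms by simp
  then have "beta_density (i + 1) (Suc n - (i + 1) + 1) x = fact (Suc n) / (fact i * fact (n - i)) * x ^ i * (1 - x) ^ (n - i)"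
    unfolding beta_density_def e by (simp only: g) simp
  also have "fact (Suc n) / (fact i * fact (n - i)) = real (Suc n) * real (n choose i)"
    using assms by (simp add: binomial_fact)
  finally show ?thesis by (simp add: Bernstein_def)
qed

text \<open>The densities of the Beta mixture are Bernstein polynomials up to the factor \<open>K = n + 1\<close>.\<close>

lemma bernstein_fun_eq:
  "bernstein_fun G (Suc n) \<tau> x =
    bern n (\<lambda>i. \<tau> * real (Suc n) * measure G (cell n i)) x"
proof -
  have "(\<Sum>j=1..Suc n. measure G {(real j - 1) / real (Suc n)<..real j / real (Suc n)} * beta_density j (Suc n - j + 1) x) =
    (\<Sum>i\<le>n. measure G (cell n i) * beta_density (i + 1) (Suc n - (i + 1) + 1) x)"
    by (rule sum.reindex_bij_witness[of _ "\<lambda>i. i + 1" "\<lambda>j. j - 1"]) (auto simp: of_nat_diff)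
  also have "\<dots> = (\<Sum>i\<le>n. measure G (cell n i) * (real (Suc n) * Bernstein n i x))"
    by (intro sum.cong[OF refl]) (simp only: beta_density_Bernstein atMost_iff)
  finally have "(\<Sum>j=1..Suc n. measure G {(real j - 1) / real (Suc n)<..real j / real (Suc n)} * beta_density j (Suc n - j + 1) x) =
    (\<Sum>i\<le>n. measure G (cell n i) * (real (Suc n) * Bernstein n i x))" .
  then have "bernstein_fun G (Suc n) \<tau> x = \<tau> * (\<Sum>i\<le>n. measure G (cell n i) * (real (Suc n) * Bernstein n i x))"
    unfolding bernstein_fun_def by (rule arg_cong)
  then show ?thesis unfolding bern_def sum_distrib_left by (simp only: mult_ac)
qed

lemma gamma_density_measurable [measurable]:
  "(\<lambda>x. ennreal (if x > 0 then x powr (a - 1) * exp (- x) / Gamma a else 0)) \<in> borel_measurable borel"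
  by measurable

lemma sets_gamma_law [simp]: "sets (gamma_law a) = sets borel"
  by (simp add: gamma_law_def)

lemma space_gamma_law [simp]: "space (gamma_law a) = UNIV"
  by (simp add: gamma_law_def)

lemma sigma_finite_gamma_law: "sigma_finite_measure (gamma_law a)"
proof (cases "a = 0")
  case True
  have "prob_space (return borel (0::real))" by (rule prob_space_return) simp
  then show ?thesis using True by (simp add: gamma_law_def prob_space_imp_sigma_finite)
next
  case False
  then show ?thesis unfolding gamma_law_def
    by (simp add: sigma_finite_measure.sigma_finite_iff_density_finite[OF lborel.sigma_finite_measure_axioms])
qed

text \<open>With a zero parameter the law is a point mass at \<open>0\<close>, and otherwise its density is positive on
  the positive half-line.\<close>

lemma gamma_law_interval_pos:
  assumes "(a = 0 \<and> p = 0) \<or> (a > 0 \<and> p \<ge> 0)" "e > 0"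
  shows "emeasure (gamma_law a) {p - e<..<p + e} > 0"
proof (cases "a = 0")
  case True
  then show ?thesis using assms by (simp add: gamma_law_def)
next
  case False
  then have a: "a > 0" "p \<ge> 0" using assms by auto
  let ?f = "\<lambda>x. ennreal (if x > 0 then x powr (a - 1) * exp (- x) / Gamma a else 0)"
  show ?thesis
  proof (rule ccontr)
    assume "\<not> ?thesis"
    then have "{p - e<..<p + e} \<in> null_sets (density lborel ?f)"
      using False by (auto simp: gamma_law_def intro!: null_setsI)
    then have "AE x in lborel. x \<in> {p - e<..<p + e} \<longrightarrow> ?f x = 0"
      by (subst (asm) null_sets_density_iff) auto
    note zero = this
    have pos: "?f x \<noteq> 0" if "x > 0" for x using that a Gamma_real_pos[of a] by (simp add: ennreal_eq_0_iff not_le)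
    from zero have "AE x in lborel. x \<notin> {max 0 (p - e)<..<p + e}"
    proof eventually_elim
      case (elim x)
      then show ?case using pos[of x] by auto
    qed
    then have "{max 0 (p - e)<..<p + e} \<in> null_sets lborel"
      by (subst (asm) AE_iff_null_sets[symmetric]) auto
    then have "emeasure lborel {max 0 (p - e)<..<p + e} = 0" by auto
    moreover have lt: "max 0 (p - e) < p + e" using a assms(2) by auto
    ultimately show False using emeasure_lborel_Ioo[OF less_imp_le[OF lt]] by (simp add: ennreal_eq_0_iff)
  qed
qed

text \<open>If independent Gamma variables are near \<open>p\<close>, so is their normalisation, because \<open>p\<close> sums
  to one. A box around \<open>p\<close> has positive probability under the product law.\<close>

lemma dirichlet_law_box_pos:
  fixes p a :: "'i \<Rightarrow> real"
  assumes I: "finite I" and ap: "\<And>i. i \<in> I \<Longrightarrow> (a i = 0 \<and> p i = 0) \<or> (a i > 0 \<and> p i \<ge> 0)"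
    and p1: "(\<Sum>i\<in>I. p i) = 1" and e: "e > 0"
  shows "emeasure (dirichlet_law I a) {w \<in> space (PiM I (\<lambda>_. borel)). \<forall>i\<in>I. \<bar>w i - p i\<bar> < e} > 0"
proof -
  define k where "k = real (card I)"
  \<comment> \<open>the sum of the entries differs from 1 by at most \<open>k * d \<le> 1 / 2\<close>, so normalising at most doubles the errors\<close>
  define d where "d = min (1 / (2 * (k + 1))) (e / (4 * (k + 1)))"
  have k0: "k \<ge> 0" by (simp add: k_def)
  have d: "d > 0" "k * d \<le> 1 / 2" "4 * ((k + 1) * d) \<le> e"
  proof -
    show "d > 0" using e k0 by (simp add: d_def)
    have "(k + 1) * d \<le> (k + 1) * (1 / (2 * (k + 1)))" unfolding d_def using k0 by (intro mult_left_mono) auto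
    also have "\<dots> = 1 / 2" using k0 by simp
    finally have "(k + 1) * d \<le> 1 / 2" .
    then show "k * d \<le> 1 / 2" using \<open>d > 0\<close> by (simp add: algebra_simps)
    have "(k + 1) * d \<le> (k + 1) * (e / (4 * (k + 1)))" unfolding d_def using k0 by (intro mult_left_mono) auto
    also have "\<dots> = e / 4"
    proof -
      have "K * (e / (4 * K)) = e / 4" if "K \<noteq> 0" for K using that by simp
      then show ?thesis using k0 by (metis add_nonneg_eq_0_iff zero_le_one zero_neq_one)
    qed
    finally show "4 * ((k + 1) * d) \<le> e" by simp
  qed
  define M where "M = (\<lambda>i. gamma_law (a i))"
  interpret product_sigma_finite M unfolding M_def by (simp add: product_sigma_finite_def sigma_finite_gamma_law)
  define E where "E = {w \<in> space (PiM I (\<lambda>_. borel :: real measure)). \<forall>i\<in>I. \<bar>w i - p i\<bar> < e}"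
  define nr where "nr z = (\<lambda>i\<in>I. z i / (\<Sum>j\<in>I. z j))" for z :: "'i \<Rightarrow> real"
  have sM: "sets (PiM I M) = sets (PiM I (\<lambda>_. borel :: real measure))"
    by (rule sets_PiM_cong) (auto simp: M_def)
  have nrm: "nr \<in> PiM I M \<rightarrow>\<^sub>M PiM I (\<lambda>_. borel)"
    unfolding nr_def measurable_cong_sets[OF sM refl]
    by (intro measurable_restrict borel_measurable_divide borel_measurable_sum measurable_component_singleton)
  have Em: "E \<in> sets (PiM I (\<lambda>_. borel :: real measure))"
  proof -
    have "{w \<in> space (PiM I (\<lambda>_. borel :: real measure)). \<forall>i\<in>I. \<bar>w i - p i\<bar> < e} \<in> sets (PiM I (\<lambda>_. borel :: real measure))"
    proof (rule sets.sets_Collect_finite_All[OF _ I])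
      fix i assume i: "i \<in> I"
      have [measurable]: "(\<lambda>w. w i) \<in> borel_measurable (PiM I (\<lambda>_. borel :: real measure))"
        by (rule measurable_component_singleton[OF i])
      show "{w \<in> space (PiM I (\<lambda>_. borel :: real measure)). \<bar>w i - p i\<bar> < e} \<in> sets (PiM I (\<lambda>_. borel :: real measure))"
        by measurable
    qed
    then show ?thesis unfolding E_def .
  qed
  define B where "B = (\<Pi>\<^sub>E i\<in>I. {p i - d<..<p i + d})"
  have "emeasure (PiM I M) B = (\<Prod>i\<in>I. emeasure (M i) {p i - d<..<p i + d})"
    unfolding B_def by (rule emeasure_PiM[OF I]) (simp add: M_def)
  moreover have "emeasure (M i) {p i - d<..<p i + d} \<noteq> 0" if "i \<in> I" for i
    using gamma_law_interval_pos[OF ap[OF that] d(1)] by (auto simp: M_def)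
  ultimately have Bpos: "emeasure (PiM I M) B > 0" using I by (simp add: zero_less_iff_neq_zero)
  have "B \<subseteq> nr -` E \<inter> space (PiM I M)"
  proof
    fix z assume z: "z \<in> B"
    have zi: "\<bar>z i - p i\<bar> < d" if "i \<in> I" for i
    proof -
      have "z i \<in> {p i - d<..<p i + d}" using z that unfolding B_def by (rule PiE_mem)
      then show ?thesis by auto
    qed
    define s where "s = (\<Sum>j\<in>I. z j)"
    have "\<bar>s - 1\<bar> = \<bar>\<Sum>j\<in>I. z j - p j\<bar>" using p1 by (simp add: s_def sum_subtractf)
    also have "\<dots> \<le> (\<Sum>j\<in>I. \<bar>z j - p j\<bar>)" by (rule sum_abs)
    also have "\<dots> \<le> (\<Sum>j\<in>I. d)" by (intro sum_mono less_imp_le zi)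
    also have "\<dots> = k * d" by (simp add: k_def)
    finally have s1: "\<bar>s - 1\<bar> \<le> k * d" .
    then have s: "s \<ge> 1 / 2" using d(2) by linarith
    have pi: "0 \<le> p i" "p i \<le> 1" if "i \<in> I" for i
    proof -
      have pn: "0 \<le> p j" if "j \<in> I" for j using ap[OF that] by auto
      show "0 \<le> p i" by (rule pn[OF that])
      show "p i \<le> 1" unfolding p1[symmetric] by (rule member_le_sum) (use that I pn in auto)
    qed
    have "\<bar>z i / s - p i\<bar> < e" if "i \<in> I" for i
    proof -
      have "z i / s - p i = ((z i - p i) + p i * (1 - s)) / s" using s by (simp add: field_simps)
      then have "\<bar>z i / s - p i\<bar> = \<bar>(z i - p i) + p i * (1 - s)\<bar> / s" using s by (simp add: abs_divide)
      also have "\<dots> < ((k + 1) * d + (k + 1) * d) / s"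
      proof (rule divide_strict_right_mono)
        have "\<bar>p i * (1 - s)\<bar> \<le> 1 * (k * d)" unfolding abs_mult
          using pi[OF that] s1 by (intro mult_mono) auto
        then have "\<bar>(z i - p i) + p i * (1 - s)\<bar> < d + k * d" using zi[OF that] by linarith
        also have "\<dots> \<le> (k + 1) * d + (k + 1) * d" using d(1) k0 by (simp add: algebra_simps)
        finally show "\<bar>(z i - p i) + p i * (1 - s)\<bar> < (k + 1) * d + (k + 1) * d" .
      qed (use s in linarith)
      also have "\<dots> \<le> ((k + 1) * d + (k + 1) * d) / (1 / 2)"
        using s d(1) k0 by (intro divide_left_mono) auto
      also have "\<dots> = 4 * ((k + 1) * d)" by simp
      also have "\<dots> \<le> e" by (rule d(3))
      finally show ?thesis .
    qed
    then have "nr z \<in> E" unfolding E_def nr_def by (auto simp: space_PiM s_def)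
    moreover have "z \<in> space (PiM I M)" using z by (auto simp: B_def space_PiM M_def PiE_iff)
    ultimately show "z \<in> nr -` E \<inter> space (PiM I M)" by simp
  qed
  then have "emeasure (PiM I M) B \<le> emeasure (PiM I M) (nr -` E \<inter> space (PiM I M))"
    by (rule emeasure_mono) (rule measurable_sets[OF nrm Em])
  also have "\<dots> = emeasure (distr (PiM I M) (PiM I (\<lambda>_. borel)) nr) E"
    by (rule emeasure_distr[OF nrm Em, symmetric])
  also have "distr (PiM I M) (PiM I (\<lambda>_. borel)) nr = dirichlet_law I a"
    unfolding dirichlet_law_def M_def nr_def[abs_def] ..
  finally show ?thesis using Bpos unfolding E_def by (rule less_le_trans[rotated])
qed

section \<open>The support of the prior\<close>

text \<open>The set function in the definition is the normalised restriction of the prior, which is a measure on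
  a \<open>\<sigma>\<close>-algebra that contains the Borel sets of the subspace \<open>Theta\<close>. Without this
  argument the measure built by \<open>measure_of\<close> could be trivial.\<close>

lemma restricted_prior_props:
  assumes M: "0 \<le> M" and sets: "sets pr = sets (metric_borel C01)" and fin: "finite_measure pr"
    and U: "openin (mtopology_of C01) U" and pos: "emeasure pr (U \<inter> Theta m M) > 0"
  defines "R \<equiv> restricted_prior m M pr"
  shows "prob_space R" "space R = Theta m M" "U \<inter> Theta m M \<in> sets R" "emeasure R (U \<inter> Theta m M) > 0"
proof -
  interpret finite_measure pr by (rule fin)
  let ?\<Theta> = "Theta m M"
  have \<Theta>: "?\<Theta> \<in> sets pr" unfolding sets by (rule closed_in_metric_borel[OF Theta_closed[OF M]])
  have \<Theta>s: "?\<Theta> \<subseteq> mspace C01" unfolding Theta_def by auto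
  define c where "c = emeasure pr ?\<Theta>"
  have Us: "U \<in> sets pr" unfolding sets by (rule open_in_metric_borel[OF U])
  have c: "c \<noteq> 0" "c \<noteq> \<infinity>"
  proof -
    have "emeasure pr (U \<inter> ?\<Theta>) \<le> c" unfolding c_def by (rule emeasure_mono[OF _ \<Theta>]) auto
    then show "c \<noteq> 0" using pos by auto
    show "c \<noteq> \<infinity>" unfolding c_def by simp
  qed
  let ?S = "metric_borel (submetric C01 ?\<Theta>)"
  have msp: "mspace (submetric C01 ?\<Theta>) = ?\<Theta>" using \<Theta>s by auto
  define \<rho> where "\<rho> = scale_measure (inverse c) (restrict_space pr ?\<Theta>)"
  have ssub: "sets ?S \<subseteq> sets \<rho>"
  proof -
    have sp: "space \<rho> = ?\<Theta>" using \<Theta>s sets_eq_imp_space_eq[OF sets] by (auto simp: \<rho>_def space_scale_measure space_restrict_space)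
    have "V \<in> sets \<rho>" if V: "openin (mtopology_of (submetric C01 ?\<Theta>)) V" for V
    proof -
      obtain W where W: "openin (mtopology_of C01) W" "V = W \<inter> ?\<Theta>"
        using V unfolding mtopology_of_submetric openin_subtopology by blast
      then have "W \<in> sets pr" unfolding sets by (intro open_in_metric_borel)
      then show ?thesis unfolding \<rho>_def W(2) using \<Theta> by (auto simp: sets_restrict_space)
    qed
    then have "sigma_sets (space \<rho>) {U. openin (mtopology_of (submetric C01 ?\<Theta>)) U} \<subseteq> sets \<rho>"
      by (intro sets.sigma_sets_subset) auto
    then show ?thesis unfolding sets_metric_borel msp sp .
  qed
  have \<rho>e: "emeasure \<rho> A = emeasure pr (A \<inter> ?\<Theta>) / c" if "A \<in> sets \<rho>" for A
  proof -
    have "A \<in> sets (restrict_space pr ?\<Theta>)" using that by (simp add: \<rho>_def)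
    then have "A \<subseteq> ?\<Theta>" using sets.sets_into_space by (fastforce simp: space_restrict_space)
    then have "emeasure (restrict_space pr ?\<Theta>) A = emeasure pr (A \<inter> ?\<Theta>)"
      using \<Theta> by (subst emeasure_restrict_space) (auto simp: Int_absorb2)
    then show ?thesis by (simp add: \<rho>_def divide_ennreal_def mult.commute)
  qed
  have Pow: "sets ?S \<subseteq> Pow ?\<Theta>" using sets.space_closed[of ?S] by (simp add: msp)
  have sa: "sigma_algebra ?\<Theta> (sets ?S)" using sets.sigma_algebra_axioms[of ?S] unfolding space_metric_borel msp .
  have setsR: "sets R = sets ?S" unfolding R_def restricted_prior_def
    by (subst sets_measure_of[OF Pow]) (rule sigma_algebra.sigma_sets_eq[OF sa])
  show spR: "space R = ?\<Theta>" unfolding R_def restricted_prior_def by (rule space_measure_of[OF Pow])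
  have Re: "emeasure R A = emeasure \<rho> A" if A: "A \<in> sets ?S" for A
  proof -
    have "emeasure R A = emeasure pr (A \<inter> ?\<Theta>) / c"
    proof (rule emeasure_measure_of[of R ?\<Theta> "sets ?S" "\<lambda>A. emeasure pr (A \<inter> ?\<Theta>) / c" A])
      show "R = measure_of ?\<Theta> (sets ?S) (\<lambda>A. emeasure pr (A \<inter> ?\<Theta>) / c)"
        unfolding R_def restricted_prior_def c_def ..
      show "positive (sets R) (\<lambda>A. emeasure pr (A \<inter> ?\<Theta>) / c)" by (simp add: positive_def)
      show "countably_additive (sets R) (\<lambda>A. emeasure pr (A \<inter> ?\<Theta>) / c)"
        unfolding countably_additive_def
      proof (intro allI impI)
        fix A :: "nat \<Rightarrow> (real \<Rightarrow> real) set"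
        assume A: "range A \<subseteq> sets R" "disjoint_family A" "\<Union> (range A) \<in> sets R"
        have Ar: "A i \<in> sets \<rho>" "\<Union> (range A) \<in> sets \<rho>" for i using A ssub unfolding setsR by auto
        then have "(\<Sum>i. emeasure \<rho> (A i)) = emeasure \<rho> (\<Union> (range A))"
          by (intro suminf_emeasure A) auto
        then show "(\<Sum>i. emeasure pr (A i \<inter> ?\<Theta>) / c) = emeasure pr (\<Union> (range A) \<inter> ?\<Theta>) / c"
          using \<rho>e Ar by simp
      qed
    qed (use A Pow setsR in auto)
    then show ?thesis using \<rho>e ssub A by auto
  qed
  have "?\<Theta> \<in> sets ?S" using sets.top[of ?S] unfolding space_metric_borel msp .
  then have "emeasure R ?\<Theta> = c / c" using Re \<rho>e ssub unfolding c_def by auto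
  also have "\<dots> = 1" using c by (simp add: ennreal_divide_self top.not_eq_extremum)
  finally show "prob_space R" by (intro prob_spaceI) (simp add: spR)
  have "openin (mtopology_of (submetric C01 ?\<Theta>)) (U \<inter> ?\<Theta>)"
    unfolding mtopology_of_submetric openin_subtopology using U by blast
  then have US: "U \<inter> ?\<Theta> \<in> sets ?S" by (rule open_in_metric_borel)
  then show "U \<inter> ?\<Theta> \<in> sets R" unfolding setsR .
  have "emeasure R (U \<inter> ?\<Theta>) = emeasure pr (U \<inter> ?\<Theta>) / c" using Re[OF US] \<rho>e ssub US by (auto simp: Int_assoc)
  also have "\<dots> > 0" using pos c by (simp add: ennreal_zero_less_divide less_top)
  finally show "emeasure R (U \<inter> ?\<Theta>) > 0" .
qed

lemma cell_in_unit_borel: "0 \<le> a \<Longrightarrow> b \<le> 1 \<Longrightarrow> {a<..b} \<in> sets unit_borel" for a b :: real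
  by (auto simp: sets_restrict_space_iff)

lemma grid_cell_in_unit_borel: "i \<le> n \<Longrightarrow> (cell n i) \<in> sets unit_borel"
  by (rule cell_in_unit_borel) auto

text \<open>On each of the countably many events \<open>K = k\<close> the function is a finite combination of fixed
  continuous functions with random coefficients.\<close>

lemma random_bernstein_measurable:
  assumes G: "G \<in> Q \<rightarrow>\<^sub>M prob_algebra unit_borel" and K: "K \<in> Q \<rightarrow>\<^sub>M count_space UNIV"
    and \<tau>: "\<tau> \<in> borel_measurable Q" and h: "continuous_on {0..1} h"
  shows "(\<lambda>\<omega>. \<lambda>x\<in>{0..1}. bernstein_fun (G \<omega>) (K \<omega>) (\<tau> \<omega>) x * h x) \<in> Q \<rightarrow>\<^sub>M metric_borel C01"
proof -
  have "(\<lambda>\<omega>. \<lambda>x\<in>{0..1}. bernstein_fun (G \<omega>) k (\<tau> \<omega>) x * h x) \<in> Q \<rightarrow>\<^sub>M metric_borel C01" for k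
  proof -
    define v where "v j \<omega> = (if j \<in> {1..k} then \<tau> \<omega> * measure (G \<omega>) {(real j - 1) / real k<..real j / real k} else 0)" for j \<omega>
    have vm: "v j \<in> borel_measurable Q" for j
    proof (cases "j \<in> {1..k}")
      case True
      have "{(real j - 1) / real k<..real j / real k} \<in> sets unit_borel"
        using True by (intro cell_in_unit_borel) auto
      then have "(\<lambda>\<omega>. measure (G \<omega>) {(real j - 1) / real k<..real j / real k}) \<in> borel_measurable Q"
        by (rule measurable_compose[OF G measurable_measure_prob_algebra])
      then show ?thesis unfolding v_def using True \<tau> by simp
    next
      case False
      then have "v j = (\<lambda>_. 0)" by (auto simp: v_def fun_eq_iff)
      then show ?thesis by simp
    qed
    have b: "continuous_on {0..1} (\<lambda>x. beta_density j (k - j + 1) x * h x)" for j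
      unfolding beta_density_def by (intro continuous_intros h)
    have "(\<lambda>\<omega>. \<lambda>x\<in>{0..1}. \<Sum>j\<in>{1..k}. v j \<omega> * (beta_density j (k - j + 1) x * h x)) \<in> Q \<rightarrow>\<^sub>M metric_borel C01"
      by (rule finite_combination_measurable) (use vm b in auto)
    moreover have "bernstein_fun (G \<omega>) k (\<tau> \<omega>) x * h x = (\<Sum>j\<in>{1..k}. v j \<omega> * (beta_density j (k - j + 1) x * h x))" for \<omega> x
      unfolding bernstein_fun_def sum_distrib_left sum_distrib_right
      by (rule sum.cong[OF refl]) (simp add: v_def mult_ac)
    ultimately show ?thesis by simp
  qed
  then show ?thesis by (rule measurable_compose_countable[OF _ K])
qed

lemma indep_three_emeasure:
  assumes Q: "prob_space Q" and ind: "indep_three Q X SX Y SY Z SZ"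
    and A: "A \<in> sets SX" "B \<in> sets SY" "C \<in> sets SZ"
    and pos: "measure Q (X -` A \<inter> space Q) > 0" "measure Q (Y -` B \<inter> space Q) > 0" "measure Q (Z -` C \<inter> space Q) > 0"
  shows "measure Q ((X -` A \<inter> space Q) \<inter> (Y -` B \<inter> space Q) \<inter> (Z -` C \<inter> space Q)) > 0"
proof -
  interpret prob_space Q by (rule Q)
  define F where "F = (!) [sets (vimage_algebra (space Q) X SX), sets (vimage_algebra (space Q) Y SY), sets (vimage_algebra (space Q) Z SZ)]"
  define E where "E = (!) [X -` A \<inter> space Q, Y -` B \<inter> space Q, Z -` C \<inter> space Q]"
  have ind': "indep_sets F {..<3}" using ind unfolding indep_three_def F_def .
  have three: "{..<3::nat} = {0, 1, 2}" by auto
  have "prob (\<Inter>j\<in>{..<3}. E j) = (\<Prod>j\<in>{..<3}. prob (E j))"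
  proof (rule indep_setsD[OF ind'])
    show "\<forall>j\<in>{..<3}. E j \<in> F j"
      unfolding three E_def F_def using A by (auto intro: in_vimage_algebra)
  qed (auto simp: three)
  then have "prob (E 0 \<inter> (E 1 \<inter> E 2)) = prob (E 0) * (prob (E 1) * prob (E 2))"
    unfolding three by simp
  then show ?thesis using pos by (simp add: E_def Int_assoc)
qed

lemma interval_mass_pos:
  assumes "full_support_01 G0" "G0 \<in> space (prob_algebra unit_borel)" "0 \<le> a" "a < b" "b \<le> 1"
  shows "measure G0 {a<..b} > 0"
proof -
  interpret prob_space G0 using assms(2) by (simp add: space_prob_algebra)
  have s: "sets G0 = sets unit_borel" using assms(2) by (simp add: space_prob_algebra)
  have "{a<..<b} \<inter> {0..1} \<noteq> {}"
  proof -
    have "(a + b) / 2 \<in> {a<..<b} \<inter> {0..1}" using assms by auto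
    then show ?thesis by blast
  qed
  then have "0 < measure G0 ({a<..<b} \<inter> {0..1})"
    using assms(1)[unfolded full_support_01_def, rule_format, of "{a<..<b}"] by simp
  also have "\<dots> \<le> measure G0 {a<..b}"
    by (rule finite_measure_mono) (use assms in \<open>auto simp: s sets_restrict_space_iff\<close>)
  finally show ?thesis .
qed

text \<open>The cell probabilities follow a Dirichlet distribution with parameters \<open>\<alpha> * G0 (cell n i)\<close>,
  all of them positive because \<open>G0\<close> has full support.\<close>

lemma dirichlet_process_cells_pos:
  assumes Q: "prob_space Q" and \<alpha>: "\<alpha> > 0" and G0: "G0 \<in> space (prob_algebra unit_borel)" "full_support_01 G0"
    and DP: "dirichlet_process Q G \<alpha> G0"
    and p: "\<And>i. i \<le> n \<Longrightarrow> p i \<ge> 0" "(\<Sum>i\<le>n. p i) = 1" and e: "e > 0"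
  shows "measure Q (G -` {\<mu> \<in> space (prob_algebra unit_borel). \<forall>i\<in>{..n}. \<bar>measure \<mu> (cell n i) - p i\<bar> < e} \<inter> space Q) > 0"
proof -
  interpret prob_space Q by (rule Q)
  \<comment> \<open>The cells leave out the point 0, which is therefore added as a cell of its own. Its target mass is 0, which is attainable whether or not \<open>G0\<close> has an atom there.\<close>
  define A where "A i = (case i of 0 \<Rightarrow> {0} | Suc i \<Rightarrow> (cell n i))" for i :: nat
  define p' where "p' i = (case i of 0 \<Rightarrow> 0 | Suc i \<Rightarrow> p i)" for i :: nat
  define I where "I = {..<n + 2}"
  have G: "G \<in> Q \<rightarrow>\<^sub>M prob_algebra unit_borel" using DP unfolding dirichlet_process_def by (rule conjunct1)
  have As: "A \<in> I \<rightarrow> sets unit_borel"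
  proof
    fix i assume "i \<in> I"
    then show "A i \<in> sets unit_borel"
    proof (cases i)
      case 0
      then show ?thesis by (simp add: A_def sets_restrict_space_iff)
    next
      case (Suc k)
      then show ?thesis using \<open>i \<in> I\<close> grid_cell_in_unit_borel[of k n] by (simp add: A_def I_def)
    qed
  qed
  have dis: "disjoint_family_on A I"
  proof -
    have d: "(cell n i) \<inter> (cell n j) = {}" if "i < j" for i j
    proof -
      have "real (i + 1) / real (Suc n) \<le> real j / real (Suc n)" using that by (intro divide_right_mono) auto
      then show ?thesis by auto
    qed
    have d0: "0 \<notin> (cell n i)" for i
      by (simp add: not_less)
    have dd: "A (Suc i) \<inter> A (Suc j) = {}" if "i \<noteq> j" for i j
    proof (cases "i < j")
      case True
      then show ?thesis using d[of i j] by (simp only: A_def nat.case)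
    next
      case False
      then have "j < i" using that by simp
      then show ?thesis using d[of j i] by (simp only: A_def nat.case Int_commute)
    qed
    have dz: "A 0 \<inter> A (Suc j) = {}" "A (Suc j) \<inter> A 0 = {}" for j
      using d0[of j] unfolding A_def nat.case by blast+
    show ?thesis unfolding disjoint_family_on_def
    proof (intro ballI impI)
      fix i j assume "i \<in> I" "j \<in> I" "i \<noteq> j"
      then show "A i \<inter> A j = {}" using dd dz by (cases i; cases j) simp_all
    qed
  qed
  have cov: "(\<Union>i<n + 2. A i) = {0..1}"
  proof
    show "(\<Union>i<n + 2. A i) \<subseteq> {0..1}"
    proof (rule UN_least)
      fix i assume "i \<in> {..<n + 2}"
      then have "A i \<in> sets unit_borel" using As unfolding I_def by (rule funcset_mem[rotated])
      from sets.sets_into_space[OF this] show "A i \<subseteq> {0..1}" by (simp add: space_restrict_space)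
    qed
    show "{0..1} \<subseteq> (\<Union>i<n + 2. A i)"
    proof
      fix x :: real assume x: "x \<in> {0..1}"
      show "x \<in> (\<Union>i<n + 2. A i)"
      proof (cases "x = 0")
        case True
        then show ?thesis by (intro UN_I[of 0]) (auto simp: A_def)
      next
        case False
        then have x: "0 < x" "x \<le> 1" using x by auto
        define j where "j = nat \<lceil>x * real (Suc n)\<rceil>"
        have j1: "real j \<ge> x * real (Suc n)" "real j < x * real (Suc n) + 1" "j \<ge> 1"
        proof -
          have "0 < x * real (Suc n)" using x by simp
          then have "\<lceil>x * real (Suc n)\<rceil> \<ge> 1" by linarith
          then show "real j \<ge> x * real (Suc n)" "real j < x * real (Suc n) + 1" "j \<ge> 1" unfolding j_def by linarith+
        qed
        have le: "x * real (Suc n) \<le> 1 * real (Suc n)" using x by (intro mult_right_mono) auto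
        have "real j < 1 * real (Suc n) + 1" by (rule less_le_trans[OF j1(2) add_right_mono[OF le]])
        then have "real j < real (n + 2)" by simp
        then have "j < n + 2" by (simp only: of_nat_less_iff)
        moreover have "x \<in> A j"
        proof -
          obtain i where i: "j = Suc i" using j1(3) by (cases j) auto
          have "real i / real (Suc n) < x" using j1(2) i by (simp add: divide_less_eq)
          moreover have "x \<le> real (i + 1) / real (Suc n)" using j1(1) i by (simp add: le_divide_eq add.commute)
          ultimately show ?thesis by (simp add: A_def i)
        qed
        ultimately show ?thesis by blast
      qed
    qed
  qed
  have law: "distr Q (PiM I (\<lambda>_. borel)) (\<lambda>\<omega>. \<lambda>i\<in>I. measure (G \<omega>) (A i)) = dirichlet_law I (\<lambda>i. \<alpha> * measure G0 (A i))"
    unfolding I_def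
  proof (rule DP[unfolded dirichlet_process_def, THEN conjunct2, rule_format, of A "n + 2"], intro conjI)
  qed (use As dis cov in \<open>simp_all only: I_def\<close>)
  define E where "E = {w \<in> space (PiM I (\<lambda>_. borel :: real measure)). \<forall>i\<in>I. \<bar>w i - p' i\<bar> < e}"
  have "0 < emeasure (dirichlet_law I (\<lambda>i. \<alpha> * measure G0 (A i))) E"
    unfolding E_def
  proof (rule dirichlet_law_box_pos)
    have "(\<Sum>i\<in>I. p' i) = p' 0 + (\<Sum>i\<le>n. p' (Suc i))"
    proof -
      have "I = {..Suc n}" by (auto simp: I_def)
      then show ?thesis using sum.atMost_Suc_shift[of p' n] by (simp only:)
    qed
    then show "(\<Sum>i\<in>I. p' i) = 1" using p(2) by (simp add: p'_def)
    fix i assume i: "i \<in> I"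
    show "\<alpha> * measure G0 (A i) = 0 \<and> p' i = 0 \<or> \<alpha> * measure G0 (A i) > 0 \<and> p' i \<ge> 0"
    proof (cases i)
      case 0
      then show ?thesis using \<alpha> measure_nonneg[of G0 "A i"] by (auto simp: p'_def less_le)
    next
      case (Suc j)
      have "measure G0 (cell n j) > 0"
        by (rule interval_mass_pos[OF G0(2,1)]) (use i Suc in \<open>auto simp: I_def divide_strict_right_mono\<close>)
      then show ?thesis using \<alpha> p(1)[of j] i Suc by (auto simp: p'_def A_def I_def)
    qed
  qed (use e in \<open>auto simp: I_def\<close>)
  also have "\<dots> = emeasure (distr Q (PiM I (\<lambda>_. borel)) (\<lambda>\<omega>. \<lambda>i\<in>I. measure (G \<omega>) (A i))) E" unfolding law ..
  finally have pos: "0 < emeasure (distr Q (PiM I (\<lambda>_. borel)) (\<lambda>\<omega>. \<lambda>i\<in>I. measure (G \<omega>) (A i))) E" .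
  have Es: "E \<in> sets (PiM I (\<lambda>_. borel))"
  proof (rule ccontr)
    assume "E \<notin> sets (PiM I (\<lambda>_. borel))"
    then have "E \<notin> sets (distr Q (PiM I (\<lambda>_. borel)) (\<lambda>\<omega>. \<lambda>i\<in>I. measure (G \<omega>) (A i)))" by simp
    from emeasure_notin_sets[OF this] pos show False by simp
  qed
  have mm: "(\<lambda>\<omega>. \<lambda>i\<in>I. measure (G \<omega>) (A i)) \<in> Q \<rightarrow>\<^sub>M PiM I (\<lambda>_. borel)"
  proof (rule measurable_restrict)
    fix i assume "i \<in> I"
    then have "A i \<in> sets unit_borel" using As by auto
    then show "(\<lambda>\<omega>. measure (G \<omega>) (A i)) \<in> borel_measurable Q"
      by (rule measurable_compose[OF G measurable_measure_prob_algebra])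
  qed
  define E' where "E' = {\<mu> \<in> space (prob_algebra unit_borel). \<forall>i\<in>{..n}. \<bar>measure \<mu> (cell n i) - p i\<bar> < e}"
  have E's: "E' \<in> sets (prob_algebra unit_borel)" unfolding E'_def
  proof (rule sets.sets_Collect_finite_All)
    fix i assume "i \<in> {..n}"
    then have "(cell n i) \<in> sets unit_borel"
      by (intro grid_cell_in_unit_borel) simp
    then have [measurable]: "(\<lambda>\<mu>. measure \<mu> (cell n i)) \<in> borel_measurable (prob_algebra unit_borel)"
      by (rule measurable_measure_prob_algebra)
    show "{\<mu> \<in> space (prob_algebra unit_borel). \<bar>measure \<mu> (cell n i) - p i\<bar> < e} \<in> sets (prob_algebra unit_borel)"
      by measurable
  qed simp
  have "(\<lambda>\<omega>. \<lambda>i\<in>I. measure (G \<omega>) (A i)) -` E \<inter> space Q \<subseteq> G -` E' \<inter> space Q"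
  proof
    fix \<omega> assume w: "\<omega> \<in> (\<lambda>\<omega>. \<lambda>i\<in>I. measure (G \<omega>) (A i)) -` E \<inter> space Q"
    have "\<bar>measure (G \<omega>) (cell n i) - p i\<bar> < e" if "i \<le> n" for i
    proof -
      have "Suc i \<in> I" using that by (simp add: I_def)
      moreover have "\<forall>i\<in>I. \<bar>(\<lambda>i\<in>I. measure (G \<omega>) (A i)) i - p' i\<bar> < e" using w unfolding E_def by blast
      ultimately have "\<bar>measure (G \<omega>) (A (Suc i)) - p' (Suc i)\<bar> < e" by force
      then show ?thesis by (simp add: A_def p'_def)
    qed
    then show "\<omega> \<in> G -` E' \<inter> space Q" using w measurable_space[OF G] by (auto simp: E'_def)
  qed
  then have "emeasure Q ((\<lambda>\<omega>. \<lambda>i\<in>I. measure (G \<omega>) (A i)) -` E \<inter> space Q) \<le> emeasure Q (G -` E' \<inter> space Q)"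
    by (rule emeasure_mono) (rule measurable_sets[OF G E's])
  then have "0 < emeasure Q (G -` E' \<inter> space Q)" using pos emeasure_distr[OF mm Es] by simp
  then show ?thesis unfolding E'_def[symmetric] by (simp add: emeasure_eq_measure)
qed

text \<open>Let \<open>c0 = \<phi>0 / \<phi>par\<^sup>\<delta>\<close>. If \<open>K = n + 1\<close>, if \<open>\<tau>\<close> is near the
  mean \<open>\<tau>0\<close> of the values \<open>c0 (i / n)\<close>, and if the cell weights are near these values
  divided by their sum, then the random mixture has Bernstein coefficients near \<open>c0 (i / n)\<close>. It is
  then uniformly near \<open>c0\<close>, and its sup norm and Lipschitz constant hardly exceed those of
  \<open>c0\<close>. The product with \<open>\<phi>par\<^sup>\<delta>\<close> has Lipschitz norm at most the product of the
  norms, which is below \<open>M\<close>. The three events are independent and each has positive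
  probability.\<close>

lemma prior_neighbourhood_pos:
  fixes Q :: "'b measure"
  assumes Q: "prob_space Q" and \<alpha>: "\<alpha> > 0" and G0: "G0 \<in> space (prob_algebra unit_borel)" "full_support_01 G0"
    and DP: "dirichlet_process Q G \<alpha> G0"
    and K: "K \<in> Q \<rightarrow>\<^sub>M count_space UNIV" "\<And>k. k \<ge> 1 \<Longrightarrow> measure Q {\<omega> \<in> space Q. K \<omega> = k} > 0"
    and \<tau>: "\<tau> \<in> borel_measurable Q" "\<And>a b. 0 \<le> a \<Longrightarrow> a < b \<Longrightarrow> measure Q {\<omega> \<in> space Q. a < \<tau> \<omega> \<and> \<tau> \<omega> < b} > 0"
    and ind: "indep_three Q G (prob_algebra unit_borel) K (count_space UNIV) \<tau> borel"
    and par: "continuous_on {0..1} \<phi>par" "\<And>x. x \<in> {0..1} \<Longrightarrow> \<phi>par x > 0"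
    and m: "0 < m" "(INF x\<in>{0..1}. \<phi>0 x) > m"
    and M: "lip_norm (\<lambda>x. \<phi>0 x / \<phi>par x powr \<delta>) * lip_norm (\<lambda>x. \<phi>par x powr \<delta>) < ennreal M"
    and s: "s > 0" and bdd: "bdd_below (\<phi>0 ` {0..1})"
  shows "\<exists>U. openin (mtopology_of C01) U \<and> (\<forall>\<phi>\<in>U. \<forall>x\<in>{0..1}. \<bar>\<phi> x - \<phi>0 x\<bar> \<le> s) \<and>
    emeasure (prior_C Q G K \<tau> \<phi>par \<delta>) (U \<inter> Theta m M) > 0"
proof -
  interpret Q: prob_space Q by (rule Q)
  define h where "h x = \<phi>par x powr \<delta>" for x
  define c0 where "c0 x = \<phi>0 x / h x" for x
  define m0 where "m0 = (INF x\<in>{0..1}. \<phi>0 x)"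
  have m0: "m0 > m" using m(2) by (simp add: m0_def)
  have \<phi>0m: "m0 \<le> \<phi>0 x" if "x \<in> {0..1}" for x unfolding m0_def by (rule cINF_lower[OF bdd that])
  have h0: "h x > 0" if "x \<in> {0..1}" for x using par(2)[OF that] by (simp add: h_def)
  have c0p: "c0 x > 0" if "x \<in> {0..1}" for x using \<phi>0m[OF that] m0 m(1) h0[OF that] by (simp add: c0_def)
  have \<phi>0e: "\<phi>0 x = c0 x * h x" if "x \<in> {0..1}" for x using h0[OF that] by (simp add: c0_def)
  have hc: "continuous_on {0..1} h" unfolding h_def
    by (intro continuous_intros par(1)) (use par(2) in force)
  have prod: "lip_norm c0 * lip_norm h < ennreal M" using M by (simp add: c0_def[abs_def] h_def[abs_def])
  have posn: "lip_norm f \<noteq> 0" if "f 0 > 0" for f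
  proof -
    have "ennreal \<bar>f 0\<bar> \<le> lip_norm f" unfolding lip_norm_def
      by (rule order_trans[OF sup_norm_upper[of 0]]) auto
    moreover have "ennreal \<bar>f 0\<bar> \<noteq> 0" using that by simp
    ultimately show ?thesis by auto
  qed
  have "lip_norm c0 * lip_norm h < \<infinity>" using prod by (rule less_trans) simp
  then have fin: "lip_norm c0 < \<infinity>" "lip_norm h < \<infinity>"
    using posn[of c0] posn[of h] c0p[of 0] h0[of 0] by (auto simp: ennreal_mult_less_top)
  obtain S0 L0 where c0b: "0 \<le> S0" "0 \<le> L0" "lip_norm c0 = ennreal (S0 + L0)" "\<And>x. x \<in> {0..1} \<Longrightarrow> \<bar>c0 x\<bar> \<le> S0"
    "\<And>x y. x \<in> {0..1} \<Longrightarrow> y \<in> {0..1} \<Longrightarrow> \<bar>c0 x - c0 y\<bar> \<le> L0 * \<bar>x - y\<bar>" by (rule lip_norm_finite[OF fin(1)]) (rule that; blast)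
  obtain Sh Lh where hb: "0 \<le> Sh" "0 \<le> Lh" "lip_norm h = ennreal (Sh + Lh)" "\<And>x. x \<in> {0..1} \<Longrightarrow> \<bar>h x\<bar> \<le> Sh"
    "\<And>x y. x \<in> {0..1} \<Longrightarrow> y \<in> {0..1} \<Longrightarrow> \<bar>h x - h y\<bar> \<le> Lh * \<bar>x - y\<bar>" by (rule lip_norm_finite[OF fin(2)]) (rule that; blast)
  have Sh: "Sh > 0" using hb(4)[of 0] h0[of 0] by simp
  have "ennreal ((S0 + L0) * (Sh + Lh)) < ennreal M"
    using prod unfolding c0b(3) hb(3) by (subst ennreal_mult) (use c0b hb in auto)
  then have NM: "(S0 + L0) * (Sh + Lh) < M" by (subst (asm) ennreal_less_iff) (use c0b hb in auto)
  have M0: "0 \<le> M"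
  proof -
    have "0 \<le> (S0 + L0) * (Sh + Lh)" using c0b hb by simp
    then show ?thesis using NM by linarith
  qed
  \<comment> \<open>\<open>e\<close> is the room for errors in the Lipschitz norm of \<open>c0\<close>\<close>
  define e where "e = (M - (S0 + L0) * (Sh + Lh)) / (Sh + Lh)"
  have e: "e > 0" "(S0 + L0 + e) * (Sh + Lh) = M" using NM Sh hb(2) by (auto simp: e_def field_simps)
  define s' where "s' = min s (m0 - m)"
  have s': "s' > 0" "s' \<le> s" "s' \<le> m0 - m" using s m0 by (auto simp: s'_def)
  \<comment> \<open>the degree \<open>n\<close> makes the Bernstein approximation of \<open>c0\<close> accurate enough; it is fixed before \<open>\<eta>\<close>, because an error \<open>\<eta>\<close> in the coefficients can raise the Lipschitz constant by \<open>2 * n * \<eta>\<close>\<close>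
  obtain n :: nat where n0: "(4 * L0 * Sh / s')\<^sup>2 < real n" using reals_Archimedean2[of "(4 * L0 * Sh / s')\<^sup>2"] by blast
  moreover have "(0::real) \<le> (4 * L0 * Sh / s')\<^sup>2" by simp
  ultimately have n: "n > 0" by linarith
  have sn: "0 < sqrt (real n)" using n by simp
  have Ln: "L0 / sqrt (real n) * Sh \<le> s' / 4"
  proof -
    have "4 * L0 * Sh / s' \<le> sqrt (real n)" using n0 by (simp add: real_le_rsqrt)
    then have "4 * L0 * Sh \<le> sqrt (real n) * s'" using s'(1) by (simp add: divide_le_eq)
    then have "L0 * Sh \<le> s' / 4 * sqrt (real n)" by (simp add: mult_ac)
    then have "L0 * Sh / sqrt (real n) \<le> s' / 4" by (subst pos_divide_le_eq[OF sn])
    then show ?thesis by simp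
  qed
  define \<eta> where "\<eta> = min (e / (1 + 2 * real n)) (s' / (4 * Sh))"
  have \<eta>: "\<eta> > 0" "(1 + 2 * real n) * \<eta> \<le> e" "\<eta> * Sh \<le> s' / 4"
  proof -
    show "\<eta> > 0" using e s' Sh by (simp add: \<eta>_def add_pos_nonneg)
    have "\<eta> \<le> e / (1 + 2 * real n)" by (simp add: \<eta>_def)
    then show "(1 + 2 * real n) * \<eta> \<le> e" by (subst (asm) pos_le_divide_eq) (auto simp: mult.commute add_pos_nonneg)
    have "\<eta> \<le> s' / (4 * Sh)" by (simp add: \<eta>_def)
    then have "\<eta> * (4 * Sh) \<le> s'" by (subst (asm) pos_le_divide_eq) (use Sh in auto)
    then show "\<eta> * Sh \<le> s' / 4" by simp
  qed
  define a where "a i = c0 (real i / real n)" for i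
  have gr: "real i / real n \<in> {0..1}" if "i \<le> n" for i using that n by simp
  have ap: "a i > 0" if "i \<le> n" for i unfolding a_def by (rule c0p[OF gr[OF that]])
  define Sa where "Sa = (\<Sum>i\<le>n. a i)"
  have Sa: "Sa > 0" unfolding Sa_def by (rule sum_pos) (use ap in auto)
  \<comment> \<open>\<open>a i = (n + 1) * \<tau>0 * p i\<close> with weights \<open>p i\<close> of sum 1\<close>
  define \<tau>0 where "\<tau>0 = Sa / real (Suc n)"
  have \<tau>0: "\<tau>0 > 0" using Sa by (simp add: \<tau>0_def)
  define p where "p i = a i / Sa" for i
  have p0: "p i \<ge> 0" if "i \<le> n" for i using ap[OF that] Sa by (simp add: p_def)
  have p1: "(\<Sum>i\<le>n. p i) = 1" using Sa unfolding p_def by (simp flip: sum_divide_distrib add: Sa_def)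
  have ape: "a i = real (Suc n) * (\<tau>0 * p i)" for i
  proof -
    have "real (Suc n) * (Sa / real (Suc n) * (a i / Sa)) = a i" using Sa by (simp del: of_nat_Suc)
    then show ?thesis unfolding \<tau>0_def p_def by simp
  qed
  define d where "d = min \<tau>0 (\<eta> / (real (Suc n) * (1 + \<tau>0)))"
  have d: "d > 0" "d \<le> \<tau>0" "real (Suc n) * (d * (1 + \<tau>0)) \<le> \<eta>"
  proof -
    have q: "0 < real (Suc n) * (1 + \<tau>0)" using \<tau>0 by simp
    show "d > 0" unfolding d_def using \<tau>0 \<eta>(1) q by simp
    show "d \<le> \<tau>0" by (simp add: d_def)
    have "d \<le> \<eta> / (real (Suc n) * (1 + \<tau>0))" by (simp add: d_def)
    then have "d * (real (Suc n) * (1 + \<tau>0)) \<le> \<eta>" unfolding pos_le_divide_eq[OF q] .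
    then show "real (Suc n) * (d * (1 + \<tau>0)) \<le> \<eta>" by (simp only: mult_ac)
  qed
  define EG where "EG = {\<mu> \<in> space (prob_algebra unit_borel). \<forall>i\<in>{..n}. \<bar>measure \<mu> (cell n i) - p i\<bar> < d}"
  have Gm: "G \<in> Q \<rightarrow>\<^sub>M prob_algebra unit_borel" using DP unfolding dirichlet_process_def by (rule conjunct1)
  have EGp: "measure Q (G -` EG \<inter> space Q) > 0"
    unfolding EG_def by (rule dirichlet_process_cells_pos[OF Q \<alpha> G0 DP p0 p1 d(1)])
  have EGs: "EG \<in> sets (prob_algebra unit_borel)" unfolding EG_def
  proof (rule sets.sets_Collect_finite_All)
    fix i assume "i \<in> {..n}"
    then have "(cell n i) \<in> sets unit_borel" by (intro grid_cell_in_unit_borel) simp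
    then have [measurable]: "(\<lambda>\<mu>. measure \<mu> (cell n i)) \<in> borel_measurable (prob_algebra unit_borel)"
      by (rule measurable_measure_prob_algebra)
    show "{\<mu> \<in> space (prob_algebra unit_borel). \<bar>measure \<mu> (cell n i) - p i\<bar> < d} \<in> sets (prob_algebra unit_borel)"
      by measurable
  qed simp
  have Kp: "measure Q (K -` {Suc n} \<inter> space Q) > 0"
  proof -
    have "K -` {Suc n} \<inter> space Q = {\<omega> \<in> space Q. K \<omega> = Suc n}" by auto
    then show ?thesis using K(2)[of "Suc n"] by simp
  qed
  have \<tau>p: "measure Q (\<tau> -` {\<tau>0 - d<..<\<tau>0 + d} \<inter> space Q) > 0"
  proof -
    have "\<tau> -` {\<tau>0 - d<..<\<tau>0 + d} \<inter> space Q = {\<omega> \<in> space Q. \<tau>0 - d < \<tau> \<omega> \<and> \<tau> \<omega> < \<tau>0 + d}" by auto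
    then show ?thesis using \<tau>(2)[of "\<tau>0 - d" "\<tau>0 + d"] d by simp
  qed
  define E where "E = (G -` EG \<inter> space Q) \<inter> (K -` {Suc n} \<inter> space Q) \<inter> (\<tau> -` {\<tau>0 - d<..<\<tau>0 + d} \<inter> space Q)"
  have Ep: "measure Q E > 0" unfolding E_def
    by (rule indep_three_emeasure[OF Q ind EGs _ _ EGp Kp \<tau>p]) auto
  define f where "f \<omega> = (\<lambda>x\<in>{0..1}. bernstein_fun (G \<omega>) (K \<omega>) (\<tau> \<omega>) x * h x)" for \<omega>
  have fm: "f \<in> Q \<rightarrow>\<^sub>M metric_borel C01"
    unfolding f_def by (rule random_bernstein_measurable[OF Gm K(1) \<tau>(1) hc])
  have pr: "prior_C Q G K \<tau> \<phi>par \<delta> = distr Q (metric_borel C01) f"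
    unfolding prior_C_def f_def[abs_def] h_def ..
  define \<phi>0' where "\<phi>0' = restrict \<phi>0 {0..1}"
  have c0l: "lipschitz01 L0 c0" unfolding lipschitz01_def using c0b(5) by blast
  have \<phi>0c: "\<phi>0' \<in> mspace C01"
  proof -
    have "continuous_on {0..1} (\<lambda>x. c0 x * h x)" by (intro continuous_intros hc lipschitz01_continuous[OF c0l])
    then have "continuous_on {0..1} \<phi>0'" by (rule continuous_on_eq) (simp add: \<phi>0'_def \<phi>0e)
    then show ?thesis unfolding mspace_C01 by (simp add: \<phi>0'_def)
  qed
  interpret MS: Metric_space "mspace C01" "mdist C01" by (rule Metric_space_mspace_mdist)
  define U where "U = MS.mball \<phi>0' s"
  have Uo: "openin (mtopology_of C01) U" unfolding U_def mtopology_of_def by (rule MS.openin_mball)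
  have key: "f \<omega> \<in> U \<inter> Theta m M" if w: "\<omega> \<in> E" for \<omega>
  proof -
    have sp: "\<omega> \<in> space Q" and Kw: "K \<omega> = Suc n" and \<tau>w: "\<bar>\<tau> \<omega> - \<tau>0\<bar> < d" and Gw: "G \<omega> \<in> EG"
      using w unfolding E_def by (auto simp: abs_less_iff)
    define w where "w i = measure (G \<omega>) (cell n i)" for i
    have wp: "\<bar>w i - p i\<bar> < d" if "i \<le> n" for i using Gw that unfolding EG_def w_def by blast
    have w01: "0 \<le> w i" "w i \<le> 1" for i
    proof -
      have "prob_space (G \<omega>)" using measurable_space[OF Gm sp] by (simp add: space_prob_algebra)
      then show "w i \<le> 1" unfolding w_def by (rule prob_space.prob_le_1)
    qed (simp add: w_def)
    define a' where "a' i = \<tau> \<omega> * real (Suc n) * w i" for i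
    have aa: "\<bar>a' i - a i\<bar> \<le> \<eta>" if "i \<le> n" for i
    proof -
      have "a' i - a i = real (Suc n) * ((\<tau> \<omega> - \<tau>0) * w i + \<tau>0 * (w i - p i))"
        unfolding a'_def ape by (simp only: algebra_simps)
      then have "\<bar>a' i - a i\<bar> = real (Suc n) * \<bar>(\<tau> \<omega> - \<tau>0) * w i + \<tau>0 * (w i - p i)\<bar>"
        by (simp only: abs_mult abs_of_nat)
      also have "\<dots> \<le> real (Suc n) * (d * 1 + \<tau>0 * d)"
      proof (intro mult_left_mono order_trans[OF abs_triangle_ineq] add_mono)
        show "\<bar>(\<tau> \<omega> - \<tau>0) * w i\<bar> \<le> d * 1" unfolding abs_mult using \<tau>w w01[of i] d by (intro mult_mono) auto
        show "\<bar>\<tau>0 * (w i - p i)\<bar> \<le> \<tau>0 * d" unfolding abs_mult using wp[OF that] \<tau>0 by (intro mult_mono) auto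
      qed simp
      also have "d * 1 + \<tau>0 * d = d * (1 + \<tau>0)" by (simp add: algebra_simps)
      finally show ?thesis using d(3) by linarith
    qed
    define c where "c = bern n a'"
    have fe: "f \<omega> x = c x * h x" if "x \<in> {0..1}" for x
      using that unfolding f_def Kw c_def a'_def w_def bernstein_fun_eq by simp
    have cS: "\<bar>c x\<bar> \<le> S0 + \<eta>" if "x \<in> {0..1}" for x unfolding c_def
    proof (rule bern_le[OF _ that])
      fix i assume i: "i \<le> n"
      have "\<bar>a i\<bar> \<le> S0" unfolding a_def by (rule c0b(4)[OF gr[OF i]])
      then show "\<bar>a' i\<bar> \<le> S0 + \<eta>" using aa[OF i] by linarith
    qed
    have cL: "\<bar>c x - c y\<bar> \<le> (L0 + 2 * real n * \<eta>) * \<bar>x - y\<bar>" if "x \<in> {0..1}" "y \<in> {0..1}" for x y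
    proof -
      have "\<bar>c x - c y\<bar> \<le> real n * (L0 / real n + 2 * \<eta>) * \<bar>x - y\<bar>" unfolding c_def
      proof (rule bern_lipschitz[OF _ that])
        fix i assume i: "i < n"
        have "\<bar>a (Suc i) - a i\<bar> \<le> L0 * \<bar>real (Suc i) / real n - real i / real n\<bar>"
          unfolding a_def using i by (intro c0b(5) gr) auto
        also have "real (Suc i) / real n - real i / real n = 1 / real n" by (simp add: diff_divide_distrib[symmetric])
        finally have "\<bar>a (Suc i) - a i\<bar> \<le> L0 / real n" by simp
        then show "\<bar>a' (Suc i) - a' i\<bar> \<le> L0 / real n + 2 * \<eta>" using aa[of i] aa[of "Suc i"] i by linarith
      qed
      also have "real n * (L0 / real n + 2 * \<eta>) = L0 + 2 * real n * \<eta>" using n by (simp add: algebra_simps)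
      finally show ?thesis .
    qed
    have cc: "\<bar>c x - c0 x\<bar> \<le> \<eta> + L0 / sqrt (real n)" if x: "x \<in> {0..1}" for x
    proof -
      have "\<bar>c x - bern n a x\<bar> \<le> \<eta>" unfolding c_def bern_diff by (rule bern_le[OF _ x]) (use aa in auto)
      moreover have "\<bar>bern n a x - c0 x\<bar> \<le> L0 / sqrt (real n)"
        unfolding bern_def a_def by (rule bernstein_approx[OF c0l c0b(2) n x])
      ultimately show ?thesis by linarith
    qed
    have close: "\<bar>f \<omega> x - \<phi>0 x\<bar> \<le> s' / 2" if x: "x \<in> {0..1}" for x
    proof -
      have "\<bar>f \<omega> x - \<phi>0 x\<bar> = \<bar>c x - c0 x\<bar> * \<bar>h x\<bar>" unfolding fe[OF x] \<phi>0e[OF x] by (simp add: left_diff_distrib[symmetric] abs_mult)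
      also have "\<dots> \<le> (\<eta> + L0 / sqrt (real n)) * Sh" by (intro mult_mono cc[OF x] hb(4)[OF x]) (use \<eta> c0b in auto)
      also have "\<dots> \<le> s' / 2" unfolding distrib_right using \<eta>(3) Ln by linarith
      finally show ?thesis .
    qed
    have fC: "f \<omega> \<in> mspace C01" using measurable_space[OF fm sp] by simp
    have "mdist C01 \<phi>0' (f \<omega>) \<le> s' / 2"
      unfolding C01_mdist_le[OF \<phi>0c fC] using close by (simp add: \<phi>0'_def abs_minus_commute)
    then have "f \<omega> \<in> U" unfolding U_def MS.in_mball using \<phi>0c fC s' by simp
    moreover have "f \<omega> \<in> Theta m M"
      unfolding Theta_iff[OF M0]
    proof (intro conjI ballI impI fC)
      fix x :: real assume x: "x \<in> {0..1}"
      show "m \<le> f \<omega> x" using close[OF x] \<phi>0m[OF x] s' by linarith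
    next
      fix x y z :: real assume x: "x \<in> {0..1}" and y: "y \<in> {0..1}" and z: "z \<in> {0..1}" and yz: "y \<noteq> z"
      have 1: "\<bar>f \<omega> x\<bar> \<le> (S0 + \<eta>) * Sh" unfolding fe[OF x] abs_mult
        by (intro mult_mono cS[OF x] hb(4)[OF x]) (use c0b \<eta> in auto)
      have "f \<omega> y - f \<omega> z = c y * (h y - h z) + (c y - c z) * h z" unfolding fe[OF y] fe[OF z] by (simp add: algebra_simps)
      also have "\<bar>\<dots>\<bar> \<le> (S0 + \<eta>) * (Lh * \<bar>y - z\<bar>) + ((L0 + 2 * real n * \<eta>) * \<bar>y - z\<bar>) * Sh"
      proof (intro order_trans[OF abs_triangle_ineq] add_mono)
        show "\<bar>c y * (h y - h z)\<bar> \<le> (S0 + \<eta>) * (Lh * \<bar>y - z\<bar>)" unfolding abs_mult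
          by (intro mult_mono cS[OF y] hb(5)[OF y z]) (use c0b \<eta> in auto)
        show "\<bar>(c y - c z) * h z\<bar> \<le> ((L0 + 2 * real n * \<eta>) * \<bar>y - z\<bar>) * Sh" unfolding abs_mult
          by (intro mult_mono cL[OF y z] hb(4)[OF z]) (use c0b \<eta> in auto)
      qed
      also have "\<dots> = ((S0 + \<eta>) * Lh + (L0 + 2 * real n * \<eta>) * Sh) * \<bar>y - z\<bar>" by (simp only: algebra_simps)
      finally have 2: "\<bar>(f \<omega> y - f \<omega> z) / (y - z)\<bar> \<le> (S0 + \<eta>) * Lh + (L0 + 2 * real n * \<eta>) * Sh"
        using yz by (simp only: abs_divide) (simp add: divide_le_eq)
      have "(S0 + \<eta>) * Sh + ((S0 + \<eta>) * Lh + (L0 + 2 * real n * \<eta>) * Sh) + (L0 + 2 * real n * \<eta>) * Lh =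
        (S0 + L0 + (1 + 2 * real n) * \<eta>) * (Sh + Lh)" by (simp add: algebra_simps)
      also have "\<dots> \<le> (S0 + L0 + e) * (Sh + Lh)" by (intro mult_right_mono add_left_mono \<eta>(2)) (use hb in simp)
      finally have "(S0 + \<eta>) * Sh + ((S0 + \<eta>) * Lh + (L0 + 2 * real n * \<eta>) * Sh) + (L0 + 2 * real n * \<eta>) * Lh \<le> M" unfolding e(2) .
      moreover have "0 \<le> (L0 + 2 * real n * \<eta>) * Lh" using c0b hb \<eta> by simp
      ultimately show "\<bar>f \<omega> x\<bar> + \<bar>(f \<omega> y - f \<omega> z) / (y - z)\<bar> \<le> M" using 1 2 by linarith
    qed
    ultimately show ?thesis by blast
  qed
  have UT: "U \<inter> Theta m M \<in> sets (metric_borel C01)"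
    by (intro sets.Int open_in_metric_borel[OF Uo] closed_in_metric_borel[OF Theta_closed[OF M0]])
  have "0 < emeasure Q E" using Ep by (simp add: Q.emeasure_eq_measure)
  also have "\<dots> \<le> emeasure Q (f -` (U \<inter> Theta m M) \<inter> space Q)"
    by (rule emeasure_mono[OF _ measurable_sets[OF fm UT]]) (use key E_def in auto)
  also have "\<dots> = emeasure (prior_C Q G K \<tau> \<phi>par \<delta>) (U \<inter> Theta m M)" unfolding pr by (rule emeasure_distr[OF fm UT, symmetric])
  finally have pos: "0 < emeasure (prior_C Q G K \<tau> \<phi>par \<delta>) (U \<inter> Theta m M)" .
  have near: "\<forall>\<phi>\<in>U. \<forall>x\<in>{0..1}. \<bar>\<phi> x - \<phi>0 x\<bar> \<le> s"
  proof (intro ballI)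
    fix \<phi> and x :: real assume u: "\<phi> \<in> U" and x: "x \<in> {0..1}"
    then have "\<phi> \<in> mspace C01" "mdist C01 \<phi>0' \<phi> \<le> s" unfolding U_def by auto
    then have "\<bar>\<phi>0' x - \<phi> x\<bar> \<le> s" using C01_mdist_le[OF \<phi>0c, of \<phi> s] x by blast
    then show "\<bar>\<phi> x - \<phi>0 x\<bar> \<le> s" using x by (simp add: \<phi>0'_def abs_minus_commute)
  qed
  show ?thesis using Uo near pos by blast
qed

section \<open>The likelihood and its divergence\<close>

lemma Gamma_par_mult_vec:
  assumes "v \<in> carrier_vec n" "t < n"
  shows "(Gamma_par n \<psi> *\<^sub>v v) $ t = toep n \<psi> (\<lambda>s. v $ s) t"
  using assms by (simp add: Gamma_par_def toep_def scalar_prod_def atLeast0LessThan)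

text \<open>Positive definiteness, from the positive lower bound on the symbol.\<close>

lemma Gamma_par_inverse:
  assumes par: "continuous_on {0..1} \<psi>" "\<And>u. u \<in> {0..1} \<Longrightarrow> b \<le> \<psi> u" "0 < b"
  shows "Gamma_par n \<psi> * the (mat_inverse (Gamma_par n \<psi>)) = 1\<^sub>m n"
    and "the (mat_inverse (Gamma_par n \<psi>)) \<in> carrier_mat n n"
proof -
  have A: "Gamma_par n \<psi> \<in> carrier_mat n n" by (simp add: Gamma_par_def)
  have "Determinant.det (Gamma_par n \<psi>) \<noteq> 0"
  proof
    assume "Determinant.det (Gamma_par n \<psi>) = 0"
    then obtain v where v: "v \<in> carrier_vec n" "v \<noteq> 0\<^sub>v n" "Gamma_par n \<psi> *\<^sub>v v = 0\<^sub>v n"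
      unfolding det_0_iff_vec_prod_zero[OF A] by blast
    define x where "x s = v $ s" for s
    have "toep n \<psi> x t = 0" if "t < n" for t
      using Gamma_par_mult_vec[OF v(1) that, of \<psi>] v(3) that by (simp add: x_def[abs_def])
    then have "2 * pi * b * (nrm n x)\<^sup>2 \<le> 0" using toep_lower[where b=b and \<psi>=\<psi> and n=n and x=x] par by simp
    moreover have "0 \<le> 2 * pi * b * (nrm n x)\<^sup>2" using par(3) by simp
    ultimately have "2 * pi * b * (nrm n x)\<^sup>2 = 0" by (rule antisym)
    then have "(nrm n x)\<^sup>2 = 0" using par(3) by simp
    then have "(\<Sum>t<n. (x t)\<^sup>2) = 0" unfolding nrm_sq .
    then have "x t = 0" if "t < n" for t using that by (subst (asm) sum_nonneg_eq_0_iff) auto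
    then have "v = 0\<^sub>v n" using v(1) by (intro eq_vecI) (auto simp: x_def)
    then show False using v(2) by simp
  qed
  then have "Gamma_par n \<psi> \<in> Units (ring_mat TYPE(real) n ())" by (rule det_non_zero_imp_unit[OF A])
  then have "mat_inverse (Gamma_par n \<psi>) \<noteq> None" using mat_inverse(1)[OF A, where b="()"] by auto
  then have "mat_inverse (Gamma_par n \<psi>) = Some (the (mat_inverse (Gamma_par n \<psi>)))" by simp
  from mat_inverse(2)[OF A this]
  show "Gamma_par n \<psi> * the (mat_inverse (Gamma_par n \<psi>)) = 1\<^sub>m n"
    "the (mat_inverse (Gamma_par n \<psi>)) \<in> carrier_mat n n" by auto
qed

lemma C_mat_mult_vec:
  assumes "x \<in> carrier_vec n" "t < n"
  shows "(C_mat n \<phi>par \<phi> *\<^sub>v x) $ t = circ n (root_ratio \<phi> \<phi>par) (\<lambda>s. x $ s) t"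
proof -
  define D where "D = D_inv_sqrt n (\<lambda>x. \<phi> x / \<phi>par x)"
  have c: "DFT n \<in> carrier_mat n n" "D \<in> carrier_mat n n" "transpose_mat (DFT n) \<in> carrier_mat n n"
    by (auto simp: DFT_eq D_def D_inv_sqrt_def)
  have F: "(DFT n *\<^sub>v x) $ i = fcoef n (\<lambda>s. x $ s) i" if "i < n" for i
    using that assms(1) by (simp add: DFT_eq fcoef_def scalar_prod_def atLeast0LessThan)
  have Dw: "(D *\<^sub>v w) $ i = (\<phi> (grid n i) / \<phi>par (grid n i)) powr (- 1 / 2) * w $ i" if "i < n" "w \<in> carrier_vec n" for i w
  proof -
    have entry: "D $$ (i, j) = (if i = j then (\<phi> (grid n j) / \<phi>par (grid n j)) powr (- 1 / 2) else 0)" if "j < n" for j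
      using that \<open>i < n\<close> by (simp add: D_def D_inv_sqrt_def mat_diag_def grid_def)
    have "(D *\<^sub>v w) $ i = (\<Sum>j<n. D $$ (i, j) * w $ j)"
      using that c(2) by (simp add: scalar_prod_def atLeast0LessThan)
    also have "\<dots> = (\<Sum>j<n. (if i = j then (\<phi> (grid n j) / \<phi>par (grid n j)) powr (- 1 / 2) else 0) * w $ j)"
      by (rule sum.cong[OF refl]) (simp only: entry lessThan_iff)
    also have "\<dots> = (\<Sum>j<n. if i = j then (\<phi> (grid n j) / \<phi>par (grid n j)) powr (- 1 / 2) * w $ j else 0)"
      by (rule sum.cong) auto
    finally show ?thesis using that by simp
  qed
  have T: "(transpose_mat (DFT n) *\<^sub>v w) $ t = (\<Sum>i<n. dft n i t * w $ i)" if "w \<in> carrier_vec n" for w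
    using that assms(2) by (simp add: DFT_eq scalar_prod_def atLeast0LessThan)
  have "C_mat n \<phi>par \<phi> *\<^sub>v x = transpose_mat (DFT n) *\<^sub>v (D *\<^sub>v (DFT n *\<^sub>v x))"
  proof -
    have TD: "transpose_mat (DFT n) * D \<in> carrier_mat n n" by (rule mult_carrier_mat[OF c(3,2)])
    have Fx: "DFT n *\<^sub>v x \<in> carrier_vec n" by (rule mult_mat_vec_carrier[OF c(1) assms(1)])
    show ?thesis
      unfolding C_mat_def D_def[symmetric] assoc_mult_mat_vec[OF TD c(1) assms(1)]
        assoc_mult_mat_vec[OF c(3,2) Fx] ..
  qed
  then have "(C_mat n \<phi>par \<phi> *\<^sub>v x) $ t = (\<Sum>i<n. dft n i t * (D *\<^sub>v (DFT n *\<^sub>v x)) $ i)"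
    using T c assms(1) by simp
  also have "\<dots> = circ n (root_ratio \<phi> \<phi>par) (\<lambda>s. x $ s) t"
    unfolding circ_def
  proof (rule sum.cong[OF refl])
    fix i assume "i \<in> {..<n}"
    then have i: "i < n" by simp
    have w: "DFT n *\<^sub>v x \<in> carrier_vec n" using c(1) assms(1) by simp
    show "dft n i t * (D *\<^sub>v (DFT n *\<^sub>v x)) $ i =
      (\<phi> (grid n i) / \<phi>par (grid n i)) powr (- 1 / 2) * fcoef n (\<lambda>s. x $ s) i * dft n i t"
      unfolding Dw[OF i w] F[OF i] by (simp only: mult_ac)
  qed
  finally show ?thesis .
qed

lemma C_mat_carrier: "C_mat n \<phi>par \<phi> \<in> carrier_mat n n"
  unfolding C_mat_def by (auto simp: DFT_eq D_inv_sqrt_def)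

lemma C_mat_symmetric: "transpose_mat (C_mat n \<phi>par \<phi>) = C_mat n \<phi>par \<phi>"
proof -
  define D where "D = D_inv_sqrt n (\<lambda>x. \<phi> x / \<phi>par x)"
  have c: "DFT n \<in> carrier_mat n n" "D \<in> carrier_mat n n" "transpose_mat (DFT n) \<in> carrier_mat n n"
    by (auto simp: DFT_eq D_def D_inv_sqrt_def)
  have "transpose_mat D = D" by (rule eq_matI) (auto simp: D_def D_inv_sqrt_def mat_diag_def)
  then have "transpose_mat (transpose_mat (DFT n) * D * DFT n) = transpose_mat (DFT n) * (D * DFT n)"
    using c by (simp add: transpose_mult[of _ n n _ n])
  also have "\<dots> = transpose_mat (DFT n) * D * DFT n" using c by (simp add: assoc_mult_mat[of _ n n _ n _ n])
  finally show ?thesis unfolding C_mat_def D_def .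
qed

lemma det_C_mat:
  "Determinant.det (C_mat n \<phi>par \<phi>) = (Determinant.det (DFT n))\<^sup>2 * (\<Prod>i<n. (\<phi> (grid n i) / \<phi>par (grid n i)) powr (- 1 / 2))"
proof -
  define D where "D = D_inv_sqrt n (\<lambda>x. \<phi> x / \<phi>par x)"
  have c: "DFT n \<in> carrier_mat n n" "D \<in> carrier_mat n n" "transpose_mat (DFT n) \<in> carrier_mat n n"
    by (auto simp: DFT_eq D_def D_inv_sqrt_def)
  have "Determinant.det D = prod_list (diag_mat D)"
    by (rule det_upper_triangular[OF _ c(2)]) (auto simp: upper_triangular_def D_def D_inv_sqrt_def mat_diag_def)
  also have "\<dots> = (\<Prod>i<n. (\<phi> (grid n i) / \<phi>par (grid n i)) powr (- 1 / 2))"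
  proof -
    have "diag_mat D = map (\<lambda>i. (\<phi> (grid n i) / \<phi>par (grid n i)) powr (- 1 / 2)) [0..<n]"
      unfolding diag_mat_def using c(2) by (auto simp: D_def D_inv_sqrt_def mat_diag_def grid_def)
    then show ?thesis by (simp add: prod.distinct_set_conv_list[symmetric] atLeast0LessThan)
  qed
  finally have dD: "Determinant.det D = (\<Prod>i<n. (\<phi> (grid n i) / \<phi>par (grid n i)) powr (- 1 / 2))" .
  have "Determinant.det (transpose_mat (DFT n) * D * DFT n) = Determinant.det (DFT n) * Determinant.det D * Determinant.det (DFT n)"
    using c by (simp add: det_mult[of _ n] det_transpose[OF c(1)])
  then show ?thesis unfolding C_mat_def D_def[symmetric] dD by (simp add: power2_eq_square mult_ac)
qed

text \<open>The factor \<open>\<kappa>\<close> collects what does not depend on \<open>\<phi>\<close>, including the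
  determinant of the Fourier matrix, whose value is never needed because posterior ratios do not see it.
  The vector \<open>U\<close> solves \<open>\<Gamma>\<^sub>p\<^sub>a\<^sub>r U = C x\<close>, which avoids the inverse in the
  analysis.\<close>

lemma likelihood_formula:
  assumes par: "continuous_on {0..1} \<phi>par" "\<And>u. u \<in> {0..1} \<Longrightarrow> b \<le> \<phi>par u" "0 < b"
  shows "\<exists>\<kappa>. \<forall>\<phi> x. (\<forall>u\<in>{0..1}. 0 < \<phi> u) \<longrightarrow>
    (\<exists>U. (\<forall>t<n. toep n \<phi>par U t = circ n (root_ratio \<phi> \<phi>par) x t) \<and>
      corrected_likelihood n \<phi>par \<phi> (vec n x) = \<kappa> * exp (- 1 / 2 *
        ((\<Sum>i<n. ln (\<phi> (grid n i))) + (\<Sum>t<n. circ n (root_ratio \<phi> \<phi>par) x t * U t))))"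
proof -
  define B where "B = the (mat_inverse (Gamma_par n \<phi>par))"
  have B: "Gamma_par n \<phi>par * B = 1\<^sub>m n" "B \<in> carrier_mat n n"
    unfolding B_def using Gamma_par_inverse[OF par] by auto
  have Gc: "Gamma_par n \<phi>par \<in> carrier_mat n n" by (simp add: Gamma_par_def)
  have pp: "0 < \<phi>par u" if "u \<in> {0..1}" for u using par(2)[OF that] par(3) by linarith
  define \<kappa> where "\<kappa> = (2 * pi) powr (- real n / 2) * (sqrt (Determinant.det B) * (Determinant.det (DFT n))\<^sup>2 * exp (1 / 2 * (\<Sum>i<n. ln (\<phi>par (grid n i)))))"
  have "\<exists>U. (\<forall>t<n. toep n \<phi>par U t = circ n (root_ratio \<phi> \<phi>par) x t) \<and>
      corrected_likelihood n \<phi>par \<phi> (vec n x) = \<kappa> * exp (- 1 / 2 *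
        ((\<Sum>i<n. ln (\<phi> (grid n i))) + (\<Sum>t<n. circ n (root_ratio \<phi> \<phi>par) x t * U t)))"
    if pos: "\<forall>u\<in>{0..1}. 0 < \<phi> u" for \<phi> x
  proof -
    define C where "C = C_mat n \<phi>par \<phi>"
    have C: "C \<in> carrier_mat n n" "transpose_mat C = C" unfolding C_def by (rule C_mat_carrier, rule C_mat_symmetric)
    define X where "X = vec n x"
    have X: "X \<in> carrier_vec n" by (simp add: X_def)
    define Y where "Y = C *\<^sub>v X"
    have Y: "Y \<in> carrier_vec n" unfolding Y_def using C X by simp
    define V where "V = B *\<^sub>v Y"
    have V: "V \<in> carrier_vec n" unfolding V_def using B Y by simp
    have Xs: "circ n g (\<lambda>s. X $ s) t = circ n g x t" for g t
      unfolding circ_def fcoef_def X_def by simp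
    have Yt: "Y $ t = circ n (root_ratio \<phi> \<phi>par) x t" if "t < n" for t
      unfolding Y_def C_def C_mat_mult_vec[OF X that] Xs ..
    have "Gamma_par n \<phi>par *\<^sub>v V = (Gamma_par n \<phi>par * B) *\<^sub>v Y"
      unfolding V_def using Gc B(2) Y by (simp add: assoc_mult_mat_vec[of _ n n _ n])
    then have GV: "Gamma_par n \<phi>par *\<^sub>v V = Y" unfolding B(1) using Y by simp
    have toepV: "toep n \<phi>par (\<lambda>s. V $ s) t = circ n (root_ratio \<phi> \<phi>par) x t" if "t < n" for t
      using Gamma_par_mult_vec[OF V that, of \<phi>par] Yt[OF that] unfolding GV by simp
    have "(C * B * C) *\<^sub>v X = C *\<^sub>v V"
      unfolding V_def Y_def using C(1) B(2) X by (simp add: assoc_mult_mat_vec[of _ n n _ n])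
    then have "scalar_prod X ((C * B * C) *\<^sub>v X) = scalar_prod (transpose_mat C *\<^sub>v X) V"
      using transpose_vec_mult_scalar[OF C(1) V X] C(1) V X by (simp add: comm_scalar_prod[of _ n])
    also have "\<dots> = (\<Sum>t<n. Y $ t * V $ t)" unfolding C(2) Y_def[symmetric] using V by (simp add: scalar_prod_def atLeast0LessThan)
    also have "\<dots> = (\<Sum>t<n. circ n (root_ratio \<phi> \<phi>par) x t * V $ t)"
      by (rule sum.cong[OF refl]) (simp add: Yt)
    finally have q: "scalar_prod X ((C * B * C) *\<^sub>v X) = (\<Sum>t<n. circ n (root_ratio \<phi> \<phi>par) x t * V $ t)" .
    have gpos: "0 < \<phi> (grid n i)" "0 < \<phi>par (grid n i)" if "i < n" for i
      using pos pp grid_range[OF that] by auto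
    have "(\<Prod>i<n. (\<phi> (grid n i) / \<phi>par (grid n i)) powr (- 1 / 2)) = (\<Prod>i<n. exp (- 1 / 2 * ln (\<phi> (grid n i)) + 1 / 2 * ln (\<phi>par (grid n i))))"
    proof (rule prod.cong[OF refl])
      fix i assume "i \<in> {..<n}"
      then have g: "0 < \<phi> (grid n i)" "0 < \<phi>par (grid n i)" using gpos by auto
      then have "(\<phi> (grid n i) / \<phi>par (grid n i)) powr (- 1 / 2) = exp (- 1 / 2 * (ln (\<phi> (grid n i)) - ln (\<phi>par (grid n i))))"
        by (simp add: powr_def ln_div)
      then show "(\<phi> (grid n i) / \<phi>par (grid n i)) powr (- 1 / 2) = exp (- 1 / 2 * ln (\<phi> (grid n i)) + 1 / 2 * ln (\<phi>par (grid n i)))"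
        by (simp add: algebra_simps diff_divide_distrib)
    qed
    also have "\<dots> = exp (- 1 / 2 * (\<Sum>i<n. ln (\<phi> (grid n i)))) * exp (1 / 2 * (\<Sum>i<n. ln (\<phi>par (grid n i))))"
      by (simp only: exp_sum[OF finite_lessThan, symmetric] exp_add[symmetric] sum.distrib sum_distrib_left)
    finally have pr: "(\<Prod>i<n. (\<phi> (grid n i) / \<phi>par (grid n i)) powr (- 1 / 2)) =
      exp (- 1 / 2 * (\<Sum>i<n. ln (\<phi> (grid n i)))) * exp (1 / 2 * (\<Sum>i<n. ln (\<phi>par (grid n i))))" .
    have "Determinant.det (B * (C * C)) = Determinant.det B * (Determinant.det C)\<^sup>2"
      using B(2) C(1) by (simp add: det_mult[of _ n] power2_eq_square)
    then have "sqrt (Determinant.det (B * (C * C))) = sqrt (Determinant.det B) * \<bar>Determinant.det C\<bar>" by (simp add: real_sqrt_mult)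
    also have "\<bar>Determinant.det C\<bar> = (Determinant.det (DFT n))\<^sup>2 * (exp (- 1 / 2 * (\<Sum>i<n. ln (\<phi> (grid n i)))) * exp (1 / 2 * (\<Sum>i<n. ln (\<phi>par (grid n i)))))"
      unfolding C_def det_C_mat pr by (simp add: abs_mult)
    finally have sd: "sqrt (Determinant.det (B * (C * C))) = sqrt (Determinant.det B) * ((Determinant.det (DFT n))\<^sup>2 *
      (exp (- 1 / 2 * (\<Sum>i<n. ln (\<phi> (grid n i)))) * exp (1 / 2 * (\<Sum>i<n. ln (\<phi>par (grid n i))))))" .
    have "corrected_likelihood n \<phi>par \<phi> X = (2 * pi) powr (- real n / 2) * sqrt (Determinant.det (B * (C * C))) * exp (- 1 / 2 * scalar_prod X ((C * B * C) *\<^sub>v X))"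
      unfolding corrected_likelihood_def Let_def B_def C_def ..
    also have "\<dots> = \<kappa> * (exp (- 1 / 2 * (\<Sum>i<n. ln (\<phi> (grid n i)))) * exp (- 1 / 2 * (\<Sum>t<n. circ n (root_ratio \<phi> \<phi>par) x t * V $ t)))"
      unfolding sd q \<kappa>_def by (simp only: mult_ac)
    also have "\<dots> = \<kappa> * exp (- 1 / 2 * ((\<Sum>i<n. ln (\<phi> (grid n i))) + (\<Sum>t<n. circ n (root_ratio \<phi> \<phi>par) x t * V $ t)))"
      unfolding exp_add[symmetric] distrib_left ..
    finally show ?thesis using toepV unfolding X_def by (intro exI[of _ "\<lambda>s. V $ s"]) blast
  qed
  then show ?thesis by blast
qed

text \<open>Twice the inequality \<open>ln v \<le> v - 1\<close> at \<open>v = sqrt u\<close>. The left-hand side is a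
  squared Hellinger distance.\<close>

lemma kl_lower: "(sqrt u - 1)\<^sup>2 \<le> u - 1 - ln u" if "0 < u" for u :: real
proof -
  have "ln (sqrt u) \<le> sqrt u - 1" using that by (intro ln_le_minus_one) simp
  then have "ln u / 2 \<le> sqrt u - 1" using that by (simp add: ln_sqrt)
  then show ?thesis using that by (simp add: power2_diff)
qed

lemma kl_upper: "u - 1 - ln u \<le> (u - 1)\<^sup>2 / u" if "0 < u" for u :: real
proof -
  have "ln (1 / u) \<le> 1 / u - 1" using that by (intro ln_le_minus_one) simp
  then have "u - 1 - ln u \<le> u - 1 + (1 / u - 1)" using that by (simp add: ln_div)
  also have "\<dots> = (u - 1)\<^sup>2 / u" using that by (simp add: power2_eq_square field_simps)
  finally show ?thesis .
qed

text \<open>The Fourier frequencies fill \<open>[0,1]\<close> with density \<open>n\<close> (most of them counted twice), and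
  at least half of the interval of radius \<open>s\<close> around \<open>x\<close> lies within \<open>[0,1]\<close>.\<close>

lemma grid_points_near:
  assumes s: "0 < s" "s \<le> 1 / 2" and x: "x \<in> {0..1}" and n: "8 / s \<le> real n"
  shows "\<exists>S\<subseteq>{..<n}. s / 4 * real n \<le> real (card S) \<and> (\<forall>i\<in>S. \<bar>grid n i - x\<bar> \<le> s)"
proof -
  have sn: "8 \<le> s * real n" using n s by (simp add: divide_le_eq mult.commute)
  have n0: "real n > 0"
  proof (rule ccontr)
    assume "\<not> 0 < real n"
    then have "n = 0" by simp
    then show False using sn by simp
  qed
  have sn2: "s * real n \<le> 1 / 2 * real n" using s(2) n0 by (intro mult_right_mono) auto
  define q where "q = nat \<lfloor>s * real n / 2\<rfloor>"
  define p where "p = nat \<lfloor>x * real n\<rfloor>"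
  have q: "real q \<le> s * real n / 2" "s * real n / 2 < real q + 1" unfolding q_def using sn by linarith+
  have xn: "0 \<le> x * real n" "x * real n \<le> 1 * real n" using x n0 by (auto intro!: mult_right_mono simp del: mult_1)
  have p: "real p \<le> x * real n" "x * real n < real p + 1" unfolding p_def using xn by linarith+
  have near: "\<bar>grid n i - x\<bar> \<le> s" if "\<bar>real i - x * real n\<bar> \<le> s * real n / 2 + 1" for i
  proof -
    have "grid n i * real n = 2 * real (freq_index i)" using n0 by (simp add: grid_def)
    moreover have "real i \<le> 2 * real (freq_index i)" "2 * real (freq_index i) \<le> real i + 1"
      unfolding freq_index_def by linarith+
    ultimately have "\<bar>grid n i * real n - x * real n\<bar> \<le> s * real n" using that sn by linarith
    then have "\<bar>grid n i - x\<bar> * real n \<le> s * real n" unfolding left_diff_distrib[symmetric] abs_mult by simp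
    then show ?thesis using n0 by simp
  qed
  show ?thesis
  \<comment> \<open>take indices to the right of \<open>x\<close> in the left half and to the left of it otherwise, so that they stay in range\<close>
  proof (cases "x * real n \<le> real n / 2")
    case True
    show ?thesis
    proof (intro exI[of _ "{p + 1..p + q}"] conjI subsetI ballI)
      fix i assume i: "i \<in> {p + 1..p + q}"
      then have "real i \<le> real p + real q" "real p + 1 \<le> real i" by (auto simp flip: of_nat_add of_nat_Suc)
      then have b: "real i \<le> x * real n + s * real n / 2" "x * real n \<le> real i" using p q by linarith+
      then have "real i < real n" using True sn2 n0 by linarith
      then show "i \<in> {..<n}" by simp
      show "\<bar>grid n i - x\<bar> \<le> s" by (rule near) (use b sn in linarith)
    next
      have "real (card {p + 1..p + q}) = real q" by simp
      then show "s / 4 * real n \<le> real (card {p + 1..p + q})" using q sn by linarith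
    qed
  next
    case False
    show ?thesis
    proof (intro exI[of _ "{p - q..<p}"] conjI subsetI ballI)
      have qp: "q \<le> p"
      proof -
        have "real q \<le> real p" using False q p sn2 sn by linarith
        then show ?thesis by simp
      qed
      fix i assume i: "i \<in> {p - q..<p}"
      then have "real p \<le> real i + real q" "real i + 1 \<le> real p" using qp by (auto simp flip: of_nat_add of_nat_Suc)
      then have b: "x * real n - 1 - s * real n / 2 \<le> real i" "real i \<le> x * real n" using p q by linarith+
      show "i \<in> {..<n}"
      proof -
        have "real p \<le> real n" using p xn by linarith
        then show ?thesis using i by auto
      qed
      show "\<bar>grid n i - x\<bar> \<le> s" by (rule near) (use b in linarith)
    next
      have "real q \<le> real p" using False q p sn2 sn by linarith
      then have "real (card {p - q..<p}) = real q" by simp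
      then show "s / 4 * real n \<le> real (card {p - q..<p})" using q sn by linarith
    qed
  qed
qed

text \<open>The numerator is at most the maximal integrand on \<open>A\<close>, the denominator at least the
  contribution of \<open>B\<close>. The integral of a function that is not integrable is zero by convention,
  and then the bound holds as well.\<close>

lemma posterior_ratio_bound:
  fixes ell :: "(real \<Rightarrow> real) \<Rightarrow> real"
  assumes R: "prob_space R" and lik: "\<And>\<phi>. \<phi> \<in> space R \<Longrightarrow> L \<phi> = \<kappa> * exp (- 1 / 2 * ell \<phi>)"
    and A: "\<And>\<phi>. \<phi> \<in> A \<Longrightarrow> \<phi> \<in> space R \<Longrightarrow> a \<le> ell \<phi>"
    and B: "B \<in> sets R" "\<And>\<phi>. \<phi> \<in> B \<Longrightarrow> ell \<phi> \<le> b" "measure R B > 0"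
  shows "\<bar>(LINT \<phi>:A|R. L \<phi>) / (LINT \<phi>:space R|R. L \<phi>)\<bar> \<le> exp (- (a - b) / 2) / measure R B"
proof -
  interpret prob_space R by (rule R)
  define J where "J \<phi> = exp (- 1 / 2 * ell \<phi>)" for \<phi>
  have e: "(LINT \<phi>:S|R. L \<phi>) = \<kappa> * (LINT \<phi>:S|R. J \<phi>)" for S
  proof -
    have "(LINT \<phi>:S|R. L \<phi>) = (LINT \<phi>|R. \<kappa> * (indicator S \<phi> *\<^sub>R J \<phi>))"
      unfolding set_lebesgue_integral_def by (rule Bochner_Integration.integral_cong) (auto simp: lik J_def)
    then show ?thesis unfolding set_lebesgue_integral_def by simp
  qed
  have rhs: "0 \<le> exp (- (a - b) / 2) / measure R B" by simp
  show ?thesis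
  proof (cases "\<kappa> = 0 \<or> \<not> integrable R J")
    case True
    then have "(LINT \<phi>:space R|R. L \<phi>) = 0"
    proof
      assume "\<not> integrable R J"
      moreover have "(LINT \<phi>:space R|R. J \<phi>) = (LINT \<phi>|R. J \<phi>)"
        unfolding set_lebesgue_integral_def by (rule Bochner_Integration.integral_cong) auto
      ultimately show ?thesis unfolding e by (simp add: not_integrable_integral_eq)
    qed (simp add: e)
    then show ?thesis using rhs by simp
  next
    case False
    then have \<kappa>: "\<kappa> \<noteq> 0" and J: "integrable R J" by auto
    have J0: "0 < J \<phi>" for \<phi> by (simp add: J_def)
    have "(LINT \<phi>:space R|R. J \<phi>) = (LINT \<phi>|R. J \<phi>)"
      unfolding set_lebesgue_integral_def by (rule Bochner_Integration.integral_cong) auto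
    moreover have "exp (- b / 2) * measure R B \<le> (LINT \<phi>|R. J \<phi>)"
    proof -
      have "exp (- b / 2) * measure R B = (LINT \<phi>|R. exp (- b / 2) * indicator B \<phi>)"
        using B(1) by simp
      also have "\<dots> \<le> (LINT \<phi>|R. J \<phi>)"
      proof (rule integral_mono[OF _ J])
        show "integrable R (\<lambda>\<phi>. exp (- b / 2) * indicator B \<phi>)" using B(1) by (simp add: emeasure_eq_measure)
        show "exp (- b / 2) * indicator B \<phi> \<le> J \<phi>" for \<phi>
          using B(2)[of \<phi>] J0[of \<phi>] by (auto simp: J_def indicator_def)
      qed
      finally show ?thesis .
    qed
    ultimately have den: "exp (- b / 2) * measure R B \<le> (LINT \<phi>:space R|R. J \<phi>)" by simp
    have num0: "0 \<le> (LINT \<phi>:A|R. J \<phi>)"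
      unfolding set_lebesgue_integral_def by (rule Bochner_Integration.integral_nonneg) (use J0 in \<open>auto simp: less_imp_le\<close>)
    have num: "(LINT \<phi>:A|R. J \<phi>) \<le> exp (- a / 2)"
    proof (cases "integrable R (\<lambda>\<phi>. indicator A \<phi> *\<^sub>R J \<phi>)")
      case True
      have "(LINT \<phi>:A|R. J \<phi>) \<le> (LINT \<phi>|R. exp (- a / 2))"
        unfolding set_lebesgue_integral_def
      proof (rule integral_mono[OF True])
        show "indicator A \<phi> *\<^sub>R J \<phi> \<le> exp (- a / 2)" if "\<phi> \<in> space R" for \<phi>
          using A[OF _ that] by (auto simp: J_def indicator_def)
      qed simp
      then show ?thesis by (simp add: prob_space)
    next
      case False
      then show ?thesis unfolding set_lebesgue_integral_def by (simp add: not_integrable_integral_eq)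
    qed
    have d0: "0 < exp (- b / 2) * measure R B" using B(3) by simp
    have "(LINT \<phi>:A|R. L \<phi>) / (LINT \<phi>:space R|R. L \<phi>) = (LINT \<phi>:A|R. J \<phi>) / (LINT \<phi>:space R|R. J \<phi>)"
      unfolding e using \<kappa> by simp
    then have "\<bar>(LINT \<phi>:A|R. L \<phi>) / (LINT \<phi>:space R|R. L \<phi>)\<bar> = \<bar>(LINT \<phi>:A|R. J \<phi>) / (LINT \<phi>:space R|R. J \<phi>)\<bar>"
      by (rule arg_cong)
    also have "\<dots> = (LINT \<phi>:A|R. J \<phi>) / (LINT \<phi>:space R|R. J \<phi>)"
      using num0 den d0 by (intro abs_of_nonneg divide_nonneg_nonneg) auto
    also have "\<dots> \<le> exp (- a / 2) / (exp (- b / 2) * measure R B)"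
      by (intro frac_le num den d0) simp
    also have "\<dots> = exp (- (a - b) / 2) / measure R B"
    proof -
      have "- a / 2 - (- b / 2) = - (a - b) / 2" by (simp only: diff_divide_distrib[symmetric] minus_diff_eq) simp
      then show ?thesis unfolding divide_divide_eq_left[symmetric] exp_diff[symmetric] by (simp only:)
    qed
    finally show ?thesis .
  qed
qed

section \<open>Typical samples\<close>

text \<open>Markov's inequality for \<open>W\<close>, whose expectation stays bounded while \<open>n\<close> grows.\<close>

lemma (in prob_space) converges_in_prob_perturb:
  assumes A: "\<And>n. A n \<in> borel_measurable M" "converges_in_prob M A l"
    and W: "\<And>n. integrable M (W n)" "\<And>n \<omega>. 0 \<le> W n \<omega>" "\<And>n. (\<integral>\<omega>. W n \<omega> \<partial>M) \<le> c"
    and near: "\<And>n \<omega>. N \<le> n \<Longrightarrow> \<bar>B n \<omega> - A n \<omega>\<bar> \<le> W n \<omega> / real n"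
  shows "converges_in_prob M B l"
  unfolding converges_in_prob_def
proof (intro allI impI)
  fix \<epsilon> :: real assume e: "0 < \<epsilon>"
  note [measurable] = A(1) borel_measurable_integrable[OF W(1)]
  let ?p = "\<lambda>n. measure M {\<omega> \<in> space M. \<bar>A n \<omega> - l\<bar> > \<epsilon> / 2}"
  have "0 < \<epsilon> / 2" using e by simp
  then have "?p \<longlonglongrightarrow> 0" by (rule A(2)[unfolded converges_in_prob_def, rule_format])
  moreover have "(\<lambda>n. (c * 2 / \<epsilon>) * inverse (real n)) \<longlonglongrightarrow> (c * 2 / \<epsilon>) * 0"
    by (intro tendsto_mult tendsto_const LIMSEQ_inverse_real_of_nat lim_inverse_n)
  ultimately have lim: "(\<lambda>n. ?p n + (c * 2 / \<epsilon>) * inverse (real n)) \<longlonglongrightarrow> 0"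
    using tendsto_add[of ?p 0 sequentially "\<lambda>n. (c * 2 / \<epsilon>) * inverse (real n)" "(c * 2 / \<epsilon>) * 0"] by simp
  have "measure M {\<omega> \<in> space M. \<bar>B n \<omega> - l\<bar> > \<epsilon>} \<le> ?p n + (c * 2 / \<epsilon>) * inverse (real n)" if n: "max N 1 \<le> n" for n
  proof -
    have n0: "0 < real n" "N \<le> n" using n by auto
    let ?E = "{\<omega> \<in> space M. \<bar>A n \<omega> - l\<bar> > \<epsilon> / 2}" and ?F = "{\<omega> \<in> space M. \<epsilon> / 2 * real n \<le> W n \<omega>}"
    have "{\<omega> \<in> space M. \<bar>B n \<omega> - l\<bar> > \<epsilon>} \<subseteq> ?E \<union> ?F"
    proof (rule subsetI, rule ccontr)
      fix \<omega> assume w: "\<omega> \<in> {\<omega> \<in> space M. \<bar>B n \<omega> - l\<bar> > \<epsilon>}" "\<omega> \<notin> ?E \<union> ?F"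
      then have "W n \<omega> < \<epsilon> / 2 * real n" "\<bar>A n \<omega> - l\<bar> \<le> \<epsilon> / 2" "\<bar>B n \<omega> - l\<bar> > \<epsilon>" by auto
      moreover have "W n \<omega> / real n < \<epsilon> / 2" if "W n \<omega> < \<epsilon> / 2 * real n"
        using that by (subst pos_divide_less_eq[OF n0(1)])
      ultimately show False using near[OF n0(2), of \<omega>] by linarith
    qed
    then have "measure M {\<omega> \<in> space M. \<bar>B n \<omega> - l\<bar> > \<epsilon>} \<le> measure M (?E \<union> ?F)"
      by (rule finite_measure_mono) measurable
    also have "\<dots> \<le> measure M ?E + measure M ?F"
      by (rule measure_Un_le) measurable
    also have "measure M ?F \<le> (\<integral>\<omega>. W n \<omega> \<partial>M) / (\<epsilon> / 2 * real n)"
      by (rule integral_Markov_inequality_measure[OF W(1), of "{}"]) (use W(2) e n0 in auto)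
    also have "\<dots> \<le> c / (\<epsilon> / 2 * real n)" by (intro divide_right_mono W(3)) (use e n0 in auto)
    also have "\<dots> = (c * 2 / \<epsilon>) * inverse (real n)" using e n0 by (simp add: field_simps)
    finally show ?thesis by simp
  qed
  then have ev: "\<forall>\<^sub>F n in sequentially. measure M {\<omega> \<in> space M. \<bar>B n \<omega> - l\<bar> > \<epsilon>} \<le> ?p n + (c * 2 / \<epsilon>) * inverse (real n)"
    unfolding eventually_sequentially by (intro exI[of _ "max N 1"]) simp
  show "(\<lambda>n. measure M {\<omega> \<in> space M. \<bar>B n \<omega> - l\<bar> > \<epsilon>}) \<longlonglongrightarrow> 0"
    by (rule tendsto_sandwich[OF _ ev tendsto_const lim]) simp
qed

lemma (in prob_space) finite_family_in_prob:
  assumes I: "finite I" and Y: "\<And>i n. i \<in> I \<Longrightarrow> Y i n \<in> borel_measurable M"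
    and conv: "\<And>i. i \<in> I \<Longrightarrow> converges_in_prob M (Y i) (l i)" and d: "0 < d"
  shows "(\<lambda>n. measure M {\<omega> \<in> space M. \<exists>i\<in>I. d < \<bar>Y i n \<omega> - l i\<bar>}) \<longlonglongrightarrow> 0"
    and "{\<omega> \<in> space M. \<exists>i\<in>I. d < \<bar>Y i n \<omega> - l i\<bar>} \<in> sets M"
proof -
  have eq: "{\<omega> \<in> space M. \<exists>i\<in>I. d < \<bar>Y i n \<omega> - l i\<bar>} = (\<Union>i\<in>I. {\<omega> \<in> space M. d < \<bar>Y i n \<omega> - l i\<bar>})" for n by auto
  have ms: "{\<omega> \<in> space M. d < \<bar>Y i n \<omega> - l i\<bar>} \<in> sets M" if "i \<in> I" for i n
  proof -
    note [measurable] = Y[OF that]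
    show ?thesis by measurable
  qed
  show "{\<omega> \<in> space M. \<exists>i\<in>I. d < \<bar>Y i n \<omega> - l i\<bar>} \<in> sets M"
    unfolding eq by (rule sets.finite_UN[OF I ms])
  have "(\<lambda>n. \<Sum>i\<in>I. measure M {\<omega> \<in> space M. d < \<bar>Y i n \<omega> - l i\<bar>}) \<longlonglongrightarrow> (\<Sum>i\<in>I. 0)"
    by (rule tendsto_sum) (use conv d in \<open>auto simp: converges_in_prob_def\<close>)
  then have lim: "(\<lambda>n. \<Sum>i\<in>I. measure M {\<omega> \<in> space M. d < \<bar>Y i n \<omega> - l i\<bar>}) \<longlonglongrightarrow> 0" by simp
  have "measure M {\<omega> \<in> space M. \<exists>i\<in>I. d < \<bar>Y i n \<omega> - l i\<bar>} \<le> (\<Sum>i\<in>I. measure M {\<omega> \<in> space M. d < \<bar>Y i n \<omega> - l i\<bar>})" for n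
    unfolding eq by (rule finite_measure_subadditive_finite[OF I]) (use ms in auto)
  then show "(\<lambda>n. measure M {\<omega> \<in> space M. \<exists>i\<in>I. d < \<bar>Y i n \<omega> - l i\<bar>}) \<longlonglongrightarrow> 0"
    by (intro tendsto_sandwich[OF _ _ tendsto_const lim] always_eventually allI) simp
qed

text \<open>The shifts by \<open>k\<close> and by \<open>- k\<close> contribute equally, by reindexing.\<close>

lemma cyclic_shift_sum:
  fixes x :: "nat \<Rightarrow> real"
  assumes "k \<le> n" "0 < n"
  shows "(\<Sum>t<n. x t * circ n (cosk k) x t) = (\<Sum>t<n. x t * x ((t + k) mod n))"
proof -
  have "(\<Sum>t<n. x t * x ((t + n - k) mod n)) = (\<Sum>t<n. x ((t + k) mod n) * x t)"
  proof (rule sum.reindex_bij_witness[of _ "\<lambda>t. (t + k) mod n" "\<lambda>t. (t + n - k) mod n"])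
    fix t assume "t \<in> {..<n}"
    then have t: "t < n" by simp
    have a: "((t + n - k) mod n + k) mod n = t"
    proof -
      have "((t + n - k) mod n + k) mod n = (t + n - k + k) mod n" by (rule mod_add_left_eq)
      then show ?thesis using t assms by simp
    qed
    have b: "((t + k) mod n + n - k) mod n = t"
    proof -
      have "((t + k) mod n + n - k) mod n = ((t + k) mod n + (n - k)) mod n" using assms by simp
      also have "\<dots> = (t + k + (n - k)) mod n" by (rule mod_add_left_eq)
      finally show ?thesis using t assms by simp
    qed
    show "((t + n - k) mod n + k) mod n = t" "((t + k) mod n + n - k) mod n = t" by (fact a, fact b)
    show "(t + n - k) mod n \<in> {..<n}" "(t + k) mod n \<in> {..<n}" using assms by auto
    show "x (((t + n - k) mod n + k) mod n) * x ((t + n - k) mod n) = x t * x ((t + n - k) mod n)" unfolding a ..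
  qed
  then have "(\<Sum>t<n. x t * x ((t + k) mod n)) = ((\<Sum>t<n. x t * x ((t + k) mod n)) + (\<Sum>t<n. x t * x ((t + n - k) mod n))) / 2"
    by (simp add: mult.commute)
  also have "\<dots> = (\<Sum>t<n. x t * circ n (cosk k) x t)"
    unfolding sum.distrib[symmetric] sum_divide_distrib
  proof (rule sum.cong[OF refl])
    fix t assume "t \<in> {..<n}"
    then have "circ n (cosk k) x t = (x ((t + k) mod n) + x ((t + n - k) mod n)) / 2"
      using assms by (intro circ_cos) auto
    then show "(x t * x ((t + k) mod n) + x t * x ((t + n - k) mod n)) / 2 = x t * circ n (cosk k) x t"
      by (simp only: distrib_left times_divide_eq_right)
  qed
  finally show ?thesis ..
qed

context remotely_uncorrelated_series
begin

abbreviation sample :: "'a \<Rightarrow> nat \<Rightarrow> real" where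
  "sample \<omega> \<equiv> \<lambda>t. X (int t + 1) \<omega>"

lemma gamma_symmetric: "\<gamma> (- k) = \<gamma> k"
proof -
  have "\<gamma> (- k) = (\<integral>\<omega>. X 0 \<omega> * X (- k) \<omega> \<partial>P)" unfolding expectation_product by simp
  also have "\<dots> = (\<integral>\<omega>. X (- k) \<omega> * X 0 \<omega> \<partial>P)" by (simp only: mult.commute)
  also have "\<dots> = \<gamma> k" unfolding expectation_product by simp
  finally show ?thesis .
qed

lemma expectation_square: "(\<integral>\<omega>. (X s \<omega>)\<^sup>2 \<partial>P) = \<gamma> 0"
  using expectation_product[of s s] by (simp add: power2_eq_square)

lemma gamma_0_nonneg: "0 \<le> \<gamma> 0"
  unfolding expectation_square[of 0, symmetric] by simp

lemma mean_squares:
  "integrable P (\<lambda>\<omega>. ((X s \<omega>)\<^sup>2 + (X t \<omega>)\<^sup>2) / 2)" "(\<integral>\<omega>. ((X s \<omega>)\<^sup>2 + (X t \<omega>)\<^sup>2) / 2 \<partial>P) = \<gamma> 0"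
  using square_integrable by (auto simp: expectation_square)

text \<open>The cyclic and the ordinary sample autocovariance differ in the last \<open>k\<close> products only.\<close>

lemma cyclic_autocovariance_converges:
  "converges_in_prob P (\<lambda>n \<omega>. (\<Sum>t<n. sample \<omega> t * circ n (cosk k) (sample \<omega>) t) / real n) (\<gamma> (int k))"
proof (rule converges_in_prob_perturb[OF _ sample_autocovariance_converges])
  define w where "w n t \<omega> = ((X (int t + 1) \<omega>)\<^sup>2 + (X (int ((t + k) mod n) + 1) \<omega>)\<^sup>2) / 2 +
    ((X (int t + 1) \<omega>)\<^sup>2 + (X (int t + 1 + int k) \<omega>)\<^sup>2) / 2" for n t \<omega>
  define W where "W n \<omega> = (\<Sum>t\<in>{n - k..<n}. w n t \<omega>)" for n \<omega>
  have wi: "integrable P (\<lambda>\<omega>. w n t \<omega>)" for n t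
    unfolding w_def by (rule Bochner_Integration.integrable_add[OF mean_squares(1) mean_squares(1)])
  have we: "(\<integral>\<omega>. w n t \<omega> \<partial>P) = 2 * \<gamma> 0" for n t
    unfolding w_def Bochner_Integration.integral_add[OF mean_squares(1) mean_squares(1)] mean_squares(2) by simp
  show "integrable P (W n)" for n unfolding W_def by (rule Bochner_Integration.integrable_sum[OF wi])
  show "0 \<le> W n \<omega>" for n \<omega> unfolding W_def w_def by (intro sum_nonneg) simp
  show "(\<integral>\<omega>. W n \<omega> \<partial>P) \<le> real k * (2 * \<gamma> 0)" for n
  proof -
    have "(\<integral>\<omega>. W n \<omega> \<partial>P) = (\<Sum>t\<in>{n - k..<n}. 2 * \<gamma> 0)"
      unfolding W_def Bochner_Integration.integral_sum[OF wi] we ..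
    also have "\<dots> = real (n - (n - k)) * (2 * \<gamma> 0)" by simp
    also have "\<dots> \<le> real k * (2 * \<gamma> 0)" by (intro mult_right_mono) (use gamma_0_nonneg in auto)
    finally show ?thesis .
  qed
  have ab: "\<bar>a * b\<bar> \<le> (a\<^sup>2 + b\<^sup>2) / 2" for a b :: real
    using zero_le_power2[of "a - b"] zero_le_power2[of "a + b"] unfolding power2_diff power2_sum by (auto simp: abs_le_iff)
  fix n \<omega> assume "max k 1 \<le> n"
  then have n: "k \<le> n" "0 < n" by auto
  define x where "x = sample \<omega>"
  define y where "y t = X (int t + 1 + int k) \<omega>" for t
  have "x (t + k) = y t" for t by (simp add: x_def y_def add_ac)
  then have same: "x ((t + k) mod n) = y t" if "t < n - k" for t using that by simp
  have "(\<Sum>t<n. x t * x ((t + k) mod n)) - (\<Sum>t<n. x t * y t) = (\<Sum>t<n. x t * x ((t + k) mod n) - x t * y t)"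
    by (simp add: sum_subtractf)
  also have "\<dots> = (\<Sum>t\<in>{n - k..<n}. x t * x ((t + k) mod n) - x t * y t)"
  proof (rule sum.mono_neutral_right)
    show "\<forall>t\<in>{..<n} - {n - k..<n}. x t * x ((t + k) mod n) - x t * y t = 0"
    proof
      fix t assume "t \<in> {..<n} - {n - k..<n}"
      then have "t < n - k" by auto
      then show "x t * x ((t + k) mod n) - x t * y t = 0" unfolding same[OF \<open>t < n - k\<close>] by simp
    qed
  qed auto
  finally have "\<bar>(\<Sum>t<n. x t * x ((t + k) mod n)) - (\<Sum>t<n. x t * y t)\<bar> \<le> (\<Sum>t\<in>{n - k..<n}. \<bar>x t * x ((t + k) mod n) - x t * y t\<bar>)"
    by simp
  also have "\<dots> \<le> (\<Sum>t\<in>{n - k..<n}. ((x t)\<^sup>2 + (x ((t + k) mod n))\<^sup>2) / 2 + ((x t)\<^sup>2 + (y t)\<^sup>2) / 2)"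
  proof (rule sum_mono)
    fix t
    show "\<bar>x t * x ((t + k) mod n) - x t * y t\<bar> \<le> ((x t)\<^sup>2 + (x ((t + k) mod n))\<^sup>2) / 2 + ((x t)\<^sup>2 + (y t)\<^sup>2) / 2"
      using ab[of "x t" "x ((t + k) mod n)"] ab[of "x t" "y t"] by linarith
  qed
  also have "\<dots> = W n \<omega>" unfolding W_def w_def x_def y_def ..
  finally have "\<bar>(\<Sum>t<n. x t * circ n (cosk k) x t) - (\<Sum>t<n. x t * y t)\<bar> / real n \<le> W n \<omega> / real n"
    unfolding cyclic_shift_sum[OF n] by (rule divide_right_mono) simp
  then show "\<bar>(\<Sum>t<n. sample \<omega> t * circ n (cosk k) (sample \<omega>) t) / real n - (\<Sum>i<n. X (int i + 1) \<omega> * X (int i + 1 + int k) \<omega>) / real n\<bar> \<le> W n \<omega> / real n"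
    unfolding diff_divide_distrib[symmetric] abs_divide x_def y_def by simp
next
  show "(\<lambda>\<omega>. (\<Sum>i<n. X (int i + 1) \<omega> * X (int i + 1 + int k) \<omega>) / real n) \<in> borel_measurable P" for n
    by measurable
qed

text \<open>At most \<open>4 * k\<close> squares of sample values are involved, each with expectation \<open>\<gamma> 0\<close>.\<close>

lemma corner_negligible:
  "converges_in_prob P (\<lambda>n \<omega>. (nrm n (defect n (cosk k) (circ n (cosk l) (sample \<omega>))))\<^sup>2 / real n) 0"
proof (rule converges_in_prob_perturb[where A="\<lambda>n \<omega>. 0"])
  define w where "w n t \<omega> = ((X (int ((t + l) mod n) + 1) \<omega>)\<^sup>2 + (X (int ((t + n - l) mod n) + 1) \<omega>)\<^sup>2) / 2" for n t \<omega>
  define W where "W n \<omega> = 2 * pi\<^sup>2 * ((\<Sum>t<k. w n t \<omega>) + (\<Sum>t\<in>{n - k..<n}. w n t \<omega>))" for n \<omega>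
  have wi: "integrable P (w n t)" "(\<integral>\<omega>. w n t \<omega> \<partial>P) = \<gamma> 0" for n t unfolding w_def using mean_squares by auto
  have wi': "integrable P (\<lambda>\<omega>. w n t \<omega>)" for n t using wi(1) by simp
  have w0: "0 \<le> w n t \<omega>" for n t \<omega> unfolding w_def by simp
  show "(\<lambda>\<omega>. 0) \<in> borel_measurable P" by simp
  show "converges_in_prob P (\<lambda>n \<omega>. 0) 0" unfolding converges_in_prob_def by auto
  show Wi: "integrable P (W n)" for n unfolding W_def
    by (intro integrable_mult_right Bochner_Integration.integrable_add Bochner_Integration.integrable_sum wi')
  show "0 \<le> W n \<omega>" for n \<omega> unfolding W_def by (intro mult_nonneg_nonneg add_nonneg_nonneg sum_nonneg w0) auto
  show "(\<integral>\<omega>. W n \<omega> \<partial>P) \<le> 2 * pi\<^sup>2 * (real k * \<gamma> 0 + real k * \<gamma> 0)" for n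
  proof -
    have s: "integrable P (\<lambda>\<omega>. \<Sum>t\<in>J. w n t \<omega>)" "(\<integral>\<omega>. (\<Sum>t\<in>J. w n t \<omega>) \<partial>P) = real (card J) * \<gamma> 0" for J
      using wi by auto
    have "(\<integral>\<omega>. W n \<omega> \<partial>P) = 2 * pi\<^sup>2 * (real k * \<gamma> 0 + real (card {n - k..<n}) * \<gamma> 0)"
      unfolding W_def integral_mult_right_zero Bochner_Integration.integral_add[OF s(1) s(1)] s(2) by simp
    also have "\<dots> \<le> 2 * pi\<^sup>2 * (real k * \<gamma> 0 + real k * \<gamma> 0)"
      by (intro mult_left_mono add_left_mono mult_right_mono gamma_0_nonneg) auto
    finally show ?thesis .
  qed
  fix n \<omega> assume n: "max k l \<le> n"
  define z where "z = circ n (cosk l) (sample \<omega>)"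
  have z: "(z t)\<^sup>2 \<le> w n t \<omega>" if "t < n" for t
  proof -
    have "((a + b) / 2)\<^sup>2 \<le> (a\<^sup>2 + b\<^sup>2) / 2" for a b :: real
      using zero_le_power2[of "a - b"] unfolding power_divide power2_diff power2_sum by simp
    then show ?thesis using that n unfolding z_def w_def by (subst circ_cos) auto
  qed
  have "(nrm n (defect n (cosk k) z))\<^sup>2 \<le> 2 * pi\<^sup>2 * ((\<Sum>t<k. (z t)\<^sup>2) + (\<Sum>t\<in>{n - k..<n}. (z t)\<^sup>2))"
    unfolding defect_def[abs_def] using n by (intro nrm_corner_sq) simp
  also have "\<dots> \<le> W n \<omega>" unfolding W_def
    by (intro mult_left_mono add_mono sum_mono z) (use n in auto)
  finally have "(nrm n (defect n (cosk k) z))\<^sup>2 / real n \<le> W n \<omega> / real n" by (rule divide_right_mono) simp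
  then show "\<bar>(nrm n (defect n (cosk k) (circ n (cosk l) (sample \<omega>))))\<^sup>2 / real n - 0\<bar> \<le> W n \<omega> / real n"
    unfolding z_def by simp
qed

text \<open>The exceptional events are chosen measurable so that they can bound the measure of sets whose
  measurability is unknown. Lag \<open>0\<close> gives the bound on the norm.\<close>

lemma typical_sample:
  assumes d: "0 < d"
  shows "\<exists>bad. (\<forall>n. bad n \<in> sets P) \<and> (\<lambda>n. measure P (bad n)) \<longlonglongrightarrow> 0 \<and>
    (\<forall>n>0. \<forall>\<omega>\<in>space P - bad n. (nrm n (sample \<omega>))\<^sup>2 \<le> (\<gamma> 0 + 1) * real n \<and>
      (\<forall>k\<le>D. \<bar>(\<Sum>t<n. sample \<omega> t * circ n (cosk k) (sample \<omega>) t) / real n - \<gamma> (int k)\<bar> \<le> d) \<and>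
      (\<forall>k\<le>D. \<forall>l\<le>D. (nrm n (defect n (cosk k) (circ n (cosk l) (sample \<omega>))))\<^sup>2 \<le> d\<^sup>2 * real n))"
proof -
  define S where "S k n \<omega> = (\<Sum>t<n. sample \<omega> t * circ n (cosk k) (sample \<omega>) t) / real n" for k n \<omega>
  define T where "T p n \<omega> = (nrm n (defect n (cosk (fst p)) (circ n (cosk (snd p)) (sample \<omega>))))\<^sup>2 / real n" for p n \<omega>
  have fm: "(\<lambda>\<omega>. fcoef n (\<lambda>t. f t \<omega>) i) \<in> borel_measurable P" if "\<And>t. f t \<in> borel_measurable P" for f n i
    unfolding fcoef_def by (intro borel_measurable_sum borel_measurable_times borel_measurable_const that)
  have cm: "(\<lambda>\<omega>. circ n \<xi> (\<lambda>t. f t \<omega>) t) \<in> borel_measurable P" if "\<And>t. f t \<in> borel_measurable P" for f n \<xi> t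
    unfolding circ_def by (intro borel_measurable_sum borel_measurable_times borel_measurable_const fm that)
  have tm: "(\<lambda>\<omega>. toep n \<xi> (\<lambda>t. f t \<omega>) t) \<in> borel_measurable P" if "\<And>t. f t \<in> borel_measurable P" for f n \<xi> t
    unfolding toep_def by (intro borel_measurable_sum borel_measurable_times borel_measurable_const that)
  have Sm: "S k n \<in> borel_measurable P" for k n
    unfolding S_def by (intro borel_measurable_divide borel_measurable_sum borel_measurable_times borel_measurable_const cm X_meas)
  have Tm: "T p n \<in> borel_measurable P" for p n
    unfolding T_def nrm_sq defect_def[abs_def]
    by (intro borel_measurable_divide borel_measurable_sum borel_measurable_power borel_measurable_diff
      borel_measurable_times borel_measurable_const cm tm X_meas)
  define d1 where "d1 = min d 1"
  have d1: "0 < d1" "d1 \<le> d" "d1 \<le> 1" "0 < d\<^sup>2" using d by (auto simp: d1_def)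
  define E where "E n = {\<omega> \<in> space P. \<exists>k\<in>{..D}. d1 < \<bar>S k n \<omega> - \<gamma> (int k)\<bar>}" for n
  define F where "F n = {\<omega> \<in> space P. \<exists>p\<in>{..D} \<times> {..D}. d\<^sup>2 < \<bar>T p n \<omega> - 0\<bar>}" for n
  have E: "(\<lambda>n. measure P (E n)) \<longlonglongrightarrow> 0" "\<And>n. E n \<in> sets P"
    unfolding E_def
    by (rule finite_family_in_prob; use Sm d1 cyclic_autocovariance_converges in \<open>auto simp: S_def[abs_def]\<close>)+
  have F: "(\<lambda>n. measure P (F n)) \<longlonglongrightarrow> 0" "\<And>n. F n \<in> sets P"
    unfolding F_def
    by (rule finite_family_in_prob[where l="\<lambda>p. 0"]; use Tm d1 corner_negligible in \<open>auto simp: T_def[abs_def]\<close>)+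
  have sum: "(\<lambda>n. measure P (E n) + measure P (F n)) \<longlonglongrightarrow> 0" using tendsto_add[OF E(1) F(1)] by simp
  have le: "\<forall>\<^sub>F n in sequentially. measure P (E n \<union> F n) \<le> measure P (E n) + measure P (F n)"
    by (rule always_eventually, rule allI, rule measure_Un_le[OF E(2) F(2)])
  have ge: "\<forall>\<^sub>F n in sequentially. 0 \<le> measure P (E n \<union> F n)"
    by (rule always_eventually, rule allI, rule measure_nonneg)
  have lim: "(\<lambda>n. measure P (E n \<union> F n)) \<longlonglongrightarrow> 0"
    by (rule tendsto_sandwich[OF ge le tendsto_const sum])
  have good: "(nrm n (sample \<omega>))\<^sup>2 \<le> (\<gamma> 0 + 1) * real n \<and>
      (\<forall>k\<le>D. \<bar>(\<Sum>t<n. sample \<omega> t * circ n (cosk k) (sample \<omega>) t) / real n - \<gamma> (int k)\<bar> \<le> d) \<and>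
      (\<forall>k\<le>D. \<forall>l\<le>D. (nrm n (defect n (cosk k) (circ n (cosk l) (sample \<omega>))))\<^sup>2 \<le> d\<^sup>2 * real n)"
    if n: "0 < n" and w: "\<omega> \<in> space P - (E n \<union> F n)" for n \<omega>
  proof (intro conjI allI impI)
    have S: "\<bar>S k n \<omega> - \<gamma> (int k)\<bar> \<le> d1" if "k \<le> D" for k using w that unfolding E_def by force
    have rn: "0 < real n" using n by simp
    have "S 0 n \<omega> = (nrm n (sample \<omega>))\<^sup>2 / real n"
      unfolding S_def cyclic_shift_sum[OF le0 n] nrm_sq by (simp add: power2_eq_square)
    then have "(nrm n (sample \<omega>))\<^sup>2 / real n \<le> \<gamma> 0 + 1" using S[of 0] d1(3) by simp
    then show "(nrm n (sample \<omega>))\<^sup>2 \<le> (\<gamma> 0 + 1) * real n" by (subst (asm) pos_divide_le_eq[OF rn])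
    show "\<bar>(\<Sum>t<n. sample \<omega> t * circ n (cosk k) (sample \<omega>) t) / real n - \<gamma> (int k)\<bar> \<le> d" if "k \<le> D" for k
      using S[OF that] d1(2) unfolding S_def by linarith
    show "(nrm n (defect n (cosk k) (circ n (cosk l) (sample \<omega>))))\<^sup>2 \<le> d\<^sup>2 * real n" if "k \<le> D" "l \<le> D" for k l
    proof -
      have "\<bar>T (k, l) n \<omega> - 0\<bar> \<le> d\<^sup>2" using w that unfolding F_def by force
      then have "T (k, l) n \<omega> \<le> d\<^sup>2" by linarith
      then show ?thesis unfolding T_def by (simp add: pos_divide_le_eq[OF rn])
    qed
  qed
  show ?thesis
  proof (intro exI[of _ "\<lambda>n. E n \<union> F n"] conjI allI impI ballI lim)
    show "E n \<union> F n \<in> sets P" for n by (rule sets.Un[OF E(2) F(2)])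
  qed (use good in simp_all)
qed

end

section \<open>Posterior concentration\<close>

lemma Theta_admissible:
  assumes "0 \<le> M" "\<phi> \<in> Theta m M"
  shows "admissible m M \<phi>"
proof -
  have b: "\<forall>x\<in>{0..1}. \<forall>y\<in>{0..1}. \<forall>z\<in>{0..1}. y \<noteq> z \<longrightarrow> \<bar>\<phi> x\<bar> + \<bar>(\<phi> y - \<phi> z) / (y - z)\<bar> \<le> M"
    and low: "\<forall>x\<in>{0..1}. m \<le> \<phi> x"
    using assms(2) unfolding Theta_iff[OF assms(1)] by auto
  have "\<bar>\<phi> x - \<phi> y\<bar> \<le> M * \<bar>x - y\<bar>" if "x \<in> {0..1}" "y \<in> {0..1}" for x y
  proof (cases "x = y")
    case False
    have "\<bar>\<phi> x\<bar> + \<bar>(\<phi> x - \<phi> y) / (x - y)\<bar> \<le> M" using b that False by simp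
    then have "\<bar>\<phi> x - \<phi> y\<bar> / \<bar>x - y\<bar> \<le> M" unfolding abs_divide by linarith
    then show ?thesis using False by (subst (asm) pos_divide_le_eq) auto
  qed simp
  moreover have "\<phi> x \<le> M" if "x \<in> {0..1}" for x
  proof -
    have "\<bar>\<phi> x\<bar> + \<bar>(\<phi> 0 - \<phi> 1) / (0 - 1)\<bar> \<le> M"
      by (rule b[rule_format]) (use that in auto)
    then show ?thesis by linarith
  qed
  ultimately show ?thesis using low unfolding admissible_def lipschitz01_def by simp
qed

lemma lip_const_finite:
  assumes "lip_const f < \<infinity>"
  obtains L where "0 \<le> L" "lipschitz01 L f"
proof
  define L where "L = enn2real (lip_const f)"
  show L0: "0 \<le> L" by (simp add: L_def)
  have "lip_const f \<le> ennreal L" using assms by (simp add: L_def ennreal_enn2real)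
  then have b: "\<forall>x\<in>{0..1}. \<forall>y\<in>{0..1}. x \<noteq> y \<longrightarrow> \<bar>(f x - f y) / (x - y)\<bar> \<le> L"
    unfolding lip_const_le_iff[OF L0] .
  show "lipschitz01 L f" unfolding lipschitz01_def
  proof (intro ballI)
    fix x y :: real assume xy: "x \<in> {0..1}" "y \<in> {0..1}"
    show "\<bar>f x - f y\<bar> \<le> L * \<bar>x - y\<bar>"
    proof (cases "x = y")
      case False
      then have "\<bar>f x - f y\<bar> / \<bar>x - y\<bar> \<le> L" using b xy unfolding abs_divide by simp
      then show ?thesis using False by (subst (asm) pos_divide_le_eq) auto
    qed simp
  qed
qed

text \<open>Combine \<open>kl_lower\<close> with \<open>\<bar>u - 1\<bar> = \<bar>sqrt u - 1\<bar> * (sqrt u + 1)\<close> for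
  \<open>u = q / p \<le> B / m\<close>.\<close>

lemma kl_separated:
  fixes p q :: real
  assumes "0 < m" "m \<le> p" "p \<le> M" "0 < q" "q \<le> B" and a: "0 \<le> a" "a \<le> \<bar>p - q\<bar>"
  shows "(a / M / (sqrt (B / m) + 1))\<^sup>2 \<le> q / p - 1 - ln (q / p)"
proof -
  have p: "0 < p" "0 < M" using assms by linarith+
  define u where "u = q / p"
  have u: "0 < u" "u \<le> B / m" using assms p by (auto simp: u_def intro!: frac_le)
  have "a / M \<le> \<bar>p - q\<bar> / p" using a p assms by (intro frac_le) auto
  also have "\<dots> = \<bar>u - 1\<bar>"
  proof -
    have "u - 1 = (q - p) / p" using p(1) by (simp add: u_def diff_divide_distrib)
    then show ?thesis using p(1) by (simp add: abs_minus_commute)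
  qed
  also have "\<dots> = \<bar>sqrt u - 1\<bar> * (sqrt u + 1)"
  proof -
    have "(sqrt u - 1) * (sqrt u + 1) = sqrt u * sqrt u - 1" by (simp add: algebra_simps)
    then have "u - 1 = (sqrt u - 1) * (sqrt u + 1)" using u(1) by simp
    then have "\<bar>u - 1\<bar> = \<bar>sqrt u - 1\<bar> * \<bar>sqrt u + 1\<bar>" by (simp only: abs_mult)
    then show ?thesis using u by simp
  qed
  also have "\<dots> \<le> \<bar>sqrt u - 1\<bar> * (sqrt (B / m) + 1)" using u by (intro mult_left_mono) auto
  finally have "a / M \<le> \<bar>sqrt u - 1\<bar> * (sqrt (B / m) + 1)" .
  moreover have "0 \<le> sqrt (B / m)" using u by simp
  then have pos: "0 < sqrt (B / m) + 1" by linarith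
  ultimately have "a / M / (sqrt (B / m) + 1) \<le> \<bar>sqrt u - 1\<bar>" by (subst pos_divide_le_eq)
  moreover have "0 \<le> a / M / (sqrt (B / m) + 1)" by (intro divide_nonneg_nonneg a(1) less_imp_le[OF pos] less_imp_le[OF p(2)])
  ultimately have "(a / M / (sqrt (B / m) + 1))\<^sup>2 \<le> \<bar>sqrt u - 1\<bar>\<^sup>2" by (rule power_mono)
  also have "\<dots> = (sqrt u - 1)\<^sup>2" by simp
  also have "\<dots> \<le> u - 1 - ln u" by (rule kl_lower[OF u(1)])
  finally show ?thesis unfolding u_def .
qed

lemma kl_near:
  fixes p q :: real
  assumes "0 < m" "m \<le> p" "m \<le> q" "\<bar>p - q\<bar> \<le> s"
  shows "q / p - 1 - ln (q / p) \<le> (s / m)\<^sup>2"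
proof -
  have p: "0 < p" "0 < q" using assms by linarith+
  have "q / p - 1 - ln (q / p) \<le> (q / p - 1)\<^sup>2 / (q / p)" by (rule kl_upper) (use p in simp)
  also have "\<dots> = (p - q)\<^sup>2 / (p * q)" using p by (simp add: power2_eq_square field_simps)
  also have "\<dots> \<le> s\<^sup>2 / (m * m)"
  proof (rule frac_le)
    have "\<bar>p - q\<bar>\<^sup>2 \<le> s\<^sup>2" by (rule power_mono) (use assms in auto)
    then show "(p - q)\<^sup>2 \<le> s\<^sup>2" by simp
    show "m * m \<le> p * q" by (rule mult_mono) (use assms p in auto)
  qed (use assms in auto)
  also have "\<dots> = (s / m)\<^sup>2" by (simp add: power2_eq_square)
  finally show ?thesis .
qed

lemma score_decomposition:
  fixes p q :: real
  assumes "0 < p" "0 < q"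
  shows "ln p + q / p = (ln q + 1) + (q / p - 1 - ln (q / p))"
  using assms by (simp add: ln_div)

text \<open>The difference between \<open>\<phi>\<close> and \<open>\<phi>0\<close> has Lipschitz constant \<open>M + L\<close>, so it
  keeps half of its size at \<open>x\<close> throughout distance \<open>s\<close>, and a proportion \<open>s / 4\<close> of
  the frequencies lies there.\<close>

lemma divergence_lower:
  assumes m: "0 < m" and \<phi>: "admissible m M \<phi>" and \<phi>0: "lipschitz01 L \<phi>0" "\<forall>u\<in>{0..1}. 0 < \<phi>0 u \<and> \<phi>0 u \<le> B"
    and x: "x \<in> {0..1}" "r / 2 \<le> \<bar>\<phi> x - \<phi>0 x\<bar>" and r: "0 < r"
    and s: "0 < s" "s \<le> 1 / 2" "(M + L) * s \<le> r / 4" "0 \<le> M + L" and n: "8 / s \<le> real n"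
  shows "(r / 4 / M / (sqrt (B / m) + 1))\<^sup>2 * (s / 4) * real n \<le>
    (\<Sum>i<n. \<phi>0 (grid n i) / \<phi> (grid n i) - 1 - ln (\<phi>0 (grid n i) / \<phi> (grid n i)))"
proof -
  define k where "k i = \<phi>0 (grid n i) / \<phi> (grid n i) - 1 - ln (\<phi>0 (grid n i) / \<phi> (grid n i))" for i
  define \<kappa> where "\<kappa> = (r / 4 / M / (sqrt (B / m) + 1))\<^sup>2"
  have \<phi>b: "m \<le> \<phi> u" "\<phi> u \<le> M" if "u \<in> {0..1}" for u using \<phi> that unfolding admissible_def by auto
  have lip: "\<bar>\<phi> u - \<phi> v\<bar> \<le> M * \<bar>u - v\<bar>" "\<bar>\<phi>0 u - \<phi>0 v\<bar> \<le> L * \<bar>u - v\<bar>" if "u \<in> {0..1}" "v \<in> {0..1}" for u v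
    using \<phi> \<phi>0(1) that unfolding admissible_def lipschitz01_def by auto
  obtain S where S: "S \<subseteq> {..<n}" "s / 4 * real n \<le> real (card S)" "\<forall>i\<in>S. \<bar>grid n i - x\<bar> \<le> s"
    using grid_points_near[OF s(1,2) x(1) n] by blast
  have k0: "0 \<le> k i" if "i < n" for i
  proof -
    have "0 < \<phi>0 (grid n i) / \<phi> (grid n i)" using \<phi>b(1)[OF grid_range[OF that]] m \<phi>0(2) grid_range[OF that] by (intro divide_pos_pos) auto
    then show ?thesis unfolding k_def by (rule order_trans[OF zero_le_power2 kl_lower])
  qed
  have kS: "\<kappa> \<le> k i" if "i \<in> S" for i
    unfolding \<kappa>_def k_def
  proof (rule kl_separated[OF m])
    have i: "i < n" using S(1) that by auto
    note g = grid_range[OF i]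
    show "m \<le> \<phi> (grid n i)" "\<phi> (grid n i) \<le> M" using \<phi>b[OF g] by auto
    show "0 < \<phi>0 (grid n i)" "\<phi>0 (grid n i) \<le> B" using \<phi>0(2) g by auto
    show "0 \<le> r / 4" using r by simp
    have "(M + L) * \<bar>grid n i - x\<bar> \<le> (M + L) * s" using S(3) that s(4) by (intro mult_left_mono) auto
    then have "M * \<bar>grid n i - x\<bar> + L * \<bar>grid n i - x\<bar> \<le> r / 4" using s(3) unfolding distrib_right by linarith
    then show "r / 4 \<le> \<bar>\<phi> (grid n i) - \<phi>0 (grid n i)\<bar>" using lip[OF g x(1)] x(2) by linarith
  qed
  have "\<kappa> * (s / 4) * real n = \<kappa> * (s / 4 * real n)" by simp
  also have "\<dots> \<le> \<kappa> * real (card S)" by (intro mult_left_mono S(2)) (simp add: \<kappa>_def)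
  also have "\<dots> = (\<Sum>i\<in>S. \<kappa>)" by simp
  also have "\<dots> \<le> (\<Sum>i\<in>S. k i)" by (rule sum_mono[OF kS])
  also have "\<dots> \<le> (\<Sum>i<n. k i)" by (rule sum_mono2) (use S(1) k0 in auto)
  finally show ?thesis unfolding \<kappa>_def k_def .
qed

lemma exp_decay_eventually_le:
  fixes g p \<epsilon> :: real
  assumes "0 < g" "0 < p" "0 < \<epsilon>"
  shows "\<forall>\<^sub>F n in sequentially. exp (- g * real n) / p \<le> \<epsilon>"
proof -
  have "(\<lambda>n. exp (- g) ^ n) \<longlonglongrightarrow> 0" by (rule LIMSEQ_power_zero) (use assms(1) in simp)
  then have "\<forall>\<^sub>F n in sequentially. exp (- g) ^ n < \<epsilon> * p"
    by (rule order_tendstoD(2)) (use assms in simp)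
  then show ?thesis
  proof (rule eventually_mono)
    fix n assume "exp (- g) ^ n < \<epsilon> * p"
    moreover have "exp (- g * real n) = exp (- g) ^ n" using exp_of_nat_mult[of n "- g"] by (simp add: mult.commute)
    ultimately show "exp (- g * real n) / p \<le> \<epsilon>" using assms(2) by (subst pos_divide_le_eq) auto
  qed
qed

text \<open>On distant functions the contrast exceeds the constant \<open>b0\<close> by \<open>(g - e) * n\<close> at least,
  and on \<open>B'\<close> by \<open>2 * e * n\<close> at most: one \<open>e\<close> from the quadratic form and one from
  the divergence. The gap is \<open>(g - 3 * e) * n \<ge> g * n / 2\<close>.\<close>

lemma posterior_mass_bound:
  fixes x :: "nat \<Rightarrow> real"
  assumes par: "continuous_on {0..1} \<phi>par" "\<forall>u\<in>{0..1}. b \<le> \<phi>par u" "0 < b"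
    and m: "0 < m" "0 \<le> M" and \<phi>0: "lipschitz01 L \<phi>0" "\<forall>u\<in>{0..1}. m \<le> \<phi>0 u \<and> \<phi>0 u \<le> B" "0 \<le> L"
    and r: "0 < r" and s: "0 < s" "s \<le> 1 / 2" "(M + L) * s \<le> r / 4" and n: "8 / s \<le> real n"
    and g: "g = (r / 4 / M / (sqrt (B / m) + 1))\<^sup>2 * (s / 4)"
    and quad: "\<And>\<phi> U. admissible m M \<phi> \<Longrightarrow>
      \<forall>t<n. toep n \<phi>par U t = circ n (root_ratio \<phi> \<phi>par) x t \<Longrightarrow>
      \<bar>(\<Sum>t<n. circ n (root_ratio \<phi> \<phi>par) x t * U t) - (\<Sum>i<n. \<phi>0 (grid n i) / \<phi> (grid n i))\<bar> \<le> e * real n"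
    and R: "prob_space R" "space R = Theta m M"
    and B: "B' \<in> sets R" "B' \<subseteq> Theta m M" "0 < measure R B'"
      "\<forall>\<phi>\<in>B'. \<forall>u\<in>{0..1}. \<bar>\<phi> u - \<phi>0 u\<bar> \<le> t" "(t / m)\<^sup>2 \<le> e"
    and ge: "6 * e \<le> g"
  shows "\<bar>pseudo_posterior n \<phi>par R (vec n x) {\<phi> \<in> Theta m M. sup_norm (\<lambda>x. \<phi> x - \<phi>0 x) \<ge> ennreal r}\<bar> \<le>
    exp (- (g / 4) * real n) / measure R B'"
proof -
  define gf where "gf \<phi> = (root_ratio \<phi> \<phi>par)" for \<phi>
  obtain \<kappa> where \<kappa>: "\<forall>\<phi> x. (\<forall>u\<in>{0..1}. 0 < \<phi> u) \<longrightarrow>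
    (\<exists>U. (\<forall>t<n. toep n \<phi>par U t = circ n (root_ratio \<phi> \<phi>par) x t) \<and>
      corrected_likelihood n \<phi>par \<phi> (vec n x) = \<kappa> * exp (- 1 / 2 *
        ((\<Sum>i<n. ln (\<phi> (grid n i))) + (\<Sum>t<n. circ n (root_ratio \<phi> \<phi>par) x t * U t))))"
    using likelihood_formula[OF par(1) par(2)[rule_format] par(3), of n] by blast
  have adm: "admissible m M \<phi>" if "\<phi> \<in> Theta m M" for \<phi> by (rule Theta_admissible[OF m(2) that])
  have \<phi>b: "m \<le> \<phi> u" "\<phi> u \<le> M" if "\<phi> \<in> Theta m M" "u \<in> {0..1}" for \<phi> u
    using adm[OF that(1)] that(2) unfolding admissible_def by auto
  have "\<forall>\<phi>\<in>Theta m M. \<exists>U. (\<forall>t<n. toep n \<phi>par U t = circ n (gf \<phi>) x t) \<and>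
      corrected_likelihood n \<phi>par \<phi> (vec n x) = \<kappa> * exp (- 1 / 2 *
        ((\<Sum>i<n. ln (\<phi> (grid n i))) + (\<Sum>t<n. circ n (gf \<phi>) x t * U t)))"
  proof
    fix \<phi> assume "\<phi> \<in> Theta m M"
    then have "\<forall>u\<in>{0..1}. 0 < \<phi> u" using \<phi>b(1)[of \<phi>] m by force
    then show "\<exists>U. (\<forall>t<n. toep n \<phi>par U t = circ n (gf \<phi>) x t) \<and>
      corrected_likelihood n \<phi>par \<phi> (vec n x) = \<kappa> * exp (- 1 / 2 *
        ((\<Sum>i<n. ln (\<phi> (grid n i))) + (\<Sum>t<n. circ n (gf \<phi>) x t * U t)))"
      unfolding gf_def by (rule \<kappa>[THEN spec, THEN spec, THEN mp])
  qed
  from bchoice[OF this] obtain Uf where Uf: "\<forall>\<phi>\<in>Theta m M. (\<forall>t<n. toep n \<phi>par (Uf \<phi>) t = circ n (gf \<phi>) x t) \<and>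
      corrected_likelihood n \<phi>par \<phi> (vec n x) = \<kappa> * exp (- 1 / 2 *
        ((\<Sum>i<n. ln (\<phi> (grid n i))) + (\<Sum>t<n. circ n (gf \<phi>) x t * Uf \<phi> t)))" ..
  define ell where "ell \<phi> = (\<Sum>i<n. ln (\<phi> (grid n i))) + (\<Sum>t<n. circ n (gf \<phi>) x t * Uf \<phi> t)" for \<phi>
  define kl where "kl \<phi> = (\<Sum>i<n. \<phi>0 (grid n i) / \<phi> (grid n i) - 1 - ln (\<phi>0 (grid n i) / \<phi> (grid n i)))" for \<phi>
  define b0 where "b0 = (\<Sum>i<n. ln (\<phi>0 (grid n i)) + 1)"
  have ell: "\<bar>ell \<phi> - (b0 + kl \<phi>)\<bar> \<le> e * real n" if \<phi>: "\<phi> \<in> Theta m M" for \<phi>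
  proof -
    have "(\<Sum>i<n. ln (\<phi> (grid n i))) + (\<Sum>i<n. \<phi>0 (grid n i) / \<phi> (grid n i)) = b0 + kl \<phi>"
      unfolding b0_def kl_def sum.distrib[symmetric]
    proof (rule sum.cong[OF refl])
      fix i assume "i \<in> {..<n}"
      then have gr: "grid n i \<in> {0..1}" by (intro grid_range) simp
      have "0 < \<phi> (grid n i)" "0 < \<phi>0 (grid n i)" using \<phi>b(1)[OF \<phi> gr] \<phi>0(2)[rule_format, OF gr] m by linarith+
      then show "ln (\<phi> (grid n i)) + \<phi>0 (grid n i) / \<phi> (grid n i) =
        (ln (\<phi>0 (grid n i)) + 1) + (\<phi>0 (grid n i) / \<phi> (grid n i) - 1 - ln (\<phi>0 (grid n i) / \<phi> (grid n i)))"
        by (rule score_decomposition)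
    qed
    moreover have "\<bar>(\<Sum>t<n. circ n (gf \<phi>) x t * Uf \<phi> t) - (\<Sum>i<n. \<phi>0 (grid n i) / \<phi> (grid n i))\<bar> \<le> e * real n"
      using quad[OF adm[OF \<phi>], of "Uf \<phi>"] Uf \<phi> unfolding gf_def by simp
    ultimately show ?thesis unfolding ell_def by linarith
  qed
  let ?A = "{\<phi> \<in> Theta m M. sup_norm (\<lambda>x. \<phi> x - \<phi>0 x) \<ge> ennreal r}"
  have "\<bar>(LINT \<phi>:?A|R. corrected_likelihood n \<phi>par \<phi> (vec n x)) / (LINT \<phi>:space R|R. corrected_likelihood n \<phi>par \<phi> (vec n x))\<bar>
    \<le> exp (- ((b0 + g * real n - e * real n) - (b0 + 2 * e * real n)) / 2) / measure R B'"
  proof (rule posterior_ratio_bound[OF R(1), where ell=ell and \<kappa>=\<kappa>])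
    show "corrected_likelihood n \<phi>par \<phi> (vec n x) = \<kappa> * exp (- 1 / 2 * ell \<phi>)" if "\<phi> \<in> space R" for \<phi>
      using Uf that unfolding R(2) ell_def by simp
    show "b0 + g * real n - e * real n \<le> ell \<phi>" if A: "\<phi> \<in> ?A" for \<phi>
    proof -
      have \<phi>: "\<phi> \<in> Theta m M" using A by simp
      have "\<exists>y\<in>{0..1}. r / 2 \<le> \<bar>\<phi> y - \<phi>0 y\<bar>"
      proof (rule ccontr)
        assume "\<not> ?thesis"
        then have "\<forall>y\<in>{0..1}. \<bar>\<phi> y - \<phi>0 y\<bar> \<le> r / 2" by force
        then have "sup_norm (\<lambda>x. \<phi> x - \<phi>0 x) \<le> ennreal (r / 2)" using sup_norm_le_iff[of "r / 2" "\<lambda>x. \<phi> x - \<phi>0 x"] r by simp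
        then have "ennreal r \<le> ennreal (r / 2)" using A by auto
        then show False using r by (simp add: ennreal_le_iff)
      qed
      then obtain y where y: "y \<in> {0..1}" "r / 2 \<le> \<bar>\<phi> y - \<phi>0 y\<bar>" by blast
      have "\<forall>u\<in>{0..1}. 0 < \<phi>0 u \<and> \<phi>0 u \<le> B" using \<phi>0(2) m by force
      then have "g * real n \<le> kl \<phi>" unfolding g kl_def
        by (intro divergence_lower[OF m(1) adm[OF \<phi>] \<phi>0(1) _ y r s(1,2,3) _ n]) (use m \<phi>0(3) in auto)
      then show ?thesis using ell[OF \<phi>] by linarith
    qed
    show "B' \<in> sets R" "measure R B' > 0" by fact+
    show "ell \<phi> \<le> b0 + 2 * e * real n" if "\<phi> \<in> B'" for \<phi>
    proof -
      have \<phi>: "\<phi> \<in> Theta m M" using that B(2) by blast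
      have "kl \<phi> \<le> (\<Sum>i<n. e)" unfolding kl_def
      proof (rule sum_mono)
        fix i assume "i \<in> {..<n}"
        then have gr: "grid n i \<in> {0..1}" by (intro grid_range) simp
        have "\<phi>0 (grid n i) / \<phi> (grid n i) - 1 - ln (\<phi>0 (grid n i) / \<phi> (grid n i)) \<le> (t / m)\<^sup>2"
          by (rule kl_near[OF m(1) \<phi>b(1)[OF \<phi> gr]]) (use \<phi>0(2) B(4) that gr in auto)
        then show "\<phi>0 (grid n i) / \<phi> (grid n i) - 1 - ln (\<phi>0 (grid n i) / \<phi> (grid n i)) \<le> e" using B(5) by linarith
      qed
      then have "kl \<phi> \<le> e * real n" by (simp add: mult.commute)
      then show ?thesis using ell[OF \<phi>] by linarith
    qed
  qed
  also have "\<dots> \<le> exp (- (g / 4) * real n) / measure R B'"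
  proof (rule divide_right_mono)
    have "6 * e * real n \<le> g * real n" by (rule mult_right_mono[OF ge]) simp
    then have "- ((b0 + g * real n - e * real n) - (b0 + 2 * e * real n)) / 2 \<le> - (g / 4) * real n" by simp
    then show "exp (- ((b0 + g * real n - e * real n) - (b0 + 2 * e * real n)) / 2) \<le> exp (- (g / 4) * real n)" by simp
  qed simp
  finally show ?thesis unfolding pseudo_posterior_def .
qed

theorem theorem3p1:
  fixes P :: "'a measure" and X :: "int \<Rightarrow> 'a \<Rightarrow> real"
    and \<gamma>0 :: "int \<Rightarrow> real" and \<phi>0 \<phi>par :: "real \<Rightarrow> real"
    and Q :: "'b measure" and G :: "'b \<Rightarrow> real measure" and K :: "'b \<Rightarrow> nat" and \<tau> :: "'b \<Rightarrow> real"
    and \<alpha> \<delta> m M r :: real and G0 :: "real measure"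
  assumes "prob_space P"
    and "\<And>k. X k \<in> borel_measurable P"
    and "strictly_stationary P X"
    and "\<And>k. integrable P (\<lambda>\<omega>. (X k \<omega>)\<^sup>2)"
    and "\<And>k. (LINT \<omega>|P. X k \<omega>) = 0"
    and "\<gamma>0 = autocov P X"
    and "AE \<omega> in P. real_cond_exp P (remote_past P X) (X 0) \<omega> = 0"
    and "\<And>k. AE \<omega> in P. real_cond_exp P (remote_past P X) (\<lambda>\<omega>. X 0 \<omega> * X k \<omega>) \<omega> = \<gamma>0 k"
    and "(\<lambda>k. \<bar>\<gamma>0 k\<bar>) summable_on UNIV"
    and "\<phi>0 = spectral_density \<gamma>0"
    and "\<exists>\<beta>>0. \<forall>x\<in>{0..1}. \<phi>0 x \<ge> \<beta>"
    and "lip_const \<phi>0 < \<infinity>"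
    and "\<exists>L. L-lipschitz_on {0..1} \<phi>par"
    and "\<exists>\<beta>>0. \<forall>x\<in>{0..1}. \<phi>par x \<ge> \<beta>"
    and "0 \<le> \<delta>" "\<delta> \<le> 1"
    and "prob_space Q"
    and "\<alpha> > 0"
    and "G0 \<in> space (prob_algebra unit_borel)"
    and "full_support_01 G0"
    and "dirichlet_process Q G \<alpha> G0"
    and "K \<in> Q \<rightarrow>\<^sub>M count_space UNIV"
    and "AE \<omega> in Q. K \<omega> \<ge> 1"
    and "\<And>k. k \<ge> 1 \<Longrightarrow> measure Q {\<omega> \<in> space Q. K \<omega> = k} > 0"
    and "\<tau> \<in> borel_measurable Q"
    and "\<And>x. isCont (cdf (distr Q borel \<tau>)) x"
    and "AE \<omega> in Q. \<tau> \<omega> > 0"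
    and "\<And>a b. 0 \<le> a \<Longrightarrow> a < b \<Longrightarrow> measure Q {\<omega> \<in> space Q. a < \<tau> \<omega> \<and> \<tau> \<omega> < b} > 0"
    and "indep_three Q G (prob_algebra unit_borel) K (count_space UNIV) \<tau> borel"
    and "0 < m" "m < M"
    and "(INF x\<in>{0..1}. \<phi>0 x) > m"
    and "lip_norm (\<lambda>x. \<phi>0 x / \<phi>par x powr \<delta>) * lip_norm (\<lambda>x. \<phi>par x powr \<delta>) < ennreal M"
    and "r > 0"
  shows "converges_in_prob P
    (\<lambda>n \<omega>. pseudo_posterior n \<phi>par
       (restricted_prior m M (prior_C Q G K \<tau> \<phi>par \<delta>))
       (vec n (\<lambda>i. X (int i + 1) \<omega>))
       {\<phi> \<in> Theta m M. sup_norm (\<lambda>x. \<phi> x - \<phi>0 x) \<ge> ennreal r})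
    0"
proof -
  note prob_P = assms(1) and X_meas = assms(2) and stationary = assms(3) and square = assms(4)
    and gamma = assms(6) and remote = assms(8) and summable = assms(9) and dens = assms(10)
    and dens_pos = assms(11) and dens_lip = assms(12) and par_lip = assms(13) and par_pos = assms(14)
    and Q = assms(17) and \<alpha> = assms(18) and G0 = assms(19,20) and DP = assms(21) and K = assms(22,24)
    and \<tau> = assms(25,28) and indep = assms(29) and m0 = assms(30) and mM = assms(31) and dens_m = assms(32)
    and norm_M = assms(33) and r = assms(34)
  interpret prob_space P by (rule prob_P)
  interpret remotely_uncorrelated_series P X \<gamma>0
    by (unfold_locales; fact X_meas stationary square gamma remote)
  obtain Lp where "Lp-lipschitz_on {0..1} \<phi>par" using par_lip by blast
  then have par_cont: "continuous_on {0..1} \<phi>par" by (rule lipschitz_on_continuous_on)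
  obtain b where b: "0 < b" "\<forall>u\<in>{0..1}. b \<le> \<phi>par u" using par_pos by blast
  obtain L where L: "0 \<le> L" "lipschitz01 L \<phi>0" using lip_const_finite[OF dens_lip] by blast
  obtain \<beta> where \<beta>: "0 < \<beta>" "\<forall>u\<in>{0..1}. \<beta> \<le> \<phi>0 u" using dens_pos by blast
  have bdd: "bdd_below (\<phi>0 ` {0..1})" using \<beta>(2) by (intro bdd_belowI[of _ \<beta>]) auto
  define B where "B = \<phi>0 0 + L"
  have B: "\<forall>u\<in>{0..1}. m \<le> \<phi>0 u \<and> \<phi>0 u \<le> B"
  proof
    fix u :: real assume u: "u \<in> {0..1}"
    have "\<bar>\<phi>0 u - \<phi>0 0\<bar> \<le> L * \<bar>u - 0\<bar>"
      by (rule L(2)[unfolded lipschitz01_def, rule_format]) (use u in auto)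
    also have "\<dots> \<le> L * 1" using u L(1) by (intro mult_left_mono) auto
    finally have "\<phi>0 u \<le> B" unfolding B_def by linarith
    moreover have "(INF x\<in>{0..1}. \<phi>0 x) \<le> \<phi>0 u" by (rule cINF_lower[OF bdd u])
    ultimately show "m \<le> \<phi>0 u \<and> \<phi>0 u \<le> B" using dens_m by linarith
  qed
  have B0: "0 < B" using B[rule_format, of 0] m0 by simp
  have absB: "\<forall>u\<in>{0..1}. \<bar>\<phi>0 u\<bar> \<le> B"
  proof
    fix u :: real assume "u \<in> {0..1}"
    then show "\<bar>\<phi>0 u\<bar> \<le> B" using B[rule_format, of u] m0 by linarith
  qed
  have M: "0 < M" "0 \<le> M" using m0 mM by auto
  \<comment> \<open>within distance \<open>s\<close> the difference of two Lipschitz functions changes by at most \<open>r / 4\<close>\<close>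
  define s where "s = min (1 / 2) (r / (4 * (M + L)))"
  have s: "0 < s" "s \<le> 1 / 2" "(M + L) * s \<le> r / 4"
  proof -
    have pos: "0 < 4 * (M + L)" by (intro mult_pos_pos add_pos_nonneg M(1) L(1)) simp
    then have "0 < r / (4 * (M + L))" by (rule divide_pos_pos[OF r])
    then show "0 < s" unfolding s_def min_less_iff_conj by simp
    show "s \<le> 1 / 2" unfolding s_def by (rule min.cobounded1)
    have "s \<le> r / (4 * (M + L))" by (simp add: s_def)
    then have "s * (4 * (M + L)) \<le> r" by (subst (asm) pos_le_divide_eq[OF pos])
    then have "(M + L) * s * 4 \<le> r" by (simp only: mult_ac)
    then show "(M + L) * s \<le> r / 4" by (subst pos_le_divide_eq) simp_all
  qed
  define g where "g = (r / 4 / M / (sqrt (B / m) + 1))\<^sup>2 * (s / 4)"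
  have g: "0 < g"
  proof -
    have "0 < sqrt (B / m) + 1" using B0 m0 by (intro add_nonneg_pos) auto
    then have "0 < r / 4 / M / (sqrt (B / m) + 1)" using r M(1) by (intro divide_pos_pos) auto
    then show ?thesis unfolding g_def using s(1) by (intro mult_pos_pos zero_less_power) auto
  qed
  \<comment> \<open>three errors \<open>e * n\<close> use up half of the gain \<open>g * n\<close>\<close>
  define e where "e = g / 6"
  have e: "0 < e" "6 * e \<le> g" using g by (auto simp: e_def)
  have V: "0 < \<gamma>0 0 + 1" using gamma_0_nonneg by linarith
  have lim: "(\<lambda>n. (\<Sum>i<n. 2 * pi * \<phi>0 (grid n i) * cosk k (grid n i)) / real n) \<longlonglongrightarrow> \<gamma>0 (int k)" for k
    unfolding dens by (rule spectral_grid_coefficients[OF summable gamma_symmetric])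
  from quadratic_form_approx[OF par_cont b(2,1) m0 M(2) absB B0 lim e(1) V]
  obtain D d N where d: "0 < d" and quad: "\<forall>n\<ge>N. \<forall>x. (nrm n x)\<^sup>2 \<le> (\<gamma>0 0 + 1) * real n \<longrightarrow>
     (\<forall>k\<le>D. \<bar>(\<Sum>t<n. x t * circ n (cosk k) x t) / real n - \<gamma>0 (int k)\<bar> \<le> d) \<longrightarrow>
     (\<forall>k\<le>D. \<forall>l\<le>D. (nrm n (defect n (cosk k) (circ n (cosk l) x)))\<^sup>2 \<le> d\<^sup>2 * real n) \<longrightarrow>
     (\<forall>\<phi> U. admissible m M \<phi> \<longrightarrow> (\<forall>t<n. toep n \<phi>par U t = circ n (root_ratio \<phi> \<phi>par) x t) \<longrightarrow>
        \<bar>(\<Sum>t<n. circ n (root_ratio \<phi> \<phi>par) x t * U t) - (\<Sum>i<n. \<phi>0 (grid n i) / \<phi> (grid n i))\<bar> \<le> e * real n)"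
    by (elim exE conjE)
  from typical_sample[OF d, of D] obtain bad where bad: "\<forall>n. bad n \<in> sets P" "(\<lambda>n. measure P (bad n)) \<longlonglongrightarrow> 0"
    "\<forall>n>0. \<forall>\<omega>\<in>space P - bad n. (nrm n (sample \<omega>))\<^sup>2 \<le> (\<gamma>0 0 + 1) * real n \<and>
      (\<forall>k\<le>D. \<bar>(\<Sum>t<n. sample \<omega> t * circ n (cosk k) (sample \<omega>) t) / real n - \<gamma>0 (int k)\<bar> \<le> d) \<and>
      (\<forall>k\<le>D. \<forall>l\<le>D. (nrm n (defect n (cosk k) (circ n (cosk l) (sample \<omega>))))\<^sup>2 \<le> d\<^sup>2 * real n)"
    by (elim exE conjE)
  \<comment> \<open>functions within \<open>t\<close> of \<open>\<phi>0\<close> have divergence at most \<open>(t / m)\<^sup>2 = e\<close> per frequency\<close>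
  define t where "t = m * sqrt e"
  have t: "0 < t" "(t / m)\<^sup>2 \<le> e" using e(1) m0 by (auto simp: t_def)
  have par_pos': "0 < \<phi>par u" if "u \<in> {0..1}" for u using b(2)[rule_format, OF that] b(1) by linarith
  define pr where "pr = prior_C Q G K \<tau> \<phi>par \<delta>"
  have "\<exists>U. openin (mtopology_of C01) U \<and> (\<forall>\<phi>\<in>U. \<forall>x\<in>{0..1}. \<bar>\<phi> x - \<phi>0 x\<bar> \<le> t) \<and>
    emeasure pr (U \<inter> Theta m M) > 0"
    unfolding pr_def
    by (rule prior_neighbourhood_pos[OF Q \<alpha> G0 DP K(1) _ \<tau>(1) _ indep par_cont _ m0 dens_m norm_M t(1) bdd])
      (fact K(2) \<tau>(2) par_pos')+
  then obtain U where U: "openin (mtopology_of C01) U" "\<forall>\<phi>\<in>U. \<forall>x\<in>{0..1}. \<bar>\<phi> x - \<phi>0 x\<bar> \<le> t"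
    "emeasure pr (U \<inter> Theta m M) > 0"
    by (elim exE conjE)
  have h: "continuous_on {0..1} (\<lambda>x. \<phi>par x powr \<delta>)"
    by (intro continuous_on_powr par_cont continuous_on_const) (use par_pos' in force)
  have G: "G \<in> Q \<rightarrow>\<^sub>M prob_algebra unit_borel" using DP unfolding dirichlet_process_def by simp
  have pr: "sets pr = sets (metric_borel C01)" "finite_measure pr"
  proof -
    show "sets pr = sets (metric_borel C01)" unfolding pr_def prior_C_def by simp
    interpret Q: prob_space Q by (rule Q)
    show "finite_measure pr" unfolding pr_def prior_C_def
      by (intro prob_space.finite_measure Q.prob_space_distr random_bernstein_measurable[OF G K(1) \<tau>(1) h])
  qed
  define R where "R = restricted_prior m M pr"
  note R = restricted_prior_props[OF M(2) pr U(1,3), folded R_def]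
  define p where "p = measure R (U \<inter> Theta m M)"
  have p: "0 < p"
  proof -
    interpret R: prob_space R by (rule R(1))
    show ?thesis using R(4) unfolding p_def R.emeasure_eq_measure by simp
  qed
  have key: "\<bar>pseudo_posterior n \<phi>par R (vec n (sample \<omega>)) {\<phi> \<in> Theta m M. sup_norm (\<lambda>x. \<phi> x - \<phi>0 x) \<ge> ennreal r}\<bar>
      \<le> exp (- (g / 4) * real n) / p"
    if n: "N \<le> n" "8 / s \<le> real n" "0 < n" and w: "\<omega> \<in> space P - bad n" for n \<omega>
    unfolding p_def
  proof (rule posterior_mass_bound[OF par_cont b(2,1) m0 M(2) L(2) B L(1) r s n(2) g_def _ R(1,2,3) _ _ _ t(2) e(2)])
    fix \<phi> W
    assume ad: "admissible m M \<phi>"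
      and W: "\<forall>t<n. toep n \<phi>par W t = circ n (root_ratio \<phi> \<phi>par) (sample \<omega>) t"
    note good = bad(3)[rule_format, OF n(3) w]
    show "\<bar>(\<Sum>t<n. circ n (root_ratio \<phi> \<phi>par) (sample \<omega>) t * W t)
        - (\<Sum>i<n. \<phi>0 (grid n i) / \<phi> (grid n i))\<bar> \<le> e * real n"
      by (rule quad[THEN spec, THEN mp, OF n(1), THEN spec, THEN mp, OF good[THEN conjunct1], THEN mp,
        OF good[THEN conjunct2, THEN conjunct1], THEN mp, OF good[THEN conjunct2, THEN conjunct2],
        THEN spec, THEN spec, THEN mp, OF ad, THEN mp, OF W])
  next
    show "U \<inter> Theta m M \<subseteq> Theta m M" by blast
    show "0 < measure R (U \<inter> Theta m M)" using p unfolding p_def .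
    show "\<forall>\<phi>\<in>U \<inter> Theta m M. \<forall>u\<in>{0..1}. \<bar>\<phi> u - \<phi>0 u\<bar> \<le> t" using U(2) by blast
  qed
  show ?thesis
    unfolding converges_in_prob_def pr_def[symmetric] R_def[symmetric]
  proof (intro allI impI)
    fix \<epsilon> :: real assume \<epsilon>: "0 < \<epsilon>"
    let ?E = "\<lambda>n. {\<omega> \<in> space P. \<bar>pseudo_posterior n \<phi>par R (vec n (sample \<omega>))
      {\<phi> \<in> Theta m M. sup_norm (\<lambda>x. \<phi> x - \<phi>0 x) \<ge> ennreal r} - 0\<bar> > \<epsilon>}"
    have g4: "0 < g / 4" using g by simp
    have le: "\<forall>\<^sub>F n in sequentially. measure P (?E n) \<le> measure P (bad n)"
      using exp_decay_eventually_le[OF g4 p \<epsilon>] eventually_ge_at_top[of "max (max N 1) (nat \<lceil>8 / s\<rceil>)"]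
    proof eventually_elim
      case (elim n)
      then have n: "N \<le> n" "8 / s \<le> real n" "0 < n" by (auto simp: nat_le_iff ceiling_le_iff)
      have "?E n \<subseteq> bad n"
      proof (rule subsetI, rule ccontr)
        fix \<omega> assume w: "\<omega> \<in> ?E n" "\<omega> \<notin> bad n"
        then have "\<omega> \<in> space P - bad n" by simp
        from key[OF n this] elim(1) w(1) show False by simp
      qed
      then show ?case by (rule finite_measure_mono) (use bad(1) in simp)
    qed
    have "\<forall>\<^sub>F n in sequentially. 0 \<le> measure P (?E n)"
      by (rule always_eventually, rule allI, rule measure_nonneg)
    then show "(\<lambda>n. measure P (?E n)) \<longlonglongrightarrow> 0"
      by (rule tendsto_sandwich[OF _ le tendsto_const bad(2)])
  qed
qed

end
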